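(* Let $R$ be a commutative ring, let $\phi: R^m \to R^n$ be an $R$-linear map, and let $r, d \ge 1$ be integers. Let $Y$ be the diagonal matrix of the same format as the matrix of $\phi$ (that is, $n\times m$) with pairwise distinct indeterminates $Y_1,\dots,Y_{\min(m,n)}$ over $\mathbb{Z}$ in its diagonal positions and zeros elsewhere. Let $\Sigma$ be the set of those elements that are minimal, with respect to the partial order $\le$ on Young diagrams, among the shapes of the monomials generating the ideal $I_r(S^d(Y))$. (1) Then $$I_r(S^d(\phi)) \subset \sum_{\sigma\in\Sigma} I^{(\sigma)}(\phi),$$ with equality up to integral closure, i.e. the two ideals have the same integral closure in $R$. (2) If $\mathbb{Q} \subset R$, then $$\sum_{\sigma\in\Sigma} I_\sigma(\phi) \subset I_r(S^d(\phi)) \subset \sum_{\sigma\in\Sigma} I^\sigma(\phi).$$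
   Context: For a linear map $\chi$ between finitely generated free modules over a commutative ring (or a matrix representing it), $I_t(\chi)$ denotes the ideal generated by the $t\times t$ minors of a matrix representing $\chi$ ($I_t(\chi)=0$ if $t$ exceeds the number of rows or columns). $S^d(\phi): S^d(R^m)\to S^d(R^n)$ is the $d$-th symmetric power of $\phi$; for a matrix $Y$, $S^d(Y)$ is the $d$-th symmetric power of the associated linear map. For the diagonal matrix $Y$ of indeterminates, $S^d(Y)$ is represented by a diagonal matrix (in the monomial bases) whose nonzero entries are the monomials of degree $d$ in $Y_1,\dots,Y_{\min(m,n)}$, so $I_r(S^d(Y))$ is generated by the products of $r$ distinct monomials of degree $d$; these are the monomials referred to in the claim. Young diagrams. A Young diagram (or partition) is a non-increasing finite sequence $\sigma = (s_1,\dots,s_u)$ of positive integers. For $j\ge 1$ put $$\gamma_j(\sigma) = \sum_{i=1}^u \max(0, s_i - j + 1).$$ Young diagrams are partially ordered by: $\sigma\le\tau$ if and only if $\gamma_j(\sigma)\le\gamma_j(\tau)$ for all $j\ge 1$. Shape of a monomial. A monomial $f$ in indeterminates $Y_1,\dots,Y_k$ has a unique decomposition $f = f_1\cdots f_u$ where each $f_i$ is a squarefree monomial different from $1$ and $f_{i+1}\mid f_i$ for $i=1,\dots,u-1$. The shape of $f$ is the Young diagram $(\deg f_1,\dots,\deg f_u)$. Ideals attached to a Young diagram $\sigma=(s_1,\dots,s_u)$ and a linear map $\phi$: $$I^\sigma(\phi) = \prod_{i=1}^u I_{s_i}(\phi), \qquad I^{(\sigma)}(\phi) = \sum_{\tau\ge\sigma}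 I^\tau(\phi),$$ the sum being over all Young diagrams $\tau\ge\sigma$. The ideal $I_\sigma(\phi)$ is defined when $\mathbb{Q}\subset R$ and $s_1\le\min(m,n)$, as follows. Let $X=(X_{ij})$ be an $n\times m$ matrix of indeterminates over $\mathbb{Q}$. The group $G = \mathrm{GL}_n(\mathbb{Q})\times\mathrm{GL}_m(\mathbb{Q})$ acts on $\mathbb{Q}[X]$ by $\mathbb{Q}$-algebra automorphisms, $(A,B)$ sending each entry of $X$ to the corresponding entry of $AXB^{-1}$. Let $M_\sigma\subset\mathbb{Q}[X]$ be the $G$-submodule (i.e. the $\mathbb{Q}$-span of the $G$-orbit) generated by the product $\prod_{i=1}^u \delta_{s_i}$, where $\delta_{t}$ is the determinant of the $t\times t$ submatrix of $X$ in its upper left corner. Let $I_\sigma\subset\mathbb{Q}[X]$ be the ideal generated by $M_\sigma$. Then $I_\sigma(\phi)$ is the ideal of $R$ generated by the image of $I_\sigma$ under the $\mathbb{Q}$-algebra homomorphism $\mathbb{Q}[X]\to R$ substituting for the entries of $X$ the entries of the matrix of $\phi$. (Every $\sigma\in\Sigma$ satisfies $s_1\le\min(m,n)$.) *)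

theory Defs
  imports "HOL-Library.Poly_Mapping" "Jordan_Normal_Form.VS_Connect"
begin

section \<open>Ideals\<close>

lemma module_times: "Modules.module ((*) :: 'a::comm_ring_1 \<Rightarrow> 'a \<Rightarrow> 'a)"
  by (rule Modules.module.intro) (simp_all add: algebra_simps)

definition ideal_gen :: "'a::comm_ring_1 set \<Rightarrow> 'a set" where
  "ideal_gen = Modules.module.span (*)"

definition ideal_mult :: "'a::comm_ring_1 set \<Rightarrow> 'a set \<Rightarrow> 'a set" where
  "ideal_mult I J = ideal_gen {a * b | a b. a \<in> I \<and> b \<in> J}"

definition ideal_prod_list :: "'a::comm_ring_1 set list \<Rightarrow> 'a set" where
  "ideal_prod_list Is = foldr ideal_mult Is UNIV"

definition ideal_sum :: "'a::comm_ring_1 set set \<Rightarrow> 'a set" where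
  "ideal_sum Is = ideal_gen (\<Union>Is)"

definition integral_closure :: "'a::comm_ring_1 set \<Rightarrow> 'a set" where
  "integral_closure I = {x. \<exists>k\<ge>1. \<exists>a. (\<forall>i\<in>{1..k}. a i \<in> ideal_prod_list (replicate i I)) \<and>
     x ^ k + (\<Sum>i=1..k. a i * x ^ (k - i)) = 0}"


section \<open>Polynomials in several variables\<close>

text \<open>A monomial is its exponent vector, so multiplication of monomials is addition.\<close>

type_synonym 'v monomial = "'v \<Rightarrow>\<^sub>0 nat"
type_synonym ('v, 'a) polynomial = "('v \<Rightarrow>\<^sub>0 nat) \<Rightarrow>\<^sub>0 'a"

definition Const :: "'a \<Rightarrow> ('v, 'a::zero) polynomial" where
  "Const c = Poly_Mapping.single 0 c"

definition Var :: "'v \<Rightarrow> ('v, 'a::zero_neq_one) polynomial" where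
  "Var v = Poly_Mapping.single (Poly_Mapping.single v 1) 1"

text \<open>The substitution of \<open>f v\<close> for the variable \<open>v\<close>, with coefficients mapped by \<open>h\<close>.\<close>

definition poly_eval ::
  "('b::zero \<Rightarrow> 'a::comm_ring_1) \<Rightarrow> ('v \<Rightarrow> 'a) \<Rightarrow> ('v, 'b) polynomial \<Rightarrow> 'a" where
  "poly_eval h f p = (\<Sum>\<alpha>\<in>Poly_Mapping.keys p. h (Poly_Mapping.lookup p \<alpha>) *
     (\<Prod>v\<in>Poly_Mapping.keys \<alpha>. f v ^ Poly_Mapping.lookup \<alpha> v))"

definition mdeg :: "'v monomial \<Rightarrow> nat" where
  "mdeg \<alpha> = (\<Sum>v\<in>Poly_Mapping.keys \<alpha>. Poly_Mapping.lookup \<alpha> v)"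

definition monomials :: "nat \<Rightarrow> nat \<Rightarrow> nat monomial set" where
  "monomials k d = {\<alpha>. Poly_Mapping.keys \<alpha> \<subseteq> {..<k} \<and> mdeg \<alpha> = d}"


section \<open>Ideals of minors and symmetric powers\<close>

text \<open>Matrices with arbitrary finite row and column index sets \<open>I\<close> and \<open>J\<close>. Rows and columns are
  selected in all possible orders, so that every minor occurs together with its negative (if
  \<open>t > 1\<close>); the generated ideal does not depend on this.\<close>

definition minors :: "'i set \<Rightarrow> 'j set \<Rightarrow> ('i \<Rightarrow> 'j \<Rightarrow> 'a::comm_ring_1) \<Rightarrow> nat \<Rightarrow> 'a set" where
  "minors I J M t = {det (mat t t (\<lambda>(a, b). M (rs ! a) (cs ! b))) | rs cs.
     distinct rs \<and> set rs \<subseteq> I \<and> length rs = t \<and> distinct cs \<and> set cs \<subseteq> J \<and> length cs = t}"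

definition map_entry :: "nat \<Rightarrow> ('a::comm_ring_1 vec \<Rightarrow> 'a vec) \<Rightarrow> nat \<Rightarrow> nat \<Rightarrow> 'a" where
  "map_entry m \<phi> i j = \<phi> (unit_vec m j) $ i"

definition det_ideal :: "nat \<Rightarrow> nat \<Rightarrow> ('a::comm_ring_1 vec \<Rightarrow> 'a vec) \<Rightarrow> nat \<Rightarrow> 'a set" where
  "det_ideal m n \<phi> t = ideal_gen (minors {..<n} {..<m} (map_entry m \<phi>) t)"

text \<open>The symmetric algebra of \<open>R\<^sup>k\<close> is the polynomial ring in the variables \<open>0, \<dots>, k - 1\<close>, its
  degree \<open>d\<close> part being \<open>S\<^sup>d(R\<^sup>k)\<close> with basis \<open>monomials k d\<close>; a vector is the linear form with
  its entries as coefficients. The algebra homomorphism \<open>sym_map m \<phi>\<close> induced by \<open>\<phi>\<close> restricts to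
  \<open>S\<^sup>d(\<phi>)\<close> in degree \<open>d\<close>.\<close>

definition linear_form :: "'a::comm_ring_1 vec \<Rightarrow> (nat, 'a) polynomial" where
  "linear_form v = (\<Sum>i<dim_vec v. Const (v $ i) * Var i)"

definition sym_map :: "nat \<Rightarrow> ('a::comm_ring_1 vec \<Rightarrow> 'a vec) \<Rightarrow>
    (nat, 'a) polynomial \<Rightarrow> (nat, 'a) polynomial" where
  "sym_map m \<phi> = poly_eval Const (\<lambda>j. linear_form (\<phi> (unit_vec m j)))"

definition sym_entry :: "nat \<Rightarrow> ('a::comm_ring_1 vec \<Rightarrow> 'a vec) \<Rightarrow>
    nat monomial \<Rightarrow> nat monomial \<Rightarrow> 'a" where
  "sym_entry m \<phi> \<beta> \<alpha> = Poly_Mapping.lookup (sym_map m \<phi> (Poly_Mapping.single \<alpha> 1)) \<beta>"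

definition sym_minors :: "nat \<Rightarrow> nat \<Rightarrow> nat \<Rightarrow> ('a::comm_ring_1 vec \<Rightarrow> 'a vec) \<Rightarrow> nat \<Rightarrow> 'a set" where
  "sym_minors m n d \<phi> r = minors (monomials n d) (monomials m d) (sym_entry m \<phi>) r"

definition sym_det_ideal ::
    "nat \<Rightarrow> nat \<Rightarrow> nat \<Rightarrow> ('a::comm_ring_1 vec \<Rightarrow> 'a vec) \<Rightarrow> nat \<Rightarrow> 'a set" where
  "sym_det_ideal m n d \<phi> r = ideal_gen (sym_minors m n d \<phi> r)"


section \<open>Young diagrams and shapes\<close>

definition young_diagram :: "nat list \<Rightarrow> bool" where
  "young_diagram \<sigma> \<longleftrightarrow> sorted_wrt (\<ge>) \<sigma> \<and> (\<forall>s\<in>set \<sigma>. s > 0)"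

text \<open>Truncated subtraction yields \<open>max 0 (s - j + 1)\<close>.\<close>

definition gamma :: "nat \<Rightarrow> nat list \<Rightarrow> nat" where
  "gamma j \<sigma> = (\<Sum>s\<leftarrow>\<sigma>. s + 1 - j)"

definition young_le :: "nat list \<Rightarrow> nat list \<Rightarrow> bool" where
  "young_le \<sigma> \<tau> \<longleftrightarrow> (\<forall>j\<ge>1. gamma j \<sigma> \<le> gamma j \<tau>)"

definition mono_dvd :: "'v monomial \<Rightarrow> 'v monomial \<Rightarrow> bool" where
  "mono_dvd g f \<longleftrightarrow> (\<exists>h. f = g + h)"

definition squarefree_mono :: "'v monomial \<Rightarrow> bool" where
  "squarefree_mono f \<longleftrightarrow> (\<forall>v. Poly_Mapping.lookup f v \<le> 1)"

definition has_shape :: "'v monomial \<Rightarrow> nat list \<Rightarrow> bool" where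
  "has_shape f \<sigma> \<longleftrightarrow> (\<exists>fs. (\<forall>g\<in>set fs. squarefree_mono g \<and> g \<noteq> 0) \<and>
     sorted_wrt (\<lambda>g h. mono_dvd h g) fs \<and> sum_list fs = f \<and> \<sigma> = map mdeg fs)"

definition generic_diagonal :: "nat \<Rightarrow> nat \<Rightarrow> (nat, int) polynomial mat" where
  "generic_diagonal m n = mat n m (\<lambda>(i, j). if i = j then Var i else 0)"

text \<open>The monomials among the minors of \<open>S\<^sup>d(Y)\<close>; the other minors are \<open>0\<close> and negatives of these.
  See lemma \<open>generating_monomials_eq\<close> below.\<close>

definition generating_monomials :: "nat \<Rightarrow> nat \<Rightarrow> nat \<Rightarrow> nat \<Rightarrow> nat monomial set" where
  "generating_monomials m n d r =
     {\<mu>. Poly_Mapping.single \<mu> 1 \<in> sym_minors m n d ((*\<^sub>v) (generic_diagonal m n)) r}"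

definition minimal_shapes :: "nat \<Rightarrow> nat \<Rightarrow> nat \<Rightarrow> nat \<Rightarrow> nat list set" where
  "minimal_shapes m n d r =
     (let S = {\<sigma>. \<exists>\<mu>\<in>generating_monomials m n d r. has_shape \<mu> \<sigma>}
      in {\<sigma>\<in>S. \<forall>\<tau>\<in>S. young_le \<tau> \<sigma> \<longrightarrow> \<tau> = \<sigma>})"


section \<open>Ideals attached to a Young diagram\<close>

text \<open>\<open>I\<^sup>\<sigma>(\<phi>)\<close>, \<open>I\<^sup>(\<^sup>\<sigma>\<^sup>)(\<phi>)\<close> and \<open>I\<^sub>\<sigma>(\<phi>)\<close> are \<open>ideal_pow_shape\<close>, \<open>ideal_up_shape\<close> and
  \<open>ideal_gl_shape\<close>.\<close>

definition ideal_pow_shape :: "nat \<Rightarrow> nat \<Rightarrow> ('a::comm_ring_1 vec \<Rightarrow> 'a vec) \<Rightarrow> nat list \<Rightarrow> 'a set" where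
  "ideal_pow_shape m n \<phi> \<sigma> = ideal_prod_list (map (det_ideal m n \<phi>) \<sigma>)"

definition ideal_up_shape :: "nat \<Rightarrow> nat \<Rightarrow> ('a::comm_ring_1 vec \<Rightarrow> 'a vec) \<Rightarrow> nat list \<Rightarrow> 'a set" where
  "ideal_up_shape m n \<phi> \<sigma> =
     ideal_sum {ideal_pow_shape m n \<phi> \<tau> | \<tau>. young_diagram \<tau> \<and> young_le \<sigma> \<tau>}"

type_synonym generic_poly = "(nat \<times> nat, rat) polynomial"

definition generic_mat :: "nat \<Rightarrow> nat \<Rightarrow> generic_poly mat" where
  "generic_mat m n = mat n m Var"

definition generic_polys :: "nat \<Rightarrow> nat \<Rightarrow> generic_poly set" where
  "generic_polys m n = {p. \<forall>\<alpha>\<in>Poly_Mapping.keys p. Poly_Mapping.keys \<alpha> \<subseteq> {..<n} \<times> {..<m}}"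

definition GL :: "nat \<Rightarrow> rat mat set" where
  "GL k = {A \<in> carrier_mat k k. invertible_mat A}"

text \<open>The argument \<open>B'\<close> stands for the inverse of the second group element.\<close>

definition gl_act :: "nat \<Rightarrow> nat \<Rightarrow> rat mat \<Rightarrow> rat mat \<Rightarrow> generic_poly \<Rightarrow> generic_poly" where
  "gl_act m n A B' =
     poly_eval Const (\<lambda>ij. (map_mat Const A * generic_mat m n * map_mat Const B') $$ ij)"

definition gl_orbit :: "nat \<Rightarrow> nat \<Rightarrow> generic_poly \<Rightarrow> generic_poly set" where
  "gl_orbit m n p = {gl_act m n A B' p | A B B'.
     A \<in> GL n \<and> B \<in> GL m \<and> B' \<in> carrier_mat m m \<and> inverts_mat B B' \<and> inverts_mat B' B}"

definition corner_minor :: "nat \<Rightarrow> nat \<Rightarrow> nat \<Rightarrow> generic_poly" where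
  "corner_minor m n t = det (mat t t (\<lambda>ij. generic_mat m n $$ ij))"

definition gl_submodule :: "nat \<Rightarrow> nat \<Rightarrow> nat list \<Rightarrow> generic_poly set" where
  "gl_submodule m n \<sigma> = Modules.module.span (\<lambda>c p. Const c * p)
     (gl_orbit m n (prod_list (map (corner_minor m n) \<sigma>)))"

text \<open>The ideal is formed in the subring \<open>generic_polys m n\<close> of the type of polynomials in all
  variables indexed by \<open>nat \<times> nat\<close>.\<close>

definition generic_ideal :: "nat \<Rightarrow> nat \<Rightarrow> nat list \<Rightarrow> generic_poly set" where
  "generic_ideal m n \<sigma> = {\<Sum>p\<in>F. q p * p | F q.
     finite F \<and> F \<subseteq> gl_submodule m n \<sigma> \<and> (\<forall>p\<in>F. q p \<in> generic_polys m n)}"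

text \<open>\<open>\<iota>\<close> is the embedding of the rationals into the ring.\<close>

definition ideal_gl_shape ::
    "(rat \<Rightarrow> 'a) \<Rightarrow> nat \<Rightarrow> nat \<Rightarrow> ('a::comm_ring_1 vec \<Rightarrow> 'a vec) \<Rightarrow> nat list \<Rightarrow> 'a set" where
  "ideal_gl_shape \<iota> m n \<phi> \<sigma> =
     ideal_gen (poly_eval \<iota> (\<lambda>(i, j). map_entry m \<phi> i j) ` generic_ideal m n \<sigma>)"


section \<open>The generating monomials\<close>

lemma single_power:
  "Poly_Mapping.single (Poly_Mapping.single j (1::nat)) (c::'a::comm_ring_1) ^ k =
   Poly_Mapping.single (Poly_Mapping.single j k) (c ^ k)"
proof (induction k)
  case (Suc k)
  then show ?case by (simp add: mult_single flip: single_add)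
qed simp

lemma prod_single:
  "(\<Prod>x\<in>S. Poly_Mapping.single (g x :: 'v monomial) (h x :: 'a::comm_ring_1)) =
   Poly_Mapping.single (\<Sum>x\<in>S. g x) (\<Prod>x\<in>S. h x)"
  by (induction S rule: infinite_finite_induct) (simp_all add: mult_single)

lemma monomial_expand:
  "(\<Sum>x\<in>Poly_Mapping.keys \<alpha>. Poly_Mapping.single x (Poly_Mapping.lookup \<alpha> x)) = (\<alpha> :: 'v monomial)"
proof (rule poly_mapping_eqI)
  fix k
  show "Poly_Mapping.lookup (\<Sum>x\<in>Poly_Mapping.keys \<alpha>.
      Poly_Mapping.single x (Poly_Mapping.lookup \<alpha> x)) k = Poly_Mapping.lookup \<alpha> k"
    by (simp add: lookup_sum lookup_single when_def in_keys_iff)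
qed

lemma linear_form_generic_diagonal:
  assumes "j < m"
  shows "linear_form (generic_diagonal m n *\<^sub>v unit_vec m j) =
    (if j < n then Poly_Mapping.single (Poly_Mapping.single j 1) (Var j) else 0)"
proof -
  have e: "(generic_diagonal m n *\<^sub>v unit_vec m j) $ i = (if i = j then Var i else 0)" if "i < n" for i
    using that assms by (simp add: generic_diagonal_def)
  have d: "dim_vec (generic_diagonal m n *\<^sub>v unit_vec m j) = n"
    by (simp add: generic_diagonal_def)
  have "linear_form (generic_diagonal m n *\<^sub>v unit_vec m j) =
    (\<Sum>i<n. if i = j then Poly_Mapping.single (Poly_Mapping.single j 1) (Var j) else 0)"
    unfolding linear_form_def d
    by (rule sum.cong) (auto simp: e Const_def Var_def[of _ , where 'a="(nat,int) polynomial"] mult_single)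
  then show ?thesis by simp
qed

lemma sym_entry_generic_diagonal:
  assumes "\<alpha> \<in> monomials m d" "\<beta> \<in> monomials n d"
  shows "sym_entry m ((*\<^sub>v) (generic_diagonal m n)) \<beta> \<alpha> =
    (if \<alpha> = \<beta> then Poly_Mapping.single \<alpha> 1 else 0)"
proof -
  let ?L = "\<lambda>j. linear_form (generic_diagonal m n *\<^sub>v unit_vec m j)"
  have k: "Poly_Mapping.keys \<alpha> \<subseteq> {..<m}" "Poly_Mapping.keys \<beta> \<subseteq> {..<n}"
    using assms by (auto simp: monomials_def)
  have s: "sym_map m ((*\<^sub>v) (generic_diagonal m n)) (Poly_Mapping.single \<alpha> 1) =
     (\<Prod>v\<in>Poly_Mapping.keys \<alpha>. ?L v ^ Poly_Mapping.lookup \<alpha> v)"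
    by (simp add: sym_map_def poly_eval_def Const_def)
  show ?thesis
  proof (cases "Poly_Mapping.keys \<alpha> \<subseteq> {..<n}")
    case True
    have "(\<Prod>v\<in>Poly_Mapping.keys \<alpha>. ?L v ^ Poly_Mapping.lookup \<alpha> v) =
      (\<Prod>v\<in>Poly_Mapping.keys \<alpha>. Poly_Mapping.single (Poly_Mapping.single v (Poly_Mapping.lookup \<alpha> v))
         (Poly_Mapping.single (Poly_Mapping.single v (Poly_Mapping.lookup \<alpha> v)) 1))"
      using k True
      by (intro prod.cong) (auto simp: linear_form_generic_diagonal subset_iff single_power[simplified] Var_def)
    also have "\<dots> = Poly_Mapping.single \<alpha> (Poly_Mapping.single \<alpha> 1)"
      by (simp add: prod_single monomial_expand)
    finally show ?thesis by (simp add: sym_entry_def s lookup_single when_def)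
  next
    case False
    then obtain v where v: "v \<in> Poly_Mapping.keys \<alpha>" "\<not> v < n" by auto
    then have "?L v ^ Poly_Mapping.lookup \<alpha> v = 0"
      using k by (auto simp: linear_form_generic_diagonal in_keys_iff subset_iff zero_power_eq)
    then have "(\<Prod>v\<in>Poly_Mapping.keys \<alpha>. ?L v ^ Poly_Mapping.lookup \<alpha> v) = 0"
      using v by (intro prod_zero) auto
    moreover have "\<alpha> \<noteq> \<beta>" using False k by auto
    ultimately show ?thesis by (simp only: sym_entry_def s lookup_zero if_False)
  qed
qed

lemma monomials_min: "monomials (min m n) d = monomials m d \<inter> monomials n d"
  by (auto simp: monomials_def subset_iff)

text \<open>The generating monomials are the products of \<open>r\<close> distinct monomials of degree \<open>d\<close>.\<close>

lemma generating_monomials_eq: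
  "generating_monomials m n d r = {\<Sum>S | S. S \<subseteq> monomials (min m n) d \<and> finite S \<and> card S = r}"
    (is "?A = ?B")
proof (intro equalityI subsetI)
  let ?E = "sym_entry m ((*\<^sub>v) (generic_diagonal m n))"
  fix \<mu> assume "\<mu> \<in> ?A"
  then obtain rs cs where
    eq: "Poly_Mapping.single \<mu> 1 = det (mat r r (\<lambda>(a, b). ?E (rs ! a) (cs ! b)))"
    and rs: "distinct rs" "set rs \<subseteq> monomials n d" "length rs = r"
    and cs: "distinct cs" "set cs \<subseteq> monomials m d" "length cs = r"
    unfolding generating_monomials_def sym_minors_def minors_def by auto
  have ent: "?E (rs ! a) (cs ! b) = (if cs ! b = rs ! a then Poly_Mapping.single (rs ! a) 1 else 0)"
    if "a < r" "b < r" for a b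
  proof -
    have "rs ! a \<in> monomials n d" "cs ! b \<in> monomials m d" using that rs cs by auto
    then show ?thesis by (auto simp: sym_entry_generic_diagonal)
  qed
  define P where "P p = (\<Prod>i = 0..<r. ?E (rs ! i) (cs ! p i))" for p
  have det: "det (mat r r (\<lambda>(a, b). ?E (rs ! a) (cs ! b))) =
     (\<Sum>p | p permutes {0..<r}. signof p * P p)"
    unfolding det_def P_def by (auto intro!: sum.cong prod.cong simp: permutes_in_image)
  have match: "cs ! p i = rs ! i" if "p permutes {0..<r}" "P p \<noteq> 0" "i < r" for p i
  proof (rule ccontr)
    assume "cs ! p i \<noteq> rs ! i"
    moreover have "p i < r" using permutes_in_image[OF that(1), of i] that(3) by simp
    ultimately have "?E (rs ! i) (cs ! p i) = 0" using ent that by simp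
    then have "P p = 0" unfolding P_def using that by (intro prod_zero) auto
    then show False using that by simp
  qed
  have "Poly_Mapping.lookup (Poly_Mapping.single \<mu> (1::int)) \<mu> \<noteq> Poly_Mapping.lookup 0 \<mu>"
    by simp
  then have "(\<Sum>p | p permutes {0..<r}. signof p * P p) \<noteq> 0"
    unfolding det[symmetric] eq[symmetric] by metis
  then obtain p where p: "p permutes {0..<r}" "P p \<noteq> 0"
    by (elim sum.not_neutral_contains_not_neutral) auto
  have uniq: "q = p" if q: "q permutes {0..<r}" "P q \<noteq> 0" for q
  proof
    fix i
    show "q i = p i"
    proof (cases "i < r")
      case True
      then have "cs ! q i = cs ! p i" using match[OF q] match[OF p] by simp
      moreover have "q i < r" "p i < r" using True permutes_in_image[OF q(1)] permutes_in_image[OF p(1)] by auto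
      ultimately show ?thesis using cs by (simp add: nth_eq_iff_index_eq)
    next
      case False
      then show ?thesis using p q by (simp add: permutes_def)
    qed
  qed
  have "(\<Sum>p | p permutes {0..<r}. signof p * P p) = (\<Sum>q\<in>{p}. signof q * P q)"
  proof (rule sum.mono_neutral_right)
    show "\<forall>q\<in>{p. p permutes {0..<r}} - {p}. signof q * P q = 0"
    proof
      fix q assume "q \<in> {p. p permutes {0..<r}} - {p}"
      then have "P q = 0" using uniq[of q] by blast
      then show "signof q * P q = 0" by simp
    qed
  qed (use p in \<open>auto simp: finite_permutations\<close>)
  then have d1: "Poly_Mapping.single \<mu> 1 = signof p * P p" using eq det by simp
  have pi: "p i < r" if "i < r" for i using permutes_in_image[OF p(1), of i] that by simp
  have "P p = (\<Prod>i = 0..<r. Poly_Mapping.single (rs ! i) 1)"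
    unfolding P_def
  proof (intro prod.cong refl)
    fix i assume "i \<in> {0..<r}"
    then show "?E (rs ! i) (cs ! p i) = Poly_Mapping.single (rs ! i) 1"
      using ent[of i "p i"] match[OF p, of i] pi[of i] by (metis atLeastLessThan_iff)
  qed
  also have "\<dots> = Poly_Mapping.single (\<Sum>i = 0..<r. rs ! i) 1" by (simp add: prod_single)
  also have "(\<Sum>i = 0..<r. rs ! i) = \<Sum>(set rs)"
    using rs by (simp add: distinct_sum_list_conv_Sum[symmetric] sum_list_sum_nth)
  finally have P: "P p = Poly_Mapping.single (\<Sum>(set rs)) 1" .
  have "\<mu> = \<Sum>(set rs)"
  proof (rule ccontr)
    assume ne: "\<mu> \<noteq> \<Sum>(set rs)"
    have "Poly_Mapping.lookup (Poly_Mapping.single \<mu> (1::int)) \<mu> = 0"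
      unfolding d1 P using ne by (auto simp: sign_def lookup_single when_def)
    then show False by simp
  qed
  moreover have "set rs \<subseteq> monomials (min m n) d"
  proof
    fix x assume "x \<in> set rs"
    then obtain i where i: "i < r" "x = rs ! i" using rs by (auto simp: in_set_conv_nth)
    have "cs ! p i \<in> set cs" using pi[OF i(1)] cs by simp
    then have "x \<in> set cs" using i match[OF p] by simp
    then show "x \<in> monomials (min m n) d"
      using \<open>x \<in> set rs\<close> rs(2) cs(2) by (auto simp: monomials_min)
  qed
  ultimately show "\<mu> \<in> ?B" using rs by (auto intro!: exI[of _ "set rs"] simp: distinct_card)
next
  let ?E = "sym_entry m ((*\<^sub>v) (generic_diagonal m n))"
  fix \<mu> assume "\<mu> \<in> ?B"
  then obtain S where S: "\<mu> = \<Sum>S" "S \<subseteq> monomials (min m n) d" "finite S" "card S = r" by auto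
  obtain xs where xs: "set xs = S" "distinct xs" using finite_distinct_list[OF S(3)] by auto
  then have len: "length xs = r" using S distinct_card by metis
  have sub: "set xs \<subseteq> monomials n d" "set xs \<subseteq> monomials m d"
    using S xs by (auto simp: monomials_min)
  let ?M = "mat r r (\<lambda>(a, b). ?E (xs ! a) (xs ! b))"
  have ent: "?E (xs ! a) (xs ! b) = (if b = a then Poly_Mapping.single (xs ! a) 1 else 0)"
    if "a < r" "b < r" for a b
  proof -
    have "xs ! a \<in> monomials n d" "xs ! b \<in> monomials m d" using that sub len by auto
    then show ?thesis using that xs len by (auto simp: sym_entry_generic_diagonal nth_eq_iff_index_eq)
  qed
  have "det ?M = prod_list (diag_mat ?M)"
    by (rule det_upper_triangular[of _ r]) (auto simp: ent upper_triangular_def)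
  also have "\<dots> = (\<Prod>i = 0..<r. Poly_Mapping.single (xs ! i) 1)"
    by (simp add: prod_list_diag_prod ent)
  also have "\<dots> = Poly_Mapping.single (\<Sum>i = 0..<r. xs ! i) 1" by (simp add: prod_single)
  also have "(\<Sum>i = 0..<r. xs ! i) = \<mu>"
    using xs len S(1) by (simp add: distinct_sum_list_conv_Sum[symmetric] sum_list_sum_nth flip: xs(1))
  finally have "Poly_Mapping.single \<mu> 1 = det ?M" ..
  then show "\<mu> \<in> ?A"
    unfolding generating_monomials_def sym_minors_def minors_def using xs len sub by blast
qed

end

theory Submission
  imports Defs "HOL-Library.Product_Lexorder"
begin

text \<open>Let \<open>X\<close> be a generic matrix and \<open>f\<close> an \<open>r\<close>-minor of \<open>S\<^sup>d(X)\<close>. Straightening writes \<open>f\<close> as an integral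
  combination of standard bitableaux. Substitute \<open>X = A Y B\<close> with \<open>A\<close>, \<open>B\<close> generic and \<open>Y\<close> diagonal: by
  functoriality and Cauchy--Binet the monomials in \<open>Y\<close> that occur in \<open>f\<close> are products of \<open>r\<close> distinct monomials
  of degree \<open>d\<close>, whereas the leading monomials of standard bitableaux are distinct and their \<open>Y\<close>-parts
  show the shapes. So only shapes above an element of \<open>\<Sigma>\<close> occur, which is the first inclusion.

  Conversely let \<open>\<sigma> \<in> \<Sigma>\<close> be the shape of \<open>\<Sum>S\<close>, \<open>S\<close> a set of \<open>r\<close> monomials. Comparing weights, minimality of \<open>\<sigma>\<close> forces the minor of
  \<open>S\<^sup>d(X)\<close> with rows and columns \<open>S\<close> to be, up to sign, a product of nested minors of \<open>X\<close> of sizes \<open>\<sigma>\<close>, a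
  conjugate of the product that generates \<open>I\<^sub>\<sigma>\<close>. Replace \<open>X\<close> by \<open>G M H\<close> with generic square \<open>G\<close> and \<open>H\<close>: the
  content of the product lies in \<open>I\<^sub>r(S\<^sup>d(M))\<close>, and by the Dedekind--Mertens lemma the product of the contents
  of the factors, which is \<open>I\<^sup>\<sigma>(M)\<close>, is integral over it. The relation \<open>I\<^sub>u I\<^sub>v \<subseteq> I\<^sub>u\<^sub>-\<^sub>1 I\<^sub>v\<^sub>+\<^sub>1\<close> for \<open>v < u - 1\<close>,
  which holds up to integral closure in general and exactly over \<open>\<rat>\<close>, leads from \<open>\<sigma>\<close> to all larger diagrams.\<close>

section \<open>Ideals\<close>

text \<open>Minors are handled over the integers: the expansion has integer coefficients, so a
  homomorphism from the generic polynomial ring carries it to every commutative ring. The obstacle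
  on the way back is that I_r(S^d(X)) is only seen to contain particular products of minors, whereas
  I^\<sigma> is generated by all products of minors of the given sizes. The content of a product of
  polynomials can be smaller than the product of the contents and agrees with it only up to integral
  closure, which is how integral closure enters. It is handled through the Rees ring because closure
  under sums is not visible in its definition by equations. The special minor is a single product
  for two opposite reasons: the expansion admits only shapes above a minimal one, while a tableau
  whose content is the weight of nested minors of sizes \<sigma> has a shape at most \<sigma>. The
  bounds meet only at \<sigma>, the content then fixes the rows, and evaluation at the identity
  matrix makes the remaining integer coefficient a unit.\<close>

definition is_ideal :: "'a::comm_ring_1 set \<Rightarrow> bool" where
  "is_ideal I \<longleftrightarrow> 0 \<in> I \<and> (\<forall>x\<in>I. \<forall>y\<in>I. x + y \<in> I) \<and> (\<forall>r. \<forall>x\<in>I. r * x \<in> I)"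

lemma is_idealI:
  assumes "0 \<in> I" "\<And>x y. x \<in> I \<Longrightarrow> y \<in> I \<Longrightarrow> x + y \<in> I" "\<And>r x. x \<in> I \<Longrightarrow> r * x \<in> I"
  shows "is_ideal I"
  using assms by (auto simp: is_ideal_def)

lemma is_idealD:
  assumes "is_ideal I"
  shows "0 \<in> I" "x \<in> I \<Longrightarrow> y \<in> I \<Longrightarrow> x + y \<in> I" "x \<in> I \<Longrightarrow> r * x \<in> I" "x \<in> I \<Longrightarrow> x * r \<in> I"
  using assms by (auto simp: is_ideal_def mult.commute[of x])

lemma is_ideal_uminus: "is_ideal I \<Longrightarrow> x \<in> I \<Longrightarrow> - x \<in> I"
  using is_idealD(3)[of I x "-1"] by simp

lemma is_ideal_diff: "is_ideal I \<Longrightarrow> x \<in> I \<Longrightarrow> y \<in> I \<Longrightarrow> x - y \<in> I"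
  using is_idealD(2)[of I x "- y"] is_ideal_uminus[of I y] by simp

lemma is_ideal_sum: "is_ideal I \<Longrightarrow> (\<And>x. x \<in> F \<Longrightarrow> f x \<in> I) \<Longrightarrow> sum f F \<in> I"
  by (induction F rule: infinite_finite_induct) (auto simp: is_idealD)

lemma is_ideal_UNIV [simp]: "is_ideal UNIV"
  by (simp add: is_ideal_def)

lemma is_ideal_gen [simp]: "is_ideal (ideal_gen S)"
proof -
  interpret Modules.module "(*) :: 'a::comm_ring_1 \<Rightarrow> 'a \<Rightarrow> 'a" by (rule module_times)
  show ?thesis unfolding ideal_gen_def by (intro is_idealI span_zero span_add span_scale)
qed

lemma ideal_gen_superset: "S \<subseteq> ideal_gen S"
proof -
  interpret Modules.module "(*) :: 'a::comm_ring_1 \<Rightarrow> 'a \<Rightarrow> 'a" by (rule module_times)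
  show ?thesis unfolding ideal_gen_def by (rule span_superset)
qed

lemma ideal_gen_base: "x \<in> S \<Longrightarrow> x \<in> ideal_gen S"
  using ideal_gen_superset by blast

lemma ideal_gen_least:
  assumes "S \<subseteq> I" "is_ideal I" shows "ideal_gen S \<subseteq> I"
proof -
  interpret Modules.module "(*) :: 'a::comm_ring_1 \<Rightarrow> 'a \<Rightarrow> 'a" by (rule module_times)
  show ?thesis unfolding ideal_gen_def
    by (rule span_minimal) (use assms in \<open>auto simp: subspace_def is_idealD\<close>)
qed

lemma ideal_multI: "a \<in> I \<Longrightarrow> b \<in> J \<Longrightarrow> a * b \<in> ideal_mult I J"
  unfolding ideal_mult_def by (rule ideal_gen_base) auto

lemma is_ideal_mult [simp]: "is_ideal (ideal_mult I J)"
  by (simp add: ideal_mult_def)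

lemma ideal_mult_least:
  "(\<And>a b. a \<in> I \<Longrightarrow> b \<in> J \<Longrightarrow> a * b \<in> K) \<Longrightarrow> is_ideal K \<Longrightarrow> ideal_mult I J \<subseteq> K"
  unfolding ideal_mult_def by (rule ideal_gen_least) auto

lemma ideal_mult_mono: "I \<subseteq> I' \<Longrightarrow> J \<subseteq> J' \<Longrightarrow> ideal_mult I J \<subseteq> ideal_mult I' J'"
  by (rule ideal_mult_least) (auto intro: ideal_multI)

lemma ideal_mult_commute: "ideal_mult I J = ideal_mult J I"
  unfolding ideal_mult_def by (rule arg_cong[where f = ideal_gen]) (use mult.commute in blast)

text \<open>Inclusions of products are checked on generators by means of colon ideals: with one
  factor fixed, the admissible values of the other form an ideal, so it suffices that this ideal
  contains the generators.\<close>

lemma is_ideal_colon: "is_ideal K \<Longrightarrow> is_ideal {x. x * c \<in> K}"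
  by (rule is_idealI) (auto simp: is_idealD algebra_simps)

lemma ideal_mult_assoc_le: "ideal_mult (ideal_mult I J) K \<subseteq> ideal_mult I (ideal_mult J K)"
proof (rule ideal_mult_least)
  fix a b assume ab: "a \<in> ideal_mult I J" "b \<in> K"
  have "ideal_mult I J \<subseteq> {x. x * b \<in> ideal_mult I (ideal_mult J K)}"
    by (rule ideal_mult_least) (use ab in \<open>auto simp: mult.assoc intro!: ideal_multI is_ideal_colon\<close>)
  then show "a * b \<in> ideal_mult I (ideal_mult J K)" using ab by auto
qed simp

lemma ideal_mult_assoc: "ideal_mult (ideal_mult I J) K = ideal_mult I (ideal_mult J K)"
  using ideal_mult_assoc_le[of I J K] ideal_mult_assoc_le[of K J I]
  by (simp add: ideal_mult_commute[of _ I] ideal_mult_commute[of K] ideal_mult_commute[of J I] subset_antisym)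

lemma ideal_mult_left_commute: "ideal_mult I (ideal_mult J K) = ideal_mult J (ideal_mult I K)"
  by (simp add: ideal_mult_assoc[symmetric] ideal_mult_commute[of I J])

lemma ideal_mult_UNIV: "is_ideal I \<Longrightarrow> ideal_mult UNIV I = I"
  using ideal_multI[of 1 UNIV _ I] by (intro subset_antisym ideal_mult_least) (auto simp: is_idealD)

lemma ideal_prod_list_Nil [simp]: "ideal_prod_list [] = UNIV"
  and ideal_prod_list_Cons [simp]: "ideal_prod_list (I # Is) = ideal_mult I (ideal_prod_list Is)"
  by (simp_all add: ideal_prod_list_def)

lemma is_ideal_prod_list [simp]: "is_ideal (ideal_prod_list Is)"
  by (cases Is) auto

lemma ideal_prod_list_append:
  "ideal_prod_list (Is @ Js) = ideal_mult (ideal_prod_list Is) (ideal_prod_list Js)"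
  by (induction Is) (auto simp: ideal_mult_UNIV ideal_mult_assoc)

lemma ideal_prod_list_mset:
  "mset Is = mset Js \<Longrightarrow> ideal_prod_list Is = ideal_prod_list Js"
proof (induction Is arbitrary: Js)
  case (Cons I Is)
  then have "I \<in> set Js" by (metis list.set_intros(1) set_mset_mset)
  then obtain xs ys where Js: "Js = xs @ I # ys" by (meson split_list)
  with Cons have "ideal_prod_list Is = ideal_prod_list (xs @ ys)" by simp
  then show ?case by (simp add: Js ideal_prod_list_append ideal_mult_left_commute)
qed simp

lemma ideal_prod_list_mem:
  "list_all2 (\<in>) xs Is \<Longrightarrow> prod_list xs \<in> ideal_prod_list Is"
  by (induction rule: list_all2_induct) (auto intro: ideal_multI)

lemma ideal_prod_list_mono:
  "list_all2 (\<subseteq>) Is Js \<Longrightarrow> ideal_prod_list Is \<subseteq> ideal_prod_list Js"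
  by (induction rule: list_all2_induct) (simp_all add: ideal_mult_mono)

abbreviation ideal_pow :: "'a::comm_ring_1 set \<Rightarrow> nat \<Rightarrow> 'a set" where
  "ideal_pow I k \<equiv> ideal_prod_list (replicate k I)"

lemma ideal_pow_add: "a \<in> ideal_pow I i \<Longrightarrow> b \<in> ideal_pow I j \<Longrightarrow> a * b \<in> ideal_pow I (i + j)"
  by (simp add: replicate_add ideal_prod_list_append ideal_multI)

lemma ideal_pow_1: "x \<in> I \<Longrightarrow> x \<in> ideal_pow I 1"
  using ideal_multI[of x I 1 UNIV] by simp

lemma ideal_pow_mono: "I \<subseteq> J \<Longrightarrow> ideal_pow I k \<subseteq> ideal_pow J k"
  by (intro ideal_prod_list_mono) (auto simp: list_all2_conv_all_nth)

lemma ideal_sum_least: "(\<And>I. I \<in> Is \<Longrightarrow> I \<subseteq> K) \<Longrightarrow> is_ideal K \<Longrightarrow> ideal_sum Is \<subseteq> K"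
  unfolding ideal_sum_def by (rule ideal_gen_least) auto

lemma ideal_sum_superset: "I \<in> Is \<Longrightarrow> I \<subseteq> ideal_sum Is"
  unfolding ideal_sum_def using ideal_gen_superset[of "\<Union>Is"] by auto

lemma is_ideal_ideal_sum [simp]: "is_ideal (ideal_sum Is)"
  by (simp add: ideal_sum_def)

section \<open>Integral elements\<close>

text \<open>Subrings are subsets of one fixed ring, not types, because the arguments below pass
  through towers of extensions and through the Rees ring inside a polynomial ring.\<close>

definition subring_set :: "'a::comm_ring_1 set \<Rightarrow> bool" where
  "subring_set S \<longleftrightarrow> 0 \<in> S \<and> 1 \<in> S \<and> (\<forall>x\<in>S. \<forall>y\<in>S. x + y \<in> S \<and> x * y \<in> S) \<and> (\<forall>x\<in>S. - x \<in> S)"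

lemma subring_setD:
  assumes "subring_set S"
  shows "0 \<in> S" "1 \<in> S" "x \<in> S \<Longrightarrow> y \<in> S \<Longrightarrow> x + y \<in> S" "x \<in> S \<Longrightarrow> y \<in> S \<Longrightarrow> x * y \<in> S"
    "x \<in> S \<Longrightarrow> - x \<in> S" "x \<in> S \<Longrightarrow> y \<in> S \<Longrightarrow> x - y \<in> S"
  using assms unfolding subring_set_def by (simp_all add: diff_conv_add_uminus del: add_uminus_conv_diff)

lemma subring_set_sum: "subring_set S \<Longrightarrow> (\<And>x. x \<in> F \<Longrightarrow> f x \<in> S) \<Longrightarrow> sum f F \<in> S"
  by (induction F rule: infinite_finite_induct) (auto simp: subring_setD)

text \<open>Values at \<open>y\<close> of the polynomials over \<open>S\<close> of degree less than \<open>k\<close>, in Horner form.\<close>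

fun low :: "'a::comm_ring_1 set \<Rightarrow> 'a \<Rightarrow> nat \<Rightarrow> 'a set" where
  "low S y 0 = {0}"
| "low S y (Suc k) = {s + y * l | s l. s \<in> S \<and> l \<in> low S y k}"

declare low.simps(2) [simp del]

lemma low_SucI: "s \<in> S \<Longrightarrow> l \<in> low S y k \<Longrightarrow> s + y * l \<in> low S y (Suc k)"
  by (auto simp: low.simps(2))

lemma low_SucE:
  assumes "p \<in> low S y (Suc k)"
  obtains s l where "p = s + y * l" "s \<in> S" "l \<in> low S y k"
  using assms by (auto simp: low.simps(2))

text \<open>\<open>0 \<in> monic_values S y k\<close> is an equation of integral dependence of
  degree \<open>k\<close>. Only values at \<open>y\<close> occur, which avoids polynomials with
  coefficients in a subset.\<close>

definition monic_values :: "'a::comm_ring_1 set \<Rightarrow> 'a \<Rightarrow> nat \<Rightarrow> 'a set" where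
  "monic_values S y k = {y ^ k + l | l. l \<in> low S y k}"

definition integral_over :: "'a::comm_ring_1 set \<Rightarrow> 'a \<Rightarrow> bool" where
  "integral_over S y \<longleftrightarrow> (\<exists>k\<ge>1. 0 \<in> monic_values S y k)"

context
  fixes S :: "'a::comm_ring_1 set" and y :: 'a
  assumes S: "subring_set S"
begin

lemma low_add: "p \<in> low S y k \<Longrightarrow> q \<in> low S y k \<Longrightarrow> p + q \<in> low S y k"
proof (induction k arbitrary: p q)
  case (Suc k)
  then obtain s l s' l' where "p = s + y * l" "q = s' + y * l'" "s \<in> S" "s' \<in> S" "l \<in> low S y k" "l' \<in> low S y k"
    by (auto elim!: low_SucE)
  then have "p + q = (s + s') + y * (l + l')" "s + s' \<in> S" "l + l' \<in> low S y k"
    using S Suc.IH by (auto simp: algebra_simps subring_setD)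
  then show ?case using low_SucI by metis
qed simp

lemma low_zero: "0 \<in> low S y k"
proof (induction k)
  case (Suc k)
  then show ?case using S low_SucI[of 0 S 0 y k] by (simp add: subring_setD)
qed simp

lemma low_smult: "c \<in> S \<Longrightarrow> p \<in> low S y k \<Longrightarrow> c * p \<in> low S y k"
proof (induction k arbitrary: p)
  case (Suc k)
  then obtain s l where "p = s + y * l" "s \<in> S" "l \<in> low S y k" by (elim low_SucE) blast
  then have "c * p = c * s + y * (c * l)" "c * s \<in> S" "c * l \<in> low S y k"
    using S Suc.IH[OF Suc.prems(1), of l] Suc.prems(1) by (simp_all add: algebra_simps subring_setD)
  then show ?case using low_SucI by metis
qed simp

lemma low_uminus: "p \<in> low S y k \<Longrightarrow> - p \<in> low S y k"
  using low_smult[of "-1" p k] S by (simp add: subring_setD)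

lemma low_sum: "(\<And>i. i \<in> F \<Longrightarrow> f i \<in> low S y k) \<Longrightarrow> sum f F \<in> low S y k"
  by (induction F rule: infinite_finite_induct) (auto simp: low_add low_zero)

lemma low_times: "p \<in> low S y k \<Longrightarrow> y * p \<in> low S y (Suc k)"
  using S low_SucI[of 0 S p y k] by (simp add: subring_setD)

lemma low_const: "c \<in> S \<Longrightarrow> c \<in> low S y (Suc k)"
  using low_zero[of k] low_SucI[of c S 0 y k] by simp

lemma low_mono_Suc: "p \<in> low S y k \<Longrightarrow> p \<in> low S y (Suc k)"
proof (induction k arbitrary: p)
  case 0
  then show ?case using S low_const[of 0 0] by (simp add: subring_setD)
next
  case (Suc k)
  then show ?case by (metis low_SucI low_SucE)
qed

lemma low_mono: "k \<le> l \<Longrightarrow> p \<in> low S y k \<Longrightarrow> p \<in> low S y l"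
  by (induction l rule: dec_induct) (auto intro: low_mono_Suc)

lemma low_power: "y ^ k \<in> low S y (Suc k)"
  by (induction k) (use S in \<open>auto simp: subring_setD intro: low_const low_times\<close>)

lemma low_mult: "p \<in> low S y k \<Longrightarrow> q \<in> low S y l \<Longrightarrow> p * q \<in> low S y (k + l)"
proof (induction k arbitrary: p)
  case (Suc k)
  then obtain s p' where p: "p = s + y * p'" "s \<in> S" "p' \<in> low S y k" by (metis low_SucE)
  have "s * q \<in> low S y (Suc k + l)" using low_mono[of l "Suc k + l"] low_smult p Suc by auto
  moreover have "y * (p' * q) \<in> low S y (Suc k + l)" using low_times[OF Suc.IH[OF p(3) Suc.prems(2)]] by simp
  ultimately show ?case using low_add p(1) by (simp add: algebra_simps del: low.simps)
qed (simp add: low_zero)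

lemma low_eq: "low S y k = {\<Sum>i<k. s i * y ^ i | s. \<forall>i. s i \<in> S}"
proof (induction k)
  case 0
  have "\<exists>s. \<forall>i::nat. s i \<in> S" using S by (auto simp: subring_setD intro!: exI[of _ "\<lambda>_. 0"])
  then show ?case by auto
next
  case (Suc k)
  show ?case
  proof (intro equalityI subsetI)
    fix p assume "p \<in> low S y (Suc k)"
    then obtain c s where p: "p = c + y * (\<Sum>i<k. s i * y ^ i)" "c \<in> S" "\<forall>i. s i \<in> S"
      using Suc by (auto elim!: low_SucE)
    then have "p = (\<Sum>i<Suc k. (case i of 0 \<Rightarrow> c | Suc j \<Rightarrow> s j) * y ^ i)"
      by (subst sum.lessThan_Suc_shift) (simp add: sum_distrib_left mult.left_commute)
    moreover have "\<forall>i. (case i of 0 \<Rightarrow> c | Suc j \<Rightarrow> s j) \<in> S" using p by (auto split: nat.split)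
    ultimately show "p \<in> {\<Sum>i<Suc k. s i * y ^ i | s. \<forall>i. s i \<in> S}"
      by (intro CollectI exI[of _ "\<lambda>i. case i of 0 \<Rightarrow> c | Suc j \<Rightarrow> s j"]) simp
  next
    fix p assume "p \<in> {\<Sum>i<Suc k. s i * y ^ i | s. \<forall>i. s i \<in> S}"
    then obtain s where s: "p = (\<Sum>i<Suc k. s i * y ^ i)" "\<forall>i. s i \<in> S" by auto
    then have "p = s 0 + y * (\<Sum>i<k. s (Suc i) * y ^ i)"
      by (subst (asm) sum.lessThan_Suc_shift) (simp add: sum_distrib_left mult.left_commute)
    moreover have "(\<Sum>i<k. s (Suc i) * y ^ i) \<in> low S y k" using Suc s(2) by auto
    ultimately show "p \<in> low S y (Suc k)" using s(2) low_SucI by metis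
  qed
qed

lemma monic_times: "q \<in> monic_values S y k \<Longrightarrow> c \<in> S \<Longrightarrow> (y - c) * q \<in> monic_values S y (Suc k)"
proof -
  assume "q \<in> monic_values S y k" and c: "c \<in> S"
  then obtain l where l: "q = y ^ k + l" "l \<in> low S y k" by (auto simp: monic_values_def)
  have "(y - c) * q = y ^ Suc k + (y * l + (- c) * y ^ k + (- c) * l)" by (simp add: l algebra_simps)
  moreover have "y * l + (- c) * y ^ k + (- c) * l \<in> low S y (Suc k)"
    using l c S by (intro low_add low_times low_smult low_power low_mono_Suc) (auto simp: subring_setD)
  ultimately show ?thesis unfolding monic_values_def by blast
qed

lemma monic_times_y: "q \<in> monic_values S y k \<Longrightarrow> y * q \<in> monic_values S y (Suc k)"
  using monic_times[of q k 0] S by (simp add: subring_setD)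

lemma monic_add: "q \<in> monic_values S y k \<Longrightarrow> l \<in> low S y k \<Longrightarrow> q + l \<in> monic_values S y k"
  unfolding monic_values_def using low_add by (fastforce simp: add.assoc)

text \<open>The matrix \<open>N\<close> of \<open>y\<close> minus the coefficients kills the vector
  \<open>v\<close>, and multiplication by the adjugate turns this into
  \<open>det N * v i = 0\<close>. In the Leibniz formula only the identity permutation reaches
  degree \<open>n\<close> in \<open>y\<close>, with leading coefficient 1.\<close>

lemma determinant_trick:
  assumes c: "\<And>i j. i < n \<Longrightarrow> j < n \<Longrightarrow> c i j \<in> S"
    and v: "\<And>i. i < n \<Longrightarrow> y * v i = (\<Sum>j<n. c i j * v j)"
  obtains q where "q \<in> monic_values S y n" "\<And>i. i < n \<Longrightarrow> q * v i = 0"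
proof
  define N where "N = mat n n (\<lambda>(i, j). if i = j then y - c i j else - c i j)"
  have N: "N \<in> carrier_mat n n" by (simp add: N_def)
  define P where "P p = (\<Prod>i = 0..<n. N $$ (i, p i))" for p
  have mon: "(\<Prod>i\<in>F. y - c i i) \<in> monic_values S y (card F)" if "finite F" "F \<subseteq> {0..<n}" for F
    using that
  proof (induction F)
    case empty
    show ?case by (auto simp: monic_values_def)
  next
    case (insert i F)
    then show ?case using c by (auto intro!: monic_times)
  qed
  \<comment> \<open>A product of \<open>card F\<close> entries has degree at most
    \<open>card F\<close> in \<open>y\<close>; \<open>low\<close> counts coefficients, whence the
    \<open>Suc\<close>.\<close>
  have lo: "(\<Prod>i\<in>F. N $$ (i, p i)) \<in> low S y (Suc (card F))" if "finite F" "F \<subseteq> {0..<n}" "p permutes {0..<n}" for p F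
    using that
  proof (induction F)
    case empty
    show ?case using S low_const[of 1 0] by (simp add: subring_setD)
  next
    case (insert i F)
    have i: "i < n" "p i < n" using insert.prems permutes_in_image[OF insert.prems(2), of i] by auto
    let ?q = "\<Prod>i\<in>F. N $$ (i, p i)"
    have q: "?q \<in> low S y (Suc (card F))" using insert by auto
    have "c i (p i) * ?q \<in> low S y (Suc (card (insert i F)))"
      using low_mono_Suc[OF low_smult[OF c[OF i] q]] insert.hyps by simp
    moreover have "y * ?q \<in> low S y (Suc (card (insert i F)))"
      using low_times[OF q] insert.hyps by simp
    ultimately have "y * ?q + - (c i (p i) * ?q) \<in> low S y (Suc (card (insert i F)))"
       "- (c i (p i) * ?q) \<in> low S y (Suc (card (insert i F)))"
      by (blast intro: low_add low_uminus)+
    moreover have "(\<Prod>i\<in>insert i F. N $$ (i, p i)) =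
        (if i = p i then y * ?q + - (c i (p i) * ?q) else - (c i (p i) * ?q))"
      using i insert.hyps by (auto simp: N_def algebra_simps)
    ultimately show ?case by (cases "i = p i") simp_all
  qed
  \<comment> \<open>Some off-diagonal factor is free of \<open>y\<close>, and the other
    \<open>n - 1\<close> factors contribute degree at most \<open>n - 1\<close>, so the term lies
    strictly below degree \<open>n\<close>.\<close>
  have off: "signof p * P p \<in> low S y n" if p: "p permutes {0..<n}" "p \<noteq> id" for p
  proof -
    obtain i where "p i \<noteq> i" using p(2) by (auto simp: fun_eq_iff)
    then have i: "i < n" using p(1) unfolding permutes_def by (metis atLeastLessThan_iff le0)
    then have "p i < n" using permutes_in_image[OF p(1), of i] by auto
    have "P p = - c i (p i) * (\<Prod>i\<in>{0..<n} - {i}. N $$ (i, p i))"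
      unfolding P_def using i \<open>p i < n\<close> \<open>p i \<noteq> i\<close> by (subst prod.remove[of _ i]) (auto simp: N_def)
    also have "\<dots> \<in> low S y n"
      using lo[of "{0..<n} - {i}" p] p(1) i c[OF i \<open>p i < n\<close>] S
      by (intro low_smult) (auto simp: subring_setD)
    finally show ?thesis
      by (cases "sign p = 1") (auto simp: sign_def intro: low_uminus)
  qed
  have "det N = (\<Sum>p | p permutes {0..<n}. signof p * P p)"
    using det_def'[OF N] by (simp add: P_def)
  also have "\<dots> = signof id * P id + (\<Sum>p \<in> {p. p permutes {0..<n}} - {id}. signof p * P p)"
    by (rule sum.remove) (auto simp: finite_permutations permutes_id)
  also have "signof id * P id = (\<Prod>i\<in>{0..<n}. y - c i i)"
    by (simp add: P_def N_def)
  finally show "det N \<in> monic_values S y n"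
    using mon[of "{0..<n}"] off unfolding id_def by (auto intro!: monic_add low_sum)
  fix i assume i: "i < n"
  define w where "w = vec n v"
  have w: "w \<in> carrier_vec n" by (simp add: w_def)
  have Nw: "N *\<^sub>v w = 0\<^sub>v n"
  proof (rule eq_vecI)
    fix k assume k: "k < dim_vec (0\<^sub>v n :: 'a vec)"
    have "(N *\<^sub>v w) $ k = (\<Sum>j = 0..<n. (if k = j then y - c k j else - c k j) * v j)"
      using k by (simp add: N_def w_def scalar_prod_def)
    also have "\<dots> = (\<Sum>j = 0..<n. (if k = j then y * v j else 0) - c k j * v j)"
      by (rule sum.cong) (auto simp: algebra_simps)
    also have "\<dots> = 0" using v[of k] k by (simp add: sum_subtractf lessThan_atLeast0)
    finally show "(N *\<^sub>v w) $ k = 0\<^sub>v n $ k" using k by simp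
  qed (simp add: N_def)
  have "(det N \<cdot>\<^sub>m 1\<^sub>m n) *\<^sub>v w = (adj_mat N * N) *\<^sub>v w" using adj_mat[OF N] by simp
  also have "\<dots> = adj_mat N *\<^sub>v (N *\<^sub>v w)"
    using adj_mat(1)[OF N] N w by (rule assoc_mult_mat_vec)
  also have "\<dots> = 0\<^sub>v n" unfolding Nw using adj_mat(1)[OF N] by (intro eq_vecI) (auto simp: scalar_prod_def)
  finally have "((det N \<cdot>\<^sub>m 1\<^sub>m n) *\<^sub>v w) $ i = 0" using i by simp
  moreover have "((det N \<cdot>\<^sub>m 1\<^sub>m n) *\<^sub>v w) $ i = det N * v i"
  proof -
    have "((det N \<cdot>\<^sub>m 1\<^sub>m n) *\<^sub>v w) $ i = (\<Sum>j = 0..<n. det N * (if j = i then 1 else 0) * v j)"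
      using i by (simp add: w_def scalar_prod_def)
    also have "\<dots> = (\<Sum>j = 0..<n. if j = i then det N * v j else 0)" by (rule sum.cong) auto
    finally have "((det N \<cdot>\<^sub>m 1\<^sub>m n) *\<^sub>v w) $ i = (\<Sum>j = 0..<n. if j = i then det N * v j else 0)" .
    then show ?thesis using i by simp
  qed
  ultimately show "det N * v i = 0" by simp
qed

end

section \<open>Towers of integral extensions\<close>

lemma low_subset: "S \<subseteq> S' \<Longrightarrow> low S y k \<subseteq> low S' y k"
proof (induction k)
  case (Suc k)
  then show ?case by (auto simp: low.simps(2))
qed simp

lemma integral_over_mono: "integral_over S y \<Longrightarrow> S \<subseteq> S' \<Longrightarrow> integral_over S' y"
  unfolding integral_over_def monic_values_def using low_subset[of S S' y] by blast

definition adjoin :: "'a::comm_ring_1 set \<Rightarrow> 'a \<Rightarrow> 'a set" where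
  "adjoin S y = (\<Union>k. low S y k)"

lemma subring_set_adjoin: "subring_set S \<Longrightarrow> subring_set (adjoin S y)"
  unfolding adjoin_def subring_set_def[of "\<Union> _"]
proof (intro conjI ballI)
  assume S: "subring_set S"
  show "0 \<in> (\<Union>k. low S y k)" using low_zero[OF S] by blast
  show "1 \<in> (\<Union>k. low S y k)" using low_power[OF S, of y 0] by (metis UN_iff UNIV_I power_0)
  fix p q assume "p \<in> (\<Union>k. low S y k)" "q \<in> (\<Union>k. low S y k)"
  then obtain k l where "p \<in> low S y k" "q \<in> low S y l" by auto
  then have "p + q \<in> low S y (max k l)" "p * q \<in> low S y (k + l)" "- p \<in> low S y k"
    using low_mono[OF S, of k "max k l" p] low_mono[OF S, of l "max k l" q]
    by (auto intro!: low_add[OF S] low_mult[OF S] low_uminus[OF S])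
  then show "p + q \<in> (\<Union>k. low S y k)" "p * q \<in> (\<Union>k. low S y k)" by auto
next
  assume S: "subring_set S"
  fix p assume "p \<in> (\<Union>k. low S y k)"
  then show "- p \<in> (\<Union>k. low S y k)" using low_uminus[OF S] by blast
qed

lemma adjoin_superset: "subring_set S \<Longrightarrow> S \<subseteq> adjoin S y" "subring_set S \<Longrightarrow> y \<in> adjoin S y"
  unfolding adjoin_def using low_const[of S _ y 0] low_power[of S y 1] by (fastforce, metis UN_iff UNIV_I power_one_right)

lemma integral_over_self: "subring_set S \<Longrightarrow> y \<in> S \<Longrightarrow> integral_over S y"
  unfolding integral_over_def monic_values_def
  using low_const[of S "- y" y 0] by (intro exI[of _ 1]) (auto intro!: exI[of _ "- y"] simp: subring_setD)

text \<open>The monic equation rewrites \<open>y ^ k\<close> in lower powers, so the span of the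
  first \<open>k\<close> powers is stable under multiplication by \<open>y\<close>.\<close>

lemma adjoin_integral:
  assumes S: "subring_set S" and k: "0 \<in> monic_values S y k"
  shows "adjoin S y = low S y k"
proof -
  have y: "y ^ k \<in> low S y k"
  proof -
    obtain l where "0 = y ^ k + l" "l \<in> low S y k" using k by (auto simp: monic_values_def)
    then have "y ^ k = - l" "l \<in> low S y k" by (auto simp: eq_neg_iff_add_eq_0)
    then show ?thesis using low_uminus[OF S] by auto
  qed
  have step: "y * p \<in> low S y k" if "p \<in> low S y k" for p
  proof (cases k)
    case 0
    then show ?thesis using that by simp
  next
    case (Suc k')
    obtain s where s: "p = (\<Sum>i<k. s i * y ^ i)" "\<forall>i. s i \<in> S" using \<open>p \<in> low S y k\<close> unfolding low_eq[OF S] by blast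
    have "s i * y ^ Suc i \<in> low S y k" if "i < k" for i
    proof (cases "Suc i = k")
      case False
      then show ?thesis using s(2) that low_power[OF S, of y "Suc i"] low_mono[OF S, of "Suc (Suc i)" k]
        by (intro low_smult[OF S]) auto
    qed (use s(2) y in \<open>auto intro!: low_smult[OF S]\<close>)
    then have "(\<Sum>i<k. s i * y ^ Suc i) \<in> low S y k" by (intro low_sum[OF S]) auto
    then show ?thesis by (simp add: s(1) sum_distrib_left mult.left_commute)
  qed
  have one: "l \<in> low S y k" if "l \<in> low S y j" for l j
    using that
  proof (induction j arbitrary: l)
    case 0
    then show ?case using low_zero[OF S] by simp
  next
    case (Suc j)
    then obtain s l' where l: "l = s + y * l'" "s \<in> S" "l' \<in> low S y j" by (metis low_SucE)
    have "s \<in> low S y k"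
    proof (cases k)
      \<comment> \<open>In degree 0 the only monic value is 1, so here 1 = 0 and the ring is
        trivial.\<close>
      case 0
      then have "(1::'a) = 0" using k by (auto simp: monic_values_def)
      then have "s = 0" by (metis mult_1 mult_zero_left)
      then show ?thesis using low_zero[OF S] by simp
    qed (use low_const[OF S] l in auto)
    then show ?case using step[OF Suc.IH[OF l(3)]] l(1) low_add[OF S] by simp
  qed
  then show ?thesis unfolding adjoin_def by blast
qed

lemma sum_lessThan_prod:
  "(\<Sum>i<k * e. f (i div e) (i mod e)) = (\<Sum>i<k. \<Sum>j<e. f i (j::nat) :: 'a::comm_monoid_add)"
proof (cases "e = 0")
  case False
  have "(\<Sum>i<k. \<Sum>j<e. f i j) = (\<Sum>(i, j)\<in>{..<k} \<times> {..<e}. f i j)" by (simp add: sum.cartesian_product)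
  also have "\<dots> = (\<Sum>i<k * e. f (i div e) (i mod e))"
  proof (rule sum.reindex_bij_witness[of _ "\<lambda>i. (i div e, i mod e)" "\<lambda>(i, j). i * e + j"])
    fix a assume a: "a \<in> {..<k} \<times> {..<e}"
    obtain i j where ij: "a = (i, j)" "i < k" "j < e" using a by auto
    have "i * e + j < i * e + e" using ij by simp
    also have "\<dots> = Suc i * e" by simp
    also have "\<dots> \<le> k * e" using ij by (intro mult_le_mono1) auto
    finally show "(case a of (i, j) \<Rightarrow> i * e + j) \<in> {..<k * e}" using ij by simp
  qed (use False in \<open>auto simp: less_mult_imp_div_less\<close>)
  finally show ?thesis ..
qed simp

text \<open>The products \<open>y ^ i * z ^ j\<close> with \<open>i < k\<close> and
  \<open>j < e\<close> span over \<open>S\<close> a module that is stable under \<open>z\<close>;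
  the determinant trick applies to it.\<close>

lemma integral_over_adjoin:
  assumes S: "subring_set S" and y: "integral_over S y" and z: "integral_over (adjoin S y) z"
  shows "integral_over S z"
proof -
  obtain k where k: "k \<ge> 1" "0 \<in> monic_values S y k" using y by (auto simp: integral_over_def)
  note A = adjoin_integral[OF S k(2)] subring_set_adjoin[OF S, of y]
  obtain e where e: "e \<ge> 1" "0 \<in> monic_values (adjoin S y) z e" using z by (auto simp: integral_over_def)
  then obtain l where l: "0 = z ^ e + l" "l \<in> low (adjoin S y) z e" by (auto simp: monic_values_def)
  then obtain t where t: "l = (\<Sum>j<e. t j * z ^ j)" "\<forall>j. t j \<in> adjoin S y"
    unfolding low_eq[OF A(2)] by blast
  \<comment> \<open>The pair of exponents is packed into one index below \<open>k * e\<close>: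
    quotient and remainder by \<open>e\<close>.\<close>
  define V where "V i = y ^ (i div e) * z ^ (i mod e)" for i
  have yk: "y ^ i \<in> adjoin S y" for i
    using A(2) adjoin_superset(2)[OF S, of y] by (induction i) (auto simp: subring_setD)
  have "\<exists>c. (\<forall>j. c j \<in> S) \<and> z * V i = (\<Sum>j<k * e. c j * V j)" if i: "i < k * e" for i
  proof -
    have "\<exists>u. (\<forall>j. u j \<in> adjoin S y) \<and> z * V i = (\<Sum>j<e. u j * z ^ j)"
    proof (cases "Suc (i mod e) = e")
      case True
      have "z * V i = y ^ (i div e) * z ^ Suc (i mod e)" by (simp add: V_def)
      also have "z ^ Suc (i mod e) = - l" using l(1) True by (simp add: eq_neg_iff_add_eq_0)
      also have "y ^ (i div e) * - l = (\<Sum>j<e. (- (y ^ (i div e)) * t j) * z ^ j)"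
        by (simp add: t(1) sum_distrib_left sum_negf mult.assoc)
      finally show ?thesis using t(2) yk A(2)
        by (intro exI[of _ "\<lambda>j. - (y ^ (i div e)) * t j"]) (auto simp: subring_setD)
    next
      case False
      then have *: "Suc (i mod e) < e" using e(1) mod_less_divisor[of e i] by linarith
      have "z * V i = (\<Sum>j<e. (if j = Suc (i mod e) then y ^ (i div e) else 0) * z ^ j)"
        using * by (simp add: V_def if_distrib[of "\<lambda>x. x * _"] cong: if_cong)
      then show ?thesis using yk A(2)
        by (intro exI[of _ "\<lambda>j. if j = Suc (i mod e) then y ^ (i div e) else 0"]) (auto simp: subring_setD)
    qed
    then obtain u where u: "\<forall>j. u j \<in> adjoin S y" "z * V i = (\<Sum>j<e. u j * z ^ j)" by auto
    have "\<forall>j. \<exists>s. (\<forall>i. s i \<in> S) \<and> u j = (\<Sum>i<k. s i * y ^ i)"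
      using u(1) unfolding A(1) low_eq[OF S] by auto
    then obtain s where s: "\<And>j i. s j i \<in> S" "\<And>j. u j = (\<Sum>i<k. s j i * y ^ i)" by metis
    have "(\<Sum>j<k * e. s (j mod e) (j div e) * V j) = (\<Sum>i<k. \<Sum>j<e. s j i * (y ^ i * z ^ j))"
      unfolding V_def by (rule sum_lessThan_prod)
    also have "\<dots> = (\<Sum>j<e. \<Sum>i<k. s j i * (y ^ i * z ^ j))" by (rule sum.swap)
    also have "\<dots> = z * V i" unfolding u(2) s(2) by (simp add: sum_distrib_right mult.assoc)
    finally show ?thesis using s(1) by (intro exI[of _ "\<lambda>j. s (j mod e) (j div e)"]) auto
  qed
  then obtain c where c: "\<And>i j. i < k * e \<Longrightarrow> c i j \<in> S" "\<And>i. i < k * e \<Longrightarrow> z * V i = (\<Sum>j<k * e. c i j * V j)"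
    by metis
  obtain q where q: "q \<in> monic_values S z (k * e)" "\<And>i. i < k * e \<Longrightarrow> q * V i = 0"
    using determinant_trick[OF S, of "k * e" c z V] c by blast
  \<comment> \<open>\<open>V 0 = 1\<close>, so an element that annihilates all \<open>V i\<close> is
    0.\<close>
  have "q = 0" using q(2)[of 0] k(1) e(1) by (simp add: V_def)
  then show ?thesis unfolding integral_over_def using q(1) k(1) e(1) by (intro exI[of _ "k * e"]) auto
qed

text \<open>Sum and product lie in the ring \<open>S[x][y]\<close>, and integrality descends from it
  in two steps.\<close>

lemma integral_over_add_mult:
  assumes S: "subring_set S" and x: "integral_over S x" and y: "integral_over S y"
  shows "integral_over S (x + y)" "integral_over S (x * y)"
proof -
  note S1 = subring_set_adjoin[OF S, of x]
  note S2 = subring_set_adjoin[OF S1, of y]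
  have "x \<in> adjoin (adjoin S x) y" "y \<in> adjoin (adjoin S x) y"
    using adjoin_superset[OF S, of x] adjoin_superset[OF S1, of y] by auto
  then have "integral_over (adjoin (adjoin S x) y) (x + y)" "integral_over (adjoin (adjoin S x) y) (x * y)"
    using S2 by (auto intro!: integral_over_self simp: subring_setD)
  then show "integral_over S (x + y)" "integral_over S (x * y)"
    using integral_over_adjoin[OF S x] integral_over_adjoin[OF S1] integral_over_mono[OF y adjoin_superset(1)[OF S]]
    by blast+
qed

text \<open>An equation for \<open>z\<close> involves finitely many integral coefficients. They are
  adjoined one after another to a ring \<open>T\<close>, keeping the property that whatever is
  integral over \<open>T\<close> is integral over \<open>S\<close>.\<close>

lemma integral_over_trans:
  assumes S: "subring_set S" and z: "integral_over (Collect (integral_over S)) z"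
  shows "integral_over S z"
proof -
  obtain k l where l: "k \<ge> 1" "0 = z ^ k + l" "l \<in> low (Collect (integral_over S)) z k"
    using z by (auto simp: integral_over_def monic_values_def)
  have *: "\<exists>T. subring_set T \<and> S \<subseteq> T \<and> l \<in> low T z j \<and> (\<forall>w. integral_over T w \<longrightarrow> integral_over S w)"
    if "l \<in> low (Collect (integral_over S)) z j" for j l
    using that
  proof (induction j arbitrary: l)
    case 0
    then show ?case using S by auto
  next
    case (Suc j)
    then obtain s l' where l': "l = s + z * l'" "integral_over S s" "l' \<in> low (Collect (integral_over S)) z j"
      by (auto elim!: low_SucE)
    obtain T where T: "subring_set T" "S \<subseteq> T" "l' \<in> low T z j" "\<And>w. integral_over T w \<Longrightarrow> integral_over S w"
      using Suc.IH[OF l'(3)] by blast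
    let ?T = "adjoin T s"
    have "l' \<in> low ?T z j" using T(3) low_subset[OF adjoin_superset(1)[OF T(1)]] by blast
    then have "l \<in> low ?T z (Suc j)" using l'(1) adjoin_superset(2)[OF T(1)] low_SucI by metis
    moreover have "integral_over S w" if "integral_over ?T w" for w
      using integral_over_adjoin[OF T(1) integral_over_mono[OF l'(2) T(2)] that] T(4) by blast
    ultimately show ?case using subring_set_adjoin[OF T(1)] adjoin_superset(1)[OF T(1)] T(2)
      by (intro exI[of _ ?T]) blast
  qed
  obtain T where "l \<in> low T z k" "\<And>w. integral_over T w \<Longrightarrow> integral_over S w" using *[OF l(3)] by blast
  then show ?thesis using l(1,2) unfolding integral_over_def monic_values_def by blast
qed

section \<open>Integral closure of ideals\<close>

text \<open>The Rees ring of \<open>A\<close> inside \<open>R[t]\<close>; \<open>x\<close> is integral over the ideal \<open>A\<close> if and only if \<open>x t\<close> is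
  integral over the Rees ring.\<close>

definition rees :: "'a::comm_ring_1 set \<Rightarrow> 'a poly set" where
  "rees A = {p. \<forall>i. coeff p i \<in> ideal_pow A i}"

lemma subring_rees: "subring_set (rees A)"
  unfolding subring_set_def
proof (intro conjI ballI)
  show "0 \<in> rees A" by (simp add: rees_def is_idealD)
  have "coeff (1 :: 'a poly) i \<in> ideal_pow A i" for i by (cases i) (auto simp: is_idealD)
  then show "1 \<in> rees A" by (simp add: rees_def)
  fix p q assume pq: "p \<in> rees A" "q \<in> rees A"
  then show "p + q \<in> rees A" by (simp add: rees_def is_idealD)
  have "coeff p j * coeff q (i - j) \<in> ideal_pow A i" if "j \<le> i" for i j
    using ideal_pow_add[of "coeff p j" j A "coeff q (i - j)" "i - j"] pq that by (simp add: rees_def)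
  then show "p * q \<in> rees A" by (auto simp: rees_def coeff_mult intro!: is_ideal_sum)
next
  fix p assume "p \<in> rees A"
  then show "- p \<in> rees A" by (simp add: rees_def is_ideal_uminus)
qed

lemma monom_rees: "c \<in> ideal_pow A i \<Longrightarrow> monom c i \<in> rees A"
  by (auto simp: rees_def is_idealD)

lemma monom_power: "monom x n ^ k = monom (x ^ k) (n * k)"
  by (induction k) (simp_all add: mult_monom)

lemma coeff_mult_monom: "coeff (p * monom c i) k = (if k < i then 0 else coeff p (k - i) * c)"
  using coeff_monom_mult[of c i p k] by (simp add: mult.commute)

text \<open>Multiplying the i-th coefficient by \<open>t^i\<close> makes an equation for
  \<open>x\<close> into one for \<open>x t\<close>. Conversely, an equation for \<open>x t\<close>
  over the Rees ring may be inhomogeneous, but its part of degree \<open>k\<close> in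
  \<open>t\<close> is again an equation, with coefficients in the required powers of the
  ideal.\<close>

lemma integral_closure_iff:
  "x \<in> integral_closure A \<longleftrightarrow> integral_over (rees A) (monom x 1)"
proof
  assume "x \<in> integral_closure A"
  then obtain k a where k: "k \<ge> 1" "\<And>i. i \<in> {1..k} \<Longrightarrow> a i \<in> ideal_pow A i"
    "x ^ k + (\<Sum>i=1..k. a i * x ^ (k - i)) = 0"
    unfolding integral_closure_def by blast
  define s where "s i = (if i < k then monom (a (k - i)) (k - i) else 0)" for i
  have s: "s i \<in> rees A" for i
    using k(2)[of "k - i"] subring_setD(1)[OF subring_rees] by (auto simp: s_def intro!: monom_rees)
  have "(\<Sum>i<k. s i * monom x 1 ^ i) = (\<Sum>i=1..k. monom (a i * x ^ (k - i)) k)"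
    by (rule sum.reindex_bij_witness[of _ "\<lambda>i. k - i" "\<lambda>i. k - i"])
       (auto simp: s_def monom_power mult_monom)
  also have "\<dots> = monom (\<Sum>i=1..k. a i * x ^ (k - i)) k" by (simp add: monom_sum)
  finally have "monom x 1 ^ k + (\<Sum>i<k. s i * monom x 1 ^ i) = 0"
    using k(3) by (simp add: monom_power add_monom)
  moreover have "(\<Sum>i<k. s i * monom x 1 ^ i) \<in> low (rees A) (monom x 1) k"
    using s by (subst low_eq[OF subring_rees]) blast
  ultimately show "integral_over (rees A) (monom x 1)"
    unfolding integral_over_def monic_values_def using k(1) by (metis (mono_tags, lifting) mem_Collect_eq)
next
  assume "integral_over (rees A) (monom x 1)"
  then obtain k l where k: "k \<ge> 1" "0 = monom x 1 ^ k + l" "l \<in> low (rees A) (monom x 1) k"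
    by (auto simp: integral_over_def monic_values_def)
  then obtain s where s: "l = (\<Sum>i<k. s i * monom x 1 ^ i)" "\<forall>i. s i \<in> rees A"
    unfolding low_eq[OF subring_rees] by blast
  have "0 = coeff (monom x 1 ^ k + l) k" using k(2) by (metis coeff_0)
  also have "\<dots> = x ^ k + (\<Sum>i<k. coeff (s i * monom (x ^ i) i) k)"
    by (simp add: s(1) coeff_sum monom_power)
  also have "(\<Sum>i<k. coeff (s i * monom (x ^ i) i) k) = (\<Sum>i<k. coeff (s i) (k - i) * x ^ i)"
    by (intro sum.cong refl) (simp add: coeff_mult_monom)
  also have "(\<Sum>i<k. coeff (s i) (k - i) * x ^ i) = (\<Sum>i=1..k. coeff (s (k - i)) i * x ^ (k - i))"
    by (rule sum.reindex_bij_witness[of _ "\<lambda>i. k - i" "\<lambda>i. k - i"]) auto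
  finally show "x \<in> integral_closure A" unfolding integral_closure_def
    using k(1) s(2) by (intro CollectI exI[of _ k] exI[of _ "\<lambda>i. coeff (s (k - i)) i"] conjI) (simp_all add: rees_def)
qed

text \<open>Closure under addition is transported from integral elements over the Rees ring; a
  scalar is a constant polynomial there.\<close>

lemma is_ideal_integral_closure [simp]: "is_ideal (integral_closure A)"
proof (rule is_idealI)
  show "0 \<in> integral_closure A"
    using integral_over_self[OF subring_rees] subring_setD(1)[OF subring_rees, of A] by (simp add: integral_closure_iff)
  show "x + y \<in> integral_closure A" if "x \<in> integral_closure A" "y \<in> integral_closure A" for x y
    using integral_over_add_mult(1)[OF subring_rees] that by (simp add: integral_closure_iff flip: add_monom)
  show "r * x \<in> integral_closure A" if "x \<in> integral_closure A" for r x
  proof -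
    have "integral_over (rees A) (monom r 0)"
      by (intro integral_over_self subring_rees monom_rees) simp
    then have "integral_over (rees A) (monom r 0 * monom x 1)"
      using integral_over_add_mult(2)[OF subring_rees] that by (simp add: integral_closure_iff)
    then show ?thesis by (simp add: integral_closure_iff mult_monom)
  qed
qed

lemma integral_closure_superset: "A \<subseteq> integral_closure A"
  using integral_over_self[OF subring_rees monom_rees[OF ideal_pow_1]] by (auto simp: integral_closure_iff)

lemma rees_mono: "A \<subseteq> B \<Longrightarrow> rees A \<subseteq> rees B"
  unfolding rees_def using ideal_pow_mono[of A B] by blast

lemma integral_closure_mono: "A \<subseteq> B \<Longrightarrow> integral_closure A \<subseteq> integral_closure B"
  unfolding integral_closure_iff subset_iff using integral_over_mono rees_mono by blast

text \<open>Each homogeneous component \<open>c t^i\<close> of an element of the Rees ring of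
  \<open>B\<close> is integral over that of \<open>A\<close>, by induction on \<open>i\<close>;
  transitivity of integrality then applies to \<open>x t\<close>.\<close>

lemma integral_closure_trans:
  assumes B: "B \<subseteq> integral_closure A"
  shows "integral_closure B \<subseteq> integral_closure A"
proof
  fix x assume x: "x \<in> integral_closure B"
  have pow: "ideal_pow B i \<subseteq> {c. integral_over (rees A) (monom c i)}" for i
  proof (induction i)
    case 0
    show ?case by (auto intro!: integral_over_self subring_rees monom_rees)
  next
    case (Suc i)
    have "is_ideal {c. integral_over (rees A) (monom c (Suc i))}"
    proof (rule is_idealI)
      show "0 \<in> {c. integral_over (rees A) (monom c (Suc i))}"
        using integral_over_self[OF subring_rees] subring_setD(1)[OF subring_rees, of A] by simp
      show "a + b \<in> {c. integral_over (rees A) (monom c (Suc i))}"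
        if "a \<in> {c. integral_over (rees A) (monom c (Suc i))}" "b \<in> {c. integral_over (rees A) (monom c (Suc i))}" for a b
        using integral_over_add_mult(1)[OF subring_rees] that by (simp flip: add_monom)
      show "r * b \<in> {c. integral_over (rees A) (monom c (Suc i))}"
        if "b \<in> {c. integral_over (rees A) (monom c (Suc i))}" for r b
      proof -
        have "integral_over (rees A) (monom r 0)"
          by (intro integral_over_self subring_rees monom_rees) simp
        then have "integral_over (rees A) (monom r 0 * monom b (Suc i))"
          using integral_over_add_mult(2)[OF subring_rees] that by simp
        then show ?thesis by (simp add: mult_monom)
      qed
    qed
    moreover have "a * b \<in> {c. integral_over (rees A) (monom c (Suc i))}" if "a \<in> B" "b \<in> ideal_pow B i" for a b
    proof -
      have "integral_over (rees A) (monom a 1)" "integral_over (rees A) (monom b i)"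
        using that B Suc by (auto simp: integral_closure_iff)
      then have "integral_over (rees A) (monom a 1 * monom b i)"
        by (rule integral_over_add_mult(2)[OF subring_rees])
      then show ?thesis by (simp add: mult_monom)
    qed
    ultimately show ?case unfolding replicate_Suc ideal_prod_list_Cons
      by (intro ideal_mult_least) auto
  qed
  have "rees B \<subseteq> Collect (integral_over (rees A))"
  proof
    fix p assume p: "p \<in> rees B"
    have "integral_over (rees A) (\<Sum>i\<in>F. monom (coeff p i) i)" if "finite F" for F
      using that
    proof (induction F)
      case empty
      then show ?case using integral_over_self[OF subring_rees] subring_setD(1)[OF subring_rees, of A] by simp
    next
      case (insert i F)
      have "integral_over (rees A) (monom (coeff p i) i)" using pow[of i] p by (auto simp: rees_def)
      then show ?case using insert by (simp add: integral_over_add_mult(1)[OF subring_rees])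
    qed
    from this[of "{..degree p}"] show "p \<in> Collect (integral_over (rees A))"
      by (simp add: poly_as_sum_of_monoms)
  qed
  then have "integral_over (Collect (integral_over (rees A))) (monom x 1)"
    using x integral_over_mono by (auto simp: integral_closure_iff)
  then show "x \<in> integral_closure A"
    using integral_over_trans[OF subring_rees] by (simp add: integral_closure_iff)
qed

lemma ideal_pow_mult_power:
  "a \<in> ideal_pow A i \<Longrightarrow> y \<in> B \<Longrightarrow> a * y ^ i \<in> ideal_pow (ideal_mult A B) i"
proof (induction i arbitrary: a)
  case (Suc i)
  let ?K = "ideal_pow (ideal_mult A B) (Suc i)"
  have "ideal_mult A (ideal_pow A i) \<subseteq> {a. a * y ^ Suc i \<in> ?K}"
  proof (rule ideal_mult_least)
    fix a b assume "a \<in> A" "b \<in> ideal_pow A i"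
    then have "(a * y) * (b * y ^ i) \<in> ?K" using Suc by (auto intro!: ideal_multI)
    then show "a * b \<in> {a. a * y ^ Suc i \<in> ?K}" by (simp add: algebra_simps)
  qed (rule is_ideal_colon, rule is_ideal_prod_list)
  then show ?case using Suc.prems by auto
qed simp

text \<open>Multiply the equation of \<open>x\<close> by \<open>y ^ k\<close> and give the factor
  \<open>y ^ i\<close> to the i-th coefficient.\<close>

lemma integral_closure_mult:
  "ideal_mult (integral_closure A) B \<subseteq> integral_closure (ideal_mult A B)"
proof (rule ideal_mult_least)
  fix x y assume x: "x \<in> integral_closure A" and y: "y \<in> B"
  obtain k a where k: "k \<ge> 1" "\<And>i. i \<in> {1..k} \<Longrightarrow> a i \<in> ideal_pow A i"
    "x ^ k + (\<Sum>i=1..k. a i * x ^ (k - i)) = 0"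
    using x unfolding integral_closure_def by blast
  have "(x * y) ^ k + (\<Sum>i=1..k. (a i * y ^ i) * (x * y) ^ (k - i))
     = y ^ k * (x ^ k + (\<Sum>i=1..k. a i * x ^ (k - i)))"
  proof -
    have "(a i * y ^ i) * (x * y) ^ (k - i) = y ^ k * (a i * x ^ (k - i))" if "i \<in> {1..k}" for i
    proof -
      have "y ^ k = y ^ i * y ^ (k - i)" using that by (simp flip: power_add)
      then show ?thesis by (simp add: power_mult_distrib algebra_simps)
    qed
    then have "(\<Sum>i=1..k. (a i * y ^ i) * (x * y) ^ (k - i)) = (\<Sum>i=1..k. y ^ k * (a i * x ^ (k - i)))"
      by (rule sum.cong[OF refl])
    then show ?thesis unfolding distrib_left sum_distrib_left by (simp add: power_mult_distrib mult.commute)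
  qed
  then have "(x * y) ^ k + (\<Sum>i=1..k. (a i * y ^ i) * (x * y) ^ (k - i)) = 0"
    unfolding k(3) by simp
  moreover have "\<forall>i\<in>{1..k}. a i * y ^ i \<in> ideal_pow (ideal_mult A B) i"
    using k(2) y by (blast intro: ideal_pow_mult_power)
  ultimately show "x * y \<in> integral_closure (ideal_mult A B)"
    unfolding integral_closure_def using k(1) by (intro CollectI exI[of _ k] exI[of _ "\<lambda>i. a i * y ^ i"] conjI)
qed simp

text \<open>A reduction criterion: \<open>x M \<subseteq> J M\<close> for a finitely generated module \<open>M\<close> whose annihilator
  also annihilates a power of \<open>x\<close>.\<close>

lemma integral_closure_reduction:
  fixes v :: "nat \<Rightarrow> 'a::comm_ring_1"
  assumes M: "\<And>i. i < n \<Longrightarrow> x * v i = (\<Sum>j<n. c i j * v j)"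
    and c: "\<And>i j. i < n \<Longrightarrow> j < n \<Longrightarrow> c i j \<in> J"
    and ann: "\<And>q. (\<And>i. i < n \<Longrightarrow> q * v i = 0) \<Longrightarrow> q * x ^ e = 0"
  shows "x \<in> integral_closure J"
proof -
  have c1: "monom (c i j) 1 \<in> rees J" if "i < n" "j < n" for i j
    using c[OF that] ideal_pow_1 by (blast intro: monom_rees)
  have c2: "monom x 1 * monom (v i) 0 = (\<Sum>j<n. monom (c i j) 1 * monom (v j) 0)" if "i < n" for i
    by (simp add: mult_monom M[OF that] monom_sum)
  obtain q where q: "q \<in> monic_values (rees J) (monom x 1) n" "\<And>i. i < n \<Longrightarrow> q * monom (v i) 0 = 0"
    by (rule determinant_trick[OF subring_rees, of n "\<lambda>i j. monom (c i j) 1" J "monom x 1" "\<lambda>i. monom (v i) 0"])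
       (assumption | rule c1 c2 that)+
  have "coeff q i * v j = 0" if "j < n" for i j
  proof -
    have "coeff (q * monom (v j) 0) i = 0" using q(2)[OF that] by simp
    then show ?thesis by (simp add: coeff_mult_monom)
  qed
  \<comment> \<open>The annihilator hypothesis concerns elements of the base ring, so it is applied
    to each coefficient of \<open>q\<close> separately.\<close>
  then have "coeff q i * x ^ e = 0" for i by (rule ann)
  then have "q * monom (x ^ e) e = 0"
    by (intro poly_eqI) (simp add: coeff_mult_monom)
  then have z: "monom x 1 ^ e * q = 0" by (simp add: monom_power mult.commute)
  have "monom x 1 ^ i * q \<in> monic_values (rees J) (monom x 1) (n + i)" for i
  proof (induction i)
    case (Suc i)
    show ?case using monic_times_y[OF subring_rees Suc] by (simp add: mult.assoc)
  qed (use q(1) in simp)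
  \<comment> \<open>The exponent \<open>Suc e\<close> instead of \<open>e\<close> keeps the degree
    positive even for \<open>n = 0\<close> and \<open>e = 0\<close>.\<close>
  from this[of "Suc e"] have "0 \<in> monic_values (rees J) (monom x 1) (n + Suc e)"
    by (simp only: power_Suc mult.assoc z mult_zero_right)
  then show ?thesis unfolding integral_closure_iff integral_over_def by (intro exI[of _ "n + Suc e"]) auto
qed

section \<open>Polynomials\<close>

abbreviation lookup where "lookup \<equiv> Poly_Mapping.lookup"
abbreviation keys where "keys \<equiv> Poly_Mapping.keys"
abbreviation single where "single \<equiv> Poly_Mapping.single"

definition mon_eval :: "('v \<Rightarrow> 'a::comm_ring_1) \<Rightarrow> 'v monomial \<Rightarrow> 'a" where
  "mon_eval f \<alpha> = (\<Prod>v\<in>keys \<alpha>. f v ^ lookup \<alpha> v)"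

lemma mon_eval_superset: "finite V \<Longrightarrow> keys \<alpha> \<subseteq> V \<Longrightarrow> mon_eval f \<alpha> = (\<Prod>v\<in>V. f v ^ lookup \<alpha> v)"
  unfolding mon_eval_def by (rule prod.mono_neutral_left) (auto simp: in_keys_iff)

lemma mon_eval_add: "mon_eval f (\<alpha> + \<beta>) = mon_eval f \<alpha> * mon_eval f \<beta>"
  using mon_eval_superset[of "keys \<alpha> \<union> keys \<beta>" "\<alpha> + \<beta>" f] mon_eval_superset[of "keys \<alpha> \<union> keys \<beta>" \<alpha> f]
    mon_eval_superset[of "keys \<alpha> \<union> keys \<beta>" \<beta> f] Poly_Mapping.keys_add[of \<alpha> \<beta>]
  by (simp add: lookup_add power_add prod.distrib)

lemma mon_eval_0 [simp]: "mon_eval f 0 = 1"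
  by (simp add: mon_eval_def)

lemma mon_eval_single [simp]: "mon_eval f (single v k) = f v ^ k"
  by (cases "k = 0") (auto simp: mon_eval_def)

lemma hom_mon_eval: "comm_ring_hom h \<Longrightarrow> h (mon_eval f \<alpha>) = mon_eval (\<lambda>v. h (f v)) \<alpha>"
proof -
  assume "comm_ring_hom h"
  then interpret comm_ring_hom h .
  show ?thesis by (simp add: mon_eval_def hom_distribs)
qed

lemma poly_eval_superset:
  assumes "h 0 = 0" "finite V" "keys p \<subseteq> V"
  shows "poly_eval h f p = (\<Sum>\<alpha>\<in>V. h (lookup p \<alpha>) * mon_eval f \<alpha>)"
  unfolding poly_eval_def mon_eval_def[symmetric]
  by (rule sum.mono_neutral_left) (use assms in \<open>auto simp: in_keys_iff\<close>)

lemma poly_sum_single: "p = (\<Sum>\<alpha>\<in>keys p. single \<alpha> (lookup p \<alpha>))"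
  by (rule poly_mapping_eqI) (auto simp: lookup_sum lookup_single when_def in_keys_iff)

lemma poly_sum_single_superset: "finite V \<Longrightarrow> keys p \<subseteq> V \<Longrightarrow> p = (\<Sum>\<alpha>\<in>V. single \<alpha> (lookup p \<alpha>))"
  by (subst poly_sum_single) (rule sum.mono_neutral_left, auto simp: in_keys_iff)

lemma poly_mult_expand:
  fixes p q :: "('m::monoid_add \<Rightarrow>\<^sub>0 'a::semiring_0)"
  assumes "finite V" "keys p \<subseteq> V" "finite W" "keys q \<subseteq> W"
  shows "p * q = (\<Sum>\<alpha>\<in>V. \<Sum>\<beta>\<in>W. single (\<alpha> + \<beta>) (lookup p \<alpha> * lookup q \<beta>))"
proof -
  have "p * q = (\<Sum>\<alpha>\<in>V. single \<alpha> (lookup p \<alpha>)) * (\<Sum>\<beta>\<in>W. single \<beta> (lookup q \<beta>))"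
    using assms poly_sum_single_superset[of V p] poly_sum_single_superset[of W q] by simp
  also have "\<dots> = (\<Sum>\<alpha>\<in>V. \<Sum>\<beta>\<in>W. single (\<alpha> + \<beta>) (lookup p \<alpha> * lookup q \<beta>))"
    unfolding sum_product by (simp only: mult_single)
  finally show ?thesis .
qed

lemma lookup_mult_superset:
  fixes p q :: "('m::monoid_add \<Rightarrow>\<^sub>0 'a::semiring_0)"
  assumes "finite V" "keys p \<subseteq> V" "finite W" "keys q \<subseteq> W"
  shows "lookup (p * q) \<gamma> = (\<Sum>\<alpha>\<in>V. \<Sum>\<beta>\<in>W. if \<alpha> + \<beta> = \<gamma> then lookup p \<alpha> * lookup q \<beta> else 0)"
  by (simp add: poly_mult_expand[OF assms] lookup_sum lookup_single when_def)

lemma poly_eval_single: "h 0 = 0 \<Longrightarrow> poly_eval h f (single \<alpha> c) = h c * mon_eval f \<alpha>"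
  by (auto simp: poly_eval_superset[of h "{\<alpha>}"])

lemma comm_ring_hom_poly_eval:
  assumes "comm_ring_hom h" shows "comm_ring_hom (poly_eval h f)"
proof -
  interpret comm_ring_hom h by fact
  have add: "poly_eval h f (p + q) = poly_eval h f p + poly_eval h f q" for p q
    using poly_eval_superset[of h "keys p \<union> keys q" "p + q" f] poly_eval_superset[of h "keys p \<union> keys q" p f]
      poly_eval_superset[of h "keys p \<union> keys q" q f] Poly_Mapping.keys_add[of p q]
    by (simp add: lookup_add hom_distribs algebra_simps sum.distrib)
  have zero: "poly_eval h f 0 = 0" by (simp add: poly_eval_def)
  have sum: "poly_eval h f (\<Sum>x\<in>F. g x) = (\<Sum>x\<in>F. poly_eval h f (g x))" for F and g :: "'x \<Rightarrow> _"
    by (induction F rule: infinite_finite_induct) (auto simp: add zero)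
  show ?thesis
  proof
    show "poly_eval h f 1 = 1" using poly_eval_single[of h f 0 1] by simp
    show "poly_eval h f (p + q) = poly_eval h f p + poly_eval h f q" for p q by (rule add)
    show "poly_eval h f (p * q) = poly_eval h f p * poly_eval h f q" for p q
    proof -
      have "poly_eval h f (p * q) =
        poly_eval h f (\<Sum>\<alpha>\<in>keys p. \<Sum>\<beta>\<in>keys q. single (\<alpha> + \<beta>) (lookup p \<alpha> * lookup q \<beta>))"
        using poly_mult_expand[of "keys p" p "keys q" q] by simp
      also have "\<dots> = (\<Sum>\<alpha>\<in>keys p. \<Sum>\<beta>\<in>keys q. (h (lookup p \<alpha>) * mon_eval f \<alpha>) * (h (lookup q \<beta>) * mon_eval f \<beta>))"
        by (simp add: sum poly_eval_single hom_distribs mon_eval_add algebra_simps)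
      also have "\<dots> = poly_eval h f p * poly_eval h f q"
        by (simp add: poly_eval_superset[of h "keys p" p] poly_eval_superset[of h "keys q" q] sum_distrib_left sum_distrib_right)
          (rule sum.swap)
      finally show ?thesis .
    qed
  qed (rule zero)
qed

lemma comm_ring_hom_of_int: "comm_ring_hom (of_int :: int \<Rightarrow> 'a::comm_ring_1)"
  by unfold_locales auto

lemma comm_ring_hom_Const: "comm_ring_hom (Const :: 'a::comm_ring_1 \<Rightarrow> ('v, 'a) polynomial)"
  by unfold_locales (auto simp: Const_def single_add mult_single)

lemma comm_ring_hom_comp: "comm_ring_hom g \<Longrightarrow> comm_ring_hom h \<Longrightarrow> comm_ring_hom (\<lambda>x. g (h x))"
proof -
  assume "comm_ring_hom g" "comm_ring_hom h"
  then interpret g: comm_ring_hom g + h: comm_ring_hom h by auto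
  show ?thesis by unfold_locales (auto simp: hom_distribs)
qed

lemma poly_eval_Const: "h 0 = 0 \<Longrightarrow> poly_eval h f (Const c) = h c"
  by (simp add: Const_def poly_eval_single)

lemma poly_eval_Var: "comm_ring_hom h \<Longrightarrow> poly_eval h f (Var v) = f v"
proof -
  assume "comm_ring_hom h"
  then interpret comm_ring_hom h .
  show ?thesis by (simp add: Var_def poly_eval_single)
qed

lemma mon_eval_Var: "mon_eval Var \<alpha> = single \<alpha> (1 :: 'a::comm_ring_1)"
  unfolding mon_eval_def Var_def by (simp add: single_power[simplified] prod_single monomial_expand)

lemma lookup_Const_mult: "lookup (Const c * p :: ('v, 'a::comm_ring_1) polynomial) \<beta> = c * lookup p \<beta>"
proof -
  have "lookup (Const c * p) \<beta> =
      (\<Sum>\<alpha>\<in>{0}. \<Sum>\<gamma>\<in>insert \<beta> (keys p). if \<alpha> + \<gamma> = \<beta> then lookup (Const c) \<alpha> * lookup p \<gamma> else 0)"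
    by (rule lookup_mult_superset) (auto simp: Const_def split: if_splits)
  then show ?thesis by (simp add: Const_def)
qed

definition map_coeffs :: "('a::comm_ring_1 \<Rightarrow> 'b::comm_ring_1) \<Rightarrow> ('v, 'a) polynomial \<Rightarrow> ('v, 'b) polynomial" where
  "map_coeffs h = poly_eval (\<lambda>c. Const (h c)) Var"

lemma lookup_map_coeffs:
  assumes "comm_ring_hom h" shows "lookup (map_coeffs h p) \<beta> = h (lookup p \<beta>)"
proof -
  interpret comm_ring_hom h by fact
  show ?thesis unfolding map_coeffs_def
    by (subst poly_eval_superset[of _ "insert \<beta> (keys p)"])
       (auto simp: mon_eval_Var lookup_sum Const_def mult_single lookup_single when_def)
qed

lemma comm_ring_hom_map_coeffs: "comm_ring_hom h \<Longrightarrow> comm_ring_hom (map_coeffs h)"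
  unfolding map_coeffs_def by (intro comm_ring_hom_poly_eval comm_ring_hom_comp[OF comm_ring_hom_Const])

lemma map_coeffs_Const: "comm_ring_hom h \<Longrightarrow> map_coeffs h (Const c) = Const (h c)"
proof -
  assume "comm_ring_hom h"
  then interpret comm_ring_hom h .
  show ?thesis unfolding map_coeffs_def by (rule poly_eval_Const) (simp add: Const_def)
qed

lemma map_coeffs_Var: "comm_ring_hom h \<Longrightarrow> map_coeffs h (Var v) = Var v"
  unfolding map_coeffs_def by (rule poly_eval_Var[OF comm_ring_hom_comp[OF comm_ring_hom_Const]])

lemma mdeg_superset: "finite V \<Longrightarrow> keys \<alpha> \<subseteq> V \<Longrightarrow> mdeg \<alpha> = (\<Sum>v\<in>V. lookup \<alpha> v)"
  unfolding mdeg_def by (rule sum.mono_neutral_left) (auto simp: in_keys_iff)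

lemma mdeg_add: "mdeg (\<alpha> + \<beta>) = mdeg \<alpha> + mdeg \<beta>"
  using mdeg_superset[of "keys \<alpha> \<union> keys \<beta>" "\<alpha> + \<beta>"] mdeg_superset[of "keys \<alpha> \<union> keys \<beta>" \<alpha>]
    mdeg_superset[of "keys \<alpha> \<union> keys \<beta>" \<beta>] Poly_Mapping.keys_add[of \<alpha> \<beta>]
  by (simp add: lookup_add sum.distrib)

lemma mdeg_0 [simp]: "mdeg 0 = 0"
  and mdeg_single [simp]: "mdeg (single v k) = k"
  by (auto simp: mdeg_def)

lemma mdeg_sum: "mdeg (\<Sum>x\<in>F. g x) = (\<Sum>x\<in>F. mdeg (g x))"
  by (induction F rule: infinite_finite_induct) (auto simp: mdeg_add)

lemma finite_monomials: "finite (monomials k d)"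
proof -
  have "monomials k d \<subseteq> (\<lambda>f. \<Sum>v<k. single v (f v)) ` (PiE {..<k} (\<lambda>_. {..d}))"
  proof
    fix \<alpha> assume a: "\<alpha> \<in> monomials k d"
    have "lookup \<alpha> v \<le> d" if "v < k" for v
      using a that member_le_sum[of v "{..<k}" "lookup \<alpha>"] mdeg_superset[of "{..<k}" \<alpha>] by (auto simp: monomials_def)
    moreover have "\<alpha> = (\<Sum>v<k. single v (restrict (lookup \<alpha>) {..<k} v))"
      using a by (intro poly_mapping_eqI) (auto simp: monomials_def lookup_sum lookup_single when_def in_keys_iff subset_iff)
    moreover have "(\<Sum>v<k. single v (restrict (lookup \<alpha>) {..<k} v)) = (\<Sum>v<k. single v (lookup \<alpha> v))"
      by (rule sum.cong) auto
    ultimately show "\<alpha> \<in> (\<lambda>f. \<Sum>v<k. single v (f v)) ` (PiE {..<k} (\<lambda>_. {..d}))"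
      by (intro image_eqI[of _ _ "restrict (lookup \<alpha>) {..<k}"]) auto
  qed
  then show ?thesis by (rule finite_subset) (auto intro: finite_PiE)
qed

section \<open>Symmetric powers\<close>

definition lin_form :: "nat \<Rightarrow> (nat \<Rightarrow> 'j \<Rightarrow> 'a::comm_ring_1) \<Rightarrow> 'j \<Rightarrow> (nat, 'a) polynomial" where
  "lin_form n M v = (\<Sum>i<n. Const (M i v) * Var i)"

text \<open>The matrix is given by its entries rather than by a linear map, so that the same
  construction serves over the polynomial rings used below; for the matrix of a linear map it agrees
  with \<open>sym_entry\<close>.\<close>

definition sym_mat :: "nat \<Rightarrow> (nat \<Rightarrow> nat \<Rightarrow> 'a::comm_ring_1) \<Rightarrow> nat monomial \<Rightarrow> nat monomial \<Rightarrow> 'a" where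
  "sym_mat n M \<beta> \<alpha> = lookup (mon_eval (lin_form n M) \<alpha>) \<beta>"

definition mat_prod :: "nat \<Rightarrow> (nat \<Rightarrow> nat \<Rightarrow> 'a::comm_ring_1) \<Rightarrow> (nat \<Rightarrow> nat \<Rightarrow> 'a) \<Rightarrow> nat \<Rightarrow> nat \<Rightarrow> 'a" where
  "mat_prod k A B i j = (\<Sum>l<k. A i l * B l j)"

lemma sym_entry_eq:
  assumes "\<And>j. j < m \<Longrightarrow> dim_vec (\<phi> (unit_vec m j)) = n" "keys \<alpha> \<subseteq> {..<m}"
  shows "sym_entry m \<phi> \<beta> \<alpha> = sym_mat n (map_entry m \<phi>) \<beta> \<alpha>"
proof -
  have "linear_form (\<phi> (unit_vec m j)) = lin_form n (map_entry m \<phi>) j" if "j < m" for j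
    using assms(1)[OF that] by (simp add: linear_form_def lin_form_def map_entry_def)
  then have "mon_eval (\<lambda>j. linear_form (\<phi> (unit_vec m j))) \<alpha> = mon_eval (lin_form n (map_entry m \<phi>)) \<alpha>"
    unfolding mon_eval_def using assms(2) by (intro prod.cong) auto
  then show ?thesis
    by (simp add: sym_entry_def sym_map_def sym_mat_def poly_eval_single Const_def)
qed

text \<open>Entries of symmetric powers are integral polynomials in the entries of the matrix; this
  naturality carries generic identities to arbitrary rings.\<close>

lemma sym_mat_hom:
  assumes "comm_ring_hom h"
  shows "h (sym_mat n M \<beta> \<alpha>) = sym_mat n (\<lambda>i j. h (M i j)) \<beta> \<alpha>"
proof -
  interpret m: comm_ring_hom "map_coeffs h :: (nat, _) polynomial \<Rightarrow> _" by (rule comm_ring_hom_map_coeffs) fact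
  have "map_coeffs h (lin_form n M v) = lin_form n (\<lambda>i j. h (M i j)) v" for v
    by (simp add: lin_form_def m.hom_sum m.hom_mult map_coeffs_Const[OF assms] map_coeffs_Var[OF assms])
  then have "map_coeffs h (mon_eval (lin_form n M) \<alpha>) = mon_eval (lin_form n (\<lambda>i j. h (M i j))) \<alpha>"
    by (simp add: hom_mon_eval[OF m.comm_ring_hom_axioms])
  then show ?thesis unfolding sym_mat_def by (simp flip: lookup_map_coeffs[OF assms])
qed

lemma keys_mon_eval_lin_form: "keys (mon_eval (lin_form n M) \<alpha>) \<subseteq> monomials n (mdeg \<alpha>)"
proof -
  define H where "H d = {p :: (nat, 'a) polynomial. keys p \<subseteq> monomials n d}" for d
  have one: "1 \<in> H 0" by (simp add: H_def monomials_def)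
  have mult: "p * q \<in> H (d + e)" if "p \<in> H d" "q \<in> H e" for p q d e
  proof -
    have "keys (p * q) \<subseteq> {a + b | a b. a \<in> keys p \<and> b \<in> keys q}" by (rule Poly_Mapping.keys_mult)
    also have "\<dots> \<subseteq> monomials n (d + e)"
      using that Poly_Mapping.keys_add by (fastforce simp: H_def monomials_def mdeg_add subset_iff)
    finally show ?thesis by (simp add: H_def)
  qed
  have lin: "lin_form n M v \<in> H 1" for v
  proof -
    have "keys (Const (M i v) * Var i :: (nat, 'a) polynomial) \<subseteq> monomials n 1" if "i < n" for i
      using that by (auto simp: Const_def Var_def mult_single monomials_def split: if_splits)
    then have "(\<Union>i\<in>{..<n}. keys (Const (M i v) * Var i :: (nat, 'a) polynomial)) \<subseteq> monomials n 1" by blast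
    then show ?thesis unfolding H_def lin_form_def
      using keys_sum[of "\<lambda>i. Const (M i v) * Var i" "{..<n}"] by blast
  qed
  have pow: "p ^ k \<in> H k" if "p \<in> H 1" for p k
    using that one mult[of p 1] by (induction k) auto
  have "(\<Prod>v\<in>F. lin_form n M v ^ lookup \<alpha> v) \<in> H (\<Sum>v\<in>F. lookup \<alpha> v)" if "finite F" for F
    using that one by (induction F) (auto intro!: mult pow lin)
  from this[of "keys \<alpha>"] show ?thesis by (simp add: mon_eval_def mdeg_def H_def)
qed

text \<open>Functoriality of the symmetric power: substituting the linear forms of \<open>A\<close>
  for the variables in those of \<open>B\<close> gives the forms of the product, and the image of a
  monomial under \<open>B\<close> is expanded in the monomials of degree \<open>d\<close> in
  between.\<close>

lemma sym_mat_mult: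
  assumes "\<alpha> \<in> monomials m d"
  shows "sym_mat n (mat_prod k A B) \<beta> \<alpha> = (\<Sum>\<gamma>\<in>monomials k d. sym_mat n A \<beta> \<gamma> * sym_mat k B \<gamma> \<alpha>)"
proof -
  interpret e: comm_ring_hom "poly_eval Const (lin_form n A)" by (rule comm_ring_hom_poly_eval[OF comm_ring_hom_Const])
  have "poly_eval Const (lin_form n A) (lin_form k B v) = lin_form n (mat_prod k A B) v" for v
  proof -
    interpret C: comm_ring_hom "Const :: 'a \<Rightarrow> (nat, 'a) polynomial" by (rule comm_ring_hom_Const)
    have "poly_eval Const (lin_form n A) (lin_form k B v) = (\<Sum>l<k. Const (B l v) * lin_form n A l)"
      by (simp add: lin_form_def[of k B] e.hom_sum e.hom_mult poly_eval_Const poly_eval_Var[OF comm_ring_hom_Const])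
    also have "\<dots> = (\<Sum>l<k. \<Sum>i<n. Const (A i l * B l v) * Var i)"
      by (simp add: lin_form_def sum_distrib_left C.hom_mult algebra_simps)
    also have "\<dots> = (\<Sum>i<n. \<Sum>l<k. Const (A i l * B l v) * Var i)" by (rule sum.swap)
    also have "\<dots> = lin_form n (mat_prod k A B) v"
      by (simp add: lin_form_def mat_prod_def C.hom_sum sum_distrib_right)
    finally show ?thesis .
  qed
  then have "mon_eval (lin_form n (mat_prod k A B)) \<alpha> = poly_eval Const (lin_form n A) (mon_eval (lin_form k B) \<alpha>)"
    by (simp add: hom_mon_eval[OF e.comm_ring_hom_axioms])
  also have "\<dots> = (\<Sum>\<gamma>\<in>monomials k d. Const (sym_mat k B \<gamma> \<alpha>) * mon_eval (lin_form n A) \<gamma>)"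
    unfolding sym_mat_def using keys_mon_eval_lin_form[of k B \<alpha>] assms finite_monomials
    by (subst poly_eval_superset) (auto simp: Const_def monomials_def)
  finally show ?thesis unfolding sym_mat_def[of n "mat_prod k A B"]
    by (simp add: lookup_sum lookup_Const_mult sym_mat_def mult.commute[of "lookup _ \<beta>"])
qed

lemma sym_mat_diag:
  assumes "\<alpha> \<in> monomials m d" "\<beta> \<in> monomials n d"
  shows "sym_mat n (\<lambda>i j. if i = j then y i else 0) \<beta> \<alpha> = (if \<alpha> = \<beta> then mon_eval y \<alpha> else 0)"
proof -
  have lf: "lin_form n (\<lambda>i j. if i = j then y i else 0) v = (if v < n then Const (y v) * Var v else 0)" for v
  proof -
    have "lin_form n (\<lambda>i j. if i = j then y i else 0) v = (\<Sum>i<n. if i = v then Const (y v) * Var v else 0)"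
      unfolding lin_form_def by (rule sum.cong) (auto simp: Const_def)
    then show ?thesis by simp
  qed
  show ?thesis
  proof (cases "keys \<alpha> \<subseteq> {..<n}")
    case True
    interpret C: comm_ring_hom "Const :: 'a \<Rightarrow> (nat, 'a) polynomial" by (rule comm_ring_hom_Const)
    have "mon_eval (lin_form n (\<lambda>i j. if i = j then y i else 0)) \<alpha> = mon_eval (\<lambda>v. Const (y v) * Var v) \<alpha>"
      unfolding mon_eval_def using True by (intro prod.cong) (auto simp: lf)
    also have "\<dots> = Const (mon_eval y \<alpha>) * single \<alpha> 1"
      by (simp add: mon_eval_def power_mult_distrib prod.distrib C.hom_prod C.hom_power flip: mon_eval_Var)
    finally show ?thesis by (simp add: sym_mat_def lookup_Const_mult lookup_single when_def)
  next
    case False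
    then obtain v where v: "v \<in> keys \<alpha>" "\<not> v < n" by auto
    then have "lin_form n (\<lambda>i j. if i = j then y i else 0) v ^ lookup \<alpha> v = 0"
      by (auto simp: lf in_keys_iff zero_power_eq)
    then have "mon_eval (lin_form n (\<lambda>i j. if i = j then y i else 0)) \<alpha> = 0"
      unfolding mon_eval_def using v by (intro prod_zero) auto
    moreover have "\<alpha> \<noteq> \<beta>" using False assms by (auto simp: monomials_def)
    ultimately show ?thesis by (simp add: sym_mat_def)
  qed
qed

section \<open>Minors\<close>

text \<open>Index lists may be unordered or contain repetitions, since expansions and exchanges of
  columns produce such lists. Sorting costs a sign, and a repetition gives 0.\<close>

definition minor :: "('i \<Rightarrow> 'j \<Rightarrow> 'a::comm_ring_1) \<Rightarrow> 'i list \<Rightarrow> 'j list \<Rightarrow> 'a" where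
  "minor M rs cs = det (mat (length rs) (length rs) (\<lambda>(a, b). M (rs ! a) (cs ! b)))"

lemma minors_eq:
  "minors I J M t = {minor M rs cs | rs cs. distinct rs \<and> set rs \<subseteq> I \<and> length rs = t \<and>
     distinct cs \<and> set cs \<subseteq> J \<and> length cs = t}"
  unfolding minors_def minor_def by auto

lemma minor_leibniz:
  "minor M rs cs = (\<Sum>p | p permutes {0..<length rs}. signof p * (\<Prod>i = 0..<length rs. M (rs ! i) (cs ! p i)))"
  unfolding minor_def det_def by (auto intro!: sum.cong prod.cong simp: permutes_in_image)

lemma minor_Nil [simp]: "minor M [] cs = 1"
  by (simp add: minor_def)

lemma minor_cong:
  assumes "length cs = length rs" "\<And>r c. r \<in> set rs \<Longrightarrow> c \<in> set cs \<Longrightarrow> M r c = M' r c"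
  shows "minor M rs cs = minor M' rs cs"
  unfolding minor_def using assms by (intro arg_cong[of _ _ det] eq_matI) auto

lemma minor_map: "length cs = length rs \<Longrightarrow> minor M (map f rs) (map g cs) = minor (\<lambda>i j. M (f i) (g j)) rs cs"
  unfolding minor_def by (intro arg_cong[of _ _ det] eq_matI) auto

lemma minor_transpose:
  assumes "length cs = length rs" shows "minor M rs cs = minor (\<lambda>j i. M i j) cs rs"
proof -
  have "minor (\<lambda>j i. M i j) cs rs = det (transpose_mat (mat (length rs) (length rs) (\<lambda>(a, b). M (rs ! a) (cs ! b))))"
    unfolding minor_def using assms by (intro arg_cong[of _ _ det] eq_matI) auto
  then show ?thesis by (simp add: minor_def det_transpose[of _ "length rs"])
qed

lemma minor_hom: "comm_ring_hom h \<Longrightarrow> h (minor M rs cs) = minor (\<lambda>i j. h (M i j)) rs cs"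
proof -
  assume "comm_ring_hom h"
  then interpret comm_ring_hom h .
  show ?thesis unfolding minor_def hom_det[symmetric]
    by (intro arg_cong[of _ _ det] eq_matI) auto
qed

lemma minor_permute_rows:
  assumes "p permutes {0..<length rs}"
  shows "minor M (map (\<lambda>i. rs ! p i) [0..<length rs]) cs = signof p * minor M rs cs"
proof -
  have "minor M (map (\<lambda>i. rs ! p i) [0..<length rs]) cs =
     det (mat (length rs) (length rs) (\<lambda>(i, j). mat (length rs) (length rs) (\<lambda>(a, b). M (rs ! a) (cs ! b)) $$ (p i, j)))"
    unfolding minor_def using permutes_in_image[OF assms] by (intro arg_cong[of _ _ det] eq_matI) auto
  also have "\<dots> = signof p * minor M rs cs"
    unfolding minor_def by (rule det_permute_rows[OF _ assms]) simp
  finally show ?thesis .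
qed

lemma signof_cases: "signof p = (1 :: 'a::comm_ring_1) \<or> signof p = (-1 :: 'a)"
  by (auto simp: sign_def)

lemma minor_rows_mset:
  assumes "mset rs' = mset rs"
  shows "minor M rs' cs = minor M rs cs \<or> minor M rs' cs = - minor M rs cs"
proof -
  obtain p where p: "p permutes {..<length rs}" "permute_list p rs = rs'"
    using mset_eq_permutation[OF assms] by blast
  have "permute_list p rs = map (\<lambda>i. rs ! p i) [0..<length rs]"
    by (simp add: permute_list_def)
  then have "minor M rs' cs = signof p * minor M rs cs"
    using minor_permute_rows[of p rs M cs] p by (simp add: lessThan_atLeast0)
  then show ?thesis by (simp add: sign_def)
qed

lemma minor_cols_mset:
  assumes "mset cs' = mset cs" "length cs = length rs"
  shows "minor M rs cs' = minor M rs cs \<or> minor M rs cs' = - minor M rs cs"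
  using minor_rows_mset[OF assms(1), of "\<lambda>j i. M i j" rs] mset_eq_length[OF assms(1)] assms(2)
  by (simp add: minor_transpose[of cs rs M] minor_transpose[of cs' rs M])

lemma minor_rows_repeat:
  assumes "\<not> distinct rs" shows "minor M rs cs = 0"
proof -
  obtain i j where "i < length rs" "j < length rs" "i \<noteq> j" "rs ! i = rs ! j"
    using assms by (auto simp: distinct_conv_nth)
  then show ?thesis unfolding minor_def
    by (intro det_identical_rows[of _ "length rs" i j]) (auto intro!: eq_vecI)
qed

lemma minor_cols_repeat:
  assumes "\<not> distinct cs" "length cs = length rs" shows "minor M rs cs = 0"
  using minor_rows_repeat[OF assms(1)] by (simp add: minor_transpose[OF assms(2)])

lemma minor_zero_row:
  assumes "r \<in> set rs" "length cs = length rs" "\<And>c. c \<in> set cs \<Longrightarrow> M r c = 0"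
  shows "minor M rs cs = 0"
proof -
  obtain i where i: "i < length rs" "rs ! i = r" using assms(1) by (auto simp: in_set_conv_nth)
  have "(\<Prod>i = 0..<length rs. M (rs ! i) (cs ! p i)) = 0" if "p permutes {0..<length rs}" for p
    using i assms(2,3) permutes_in_image[OF that, of i] by (intro prod_zero bexI[of _ i]) auto
  then show ?thesis unfolding minor_leibniz by (intro sum.neutral) auto
qed

text \<open>The Cauchy--Binet formula before the summands are grouped by the underlying set of \<open>ks\<close>.\<close>

lemma minor_mult:
  assumes K: "finite K" and len: "length cs = length rs"
  shows "minor (\<lambda>i j. \<Sum>k\<in>K. A i k * B k j) rs cs =
    (\<Sum>ks | set ks \<subseteq> K \<and> length ks = length rs \<and> distinct ks.
       (\<Prod>i = 0..<length rs. A (rs ! i) (ks ! i)) * minor B ks cs)"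
proof -
  let ?n = "length rs" and ?P = "{p. p permutes {0..<length rs}}"
  let ?L = "{ks. set ks \<subseteq> K \<and> length ks = ?n}"
  have L: "finite ?L" using K by (rule finite_lists_length_eq)
  have prod: "(\<Prod>i = 0..<?n. \<Sum>k\<in>K. A (rs ! i) k * B k (cs ! p i)) =
      (\<Sum>ks\<in>?L. \<Prod>i = 0..<?n. A (rs ! i) (ks ! i) * B (ks ! i) (cs ! p i))" for p
  proof -
    have "(\<Prod>i = 0..<?n. \<Sum>k\<in>K. A (rs ! i) k * B k (cs ! p i)) =
      (\<Sum>g\<in>PiE {0..<?n} (\<lambda>_. K). \<Prod>i = 0..<?n. A (rs ! i) (g i) * B (g i) (cs ! p i))"
      using K by (intro prod_sum_PiE) auto
    also have "\<dots> = (\<Sum>ks\<in>?L. \<Prod>i = 0..<?n. A (rs ! i) (ks ! i) * B (ks ! i) (cs ! p i))"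
      by (rule sum.reindex_bij_witness[of _ "\<lambda>ks. restrict ((!) ks) {0..<?n}" "\<lambda>g. map g [0..<?n]"])
         (auto simp: PiE_iff extensional_def fun_eq_iff subset_iff intro!: nth_equalityI)
    finally show ?thesis .
  qed
  have "minor (\<lambda>i j. \<Sum>k\<in>K. A i k * B k j) rs cs =
     (\<Sum>p\<in>?P. \<Sum>ks\<in>?L. (\<Prod>i = 0..<?n. A (rs ! i) (ks ! i)) * (signof p * (\<Prod>i = 0..<?n. B (ks ! i) (cs ! p i))))"
    unfolding minor_leibniz prod by (simp add: sum_distrib_left prod.distrib algebra_simps)
  also have "\<dots> = (\<Sum>ks\<in>?L. \<Sum>p\<in>?P. (\<Prod>i = 0..<?n. A (rs ! i) (ks ! i)) * (signof p * (\<Prod>i = 0..<?n. B (ks ! i) (cs ! p i))))"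
    by (rule sum.swap)
  also have "\<dots> = (\<Sum>ks\<in>?L. (\<Prod>i = 0..<?n. A (rs ! i) (ks ! i)) * minor B ks cs)"
    by (rule sum.cong[OF refl]) (simp add: minor_leibniz sum_distrib_left)
  also have "\<dots> = (\<Sum>ks | set ks \<subseteq> K \<and> length ks = ?n \<and> distinct ks. (\<Prod>i = 0..<?n. A (rs ! i) (ks ! i)) * minor B ks cs)"
    by (rule sum.mono_neutral_right[OF L]) (auto simp: minor_rows_repeat)
  finally show ?thesis .
qed

lemma minor_mult_in_ideal:
  assumes "finite K" "length cs = length rs" "is_ideal I"
    and "\<And>ks. set ks \<subseteq> K \<Longrightarrow> length ks = length rs \<Longrightarrow> distinct ks \<Longrightarrow> minor B ks cs \<in> I"
  shows "minor (\<lambda>i j. \<Sum>k\<in>K. A i k * B k j) rs cs \<in> I"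
  unfolding minor_mult[OF assms(1,2)] using assms(3,4) by (auto intro!: is_ideal_sum is_idealD(3))

lemma minor_mult_in_ideal':
  assumes "finite K" "length cs = length rs" "is_ideal I"
    and "\<And>ks. set ks \<subseteq> K \<Longrightarrow> length ks = length rs \<Longrightarrow> distinct ks \<Longrightarrow> minor A rs ks \<in> I"
  shows "minor (\<lambda>i j. \<Sum>k\<in>K. A i k * B k j) rs cs \<in> I"
proof -
  have "minor (\<lambda>j i. \<Sum>k\<in>K. B k j * A i k) cs rs \<in> I"
    using minor_mult_in_ideal[of K rs cs I "\<lambda>k i. A i k" "\<lambda>j k. B k j"] assms
    by (simp add: minor_transpose[of _ rs A])
  then show ?thesis using minor_transpose[OF assms(2), of "\<lambda>i j. \<Sum>k\<in>K. A i k * B k j"] by (simp add: mult.commute)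
qed

subsection \<open>Laplace expansion along several columns\<close>

lemma set_nths_upt: "set (nths [0..<N] P) = {i. i < N \<and> i \<in> P}"
proof -
  have "\<exists>j. i = [0..<N] ! j \<and> j < length [0..<N] \<and> j \<in> P" if "i < N" "i \<in> P" for i
    using that by (intro exI[of _ i]) simp
  then show ?thesis by (auto simp: set_nths)
qed

text \<open>The signs are left unspecified: only their independence of the entries matters.\<close>

lemma minor_laplace:
  fixes M :: "'i \<Rightarrow> 'j \<Rightarrow> 'a::idom"
  assumes len: "length rs = length cs1 + length cs2"
  shows "\<exists>\<epsilon>. (\<forall>P. \<epsilon> P \<in> {1, -1}) \<and> minor M rs (cs1 @ cs2) =
    (\<Sum>P | P \<subseteq> {0..<length rs} \<and> card P = length cs1.
       \<epsilon> P * minor M (nths rs P) cs1 * minor M (nths rs ({0..<length rs} - P)) cs2)"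
proof -
  define N where "N = length rs"
  define u where "u = length cs1"
  define cs where "cs = cs1 @ cs2"
  have N: "N = u + length cs2" "u \<le> N" using len by (auto simp: N_def u_def)
  define PP where "PP = {P. P \<subseteq> {0..<N} \<and> card P = u}"
  define S where "S = {p. p permutes {0..<N}}"
  \<comment> \<open>\<open>row p\<close> is the set of rows that \<open>p\<close> sends to the first
    \<open>u\<close> columns; the Leibniz sum is grouped by it.\<close>
  define row where "row p = {i\<in>{0..<N}. p i < u}" for p :: "nat \<Rightarrow> nat"
  \<comment> \<open>Zeroing every entry outside the two blocks belonging to \<open>P\<close> leaves
    exactly the Leibniz terms with \<open>row p = P\<close>.\<close>
  define MP where "MP P = (\<lambda>i j. if (i \<in> P) = (j < u) then M (rs ! i) (cs ! j) else 0)" for P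
  have fin: "finite PP" "finite S" by (auto simp: PP_def S_def finite_permutations)
  have "row p \<in> PP" if "p \<in> S" for p
  proof -
    have p: "p permutes {0..<N}" using that by (simp add: S_def)
    have "p ` row p = {0..<u}"
    proof (intro equalityI subsetI)
      fix j assume j: "j \<in> {0..<u}"
      then have "j \<in> p ` {0..<N}" using permutes_image[OF p] N(2) by auto
      then show "j \<in> p ` row p" using j by (auto simp: row_def)
    qed (auto simp: row_def)
    moreover have "inj_on p (row p)" using permutes_inj[OF p] by (rule inj_on_subset) simp
    ultimately have "card (row p) = u" using card_image by fastforce
    then show ?thesis by (auto simp: PP_def row_def)
  qed
  then have "minor M rs cs = (\<Sum>P\<in>PP. \<Sum>p\<in>{p\<in>S. row p = P}. signof p * (\<Prod>i = 0..<N. M (rs ! i) (cs ! p i)))"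
    unfolding minor_leibniz N_def[symmetric] S_def[symmetric] using fin by (subst sum.group) auto
  also have "\<dots> = (\<Sum>P\<in>PP. minor (MP P) [0..<N] [0..<N])"
  proof (rule sum.cong[OF refl])
    fix P assume P: "P \<in> PP"
    have *: "(\<Prod>i = 0..<N. MP P i (p i)) = (if row p = P then \<Prod>i = 0..<N. M (rs ! i) (cs ! p i) else 0)" for p
    proof (cases "row p = P")
      case True
      then have "MP P i (p i) = M (rs ! i) (cs ! p i)" if "i \<in> {0..<N}" for i
        using that by (auto simp: MP_def row_def)
      then show ?thesis using True by (auto intro!: prod.cong)
    next
      case False
      then obtain i where "(i \<in> row p) \<noteq> (i \<in> P)" by blast
      moreover from this have "i \<in> {0..<N}" using P by (auto simp: row_def PP_def)
      ultimately have i: "i \<in> {0..<N}" "(i \<in> P) \<noteq> (p i < u)" by (auto simp: row_def)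
      then have "(\<Prod>i = 0..<N. MP P i (p i)) = 0" by (intro prod_zero bexI[of _ i]) (auto simp: MP_def)
      then show ?thesis using False by simp
    qed
    have "minor (MP P) [0..<N] [0..<N] = (\<Sum>p\<in>S. signof p * (\<Prod>i = 0..<N. MP P i (p i)))"
      unfolding minor_leibniz S_def by (auto intro!: sum.cong prod.cong simp: permutes_in_image)
    also have "\<dots> = (\<Sum>p\<in>{p\<in>S. row p = P}. signof p * (\<Prod>i = 0..<N. M (rs ! i) (cs ! p i)))"
      unfolding * using fin by (simp add: if_distrib[of "\<lambda>x. _ * x"] sum.inter_filter cong: if_cong)
    finally show "(\<Sum>p\<in>{p\<in>S. row p = P}. signof p * (\<Prod>i = 0..<N. M (rs ! i) (cs ! p i))) = minor (MP P) [0..<N] [0..<N]" ..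
  qed
  finally have main: "minor M rs cs = (\<Sum>P\<in>PP. minor (MP P) [0..<N] [0..<N])" .
  have "\<exists>e. \<forall>P. e P \<in> {1, -1} \<and> (P \<in> PP \<longrightarrow>
     minor (MP P) [0..<N] [0..<N] = e P * minor M (nths rs P) cs1 * minor M (nths rs ({0..<N} - P)) cs2)"
  proof (rule choice, rule allI)
    fix P
    show "\<exists>e. e \<in> {1, -1} \<and> (P \<in> PP \<longrightarrow>
     minor (MP P) [0..<N] [0..<N] = e * minor M (nths rs P) cs1 * minor M (nths rs ({0..<N} - P)) cs2)"
    proof (cases "P \<in> PP")
      case True
      let ?P' = "{0..<N} - P"
      define is1 where "is1 = nths [0..<N] P"
      define is2 where "is2 = nths [0..<N] ?P'"
      have card: "card P = u" "P \<subseteq> {0..<N}" "finite P" using True by (auto simp: PP_def intro: finite_subset)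
      have cN: "card ?P' = N - u" using card by (simp add: card_Diff_subset)
      have "{i. i < N \<and> i \<in> P} = P" "{i. i < N \<and> i \<in> {0..<N} \<and> i \<notin> P} = ?P'" using card(2) by auto
      then have l: "length is1 = u" "length is2 = N - u"
        using card(1) cN by (simp_all add: is1_def is2_def length_nths)
      have s: "set is1 = P" "set is2 = ?P'" using card(2) by (auto simp: is1_def is2_def set_nths_upt)
      have "set (is1 @ is2) = set [0..<N]" "distinct (is1 @ is2)"
        using card(2) s by (auto simp: is1_def is2_def)
      then have "mset (is1 @ is2) = mset [0..<N]"
        using set_eq_iff_mset_eq_distinct[of "is1 @ is2" "[0..<N]"] by (simp del: mset_append set_append)
      then have e: "minor (MP P) (is1 @ is2) [0..<N] = minor (MP P) [0..<N] [0..<N] \<or>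
         minor (MP P) (is1 @ is2) [0..<N] = - minor (MP P) [0..<N] [0..<N]"
        by (rule minor_rows_mset)
      have r: "nths rs P = map ((!) rs) is1" "nths rs ?P' = map ((!) rs) is2"
        by (simp_all add: is1_def is2_def N_def map_nth flip: nths_map)
      have in1: "is1 ! a \<in> P" if "a < u" for a using that l s by (metis nth_mem)
      have in2: "is2 ! a \<notin> P" if "a < N - u" for a using that l s by (metis DiffD2 nth_mem)
      \<comment> \<open>With the rows of \<open>P\<close> placed on top, the matrix is block
        diagonal; the reordering accounts for the unspecified sign.\<close>
      have "minor (MP P) (is1 @ is2) [0..<N] = det (four_block_mat
          (mat u u (\<lambda>(a, b). M (nths rs P ! a) (cs1 ! b))) (0\<^sub>m u (N - u)) (0\<^sub>m (N - u) u)
          (mat (N - u) (N - u) (\<lambda>(a, b). M (nths rs ?P' ! a) (cs2 ! b))))"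
        unfolding minor_def r using l N in1 in2
        by (intro arg_cong[of _ _ det] eq_matI) (auto simp: MP_def cs_def u_def nth_append)
      also have "\<dots> = minor M (nths rs P) cs1 * minor M (nths rs ?P') cs2"
        using l by (subst det_four_block_mat_upper_right_zero[of _ u _ "N - u"]) (auto simp: minor_def r)
      finally show ?thesis using e by (metis (no_types) insertCI mult_1 mult_minus1 minus_minus mult.assoc)
    qed auto
  qed
  then obtain e where "\<forall>P. e P \<in> {1, -1}" "\<And>P. P \<in> PP \<Longrightarrow>
     minor (MP P) [0..<N] [0..<N] = e P * minor M (nths rs P) cs1 * minor M (nths rs ({0..<N} - P)) cs2" by metis
  then show ?thesis using main unfolding PP_def cs_def N_def u_def by (intro exI[of _ e]) auto
qed

section \<open>Straightening\<close>

text \<open>An integral combination is expressed as membership in an arbitrary additive subgroup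
  that contains the admissible products; the straightening coefficients never have to be written
  down.\<close>

definition add_subgroup :: "'a::comm_ring_1 set \<Rightarrow> bool" where
  "add_subgroup S \<longleftrightarrow> 0 \<in> S \<and> (\<forall>x\<in>S. \<forall>y\<in>S. x + y \<in> S) \<and> (\<forall>x\<in>S. - x \<in> S)"

lemma add_subgroupD:
  assumes "add_subgroup S"
  shows "0 \<in> S" "x \<in> S \<Longrightarrow> y \<in> S \<Longrightarrow> x + y \<in> S" "x \<in> S \<Longrightarrow> - x \<in> S" "x \<in> S \<Longrightarrow> y \<in> S \<Longrightarrow> x - y \<in> S"
  using assms unfolding add_subgroup_def by (simp_all add: diff_conv_add_uminus del: add_uminus_conv_diff)

lemma add_subgroup_sum: "add_subgroup S \<Longrightarrow> (\<And>x. x \<in> F \<Longrightarrow> f x \<in> S) \<Longrightarrow> sum f F \<in> S"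
  by (induction F rule: infinite_finite_induct) (auto simp: add_subgroupD)

lemma add_subgroup_sign: "add_subgroup S \<Longrightarrow> e = 1 \<or> e = -1 \<Longrightarrow> x \<in> S \<Longrightarrow> e * x \<in> S"
  by (auto simp: add_subgroupD)

lemma nths_cong: "(\<And>i. i < length xs \<Longrightarrow> i \<in> A \<longleftrightarrow> i \<in> B) \<Longrightarrow> nths xs A = nths xs B"
  unfolding nths_def by (intro arg_cong[of _ _ "map fst"] filter_cong) (auto dest: set_zip_rightD)

lemma nths_diff: "nths xs ({0..<length xs} - P) = nths xs (- P)"
  by (rule nths_cong) auto

lemma mset_nths_Compl: "mset (nths xs P) + mset (nths xs (- P)) = mset xs"
proof -
  let ?z = "zip xs [0..<length xs]"
  have "mset xs = image_mset fst (mset ?z)" by (simp flip: mset_map)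
  also have "mset ?z = filter_mset (\<lambda>p. snd p \<in> P) (mset ?z) + filter_mset (\<lambda>p. snd p \<notin> P) (mset ?z)"
    by (rule multiset_partition)
  finally show ?thesis by (simp only: nths_def mset_map mset_filter image_mset_union Compl_iff)
qed

lemma nths_map_upt: "nths xs P = map ((!) xs) (nths [0..<length xs] P)"
  by (simp add: map_nth flip: nths_map)

text \<open>Both Laplace expansions of the determinant of the block matrix with rows \<open>a, c1 @ c2, b\<close>, columns
  \<open>J, J'\<close>, and zero blocks at \<open>(a, J')\<close> and \<open>(b, J)\<close>.\<close>

lemma garnir:
  fixes M :: "'i \<Rightarrow> 'j \<Rightarrow> 'a::idom"
  assumes len: "length J = length a + length c1" "length J' = length c2 + length b"
    and S: "add_subgroup S"
    and other: "\<And>P. P \<subseteq> {0..<length (c1 @ c2)} \<Longrightarrow> card P = length c1 \<Longrightarrow> P \<noteq> {0..<length c1} \<Longrightarrow>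
       minor M (a @ nths (c1 @ c2) P) J * minor M (nths (c1 @ c2) (- P) @ b) J' \<in> S"
    and big: "\<And>K k. mset K + mset k = mset (J @ J') \<Longrightarrow> length K = length (c1 @ c2) \<Longrightarrow>
       minor M (c1 @ c2) K * (\<Prod>i = 0..<length (a @ b). M ((a @ b) ! i) (k ! i)) \<in> S"
  shows "minor M (a @ c1) J * minor M (c2 @ b) J' \<in> S"
proof -
  define c where "c = c1 @ c2"
  define q where "q = length a"
  \<comment> \<open>The tags 0, 1, 2 mark the rows of \<open>a\<close>, of \<open>c1 @ c2\<close>
    and of \<open>b\<close>, and the tags 0, 1 below mark the two column blocks; thus equal indices
    in different blocks stay apart.\<close>
  define R where "R = map (Pair (0::nat)) a @ map (Pair 1) c @ map (Pair 2) b"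
  define C1 where "C1 = map (Pair (0::nat)) J"
  define C2 where "C2 = map (Pair (1::nat)) J'"
  define N where "N = length R"
  define H where "H = (\<lambda>(t, x) (u, y). if t = (0::nat) \<and> u = (1::nat) \<or> t = 2 \<and> u = 0 then 0 else M x y)"
  have lR: "length R = length C1 + length C2" using len by (simp add: R_def C1_def C2_def c_def)
  have NR: "N = q + length c + length b" by (simp add: N_def R_def q_def)
  have Hsnd: "minor H rs cs = minor M (map snd rs) (map snd cs)"
    if "length cs = length rs" "\<And>r c. r \<in> set rs \<Longrightarrow> c \<in> set cs \<Longrightarrow> H r c = M (snd r) (snd c)" for rs cs
    using that by (subst minor_map) (auto intro!: minor_cong)
  \<comment> \<open>Expansion along the rows of \<open>c\<close>: the complementary minor is
    expanded further into products of entries, so every nonzero term is a minor on all of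
    \<open>c\<close> times entries, as in \<open>big\<close>.\<close>
  have X: "minor H R (C1 @ C2) \<in> S"
  proof -
    define R1 where "R1 = map (Pair (1::nat)) c"
    define R2 where "R2 = map (Pair (0::nat)) a @ map (Pair 2) b"
    have l1: "length (C1 @ C2) = length R1 + length R2" using lR by (simp add: R1_def R2_def R_def)
    have "mset (R1 @ R2) = mset R" by (simp add: R1_def R2_def R_def)
    then have "minor H R (C1 @ C2) = minor H (R1 @ R2) (C1 @ C2) \<or> minor H R (C1 @ C2) = - minor H (R1 @ R2) (C1 @ C2)"
      using minor_rows_mset[of R "R1 @ R2" H "C1 @ C2"] by simp
    moreover have "minor H (R1 @ R2) (C1 @ C2) \<in> S"
    proof -
      have tr: "minor H (R1 @ R2) (C1 @ C2) = minor (\<lambda>j i. H i j) (C1 @ C2) (R1 @ R2)"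
        using l1 by (intro minor_transpose) simp
      obtain e where e: "\<forall>P. e P \<in> {1, -1}" "minor (\<lambda>j i. H i j) (C1 @ C2) (R1 @ R2) =
        (\<Sum>P | P \<subseteq> {0..<length (C1 @ C2)} \<and> card P = length R1. e P * minor (\<lambda>j i. H i j) (nths (C1 @ C2) P) R1 *
           minor (\<lambda>j i. H i j) (nths (C1 @ C2) ({0..<length (C1 @ C2)} - P)) R2)"
        using minor_laplace[OF l1, of "\<lambda>j i. H i j"] by blast
      have hP: "minor (\<lambda>j i. H i j) (nths (C1 @ C2) P) R1 * minor (\<lambda>j i. H i j) (nths (C1 @ C2) ({0..<length (C1 @ C2)} - P)) R2 \<in> S"
        if P: "P \<subseteq> {0..<length (C1 @ C2)}" "card P = length R1" for P
      proof -
        define K1 where "K1 = nths (C1 @ C2) P"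
        define K2 where "K2 = nths (C1 @ C2) (- P)"
        have "{i. i < length (C1 @ C2) \<and> i \<in> P} = P" using P by auto
        then have lK1: "length K1 = length R1" using P(2) by (simp add: K1_def length_nths)
        have ms: "mset K1 + mset K2 = mset (C1 @ C2)" unfolding K1_def K2_def by (rule mset_nths_Compl)
        then have lK2: "length K2 = length R2" using lK1 l1 by (metis add_left_cancel size_mset size_union)
        have "minor (\<lambda>j i. H i j) K1 R1 = minor H R1 K1" using lK1 by (simp add: minor_transpose[of K1 R1])
        also have "\<dots> = minor M c (map snd K1)"
          using lK1 by (subst Hsnd) (auto simp: R1_def H_def comp_def)
        finally have m1: "minor (\<lambda>j i. H i j) K1 R1 = minor M c (map snd K1)" .
        have "minor (\<lambda>j i. H i j) K2 R2 = minor H R2 K2" using lK2 by (simp add: minor_transpose[of K2 R2])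
        also have "\<dots> = (\<Sum>p | p permutes {0..<length R2}. signof p * (\<Prod>i = 0..<length R2. H (R2 ! i) (K2 ! p i)))"
          by (rule minor_leibniz)
        finally have m2: "minor (\<lambda>j i. H i j) K1 R1 * minor (\<lambda>j i. H i j) K2 R2 =
           (\<Sum>p | p permutes {0..<length R2}. signof p * (minor M c (map snd K1) * (\<Prod>i = 0..<length R2. H (R2 ! i) (K2 ! p i))))"
          by (simp add: m1 sum_distrib_left algebra_simps)
        have hp: "minor M c (map snd K1) * (\<Prod>i = 0..<length R2. H (R2 ! i) (K2 ! p i)) \<in> S"
          if p: "p permutes {0..<length R2}" for p
        proof (cases "\<forall>i<length R2. H (R2 ! i) (K2 ! p i) = M (snd (R2 ! i)) (snd (K2 ! p i))")
          case True
          define k where "k = map snd (permute_list p K2)"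
          have p': "p permutes {..<length K2}" using p lK2 by (simp add: lessThan_atLeast0)
          have "mset (map snd K1) + mset k = image_mset snd (mset K1 + mset K2)"
            unfolding k_def using p' by (simp add: mset_permute_list)
          also have "\<dots> = mset (J @ J')" unfolding ms by (simp add: C1_def C2_def multiset.map_comp comp_def)
          finally have "minor M c (map snd K1) * (\<Prod>i = 0..<length (a @ b). M ((a @ b) ! i) (k ! i)) \<in> S"
            unfolding c_def using lK1 by (intro big) (auto simp: R1_def c_def)
          also have "(\<Prod>i = 0..<length (a @ b). M ((a @ b) ! i) (k ! i)) = (\<Prod>i = 0..<length R2. H (R2 ! i) (K2 ! p i))"
          proof (rule prod.cong)
            fix i assume i: "i \<in> {0..<length R2}"
            have "snd (R2 ! i) = (a @ b) ! i" using i by (auto simp: R2_def nth_append)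
            moreover have "k ! i = snd (K2 ! p i)"
              using i lK2 p' by (simp add: k_def permute_list_nth)
            ultimately show "M ((a @ b) ! i) (k ! i) = H (R2 ! i) (K2 ! p i)" using True i by simp
          qed (simp add: R2_def)
          finally show ?thesis .
        next
          case False
          then obtain i where i: "i < length R2" "H (R2 ! i) (K2 ! p i) \<noteq> M (snd (R2 ! i)) (snd (K2 ! p i))" by auto
          then have "H (R2 ! i) (K2 ! p i) = 0" by (auto simp: H_def split: prod.splits if_splits)
          then have "(\<Prod>i = 0..<length R2. H (R2 ! i) (K2 ! p i)) = 0"
            using i(1) by (intro prod_zero) auto
          then show ?thesis using S by (simp only: mult_zero_right add_subgroupD)
        qed
        show ?thesis unfolding nths_diff K1_def[symmetric] K2_def[symmetric] m2
          by (rule add_subgroup_sum[OF S], rule add_subgroup_sign[OF S signof_cases hp]) simp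
      qed
      have e1: "e P = 1 \<or> e P = -1" for P using e(1) by auto
      show ?thesis unfolding tr e(2) mult.assoc
        by (rule add_subgroup_sum[OF S], rule add_subgroup_sign[OF S e1 hP]) auto
    qed
    ultimately show ?thesis using S by (auto simp: add_subgroupD)
  qed
  obtain e where e: "\<forall>P. e P \<in> {1, -1}" "minor H R (C1 @ C2) =
     (\<Sum>P | P \<subseteq> {0..<length R} \<and> card P = length C1. e P * minor H (nths R P) C1 *
        minor H (nths R ({0..<length R} - P)) C2)"
    using minor_laplace[OF lR, of H] by blast
  \<comment> \<open>The zero blocks kill \<open>T P\<close> unless the rows chosen for
    \<open>J\<close> contain all of \<open>a\<close> and none of \<open>b\<close>; what remains is a
    choice of \<open>length c1\<close> rows among \<open>c\<close>.\<close>
  define T where "T P = minor H (nths R P) C1 * minor H (nths R (- P)) C2" for P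
  have cases: "(P = {0..<q + length c1} \<and> T P = minor M (a @ c1) J * minor M (c2 @ b) J') \<or>
     (P \<noteq> {0..<q + length c1} \<and> T P \<in> S)"
    if P: "P \<subseteq> {0..<N}" "card P = length C1" for P
  proof -
    have "{i. i < N \<and> i \<in> P} = P" using P by auto
    then have l1: "length (nths R P) = length C1" using P(2) by (simp add: length_nths N_def)
    have "mset (nths R P) + mset (nths R (- P)) = mset R" by (rule mset_nths_Compl)
    then have l2: "length (nths R (- P)) = length C2"
      using l1 lR by (metis add_left_cancel size_mset size_union)
    show ?thesis
    proof (cases "(\<forall>i<q. i \<in> P) \<and> (\<forall>i<N. i \<ge> q + length c \<longrightarrow> i \<notin> P)")
      case False
      have "T P = 0"
      proof (cases "\<forall>i<q. i \<in> P")
        case False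
        then obtain i where i: "i < q" "i \<notin> P" by auto
        then have "R ! i \<in> set (nths R (- P))" using NR by (auto simp: set_nths N_def)
        moreover have "R ! i = (0, a ! i)" using i by (simp add: R_def nth_append q_def)
        ultimately have "minor H (nths R (- P)) C2 = 0"
          using l2 by (intro minor_zero_row[of "(0, a ! i)"]) (auto simp: H_def C2_def)
        then show ?thesis by (simp add: T_def)
      next
        case True
        then obtain i where i: "i < N" "i \<ge> q + length c" "i \<in> P" using False by auto
        then have "R ! i \<in> set (nths R P)" by (auto simp: set_nths N_def)
        moreover have "R ! i = (2, b ! (i - q - length c))" using i NR by (auto simp: R_def nth_append q_def)
        ultimately have "minor H (nths R P) C1 = 0"
          using l1 by (intro minor_zero_row[of "(2, b ! (i - q - length c))"]) (auto simp: H_def C1_def)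
        then show ?thesis by (simp add: T_def)
      qed
      moreover have "P \<noteq> {0..<q + length c1}" using False by (auto simp: c_def)
      ultimately show ?thesis using S by (simp add: add_subgroupD)
    next
      case True
      define P' where "P' = {j. j < length c \<and> j + q \<in> P}"
      have PP': "P = {0..<q} \<union> (\<lambda>j. j + q) ` P'"
      proof (intro equalityI subsetI)
        fix i assume i: "i \<in> P"
        show "i \<in> {0..<q} \<union> (\<lambda>j. j + q) ` P'"
        proof (cases "i < q")
          case False
          have "i < N" using i P by auto
          then have "i - q \<in> P'" using True i False NR by (auto simp: P'_def not_le)
          then show ?thesis using False by (auto intro!: image_eqI[of _ _ "i - q"])
        qed simp
      qed (use True in \<open>auto simp: P'_def\<close>)
      have "card P = q + card P'"
        unfolding PP' by (subst card_Un_disjoint) (auto simp: P'_def card_image inj_on_def)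
      then have cP': "card P' = length c1" using P(2) len by (simp add: C1_def q_def)
      have n1: "nths (map (Pair 0) a) P = map (Pair 0) a" using True by (intro nths_all) (auto simp: q_def)
      have n2: "nths (map (Pair (Suc 0)) c) {j. j + q \<in> P} = map (Pair 1) (nths c P')"
        unfolding nths_map P'_def One_nat_def by (intro arg_cong[of _ _ "map _"] nths_cong) auto
      have n3: "nths (map (Pair (2::nat)) b) {j. j + (length c + q) \<in> P} = []"
        unfolding nths_def using True NR by (auto simp: filter_empty_conv dest!: set_zip_rightD)
      have nP: "nths R P = map (Pair 0) a @ map (Pair 1) (nths c P')"
        unfolding R_def nths_append using n1 n2 n3 by (simp add: q_def add.assoc)
      have n1': "nths (map (Pair 0) a) (- P) = []"
        unfolding nths_def using True by (auto simp: filter_empty_conv q_def dest!: set_zip_rightD)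
      have n2': "nths (map (Pair (Suc 0)) c) {j. j + q \<notin> P} = map (Pair 1) (nths c (- P'))"
        unfolding nths_map P'_def One_nat_def by (intro arg_cong[of _ _ "map _"] nths_cong) auto
      have n3': "nths (map (Pair (2::nat)) b) {j. j + (length c + q) \<notin> P} = map (Pair 2) b"
        using True NR by (intro nths_all) auto
      have nPc: "nths R (- P) = map (Pair 1) (nths c (- P')) @ map (Pair 2) b"
        unfolding R_def nths_append using n1' n2' n3' by (simp add: q_def add.assoc)
      have "minor H (nths R P) C1 = minor M (a @ nths c P') J"
        using l1 by (subst Hsnd) (auto simp: nP C1_def H_def comp_def)
      moreover have "minor H (nths R (- P)) C2 = minor M (nths c (- P') @ b) J'"
        using l2 by (subst Hsnd) (auto simp: nPc C2_def H_def comp_def)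
      ultimately have T: "T P = minor M (a @ nths c P') J * minor M (nths c (- P') @ b) J'" by (simp add: T_def)
      show ?thesis
      proof (cases "P' = {0..<length c1}")
        case True
        have "nths c P' = c1" unfolding c_def True nths_append by (simp add: nths_all)
        moreover have "nths c (- P') = c2"
        proof -
          have "nths c1 (- {0..<length c1}) = []" by (auto simp: nths_def filter_empty_conv dest!: set_zip_rightD)
          moreover have "nths c2 {j. j + length c1 \<in> - {0..<length c1}} = c2" by (intro nths_all) auto
          ultimately show ?thesis unfolding c_def True nths_append by simp
        qed
        moreover have "P = {0..<q + length c1}"
        proof -
          have "(\<lambda>j. j + q) ` {0..<length c1} = {q..<q + length c1}"
            using image_add_atLeastLessThan'[of q 0 "length c1"] by (simp add: add.commute)
          then show ?thesis unfolding PP' True by auto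
        qed
        ultimately show ?thesis using T by simp
      next
        case False
        have "P' \<subseteq> {0..<length (c1 @ c2)}" by (auto simp: P'_def c_def)
        then have "T P \<in> S" unfolding T c_def using False cP' by (intro other)
        moreover have "P \<noteq> {0..<q + length c1}"
        proof
          assume "P = {0..<q + length c1}"
          then have "P' = {0..<length c1}" by (auto simp: P'_def c_def)
          then show False using False by simp
        qed
        ultimately show ?thesis by simp
      qed
    qed
  qed
  let ?P0 = "{0..<q + length c1}" and ?PP = "{P. P \<subseteq> {0..<N} \<and> card P = length C1}"
  have P0: "?P0 \<in> ?PP" using len by (auto simp: NR c_def C1_def q_def)
  have "minor H R (C1 @ C2) = (\<Sum>P\<in>?PP. e P * T P)"
    unfolding e(2) nths_diff T_def N_def by (simp add: mult.assoc)
  also have "\<dots> = e ?P0 * T ?P0 + (\<Sum>P\<in>?PP - {?P0}. e P * T P)"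
    using P0 by (intro sum.remove) auto
  finally have "e ?P0 * T ?P0 = minor H R (C1 @ C2) - (\<Sum>P\<in>?PP - {?P0}. e P * T P)" by simp
  also have "\<dots> \<in> S"
  proof (intro add_subgroupD(4)[OF S X] add_subgroup_sum[OF S] add_subgroup_sign[OF S])
    fix P assume P: "P \<in> ?PP - {?P0}"
    then show "T P \<in> S" using cases[of P] by auto
    show "e P = 1 \<or> e P = -1" using e(1) by auto
  qed
  finally have "e ?P0 * T ?P0 \<in> S" .
  moreover have "e ?P0 = 1 \<or> e ?P0 = -1" using e(1) by auto
  ultimately have "T ?P0 \<in> S" using add_subgroupD(3)[OF S, of "- T ?P0"] by auto
  then show ?thesis using cases[of ?P0] P0 by auto
qed

section \<open>Bitableaux, standardness and the termination of straightening\<close>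

type_synonym bitableau = "(nat list \<times> nat list) list"

definition bidet :: "(nat \<Rightarrow> nat \<Rightarrow> 'a::comm_ring_1) \<Rightarrow> bitableau \<Rightarrow> 'a" where
  "bidet M bt = (\<Prod>x\<leftarrow>bt. minor M (fst x) (snd x))"

definition entries :: "nat list list \<Rightarrow> nat multiset" where
  "entries T = mset (concat T)"

definition eqlen :: "bitableau \<Rightarrow> bool" where
  "eqlen bt \<longleftrightarrow> (\<forall>x\<in>set bt. length (snd x) = length (fst x))"

definition row_ok :: "nat list \<times> nat list \<Rightarrow> bool" where
  "row_ok x \<longleftrightarrow> sorted_wrt (<) (fst x) \<and> sorted_wrt (<) (snd x) \<and> length (snd x) = length (fst x) \<and> fst x \<noteq> []"

definition good :: "bitableau \<Rightarrow> bool" where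
  "good bt \<longleftrightarrow> (\<forall>x\<in>set bt. row_ok x) \<and> sorted_wrt (\<lambda>x y. length (fst y) \<le> length (fst x)) bt"

text \<open>Columns increase weakly from top to bottom. Only positions of the lower row are
  inspected, so for rows of non-increasing length both entries exist.\<close>

definition std_side :: "nat list list \<Rightarrow> bool" where
  "std_side T \<longleftrightarrow> (\<forall>i. Suc i < length T \<longrightarrow> (\<forall>q<length (T ! Suc i). T ! i ! q \<le> T ! Suc i ! q))"

definition standard :: "bitableau \<Rightarrow> bool" where
  "standard bt \<longleftrightarrow> good bt \<and> std_side (map fst bt) \<and> std_side (map snd bt)"

text \<open>The termination measure of straightening: \<open>shape_weight\<close> grows, or it is unchanged and
  \<open>position_weight\<close> drops.\<close>

definition shape_weight :: "bitableau \<Rightarrow> nat" where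
  "shape_weight bt = (\<Sum>x\<leftarrow>bt. if fst x = [] then 0 else 3 ^ length (fst x))"

fun position_weight :: "bitableau \<Rightarrow> nat" where
  "position_weight [] = 0"
| "position_weight (x # bt) = Suc (length bt) * (sum_list (fst x) + sum_list (snd x)) + position_weight bt"

lemma bidet_simps [simp]:
  "bidet M [] = 1" "bidet M (x # bt) = minor M (fst x) (snd x) * bidet M bt"
  "bidet M (bt @ bt') = bidet M bt * bidet M bt'"
  by (simp_all add: bidet_def)

lemma shape_weight_simps [simp]:
  "shape_weight [] = 0"
  "shape_weight (x # bt) = (if fst x = [] then 0 else 3 ^ length (fst x)) + shape_weight bt"
  "shape_weight (bt @ bt') = shape_weight bt + shape_weight bt'"
  by (simp_all add: shape_weight_def)

lemma entries_simps [simp]: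
  "entries [] = {#}" "entries (r # T) = mset r + entries T" "entries (T @ T') = entries T + entries T'"
  by (simp_all add: entries_def)

lemma position_weight_append:
  "position_weight (xs @ ys) = position_weight xs + length ys * (\<Sum>x\<leftarrow>xs. sum_list (fst x) + sum_list (snd x)) + position_weight ys"
  by (induction xs) (auto simp: algebra_simps)

text \<open>An entry counts once for each row from its own to the last, so shifting value from the
  upper to the lower of two adjacent rows lowers the weight.\<close>

lemma position_weight_less:
  assumes "sum_list (fst x') + sum_list (snd x') < sum_list (fst x) + sum_list (snd x)"
    "sum_list (fst x') + sum_list (snd x') + (sum_list (fst y') + sum_list (snd y')) =
     sum_list (fst x) + sum_list (snd x) + (sum_list (fst y) + sum_list (snd y))"
  shows "position_weight (pre @ x' # y' # suf) < position_weight (pre @ x # y # suf)"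
proof -
  define sx sy sx' sy' where s: "sx = sum_list (fst x) + sum_list (snd x)" "sy = sum_list (fst y) + sum_list (snd y)"
    "sx' = sum_list (fst x') + sum_list (snd x')" "sy' = sum_list (fst y') + sum_list (snd y')"
  define k where "k = Suc (length suf)"
  have "Suc k * sx' + k * sy' = k * (sx' + sy') + sx'" by (simp add: algebra_simps)
  also have "\<dots> < k * (sx + sy) + sx" using assms unfolding s[symmetric] by simp
  also have "\<dots> = Suc k * sx + k * sy" by (simp add: algebra_simps)
  finally show ?thesis unfolding position_weight_append by (simp add: s k_def algebra_simps)
qed

lemma minor_sort:
  assumes "length cs = length rs"
  shows "minor M rs cs = 0 \<or> (distinct rs \<and> distinct cs \<and>
     (minor M rs cs = minor M (sort rs) (sort cs) \<or> minor M rs cs = - minor M (sort rs) (sort cs)))"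
proof (cases "distinct rs \<and> distinct cs")
  case True
  have "minor M rs cs = minor M (sort rs) cs \<or> minor M rs cs = - minor M (sort rs) cs"
    using minor_rows_mset[of rs "sort rs" M cs] by simp
  moreover have "minor M (sort rs) cs = minor M (sort rs) (sort cs) \<or> minor M (sort rs) cs = - minor M (sort rs) (sort cs)"
    using minor_cols_mset[of cs "sort cs" "sort rs" M] assms by simp
  ultimately show ?thesis using True by auto
next
  case False
  then show ?thesis using minor_rows_repeat minor_cols_repeat assms by blast
qed

lemma row_ok_sort: "distinct rs \<Longrightarrow> distinct cs \<Longrightarrow> length cs = length rs \<Longrightarrow> rs \<noteq> [] \<Longrightarrow> row_ok (sort rs, sort cs)"
  by (auto simp: row_ok_def strict_sorted_iff) (metis length_0_conv length_sort)

text \<open>Sorting each row, dropping the empty ones and ordering by length changes the product by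
  a sign at most, unless a repeated index makes it 0. Empty rows have weight 0 so that dropping them
  preserves \<open>shape_weight\<close>.\<close>

lemma bidet_normalize:
  assumes "eqlen bt"
  shows "bidet M bt = 0 \<or> (\<exists>bt'. good bt' \<and> entries (map fst bt') = entries (map fst bt) \<and>
     entries (map snd bt') = entries (map snd bt) \<and> shape_weight bt' = shape_weight bt \<and>
     (bidet M bt = bidet M bt' \<or> bidet M bt = - bidet M bt'))"
proof -
  have "bidet M bt = 0 \<or> (\<exists>bt'. (\<forall>x\<in>set bt'. row_ok x) \<and> entries (map fst bt') = entries (map fst bt) \<and>
     entries (map snd bt') = entries (map snd bt) \<and> shape_weight bt' = shape_weight bt \<and>
     (bidet M bt = bidet M bt' \<or> bidet M bt = - bidet M bt'))"
    using assms
  proof (induction bt)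
    case Nil
    show ?case by (intro disjI2 exI[of _ "[]"]) simp
  next
    case (Cons x bt)
    obtain rs cs where x: "x = (rs, cs)" by (cases x)
    have l: "length cs = length rs" "eqlen bt" using Cons.prems by (auto simp: eqlen_def x)
    show ?case
    proof (cases "minor M rs cs = 0 \<or> bidet M bt = 0")
      case False
      then obtain bt' where bt': "\<forall>x\<in>set bt'. row_ok x" "entries (map fst bt') = entries (map fst bt)"
         "entries (map snd bt') = entries (map snd bt)" "shape_weight bt' = shape_weight bt"
         "bidet M bt = bidet M bt' \<or> bidet M bt = - bidet M bt'" using Cons.IH[OF l(2)] by blast
      show ?thesis
      proof (cases "rs = []")
        case True
        then show ?thesis using bt' l by (intro disjI2 exI[of _ bt']) (simp add: x)
      next
        case False
        have d: "distinct rs" "distinct cs"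
          "minor M rs cs = minor M (sort rs) (sort cs) \<or> minor M rs cs = - minor M (sort rs) (sort cs)"
          using minor_sort[OF l(1), of M] \<open>\<not> (minor M rs cs = 0 \<or> bidet M bt = 0)\<close> by auto
        have ne: "sort rs \<noteq> []" using False by (metis length_0_conv length_sort)
        show ?thesis
          using bt' d row_ok_sort[OF d(1,2) l(1) False] False ne
          by (intro disjI2 exI[of _ "(sort rs, sort cs) # bt'"]) (auto simp: x)
      qed
    qed (auto simp: x)
  qed
  then show ?thesis
  proof (cases "bidet M bt = 0")
    case False
    then obtain bt' where bt': "\<forall>x\<in>set bt'. row_ok x" "entries (map fst bt') = entries (map fst bt)"
       "entries (map snd bt') = entries (map snd bt)" "shape_weight bt' = shape_weight bt"
       and pm: "bidet M bt = bidet M bt' \<or> bidet M bt = - bidet M bt'"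
      using \<open>bidet M bt = 0 \<or> _\<close> by blast
    define b where "b = rev (sort_key (length \<circ> fst) bt')"
    have m: "mset b = mset bt'" by (simp add: b_def)
    have "sorted_wrt (\<lambda>x y. (length \<circ> fst) x \<le> (length \<circ> fst) y) (sort_key (length \<circ> fst) bt')"
      using sorted_sort_key[of "length \<circ> fst" bt'] by (simp add: sorted_map)
    then have "sorted_wrt (\<lambda>x y. length (fst y) \<le> length (fst x)) b" by (simp add: b_def sorted_wrt_rev)
    moreover have "bidet M b = bidet M bt'"
    proof -
      have "bidet M xs = (\<Prod>x\<in>#mset xs. minor M (fst x) (snd x))" for xs by (induction xs) auto
      then show ?thesis using m by simp
    qed
    moreover have "shape_weight b = shape_weight bt'"
    proof -
      have "shape_weight xs = (\<Sum>x\<in>#mset xs. if fst x = [] then 0 else 3 ^ length (fst x))" for xs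
        by (induction xs) auto
      then show ?thesis using m by simp
    qed
    moreover have c: "entries (map f b) = entries (map f bt')" for f
    proof -
      have "entries (map f xs) = (\<Sum>x\<in>#mset xs. mset (f x))" for xs by (induction xs) auto
      then show ?thesis using m by simp
    qed
    moreover have "set b = set bt'" using m by (metis set_mset_mset)
    ultimately show ?thesis using bt' pm
      by (intro disjI2 exI[of _ b]) (simp add: good_def)
  qed simp
qed

lemma sum_list_nths: "sum_list (nths xs P) = (\<Sum>i\<in>P \<inter> {0..<length xs}. (xs ! i :: nat))"
proof -
  have "sum_list (nths xs P) = (\<Sum>i\<leftarrow>nths [0..<length xs] P. xs ! i)" by (subst nths_map_upt) simp
  also have "\<dots> = (\<Sum>i\<in>set (nths [0..<length xs] P). xs ! i)" by (simp add: sum_list_distinct_conv_sum_set)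
  also have "set (nths [0..<length xs] P) = P \<inter> {0..<length xs}" by (auto simp: set_nths_upt)
  finally show ?thesis .
qed

text \<open>Any other choice of positions trades some entries of \<open>c1\<close> for as many
  entries of \<open>c2\<close>, which are strictly smaller.\<close>

lemma sum_list_nths_less:
  assumes less: "\<And>x y. x \<in> set c1 \<Longrightarrow> y \<in> set c2 \<Longrightarrow> y < (x :: nat)"
    and P: "P \<subseteq> {0..<length (c1 @ c2)}" "card P = length c1" "P \<noteq> {0..<length c1}"
  shows "sum_list (nths (c1 @ c2) P) < sum_list c1"
proof -
  define A where "A = {0..<length c1}"
  define f where "f i = (c1 @ c2) ! i" for i
  have fin: "finite P" "finite A" using P(1) by (auto simp: A_def intro: finite_subset)
  have "card (P - A) = card (A - P)"
    using card_Int_Diff[OF fin(1), of A] card_Int_Diff[OF fin(2), of P] P(2) by (simp add: Int_commute A_def)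
  moreover have "P \<noteq> A" using P(3) by (simp add: A_def)
  then have "P - A \<noteq> {} \<or> A - P \<noteq> {}" by blast
  then have "card (P - A) > 0 \<or> card (A - P) > 0" using fin by (simp add: card_gt_0_iff)
  ultimately have ne: "card (A - P) > 0" "card (P - A) = card (A - P)" by auto
  have lt: "f i < f j" if "i \<in> P - A" "j \<in> A - P" for i j
    using that P(1) by (intro less[of "f j" "f i", unfolded f_def, folded f_def]) (auto simp: f_def A_def nth_append)
  define x where "x = Max (f ` (P - A))"
  have PA: "P - A \<noteq> {}" using ne by (metis card.empty less_irrefl)
  have "sum f (P - A) \<le> card (P - A) * x"
    using fin sum_bounded_above[of "P - A" f x] by (auto simp: x_def)
  also have "\<dots> = (\<Sum>j\<in>A - P. x)" by (simp add: ne(2))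
  also have "\<dots> < sum f (A - P)"
  proof (rule sum_strict_mono)
    have "x \<in> f ` (P - A)" unfolding x_def using fin PA by (intro Max_in) auto
    then show "x < f j" if "j \<in> A - P" for j using lt that by auto
    show "A - P \<noteq> {}" using ne by (metis card.empty less_irrefl)
  qed (use fin in auto)
  finally have "sum f (P - A) + sum f (P \<inter> A) < sum f (A - P) + sum f (A \<inter> P)" by (simp add: Int_commute)
  then have "sum f P < sum f A"
    using sum.Int_Diff[OF fin(1), of f A] sum.Int_Diff[OF fin(2), of f P] by (simp add: add.commute)
  moreover have "sum f A = sum_list c1" by (simp add: A_def f_def sum_list_sum_nth nth_append)
  moreover have "sum_list (nths (c1 @ c2) P) = sum f P"
    unfolding sum_list_nths f_def using P(1) by (simp add: Int_absorb2)
  ultimately show ?thesis by simp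
qed

text \<open>At a violation \<open>I' ! q < I ! q\<close> the tail of \<open>I\<close> from
  \<open>q\<close> and the head of \<open>I'\<close> up to \<open>q\<close> have together one entry
  more than \<open>I\<close>, and all entries of the head are smaller than those of the tail. The
  Garnir relation therefore yields terms of the same shape with a smaller upper row, and terms with
  a row longer than \<open>I\<close>.\<close>

lemma straighten_left:
  fixes M :: "nat \<Rightarrow> nat \<Rightarrow> 'a::idom"
  assumes bt: "good bt" "\<not> std_side (map fst bt)" and S: "add_subgroup S"
    and IH: "\<And>bt'. good bt' \<Longrightarrow> entries (map fst bt') = entries (map fst bt) \<Longrightarrow>
      entries (map snd bt') = entries (map snd bt) \<Longrightarrow>
      shape_weight bt < shape_weight bt' \<or> shape_weight bt' = shape_weight bt \<and> position_weight bt' < position_weight bt \<Longrightarrow>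
      bidet M bt' \<in> S"
  shows "bidet M bt \<in> S"
proof -
  obtain i q where i: "Suc i < length bt" "q < length (fst (bt ! Suc i))" "fst (bt ! Suc i) ! q < fst (bt ! i) ! q"
    using bt(2) by (auto simp: std_side_def not_le)
  define pre where "pre = take i bt"
  define suf where "suf = drop (Suc (Suc i)) bt"
  obtain I J where IJ: "bt ! i = (I, J)" by (cases "bt ! i")
  obtain I' J' where IJ': "bt ! Suc i = (I', J')" by (cases "bt ! Suc i")
  have bt_eq: "bt = pre @ (I, J) # (I', J') # suf"
    unfolding pre_def suf_def using i(1) IJ IJ' by (metis Cons_nth_drop_Suc Suc_lessD append_take_drop_id)
  have ok: "row_ok (I, J)" "row_ok (I', J')" "\<forall>x\<in>set pre \<union> set suf. row_ok x"
    using bt(1) by (auto simp: good_def bt_eq)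
  have le: "length I' \<le> length I" using bt(1) by (auto simp: good_def bt_eq sorted_wrt_append)
  define a where "a = take q I"
  define c1 where "c1 = drop q I"
  define c2 where "c2 = take (Suc q) I'"
  define b where "b = drop (Suc q) I'"
  have q: "q < length I'" "I' ! q < I ! q" using i IJ IJ' by auto
  have Ieq: "I = a @ c1" "I' = c2 @ b" by (simp_all add: a_def c1_def c2_def b_def)
  have sI: "sorted_wrt (<) I" "sorted_wrt (<) I'" using ok by (auto simp: row_ok_def)
  have c12: "y < x" if "x \<in> set c1" "y \<in> set c2" for x y
  proof -
    obtain k where k: "k < length I - q" "x = I ! (q + k)"
    proof -
      obtain j where "j < length c1" "c1 ! j = x" using \<open>x \<in> set c1\<close> by (auto simp: in_set_conv_nth)
      then show thesis using that[of j] q le by (auto simp: c1_def)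
    qed
    obtain l where l: "l < Suc q" "y = I' ! l"
      using \<open>y \<in> set c2\<close> q(1) by (auto simp: c2_def in_set_conv_nth)
    have "I ! q \<le> x" using k sI(1) by (cases "k = 0") (auto simp: sorted_wrt_iff_nth_less intro: less_imp_le)
    moreover have "y \<le> I' ! q" using l q(1) sI(2)
      by (cases "l = q") (auto simp: sorted_wrt_iff_nth_less intro: less_imp_le)
    ultimately show ?thesis using q(2) by simp
  qed
  have lc1: "length c1 = length I - q" and lc2: "length c2 = Suc q" and la: "length a = q"
    using q le by (auto simp: c1_def c2_def a_def)
  have lc: "length (c1 @ c2) = Suc (length I)" using lc1 lc2 q le by simp
  \<comment> \<open>The rest of the bitableau is absorbed into the subgroup, so that only the two
    rows in question are manipulated.\<close>
  define S' where "S' = {x. bidet M pre * x * bidet M suf \<in> S}"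
  have S': "add_subgroup S'"
    using S unfolding S'_def add_subgroup_def by (auto simp: algebra_simps)
  have "minor M (a @ c1) J * minor M (c2 @ b) J' \<in> S'"
  proof (rule garnir[OF _ _ S'])
    show "length J = length a + length c1" "length J' = length c2 + length b"
      using ok Ieq by (auto simp: row_ok_def)
  next
    fix P assume P: "P \<subseteq> {0..<length (c1 @ c2)}" "card P = length c1" "P \<noteq> {0..<length c1}"
    define rs where "rs = a @ nths (c1 @ c2) P"
    define rs' where "rs' = nths (c1 @ c2) (- P) @ b"
    have ms: "mset (nths (c1 @ c2) P) + mset (nths (c1 @ c2) (- P)) = mset (c1 @ c2)" by (rule mset_nths_Compl)
    have "{i. i < length (c1 @ c2) \<and> i \<in> P} = P" using P by auto
    then have l1: "length (nths (c1 @ c2) P) = length c1" using P(2) by (simp add: length_nths)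
    then have l2: "length (nths (c1 @ c2) (- P)) = length c2"
      using ms by (metis add_left_cancel length_append size_mset size_union)
    have len: "length rs = length I" "length rs' = length I'" using l1 l2 by (simp_all add: rs_def rs'_def Ieq)
    have mrs: "mset rs + mset rs' = mset I + mset I'"
      using ms by (simp add: rs_def rs'_def Ieq ac_simps)
    have sl: "sum_list rs < sum_list I" using sum_list_nths_less[OF c12 P] by (simp add: rs_def Ieq)
    have st: "sum_list rs + sum_list rs' = sum_list I + sum_list I'"
      using mrs by (metis mset_append sum_list_append sum_mset_sum_list)
    have lJ: "length J = length rs" "length J' = length rs'" using ok len by (auto simp: row_ok_def)
    show "minor M (a @ nths (c1 @ c2) P) J * minor M (nths (c1 @ c2) (- P) @ b) J' \<in> S'"
    proof (cases "minor M rs J = 0 \<or> minor M rs' J' = 0")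
      case True
      then show ?thesis using S' by (auto simp: rs_def rs'_def add_subgroupD)
    next
      case False
      have d: "distinct rs" "minor M rs J = minor M (sort rs) (sort J) \<or> minor M rs J = - minor M (sort rs) (sort J)"
        "distinct rs'" "minor M rs' J' = minor M (sort rs') (sort J') \<or> minor M rs' J' = - minor M (sort rs') (sort J')"
        using minor_sort[OF lJ(1), of M] minor_sort[OF lJ(2), of M] False by auto
      have srt: "sort J = J" "sort J' = J'"
        using ok by (auto simp: row_ok_def strict_sorted_iff sorted_sort_id)
      have ne: "rs \<noteq> []" "rs' \<noteq> []" using len ok by (auto simp: row_ok_def)
      define bt' where "bt' = pre @ (sort rs, J) # (sort rs', J') # suf"
      have dJ: "distinct J" "distinct J'" using ok by (auto simp: row_ok_def strict_sorted_iff)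
      have ok': "row_ok (sort rs, J)" "row_ok (sort rs', J')"
        using row_ok_sort[OF d(1) dJ(1) lJ(1) ne(1)] row_ok_sort[OF d(3) dJ(2) lJ(2) ne(2)] srt by auto
      have "sort rs \<noteq> []" "sort rs' \<noteq> []" using ok' by (auto simp: row_ok_def)
      have "bidet M bt' \<in> S"
      proof (rule IH)
        show "good bt'" using bt(1) ok' ok(3) len
          by (auto simp: good_def bt'_def bt_eq sorted_wrt_append)
        show "entries (map fst bt') = entries (map fst bt)"
          using mrs by (simp add: bt'_def bt_eq ac_simps)
        show "entries (map snd bt') = entries (map snd bt)" by (simp add: bt'_def bt_eq)
        have "shape_weight bt' = shape_weight bt"
          using len ok \<open>sort rs \<noteq> []\<close> \<open>sort rs' \<noteq> []\<close> by (simp add: bt'_def bt_eq row_ok_def)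
        moreover have "sum_list (sort xs) = sum_list xs" for xs :: "nat list"
          by (metis mset_sort sum_mset_sum_list)
        then have "position_weight bt' < position_weight bt"
          unfolding bt'_def bt_eq using sl st by (intro position_weight_less) auto
        ultimately show "shape_weight bt < shape_weight bt' \<or>
          shape_weight bt' = shape_weight bt \<and> position_weight bt' < position_weight bt" by simp
      qed
      then have "minor M (sort rs) J * minor M (sort rs') J' \<in> S'" by (simp add: S'_def bt'_def mult.assoc)
      then show ?thesis using d srt S' unfolding rs_def[symmetric] rs'_def[symmetric]
        by (auto simp: add_subgroupD)
    qed
  next
    fix K k assume Kk: "mset K + mset k = mset (J @ J')" "length K = length (c1 @ c2)"
    define ab where "ab = a @ b"
    have "size (mset K + mset k) = size (mset (J @ J'))" by (simp only: Kk(1))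
    then have "length K + length k = length J + length J'" by simp
    then have lk: "length k = length ab"
      using Kk(2) ok by (simp add: row_ok_def ab_def Ieq)
    define bt1 where "bt1 = pre @ (c1 @ c2, K) # map (\<lambda>(r, k). ([r], [k])) (zip ab k) @ suf"
    have "eqlen bt1" using ok(3) Kk(2) by (auto simp: eqlen_def bt1_def row_ok_def)
    have sing: "minor M [r] [c] = M r c" for r c by (simp add: minor_def det_single)
    have "bidet M (map (\<lambda>(r, k). ([r], [k])) (zip ab k)) = (\<Prod>i = 0..<length ab. M (ab ! i) (k ! i))"
      using lk by (simp add: bidet_def prod.list_conv_set_nth sing comp_def case_prod_unfold)
    then have bd: "bidet M bt1 = bidet M pre * (minor M (c1 @ c2) K * (\<Prod>i = 0..<length ab. M (ab ! i) (k ! i))) * bidet M suf"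
      by (simp add: bt1_def algebra_simps)
    have ct: "entries (map (\<lambda>x. [fst x]) (zip xs ys)) = mset xs" "entries (map (\<lambda>x. [snd x]) (zip xs ys)) = mset ys"
      if "length xs = length ys" for xs ys :: "nat list"
      using that by (induction xs ys rule: list_induct2) auto
    have c1: "entries (map fst bt1) = entries (map fst bt)"
      using lk ct by (simp add: bt1_def bt_eq comp_def case_prod_unfold ab_def Ieq ac_simps)
    have c2: "entries (map snd bt1) = entries (map snd bt)"
      using lk ct Kk(1) by (simp add: bt1_def bt_eq comp_def case_prod_unfold ac_simps)
    \<comment> \<open>Here the base 3 is used: \<open>3 ^ length I + 3 ^ length I'\<close> is at
      most \<open>2 * 3 ^ length I\<close>, less than the weight of a row with one more box.\<close>
    have "(3::nat) ^ length I' \<le> 3 ^ length I" using le by (intro power_increasing) auto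
    moreover have "(0::nat) < 3 ^ length I" by simp
    ultimately have "3 ^ length I + 3 ^ length I' < (3::nat) ^ length (c1 @ c2)"
      unfolding lc power_Suc by linarith
    moreover have "c1 @ c2 \<noteq> []" using lc by auto
    moreover have "I \<noteq> []" "I' \<noteq> []" using ok by (auto simp: row_ok_def)
    ultimately have w: "shape_weight bt < shape_weight bt1" by (auto simp: bt1_def bt_eq)
    have "bidet M bt1 \<in> S"
      using bidet_normalize[OF \<open>eqlen bt1\<close>, of M]
    proof (elim disjE exE conjE)
      fix bt' assume "good bt'" "entries (map fst bt') = entries (map fst bt1)"
        "entries (map snd bt') = entries (map snd bt1)" "shape_weight bt' = shape_weight bt1"
        and pm: "bidet M bt1 = bidet M bt'"
      then show ?thesis using IH c1 c2 w by simp
    next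
      fix bt' assume "good bt'" "entries (map fst bt') = entries (map fst bt1)"
        "entries (map snd bt') = entries (map snd bt1)" "shape_weight bt' = shape_weight bt1"
        and pm: "bidet M bt1 = - bidet M bt'"
      then show ?thesis using IH c1 c2 w S by (simp add: add_subgroupD)
    qed (use S in \<open>simp add: add_subgroupD\<close>)
    then show "minor M (c1 @ c2) K * (\<Prod>i = 0..<length (a @ b). M ((a @ b) ! i) (k ! i)) \<in> S'"
      unfolding S'_def ab_def[symmetric] bd by simp
  qed
  then show ?thesis by (simp add: S'_def bt_eq Ieq mult.assoc)
qed

lemma bidet_swap: "eqlen bt \<Longrightarrow> bidet (\<lambda>j i. M i j) (map prod.swap bt) = bidet M bt"
proof (induction bt)
  case (Cons x bt)
  then show ?case using minor_transpose[of "snd x" "fst x" M] by (simp add: eqlen_def)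
qed simp

text \<open>\<open>shape_weight\<close> is bounded in terms of the number of entries, so it cannot
  grow forever. A violation on the column side is turned into one on the row side by transposing all
  minors.\<close>

theorem straightening:
  fixes M :: "nat \<Rightarrow> nat \<Rightarrow> 'a::idom"
  assumes S: "add_subgroup S" and bt: "eqlen bt"
    and std: "\<And>bt'. standard bt' \<Longrightarrow> entries (map fst bt') = entries (map fst bt) \<Longrightarrow>
      entries (map snd bt') = entries (map snd bt) \<Longrightarrow> bidet M bt' \<in> S"
  shows "bidet M bt \<in> S"
proof -
  define e where "e = size (entries (map fst bt))"
  have bound: "shape_weight b \<le> e * 3 ^ e" if "good b" "size (entries (map fst b)) = e" for b
  proof -
    have "(\<Sum>x\<leftarrow>b. length (fst x)) = e" unfolding that(2)[symmetric] by (induction b) auto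
    moreover have "shape_weight b \<le> (\<Sum>x\<leftarrow>b. length (fst x)) * 3 ^ e"
      if "\<forall>x\<in>set b. length (fst x) \<le> e"
      using that
    proof (induction b)
      case (Cons x b)
      have "(if fst x = [] then 0 else 3 ^ length (fst x)) \<le> length (fst x) * (3::nat) ^ e"
      proof (cases "fst x")
        case (Cons y ys)
        have "(3::nat) ^ length (fst x) \<le> 1 * 3 ^ e" using Cons.prems by (auto intro!: power_increasing)
        also have "\<dots> \<le> length (fst x) * 3 ^ e" by (intro mult_le_mono1) (simp add: Cons)
        finally show ?thesis by simp
      qed simp
      then show ?case using Cons by (simp add: algebra_simps)
    qed simp
    moreover have "\<forall>x\<in>set b. length (fst x) \<le> (\<Sum>x\<leftarrow>b. length (fst x))"
      by (intro ballI member_le_sum_list) auto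
    ultimately show ?thesis by simp
  qed
  have main: "bidet M b \<in> S" if "good b" "entries (map fst b) = entries (map fst bt)"
      "entries (map snd b) = entries (map snd bt)" for b
    using that
  proof (induction b rule: wf_induct_rule[OF wf_measures[of "[\<lambda>b. e * 3 ^ e - shape_weight b, position_weight]"]])
    case (1 b)
    have *: "bidet M b' \<in> S" if b': "good b'" "entries (map fst b') = entries (map fst b)"
        "entries (map snd b') = entries (map snd b)"
        "shape_weight b < shape_weight b' \<or> shape_weight b' = shape_weight b \<and> position_weight b' < position_weight b" for b'
    proof -
      have "shape_weight b' \<le> e * 3 ^ e" using b' 1 by (intro bound) (auto simp: e_def)
      then have "(b', b) \<in> measures [\<lambda>b. e * 3 ^ e - shape_weight b, position_weight]" using b'(4) by auto
      from 1(1)[OF this b'(1)] show ?thesis using b'(2,3) 1(3,4) by simp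
    qed
    have ok: "eqlen b" using 1 by (auto simp: good_def eqlen_def row_ok_def)
    show ?case
    proof (cases "std_side (map fst b)")
      case False
      then show ?thesis using straighten_left[OF 1(2) False S] * by blast
    next
      case left: True
      show ?thesis
      proof (cases "std_side (map snd b)")
        case True
        then show ?thesis using std[of b] left 1 by (auto simp: standard_def)
      next
        case False
        have sw: "good (map prod.swap b')" "shape_weight (map prod.swap b') = shape_weight b'"
            "position_weight (map prod.swap b') = position_weight b'" "eqlen b'" if "good b'" for b'
        proof -
          have *: "\<forall>x\<in>set b'. length (snd x) = length (fst x) \<and> (snd x = [] \<longleftrightarrow> fst x = [])"
            using that by (auto simp: good_def row_ok_def)
          then show "shape_weight (map prod.swap b') = shape_weight b'" "eqlen b'"
            by (auto simp: shape_weight_def comp_def eqlen_def intro!: arg_cong[of _ _ sum_list])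
          show "position_weight (map prod.swap b') = position_weight b'" by (induction b') auto
          have "sorted_wrt (\<lambda>x y. length (snd y) \<le> length (snd x)) b'"
            using that * unfolding good_def by (elim conjE sorted_wrt_mono_rel[rotated]) auto
          then show "good (map prod.swap b')" using that
            by (auto simp: good_def row_ok_def sorted_wrt_map)
        qed
        have fs: "map fst (map prod.swap b') = map snd b'" "map snd (map prod.swap b') = map fst b'"
          "map prod.swap (map prod.swap b') = b'" for b' :: bitableau
          by (auto simp: comp_def)
        have "bidet (\<lambda>j i. M i j) (map prod.swap b) \<in> S"
        proof (rule straighten_left[OF sw(1)[OF 1(2)] _ S])
          show "\<not> std_side (map fst (map prod.swap b))" using False unfolding fs .
          fix b' assume b': "good b'" "entries (map fst b') = entries (map fst (map prod.swap b))"
            "entries (map snd b') = entries (map snd (map prod.swap b))"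
            "shape_weight (map prod.swap b) < shape_weight b' \<or> shape_weight b' = shape_weight (map prod.swap b) \<and>
              position_weight b' < position_weight (map prod.swap b)"
          have "bidet M (map prod.swap b') \<in> S"
            using b' sw(1-3)[OF b'(1)] sw(2,3)[OF 1(2)] unfolding fs by (intro *) (auto simp only: fs)
          then show "bidet (\<lambda>j i. M i j) b' \<in> S"
            using bidet_swap[OF sw(4)[OF sw(1)[OF b'(1)]], of M] unfolding fs by simp
        qed
        then show ?thesis unfolding bidet_swap[OF ok, of M] .
      qed
    qed
  qed
  show ?thesis using bidet_normalize[OF bt, of M] main S by (auto simp: add_subgroupD)
qed

section \<open>Shapes and weights\<close>

definition shape :: "bitableau \<Rightarrow> nat list" where
  "shape bt = map (\<lambda>x. length (fst x)) bt"

lemma shape_simps [simp]: "shape [] = []" "shape (x # bt) = length (fst x) # shape bt"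
  by (simp_all add: shape_def)

definition indicator_mon :: "'v set \<Rightarrow> 'v monomial" where
  "indicator_mon K = (\<Sum>k\<in>K. single k 1)"

lemma lookup_indicator_mon: "finite K \<Longrightarrow> lookup (indicator_mon K) v = (if v \<in> K then 1 else 0)"
  by (simp add: indicator_mon_def lookup_sum lookup_single when_def)

lemma mdeg_indicator_mon: "finite K \<Longrightarrow> mdeg (indicator_mon K) = card K"
  by (simp add: indicator_mon_def mdeg_sum)

text \<open>The exponents of the sums of indicators of sets of cardinalities \<open>\<sigma>\<close>: the weights of a bitableau of
  shape \<open>\<sigma>\<close>.\<close>

fun weights :: "nat list \<Rightarrow> 'v monomial set" where
  "weights [] = {0}"
| "weights (s # \<sigma>) = {indicator_mon K + \<nu> | K \<nu>. finite K \<and> card K = s \<and> \<nu> \<in> weights \<sigma>}"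

lemma weights_mdeg: "\<nu> \<in> weights \<sigma> \<Longrightarrow> mdeg \<nu> = sum_list \<sigma>"
  by (induction \<sigma> arbitrary: \<nu>) (auto simp: mdeg_add mdeg_indicator_mon)

text \<open>A squarefree monomial in \<open>s\<close> variables contributes at most
  \<open>min s (card F)\<close> to the exponents on \<open>F\<close>.\<close>

lemma weights_bound:
  "\<nu> \<in> weights \<sigma> \<Longrightarrow> finite F \<Longrightarrow> (\<Sum>k\<in>F. lookup \<nu> k) \<le> (\<Sum>s\<leftarrow>\<sigma>. min s (card F))"
proof (induction \<sigma> arbitrary: \<nu>)
  case (Cons s \<sigma>)
  then obtain K \<nu>' where K: "\<nu> = indicator_mon K + \<nu>'" "finite K" "card K = s" "\<nu>' \<in> weights \<sigma>" by auto
  have "(\<Sum>k\<in>F. lookup (indicator_mon K) k) = card (F \<inter> K)"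
    using K(2) Cons.prems(2) by (simp add: lookup_indicator_mon sum.If_cases)
  also have "\<dots> \<le> min s (card F)" using K Cons.prems(2) by (auto intro!: card_mono)
  finally show ?case using Cons.IH[OF K(4) Cons.prems(2)] unfolding K(1) lookup_add sum.distrib list.map sum_list.Cons
    by (rule add_mono)
qed simp

text \<open>\<open>gamma (Suc q)\<close> counts the boxes beyond the first \<open>q\<close> columns.
  Among diagrams of equal size, a larger one in the order therefore has no more boxes in the first
  \<open>q\<close> columns.\<close>

lemma gamma_min: "gamma (Suc q) \<sigma> + (\<Sum>s\<leftarrow>\<sigma>. min s q) = sum_list \<sigma>"
  unfolding gamma_def by (induction \<sigma>) auto

lemma young_le_iff:
  "young_le \<sigma> \<tau> \<longleftrightarrow> (\<forall>q. gamma (Suc q) \<sigma> \<le> gamma (Suc q) \<tau>)"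
  unfolding young_le_def by (metis Suc_le_D Suc_le_mono One_nat_def le0)

text \<open>The first \<open>q\<close> columns of \<tau> hold at least the total exponent that a
  weight of shape \<tau> puts on \<open>q\<close> variables; the hypothesis compares this exponent
  with the first \<open>q\<close> columns of \<sigma>.\<close>

lemma young_leI:
  assumes "\<nu> \<in> weights \<tau>" "mdeg \<nu> = sum_list \<sigma>"
    and "\<And>q. \<exists>F. finite F \<and> card F \<le> q \<and> (\<Sum>s\<leftarrow>\<sigma>. min s q) \<le> (\<Sum>k\<in>F. lookup \<nu> k)"
  shows "young_le \<tau> \<sigma>"
  unfolding young_le_iff
proof
  fix q
  obtain F where F: "finite F" "card F \<le> q" "(\<Sum>s\<leftarrow>\<sigma>. min s q) \<le> (\<Sum>k\<in>F. lookup \<nu> k)" using assms(3) by blast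
  have "(\<Sum>s\<leftarrow>\<sigma>. min s q) \<le> (\<Sum>t\<leftarrow>\<tau>. min t (card F))" using F weights_bound[OF assms(1) F(1)] by simp
  also have "\<dots> \<le> (\<Sum>t\<leftarrow>\<tau>. min t q)" using F(2) by (intro sum_list_mono) auto
  finally show "gamma (Suc q) \<tau> \<le> gamma (Suc q) \<sigma>"
    using gamma_min[of q \<tau>] gamma_min[of q \<sigma>] weights_mdeg[OF assms(1)] assms(2) by simp
qed

lemma young_le_trans: "young_le \<sigma> \<tau> \<Longrightarrow> young_le \<tau> \<upsilon> \<Longrightarrow> young_le \<sigma> \<upsilon>"
  unfolding young_le_def by (meson order_trans)

lemma young_le_refl [simp]: "young_le \<sigma> \<sigma>"
  by (simp add: young_le_def)

section \<open>Leading monomials\<close>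

text \<open>With respect to the lexicographic order, in which smaller variables are more significant.\<close>

definition lead :: "('v::linorder, int) polynomial \<Rightarrow> 'v monomial \<Rightarrow> bool" where
  "lead p \<mu> \<longleftrightarrow> lookup p \<mu> = 1 \<and> (\<forall>\<nu>\<in>keys p. \<nu> \<le> \<mu>)"

lemma monomial_lessI:
  fixes \<mu> \<nu> :: "'v::linorder monomial"
  assumes "lookup \<mu> v < lookup \<nu> v" "\<And>w. w < v \<Longrightarrow> lookup \<mu> w = lookup \<nu> w"
  shows "\<mu> < \<nu>"
  using assms by (auto simp: less_poly_mapping.rep_eq less_fun_def)

lemma lead_one: "lead 1 0"
  by (auto simp: lead_def)

lemma lead_mult:
  assumes "lead p \<mu>" "lead q \<nu>" shows "lead (p * q) (\<mu> + \<nu>)"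
  unfolding lead_def
proof
  have "lookup (p * q) (\<mu> + \<nu>) = (\<Sum>\<alpha>\<in>keys p. \<Sum>\<beta>\<in>keys q. if \<alpha> + \<beta> = \<mu> + \<nu> then lookup p \<alpha> * lookup q \<beta> else 0)"
    by (rule lookup_mult_superset) auto
  also have "\<dots> = (\<Sum>\<alpha>\<in>keys p. \<Sum>\<beta>\<in>keys q. if \<alpha> = \<mu> then if \<beta> = \<nu> then 1 else 0 else 0)"
  proof (intro sum.cong refl)
    fix \<alpha> \<beta> assume ab: "\<alpha> \<in> keys p" "\<beta> \<in> keys q"
    then have le: "\<alpha> \<le> \<mu>" "\<beta> \<le> \<nu>" using assms by (auto simp: lead_def)
    show "(if \<alpha> + \<beta> = \<mu> + \<nu> then lookup p \<alpha> * lookup q \<beta> else 0) = (if \<alpha> = \<mu> then if \<beta> = \<nu> then 1 else 0 else 0)"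
    proof (cases "\<alpha> = \<mu>")
      case True
      then show ?thesis using assms by (auto simp: lead_def)
    next
      case False
      then have "\<alpha> + \<beta> < \<mu> + \<nu>" using le by (intro add_less_le_mono) auto
      then show ?thesis using False by simp
    qed
  qed
  also have "\<dots> = 1"
  proof -
    have "\<mu> \<in> keys p" "\<nu> \<in> keys q" using assms by (auto simp: lead_def in_keys_iff)
    then show ?thesis by (simp add: sum.If_cases if_distrib[of "\<lambda>x. sum x _"] sum.delta
       sum.swap[of _ "keys q"] cong: if_cong)
  qed
  finally show "lookup (p * q) (\<mu> + \<nu>) = 1" .
  show "\<forall>\<kappa>\<in>keys (p * q). \<kappa> \<le> \<mu> + \<nu>"
  proof
    fix \<kappa> assume "\<kappa> \<in> keys (p * q)"
    then obtain \<alpha> \<beta> where "\<kappa> = \<alpha> + \<beta>" "\<alpha> \<in> keys p" "\<beta> \<in> keys q" using Poly_Mapping.keys_mult by fastforce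
    then show "\<kappa> \<le> \<mu> + \<nu>" using assms by (auto simp: lead_def intro: add_mono)
  qed
qed

text \<open>The first component is 0 for the diagonal \<open>Y\<close>, 1 for \<open>A\<close> and 2
  for \<open>B\<close>; lexicographically \<open>Y\<close> outranks \<open>A\<close> and
  \<open>A\<close> outranks \<open>B\<close>. In a variable of \<open>A\<close> the inner index
  precedes the row index, so that exponents are compared column by column of
  \<open>A\<close>.\<close>

type_synonym gvar = "nat \<times> nat \<times> nat"

definition gen_y :: "nat \<Rightarrow> (gvar, int) polynomial" where "gen_y k = Var (0, k, 0)"
definition gen_a :: "nat \<Rightarrow> nat \<Rightarrow> (gvar, int) polynomial" where "gen_a i k = Var (1, k, i)"
definition gen_b :: "nat \<Rightarrow> nat \<Rightarrow> (gvar, int) polynomial" where "gen_b k j = Var (2, k, j)"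

text \<open>The entries of \<open>A Y B\<close> for generic matrices \<open>A\<close>, \<open>B\<close> and a generic diagonal matrix \<open>Y\<close>. The order of
  the variables makes the main diagonal of a minor its leading term.\<close>

definition gen_prod :: "nat \<Rightarrow> nat \<Rightarrow> nat \<Rightarrow> (gvar, int) polynomial" where
  "gen_prod K i j = (\<Sum>k<K. (gen_a i k * gen_y k) * gen_b k j)"

text \<open>The exponent of the product over all positions \<open>p\<close> of
  \<open>a_{I_p,p} y_p b_{p,J_p}\<close>, for the row \<open>x = (I, J)\<close>.\<close>

definition row_lead :: "nat list \<times> nat list \<Rightarrow> gvar monomial" where
  "row_lead x = (\<Sum>p<length (fst x). single (1, p, fst x ! p) 1 + single (0, p, 0) 1 + single (2, p, snd x ! p) 1)"

lemma sum_nth_distinct: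
  assumes "distinct ks" "q < length ks"
  shows "(\<Sum>p<length ks. if ks ! p = ks ! q \<and> P p then 1 else 0) = (if P q then 1 else (0::nat))"
proof -
  have "(\<Sum>p<length ks. if ks ! p = ks ! q \<and> P p then 1 else 0) = (\<Sum>p<length ks. if p = q then if P p then 1 else 0 else (0::nat))"
    using assms by (intro sum.cong) (auto simp: nth_eq_iff_index_eq)
  then show ?thesis using assms(2) by simp
qed

lemma sum_nth_notin:
  "k \<notin> set ks \<Longrightarrow> (\<Sum>p<length ks. if ks ! p = k \<and> P p then 1 else (0::nat)) = 0"
  by (auto simp: in_set_conv_nth)

text \<open>Cauchy--Binet and the Leibniz formula give signed monomials indexed by a list
  \<open>ks\<close> of inner indices and a permutation \<rho>. Any choice other than
  \<open>ks = [0..<s]\<close> and \<open>\<rho> = id\<close> loses at the first variable where it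
  differs: in \<open>Y\<close> if the set of inner indices is different, in \<open>A\<close> if only
  their order is, in \<open>B\<close> if only \<rho> is.\<close>

lemma lead_minor_gen_prod:
  assumes ok: "row_ok x" and K: "length (fst x) \<le> K"
  shows "lead (minor (gen_prod K) (fst x) (snd x)) (row_lead x)"
proof -
  obtain I J where x: "x = (I, J)" by (cases x)
  define s where "s = length I"
  have IJ: "sorted_wrt (<) I" "sorted_wrt (<) J" "length J = s" "s \<le> K" "length I = s"
    using assms by (auto simp: x row_ok_def s_def)
  define mon :: "nat list \<Rightarrow> (nat \<Rightarrow> nat) \<Rightarrow> gvar monomial" where "mon ks \<rho> = (\<Sum>p<s. single (1, ks ! p, I ! p) 1 + single (0, ks ! p, 0) 1 + single (2, ks ! p, J ! \<rho> p) 1)"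
    for ks \<rho>
  define LL where "LL = {ks. set ks \<subseteq> {..<K} \<and> length ks = s \<and> distinct ks}"
  define PP where "PP = {\<rho>. \<rho> permutes {0..<s}}"
  have LLfin: "finite LL" unfolding LL_def
    by (rule finite_subset[OF _ finite_lists_length_eq[of "{..<K}" s]]) auto
  have PPfin: "finite PP" by (simp add: PP_def finite_permutations)
  have "minor (gen_prod K) I J = (\<Sum>ks\<in>LL. (\<Prod>i = 0..<s. gen_a (I ! i) (ks ! i) * gen_y (ks ! i)) * minor gen_b ks J)"
    unfolding gen_prod_def[abs_def] LL_def
    using minor_mult[of "{..<K}" J I "\<lambda>i k. gen_a i k * gen_y k" gen_b] IJ by simp
  also have "\<dots> = (\<Sum>ks\<in>LL. \<Sum>\<rho>\<in>PP. single (mon ks \<rho>) (sign \<rho>))"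
  proof (rule sum.cong[OF refl])
    fix ks assume ks: "ks \<in> LL"
    have "(\<Prod>i = 0..<s. gen_a (I ! i) (ks ! i) * gen_y (ks ! i)) * (signof \<rho> * (\<Prod>i = 0..<s. gen_b (ks ! i) (J ! \<rho> i))) =
       single (mon ks \<rho>) (sign \<rho>)" for \<rho>
    proof -
      have "(\<Prod>i = 0..<s. gen_a (I ! i) (ks ! i) * gen_y (ks ! i)) * (\<Prod>i = 0..<s. gen_b (ks ! i) (J ! \<rho> i)) =
         (\<Prod>i = 0..<s. single (single (1, ks ! i, I ! i) 1 + single (0, ks ! i, 0) 1 + single (2, ks ! i, J ! \<rho> i) 1) 1)"
        by (simp add: prod.distrib[symmetric] gen_a_def gen_b_def gen_y_def Var_def mult_single)
      also have "\<dots> = single (mon ks \<rho>) 1" by (simp add: prod_single mon_def lessThan_atLeast0)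
      finally have e: "(\<Prod>i = 0..<s. gen_a (I ! i) (ks ! i) * gen_y (ks ! i)) * (\<Prod>i = 0..<s. gen_b (ks ! i) (J ! \<rho> i)) =
        single (mon ks \<rho>) 1" .
      show ?thesis unfolding mult.left_commute[of _ "signof \<rho>"] e by (simp add: sign_def single_uminus)
    qed
    then show "(\<Prod>i = 0..<s. gen_a (I ! i) (ks ! i) * gen_y (ks ! i)) * minor gen_b ks J = (\<Sum>\<rho>\<in>PP. single (mon ks \<rho>) (sign \<rho>))"
      using ks unfolding minor_leibniz LL_def PP_def by (simp add: sum_distrib_left)
  qed
  finally have expand: "minor (gen_prod K) I J = (\<Sum>ks\<in>LL. \<Sum>\<rho>\<in>PP. single (mon ks \<rho>) (sign \<rho>))" .
  have look0: "lookup (mon ks \<rho>) (0, k, c) = (if c = 0 then \<Sum>p<s. if ks ! p = k \<and> True then 1 else 0 else 0)" for ks \<rho> k c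
    by (auto simp: mon_def lookup_sum lookup_add lookup_single when_def intro!: sum.cong)
  have look1: "lookup (mon ks \<rho>) (1, k, i) = (\<Sum>p<s. if ks ! p = k \<and> I ! p = i then 1 else 0)" for ks \<rho> k i
    by (auto simp: mon_def lookup_sum lookup_add lookup_single when_def intro!: sum.cong)
  have look2: "lookup (mon ks \<rho>) (2, k, j) = (\<Sum>p<s. if ks ! p = k \<and> J ! \<rho> p = j then 1 else 0)" for ks \<rho> k j
    by (auto simp: mon_def lookup_sum lookup_add lookup_single when_def intro!: sum.cong)
  define top where "top = mon [0..<s] id"
  have less: "mon ks \<rho> < top" if ks: "ks \<in> LL" and rho: "\<rho> \<in> PP" and ne: "ks \<noteq> [0..<s] \<or> \<rho> \<noteq> id" for ks \<rho>
  proof -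
    have d: "distinct ks" "length ks = s" using ks by (auto simp: LL_def)
    have S1: "(\<Sum>p<s. if ks ! p = ks ! q \<and> P p then 1 else (0::nat)) = (if P q then 1 else 0)" if "q < s" for q P
      using sum_nth_distinct[OF d(1), of q P] that d(2) by simp
    have S0: "(\<Sum>p<s. if ks ! p = k \<and> P p then 1 else (0::nat)) = 0" if "k \<notin> set ks" for k P
      using sum_nth_notin[OF that, of P] d(2) by simp
    have T1: "(\<Sum>p<s. if [0..<s] ! p = q \<and> P p then 1 else (0::nat)) = (if q < s \<and> P q then 1 else 0)" for q P
      using sum_nth_distinct[of "[0..<s]" q P] sum_nth_notin[of q "[0..<s]" P] by (cases "q < s") auto
    have In: "I ! a < I ! b" if "a < b" "b < s" for a b using IJ that by (simp add: sorted_wrt_iff_nth_less)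
    have Jn: "J ! a < J ! b" if "a < b" "b < s" for a b using IJ that by (simp add: sorted_wrt_iff_nth_less)
    consider "set ks \<noteq> {0..<s}" | "set ks = {0..<s}" "ks \<noteq> [0..<s]" | "ks = [0..<s]" "\<rho> \<noteq> id"
      using ne by auto
    then show ?thesis
    proof cases
      \<comment> \<open>The least index missing from \<open>ks\<close> has exponent 0 instead of 1,
        and all smaller ones agree.\<close>
      case 1
      have "\<not> {0..<s} \<subseteq> set ks"
        using 1 card_subset_eq[of "set ks" "{0..<s}"] d distinct_card[of ks] by auto
      then have ex: "\<exists>k. k < s \<and> k \<notin> set ks" by auto
      define k where "k = (LEAST k. k < s \<and> k \<notin> set ks)"
      have k: "k < s" "k \<notin> set ks" using LeastI_ex[OF ex] by (auto simp: k_def)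
      have kl: "l \<in> set ks" if "l < k" for l using not_less_Least[of l] that k(1) unfolding k_def by force
      show ?thesis
      proof (rule monomial_lessI[of _ "(0, k, 0)"])
        show "lookup (mon ks \<rho>) (0, k, 0) < lookup top (0, k, 0)"
          unfolding top_def look0 using S0[OF k(2), of "\<lambda>_. True"] T1[of k "\<lambda>_. True"] k by simp
        fix w :: gvar assume "w < (0, k, 0)"
        then obtain l c where w: "w = (0, l, c)" "l < k" by (cases w) auto
        obtain q where q: "q < s" "ks ! q = l" using kl[OF w(2)] d by (auto simp: in_set_conv_nth)
        show "lookup (mon ks \<rho>) w = lookup top w"
          unfolding top_def w look0 using S1[OF q(1), of "\<lambda>_. True"] T1[of l "\<lambda>_. True"] q w k by simp
      qed
    next
      case 2
      then have ex: "\<exists>k. k < s \<and> ks ! k \<noteq> k" using d by (metis add_0 length_upt minus_nat.diff_0 nth_equalityI nth_upt)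
      define k where "k = (LEAST k. k < s \<and> ks ! k \<noteq> k)"
      have k: "k < s" "ks ! k \<noteq> k" using LeastI_ex[OF ex] by (auto simp: k_def)
      have kl: "ks ! l = l" if "l < k" for l using not_less_Least[of l] that k(1) unfolding k_def by force
      \<comment> \<open>The inner index \<open>k\<close> is used at a later position
        \<open>q\<close>, hence with a larger row index, and the variable with row index
        \<open>I ! k\<close> is absent.\<close>
      obtain q where q: "q < s" "ks ! q = k" using 2(1) k(1) d by (metis atLeastLessThan_iff in_set_conv_nth le0)
      have "k < q" using q kl[of q] k(2) by (metis linorder_neqE_nat)
      then have Iq: "I ! k < I ! q" using In q by simp
      have eq0: "lookup (mon ks \<rho>) (0, l, c) = lookup top (0, l, c)" for l c
      proof (cases "l < s")
        case True
        then obtain q' where "q' < s" "ks ! q' = l" using 2(1) d by (metis atLeastLessThan_iff in_set_conv_nth le0)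
        then show ?thesis unfolding top_def look0 using S1[of q' "\<lambda>_. True"] T1[of l "\<lambda>_. True"] True by simp
      next
        case False
        then show ?thesis unfolding top_def look0 using S0[of l "\<lambda>_. True"] T1[of l "\<lambda>_. True"] 2(1) by simp
      qed
      show ?thesis
      proof (rule monomial_lessI[of _ "(1, k, I ! k)"])
        show "lookup (mon ks \<rho>) (1, k, I ! k) < lookup top (1, k, I ! k)"
          unfolding top_def look1 using S1[OF q(1), of "\<lambda>p. I ! p = I ! k"] T1[of k "\<lambda>p. I ! p = I ! k"] q k Iq by simp
        fix w :: gvar assume "w < (1, k, I ! k)"
        then consider l c where "w = (0, l, c)" | l i where "w = (1, l, i)" "l < k" | i where "w = (1, k, i)" "i < I ! k"
          by (cases w) (auto simp: le_less)
        then show "lookup (mon ks \<rho>) w = lookup top w"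
        proof cases
          case (2 l i)
          then show ?thesis unfolding top_def 2 look1
            using S1[of l "\<lambda>p. I ! p = i"] T1[of l "\<lambda>p. I ! p = i"] kl[of l] k(1) by simp
        next
          case (3 i)
          then show ?thesis unfolding top_def 3 look1
            using S1[OF q(1), of "\<lambda>p. I ! p = i"] T1[of k "\<lambda>p. I ! p = i"] q k Iq by simp
        qed (simp add: eq0)
      qed
    next
      case 3
      have rp: "\<rho> permutes {0..<s}" using rho by (simp add: PP_def)
      obtain k0 where k0: "\<rho> k0 \<noteq> k0" using 3(2) by (auto simp: fun_eq_iff)
      have "k0 < s" using k0 permutes_not_in[OF rp, of k0] by (cases "k0 < s") auto
      then have ex: "\<exists>k. k < s \<and> \<rho> k \<noteq> k" using k0 by auto
      define k where "k = (LEAST k. k < s \<and> \<rho> k \<noteq> k)"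
      have k: "k < s" "\<rho> k \<noteq> k" using LeastI_ex[OF ex] by (auto simp: k_def)
      have kl: "\<rho> l = l" if "l < k" for l using not_less_Least[of l] that k(1) unfolding k_def by force
      \<comment> \<open>Below \<open>k\<close> the permutation is the identity, so by injectivity
        \<open>\<rho> k\<close> exceeds \<open>k\<close>, and the column index paired with
        \<open>k\<close> is too large.\<close>
      have "\<not> \<rho> k < k"
      proof
        assume "\<rho> k < k"
        then have "\<rho> (\<rho> k) = \<rho> k" by (rule kl)
        then show False using permutes_inj[OF rp] k(2) by (metis injD)
      qed
      then have "k < \<rho> k" using k(2) by simp
      moreover have "\<rho> k < s" using permutes_in_image[OF rp, of k] k(1) by simp
      ultimately have Jk: "J ! k < J ! \<rho> k" by (rule Jn)
      have eq: "lookup (mon ks \<rho>) (0, l, c) = lookup top (0, l, c)" "lookup (mon ks \<rho>) (1, l, c) = lookup top (1, l, c)" for l c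
        unfolding top_def 3(1) look0 look1 by simp_all
      show ?thesis
      proof (rule monomial_lessI[of _ "(2, k, J ! k)"])
        show "lookup (mon ks \<rho>) (2, k, J ! k) < lookup top (2, k, J ! k)"
          unfolding top_def look2 3(1) using T1[of k "\<lambda>p. J ! \<rho> p = J ! k"] T1[of k "\<lambda>p. J ! id p = J ! k"] k Jk by simp
        fix w :: gvar assume "w < (2, k, J ! k)"
        then consider l c where "w = (0, l, c)" | l c where "w = (1, l, c)" | l j where "w = (2, l, j)" "l < k" | j where "w = (2, k, j)" "j < J ! k"
          by (cases w) (auto simp: le_less less_2_cases_iff)
        then show "lookup (mon ks \<rho>) w = lookup top w"
        proof cases
          case (3 l j)
          then show ?thesis unfolding top_def 3 look2 \<open>ks = [0..<s]\<close>
            using T1[of l "\<lambda>p. J ! \<rho> p = j"] T1[of l "\<lambda>p. J ! id p = j"] kl[of l] k(1) by simp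
        next
          case (4 j)
          then show ?thesis unfolding top_def 4 look2 \<open>ks = [0..<s]\<close>
            using T1[of k "\<lambda>p. J ! \<rho> p = j"] T1[of k "\<lambda>p. J ! id p = j"] k Jk by simp
        qed (simp_all only: eq)
      qed
    qed
  qed
  have inLL: "[0..<s] \<in> LL" "id \<in> PP" using IJ by (auto simp: LL_def PP_def permutes_id)
  have rl: "row_lead x = top"
    unfolding row_lead_def top_def mon_def x by (simp add: s_def)
  have "lookup (minor (gen_prod K) I J) top = (\<Sum>ks\<in>LL. \<Sum>\<rho>\<in>PP. if ks = [0..<s] \<and> \<rho> = id then 1 else 0)"
    unfolding expand lookup_sum
  proof (intro sum.cong refl)
    fix ks \<rho> assume "ks \<in> LL" "\<rho> \<in> PP"
    then show "lookup (single (mon ks \<rho>) (sign \<rho>)) top = (if ks = [0..<s] \<and> \<rho> = id then 1 else 0)"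
      using less[of ks \<rho>] by (cases "ks = [0..<s] \<and> \<rho> = id") (auto simp: top_def lookup_single when_def)
  qed
  also have "\<dots> = (\<Sum>ks\<in>LL. if ks = [0..<s] then \<Sum>\<rho>\<in>PP. if \<rho> = id then 1 else 0 else 0)"
    by (intro sum.cong) auto
  also have "\<dots> = 1" using inLL LLfin PPfin by simp
  finally have "lookup (minor (gen_prod K) I J) top = 1" .
  moreover have "\<nu> \<le> top" if nu: "\<nu> \<in> keys (minor (gen_prod K) I J)" for \<nu>
  proof -
    have "keys (minor (gen_prod K) I J) \<subseteq> (\<Union>ks\<in>LL. \<Union>\<rho>\<in>PP. keys (single (mon ks \<rho>) (sign \<rho>)))"
      unfolding expand by (intro order_trans[OF keys_sum] UN_mono order_refl keys_sum)
    also have "\<dots> \<subseteq> (\<Union>ks\<in>LL. \<Union>\<rho>\<in>PP. {mon ks \<rho>})" by (intro UN_mono) auto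
    finally obtain ks \<rho> where "ks \<in> LL" "\<rho> \<in> PP" "\<nu> = mon ks \<rho>" using nu by auto
    then show ?thesis using less[of ks \<rho>] by (cases "ks \<noteq> [0..<s] \<or> \<rho> \<noteq> id") (auto simp: top_def intro: less_imp_le)
  qed
  ultimately show ?thesis unfolding lead_def rl by (simp add: x)
qed

subsection \<open>A standard bitableau is determined by its leading monomial\<close>

definition column :: "nat list list \<Rightarrow> nat \<Rightarrow> nat list" where
  "column T p = map (\<lambda>r. r ! p) (filter (\<lambda>r. p < length r) T)"

lemma column_simps [simp]:
  "column [] p = []" "column (r # T) p = (if p < length r then r ! p # column T p else column T p)"
  by (simp_all add: column_def)

lemma std_side_Cons: "std_side (r # T) \<Longrightarrow> std_side T"
  unfolding std_side_def by (metis Suc_less_eq length_Cons nth_Cons_Suc)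

lemma column_short: "\<forall>r\<in>set T. length r \<le> p \<Longrightarrow> column T p = []"
  by (auto simp: column_def filter_empty_conv not_less)

lemma sorted_column:
  "std_side T \<Longrightarrow> sorted_wrt (\<lambda>r r'. length r' \<le> length r) T \<Longrightarrow> sorted (column T p)"
proof (induction T)
  case (Cons r T)
  have IH: "sorted (column T p)" using Cons std_side_Cons by simp
  show ?case
  proof (cases "column T p")
    case Nil
    then show ?thesis by simp
  next
    case c: (Cons x xs)
    then obtain r' T' where T: "T = r' # T'" by (cases T) auto
    show ?thesis
    proof (cases "p < length r'")
      case True
      have "r ! p \<le> r' ! p" using Cons.prems(1) True unfolding std_side_def T by force
      moreover have "x = r' ! p" using c True by (simp add: T)
      ultimately show ?thesis using IH c by auto
    next
      case False
      then have "column T p = []" using Cons.prems(2) by (intro column_short) (auto simp: T)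
      then show ?thesis using c by simp
    qed
  qed
qed simp

lemma column_nth:
  assumes "sorted_wrt (\<lambda>r r'. length r' \<le> length r) T" "i < length T"
  shows "p < length (T ! i) \<longleftrightarrow> i < length (column T p)" "p < length (T ! i) \<Longrightarrow> column T p ! i = T ! i ! p"
  using assms
proof (induction T arbitrary: i)
  case (Cons r T)
  case 1
  then show ?case
  proof (cases "p < length r")
    case False
    then have "column T p = []" using 1 by (intro column_short) auto
    moreover have "\<forall>y\<in>set (r # T). length y \<le> length r" using 1 by auto
    then have "\<not> p < length ((r # T) ! i)" using False 1 nth_mem[of i "r # T"] by fastforce
    ultimately show ?thesis using False by simp
  qed (use 1 Cons.IH(1) in \<open>auto simp: nth_Cons split: nat.split\<close>)
next
  case (Cons r T)
  case 2
  show ?case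
  proof (cases "p < length r")
    case False
    moreover have "\<forall>y\<in>set (r # T). length y \<le> length r" using 2 by auto
    ultimately have "\<not> p < length ((r # T) ! i)" using 2 nth_mem[of i "r # T"] by fastforce
    then show ?thesis using 2 by simp
  qed (use 2 Cons.IH in \<open>auto simp: nth_Cons split: nat.split\<close>)
qed auto

text \<open>In a standard tableau the columns are sorted, so each is determined by its multiset; the
  lengths of the columns give the shape.\<close>

lemma std_side_unique:
  assumes T: "std_side T" "sorted_wrt (\<lambda>r r'. length r' \<le> length r) T" "\<forall>r\<in>set T. r \<noteq> []"
    and T': "std_side T'" "sorted_wrt (\<lambda>r r'. length r' \<le> length r) T'" "\<forall>r\<in>set T'. r \<noteq> []"
    and eq: "\<And>p. mset (column T p) = mset (column T' p)"
  shows "T = T'"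
proof -
  have c: "column T p = column T' p" for p
    using sorted_column[OF T(1,2), of p] sorted_column[OF T'(1,2), of p] eq[of p]
    by (metis properties_for_sort)
  have l: "length (column T 0) = length T" if "\<forall>r\<in>set T. r \<noteq> []" for T
    using that by (simp add: column_def)
  have lT: "length T = length T'" using l[OF T(3)] l[OF T'(3)] c by simp
  show ?thesis
  proof (rule nth_equalityI[OF lT])
    fix i assume i: "i < length T"
    have len: "p < length (T ! i) \<longleftrightarrow> p < length (T' ! i)" for p
      using column_nth(1)[OF T(2) i, of p] column_nth(1)[OF T'(2), of i p] i lT c by simp
    then have "length (T ! i) = length (T' ! i)" by (metis linorder_neqE_nat less_irrefl)
    then show "T ! i = T' ! i"
    proof (rule nth_equalityI)
      fix p assume "p < length (T ! i)"
      then show "T ! i ! p = T' ! i ! p"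
        using column_nth(2)[OF T(2) i, of p] column_nth(2)[OF T'(2), of i p] i lT c len by simp
    qed
  qed
qed

definition bitableau_lead :: "bitableau \<Rightarrow> gvar monomial" where
  "bitableau_lead bt = (\<Sum>x\<leftarrow>bt. row_lead x)"

lemma bitableau_lead_simps [simp]:
  "bitableau_lead [] = 0" "bitableau_lead (x # bt) = row_lead x + bitableau_lead bt"
  by (simp_all add: bitableau_lead_def)

lemma lookup_row_lead:
  "lookup (row_lead x) (1, p, i) = (if p < length (fst x) \<and> fst x ! p = i then 1 else 0)"
  "lookup (row_lead x) (2, p, i) = (if p < length (fst x) \<and> snd x ! p = i then 1 else 0)"
  "lookup (row_lead x) (0, p, 0) = (if p < length (fst x) then 1 else 0)"
proof -
  have *: "(\<Sum>q<l. if q = p \<and> P q then 1 else (0::nat)) = (if p < l \<and> P p then 1 else 0)" for l P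
  proof -
    have "(\<Sum>q<l. if q = p \<and> P q then 1 else (0::nat)) = (\<Sum>q<l. if q = p then if P p then 1 else 0 else 0)"
      by (intro sum.cong) auto
    then show ?thesis by simp
  qed
  have "lookup (row_lead x) (1, p, i) = (\<Sum>q<length (fst x). if q = p \<and> fst x ! q = i then 1 else 0)"
    by (auto simp: row_lead_def lookup_sum lookup_add lookup_single when_def intro!: sum.cong)
  then show "lookup (row_lead x) (1, p, i) = (if p < length (fst x) \<and> fst x ! p = i then 1 else 0)"
    unfolding * .
  have "lookup (row_lead x) (2, p, i) = (\<Sum>q<length (fst x). if q = p \<and> snd x ! q = i then 1 else 0)"
    by (auto simp: row_lead_def lookup_sum lookup_add lookup_single when_def intro!: sum.cong)
  then show "lookup (row_lead x) (2, p, i) = (if p < length (fst x) \<and> snd x ! p = i then 1 else 0)"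
    unfolding * .
  show "lookup (row_lead x) (0, p, 0) = (if p < length (fst x) then 1 else 0)"
    using *[of "\<lambda>_. True" "length (fst x)"] by (auto simp: row_lead_def lookup_sum lookup_add lookup_single when_def)
qed

lemma lookup_bitableau_lead:
  assumes "good bt"
  shows "lookup (bitableau_lead bt) (1, p, i) = count (mset (column (map fst bt) p)) i"
    "lookup (bitableau_lead bt) (2, p, i) = count (mset (column (map snd bt) p)) i"
proof -
  have "\<forall>x\<in>set bt. row_ok x" using assms by (simp add: good_def)
  then show "lookup (bitableau_lead bt) (1, p, i) = count (mset (column (map fst bt) p)) i"
    "lookup (bitableau_lead bt) (2, p, i) = count (mset (column (map snd bt) p)) i"
    unfolding bitableau_lead_def
    by (induction bt) (simp_all only: list.map sum_list.Nil sum_list.Cons lookup_zero lookup_add lookup_row_lead column_simps,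
      auto simp: row_ok_def)
qed

text \<open>The exponent of \<open>(1, p, i)\<close> counts the entries \<open>i\<close> in column
  \<open>p\<close> of the left tableau, that of \<open>(2, p, i)\<close> those of the right
  one.\<close>

lemma bitableau_lead_inj:
  assumes "standard bt" "standard bt'" "bitableau_lead bt = bitableau_lead bt'"
  shows "bt = bt'"
proof -
  have good: "good bt" "good bt'" and std: "std_side (map fst bt)" "std_side (map fst bt')"
    "std_side (map snd bt)" "std_side (map snd bt')" using assms by (auto simp: standard_def)
  have srt: "sorted_wrt (\<lambda>r r'. length r' \<le> length r) (map fst b)"
    "sorted_wrt (\<lambda>r r'. length r' \<le> length r) (map snd b)" "\<forall>r\<in>set (map fst b) \<union> set (map snd b). r \<noteq> []" if "good b" for b
  proof -
    have *: "\<forall>x\<in>set b. length (snd x) = length (fst x) \<and> fst x \<noteq> []" using that by (auto simp: good_def row_ok_def)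
    then have "\<forall>x\<in>set b. fst x \<noteq> [] \<and> snd x \<noteq> []" by (metis length_0_conv)
    then show "\<forall>r\<in>set (map fst b) \<union> set (map snd b). r \<noteq> []" by auto
    have s: "sorted_wrt (\<lambda>x y. length (fst y) \<le> length (fst x)) b" using that by (simp add: good_def)
    then show "sorted_wrt (\<lambda>r r'. length r' \<le> length r) (map fst b)" by (simp add: sorted_wrt_map)
    show "sorted_wrt (\<lambda>r r'. length r' \<le> length r) (map snd b)"
      unfolding sorted_wrt_map by (rule sorted_wrt_mono_rel[OF _ s]) (use * in auto)
  qed
  have "mset (column (map fst bt) p) = mset (column (map fst bt') p)"
    "mset (column (map snd bt) p) = mset (column (map snd bt') p)" for p
    using assms(3) lookup_bitableau_lead[OF good(1)] lookup_bitableau_lead[OF good(2)]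
    by (auto intro!: multiset_eqI)
  then have "map fst bt = map fst bt'" "map snd bt = map snd bt'"
    using std srt[OF good(1)] srt[OF good(2)] by (auto intro!: std_side_unique)
  then show ?thesis by (metis zip_map_fst_snd)
qed

lemma lead_bidet:
  "\<forall>x\<in>set bt. row_ok x \<and> length (fst x) \<le> K \<Longrightarrow> lead (bidet (gen_prod K) bt) (bitableau_lead bt)"
  by (induction bt) (auto intro: lead_one lead_mult lead_minor_gen_prod)

subsection \<open>Weights with respect to \<open>Y\<close>\<close>

definition y_part :: "gvar monomial \<Rightarrow> nat monomial" where
  "y_part = Poly_Mapping.map_key (\<lambda>k. (0, k, 0))"

lemma inj_y: "inj (\<lambda>k::nat. (0::nat, k, 0::nat))"
  by (auto intro: injI)

lemma lookup_y_part: "lookup (y_part \<mu>) k = lookup \<mu> (0, k, 0)"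
  by (simp add: y_part_def map_key.rep_eq[OF inj_y])

lemma y_part_add: "y_part (\<mu> + \<nu>) = y_part \<mu> + y_part \<nu>"
  by (rule poly_mapping_eqI) (simp add: lookup_y_part lookup_add)

lemma y_part_0 [simp]: "y_part 0 = 0"
  by (rule poly_mapping_eqI) (simp add: lookup_y_part)

definition has_weights :: "nat monomial set \<Rightarrow> (gvar, int) polynomial \<Rightarrow> bool" where
  "has_weights E p \<longleftrightarrow> y_part ` keys p \<subseteq> E"

lemma has_weights_mono: "has_weights E p \<Longrightarrow> E \<subseteq> E' \<Longrightarrow> has_weights E' p"
  by (auto simp: has_weights_def)

lemma has_weights_zero: "has_weights E 0"
  by (simp add: has_weights_def)

lemma has_weights_add: "has_weights E p \<Longrightarrow> has_weights E q \<Longrightarrow> has_weights E (p + q)"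
  using Poly_Mapping.keys_add[of p q] unfolding has_weights_def by blast

lemma has_weights_uminus: "has_weights E p \<Longrightarrow> has_weights E (- p)"
  by (simp add: has_weights_def)

lemma has_weights_sum: "(\<And>x. x \<in> F \<Longrightarrow> has_weights E (f x)) \<Longrightarrow> has_weights E (sum f F)"
  by (induction F rule: infinite_finite_induct) (auto simp: has_weights_zero has_weights_add)

lemma has_weights_mult:
  assumes "has_weights E p" "has_weights E' q" "\<And>a b. a \<in> E \<Longrightarrow> b \<in> E' \<Longrightarrow> a + b \<in> E''"
  shows "has_weights E'' (p * q)"
  using assms Poly_Mapping.keys_mult[of p q] unfolding has_weights_def
  by (auto simp: image_subset_iff y_part_add dest!: subsetD)

lemma has_weights_one: "has_weights {0} 1"
  by (simp add: has_weights_def)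

lemma subring_weight_free: "subring_set {p. has_weights {0} p}"
  unfolding subring_set_def
  by (auto intro: has_weights_zero has_weights_one has_weights_add has_weights_uminus has_weights_mult)

text \<open>Minors and entries of symmetric powers are integral polynomials in the matrix entries,
  hence lie in any subring containing these. This replaces a weight computation for each
  construction.\<close>

lemma poly_eval_in_subring:
  assumes S: "subring_set S" and f: "\<And>v. f v \<in> S"
  shows "poly_eval (of_int :: int \<Rightarrow> 'a::comm_ring_1) f p \<in> S"
proof -
  have pow: "x ^ k \<in> S" if "x \<in> S" for x k using that S by (induction k) (auto simp: subring_setD)
  have prod: "prod g F \<in> S" if "\<And>x. x \<in> F \<Longrightarrow> g x \<in> S" for g and F :: "'x set"
    using that S by (induction F rule: infinite_finite_induct) (auto simp: subring_setD)
  have nat: "of_nat k \<in> S" for k using S by (induction k) (auto simp: subring_setD)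
  have int: "of_int k \<in> S" for k
    using nat[of "nat k"] nat[of "nat (- k)"] S subring_setD(5)[OF S, of "of_nat (nat (- k))"]
    by (cases "k \<ge> 0") (auto simp: of_nat_nat)
  show ?thesis unfolding poly_eval_def
    by (intro subring_set_sum[OF S] subring_setD(4)[OF S] int prod pow f)
qed

lemma has_weights_gen_a: "has_weights {0} (gen_a i k)"
  and has_weights_gen_b: "has_weights {0} (gen_b k j)"
  by (auto simp: has_weights_def gen_a_def gen_b_def Var_def intro!: poly_mapping_eqI simp: lookup_y_part lookup_single)

lemma weight_free_sym_mat:
  assumes "\<And>i j. has_weights {0} (M i j)"
  shows "has_weights {0} (sym_mat n M \<beta> \<alpha>)" "has_weights {0} (minor (sym_mat n M) \<beta>s \<alpha>s)" "has_weights {0} (minor M rs cs)"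
proof -
  define h :: "(nat \<times> nat, int) polynomial \<Rightarrow> (gvar, int) polynomial" where "h = poly_eval of_int (\<lambda>(i, j). M i j)"
  have h: "comm_ring_hom h" unfolding h_def by (rule comm_ring_hom_poly_eval[OF comm_ring_hom_of_int])
  have hV: "h (Var (i, j)) = M i j" for i j
    unfolding h_def by (simp add: poly_eval_Var[OF comm_ring_hom_of_int])
  have img: "has_weights {0} (h p)" for p
    using poly_eval_in_subring[OF subring_weight_free, of "\<lambda>(i, j). M i j" p] assms by (auto simp: h_def split: prod.splits)
  have s: "sym_mat n M = (\<lambda>\<beta> \<alpha>. h (sym_mat n (\<lambda>i j. Var (i, j)) \<beta> \<alpha>))"
    by (intro ext) (simp add: sym_mat_hom[OF h] hV)
  show "has_weights {0} (sym_mat n M \<beta> \<alpha>)" using img by (simp add: s)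
  show "has_weights {0} (minor (sym_mat n M) \<beta>s \<alpha>s)"
    unfolding s minor_hom[OF h, symmetric] by (rule img)
  have "minor M rs cs = h (minor (\<lambda>i j. Var (i, j)) rs cs)" by (simp add: minor_hom[OF h] hV)
  then show "has_weights {0} (minor M rs cs)" using img by simp
qed

text \<open>In Cauchy--Binet the inner indices \<open>ks\<close> of a term are distinct, so its
  \<open>Y\<close>-part is squarefree with as many variables as the minor has rows.\<close>

lemma has_weights_minor:
  assumes "row_ok x"
  shows "has_weights {indicator_mon S | S. finite S \<and> card S = length (fst x)} (minor (gen_prod K) (fst x) (snd x))"
proof -
  let ?E = "{indicator_mon S | S. finite S \<and> card S = length (fst x)}"
  have "has_weights ?E ((\<Prod>i = 0..<length (fst x). gen_a (fst x ! i) (ks ! i) * gen_y (ks ! i)) * minor gen_b ks (snd x))"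
    if ks: "distinct ks" "length ks = length (fst x)" for ks
  proof -
    have wa: "has_weights {0} (\<Prod>i\<in>F. gen_a (fst x ! i) (ks ! i))" for F
      by (induction F rule: infinite_finite_induct) (auto intro: has_weights_one has_weights_mult has_weights_gen_a)
    have py: "(\<Prod>i = 0..<length (fst x). gen_y (ks ! i)) = single (\<Sum>i = 0..<length (fst x). single (0, ks ! i, 0) 1) 1"
      by (simp add: gen_y_def Var_def prod_single)
    have "y_part (\<Sum>i = 0..<length (fst x). single (0, ks ! i, 0) 1) = indicator_mon (set ks)"
    proof (rule poly_mapping_eqI)
      fix k
      have "(\<Sum>i = 0..<length (fst x). if ks ! i = k then 1 else (0::nat)) = (if k \<in> set ks then 1 else 0)"
      proof (cases "k \<in> set ks")
        case True
        then obtain q where q: "q < length ks" "ks ! q = k" by (auto simp: in_set_conv_nth)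
        then show ?thesis using sum_nth_distinct[OF ks(1) q(1), of "\<lambda>_. True"] True ks(2) by (simp add: lessThan_atLeast0)
      next
        case False
        then show ?thesis using sum_nth_notin[OF False, of "\<lambda>_. True"] ks(2) by (simp add: lessThan_atLeast0)
      qed
      moreover have "lookup (y_part (\<Sum>i = 0..<length (fst x). single (0, ks ! i, 0) 1)) k =
          (\<Sum>i = 0..<length (fst x). if ks ! i = k then 1 else 0)"
        by (auto simp: lookup_y_part lookup_sum lookup_single when_def intro!: sum.cong)
      ultimately show "lookup (y_part (\<Sum>i = 0..<length (fst x). single (0, ks ! i, 0) 1)) k = lookup (indicator_mon (set ks)) k"
        by (simp only: lookup_indicator_mon finite_set)
    qed
    then have "has_weights {indicator_mon (set ks)} (\<Prod>i = 0..<length (fst x). gen_y (ks ! i))"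
      unfolding py by (simp add: has_weights_def)
    then have "has_weights {indicator_mon (set ks)} (\<Prod>i = 0..<length (fst x). gen_a (fst x ! i) (ks ! i) * gen_y (ks ! i))"
      unfolding prod.distrib by (rule has_weights_mult[OF wa]) simp
    moreover have "has_weights {0} (minor gen_b ks (snd x))" by (rule weight_free_sym_mat(3)[OF has_weights_gen_b])
    ultimately have "has_weights {indicator_mon (set ks)}
       ((\<Prod>i = 0..<length (fst x). gen_a (fst x ! i) (ks ! i) * gen_y (ks ! i)) * minor gen_b ks (snd x))"
      by (rule has_weights_mult) simp
    then show ?thesis by (rule has_weights_mono) (use ks distinct_card in fastforce)
  qed
  moreover have "minor (gen_prod K) (fst x) (snd x) =
      (\<Sum>ks | set ks \<subseteq> {..<K} \<and> length ks = length (fst x) \<and> distinct ks.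
        (\<Prod>i = 0..<length (fst x). gen_a (fst x ! i) (ks ! i) * gen_y (ks ! i)) * minor gen_b ks (snd x))"
    unfolding gen_prod_def[abs_def] using assms by (intro minor_mult) (auto simp: row_ok_def)
  ultimately show ?thesis by (auto intro: has_weights_sum)
qed

lemma has_weights_bidet:
  "\<forall>x\<in>set bt. row_ok x \<Longrightarrow> has_weights (weights (shape bt)) (bidet (gen_prod K) bt)"
proof (induction bt)
  case (Cons x bt)
  then have "has_weights (weights (shape bt)) (bidet (gen_prod K) bt)" by simp
  moreover have "has_weights {indicator_mon S | S. finite S \<and> card S = length (fst x)} (minor (gen_prod K) (fst x) (snd x))"
    using Cons.prems by (intro has_weights_minor) simp
  ultimately show ?case unfolding bidet_simps
    by (intro has_weights_mult) auto
qed (simp add: has_weights_one)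

lemma has_weights_sym_minor:
  assumes \<alpha>s: "set \<alpha>s \<subseteq> monomials m d" and len: "length \<alpha>s = length \<beta>s"
  shows "has_weights {\<Sum>S | S. S \<subseteq> monomials K d \<and> finite S \<and> card S = length \<beta>s} (minor (sym_mat n (gen_prod K)) \<beta>s \<alpha>s)"
    (is "has_weights ?E _")
proof -
  \<comment> \<open>\<open>Y\<close> is first combined with \<open>B\<close>: the symmetric power of
    \<open>Y\<close> is diagonal and only scales the rows of that of \<open>B\<close>, so a single
    application of Cauchy--Binet is enough.\<close>
  define YB where "YB = mat_prod K (\<lambda>i j. if i = j then gen_y i else 0) gen_b"
  have YB: "YB k j = gen_y k * gen_b k j" if "k < K" for k j
    using that unfolding YB_def mat_prod_def by (simp add: if_distrib[of "\<lambda>x. x * _"] cong: if_cong)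
  have "gen_prod K = mat_prod K gen_a YB"
    by (intro ext) (auto simp: gen_prod_def mat_prod_def YB mult.assoc)
  moreover have "sym_mat K YB \<gamma> \<alpha> = mon_eval gen_y \<gamma> * sym_mat K gen_b \<gamma> \<alpha>" if "\<gamma> \<in> monomials K d" "\<alpha> \<in> monomials m d" for \<gamma> \<alpha>
  proof -
    have "sym_mat K YB \<gamma> \<alpha> = (\<Sum>\<delta>\<in>monomials K d. (if \<delta> = \<gamma> then mon_eval gen_y \<delta> else 0) * sym_mat K gen_b \<delta> \<alpha>)"
      unfolding YB_def sym_mat_mult[OF that(2)] using that(1) by (intro sum.cong) (auto simp: sym_mat_diag[where m = K and d = d])
    then show ?thesis using that(1) finite_monomials by (simp add: if_distrib[of "\<lambda>x. x * _"] cong: if_cong)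
  qed
  ultimately have entry: "sym_mat n (gen_prod K) \<beta> \<alpha> =
      (\<Sum>\<gamma>\<in>monomials K d. (sym_mat n gen_a \<beta> \<gamma> * mon_eval gen_y \<gamma>) * sym_mat K gen_b \<gamma> \<alpha>)"
    if "\<alpha> \<in> monomials m d" for \<alpha> \<beta>
    using sym_mat_mult[OF that, of n K gen_a YB \<beta>] that by (simp add: mult.assoc)
  have "minor (sym_mat n (gen_prod K)) \<beta>s \<alpha>s =
      minor (\<lambda>\<beta> \<alpha>. \<Sum>\<gamma>\<in>monomials K d. (sym_mat n gen_a \<beta> \<gamma> * mon_eval gen_y \<gamma>) * sym_mat K gen_b \<gamma> \<alpha>) \<beta>s \<alpha>s"
    using \<alpha>s len by (intro minor_cong) (auto simp: entry)
  also have "\<dots> = (\<Sum>ks | set ks \<subseteq> monomials K d \<and> length ks = length \<beta>s \<and> distinct ks.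
     (\<Prod>i = 0..<length \<beta>s. sym_mat n gen_a (\<beta>s ! i) (ks ! i) * mon_eval gen_y (ks ! i)) * minor (sym_mat K gen_b) ks \<alpha>s)"
    using finite_monomials len by (rule minor_mult)
  also have "has_weights ?E \<dots>"
  proof (rule has_weights_sum)
    fix ks assume "ks \<in> {ks. set ks \<subseteq> monomials K d \<and> length ks = length \<beta>s \<and> distinct ks}"
    then have ks: "set ks \<subseteq> monomials K d" "length ks = length \<beta>s" "distinct ks" by auto
    have my: "mon_eval gen_y \<gamma> = single (\<Sum>v\<in>keys \<gamma>. single (0, v, 0) (lookup \<gamma> v)) 1" for \<gamma>
      unfolding mon_eval_def gen_y_def Var_def by (simp add: single_power[simplified] prod_single)
    have yp: "y_part (\<Sum>v\<in>keys \<gamma>. single (0, v, 0) (lookup \<gamma> v)) = \<gamma>" for \<gamma>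
      by (rule poly_mapping_eqI) (auto simp: lookup_y_part lookup_sum lookup_single when_def in_keys_iff)
    have wy: "has_weights {\<gamma>} (mon_eval gen_y \<gamma>)" for \<gamma> by (simp add: has_weights_def my yp)
    have "has_weights {\<Sum>i\<in>F. ks ! i} (\<Prod>i\<in>F. sym_mat n gen_a (\<beta>s ! i) (ks ! i) * mon_eval gen_y (ks ! i))"
      if "finite F" for F
      using that
    proof (induction F)
      case (insert i F)
      have "has_weights {ks ! i} (sym_mat n gen_a (\<beta>s ! i) (ks ! i) * mon_eval gen_y (ks ! i))"
        by (rule has_weights_mult[OF weight_free_sym_mat(1)[OF has_weights_gen_a] wy]) simp
      then show ?case unfolding prod.insert[OF insert.hyps] sum.insert[OF insert.hyps]
        by (rule has_weights_mult[OF _ insert.IH]) simp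
    qed (simp add: has_weights_one)
    then have "has_weights {\<Sum>i = 0..<length \<beta>s. ks ! i}
       ((\<Prod>i = 0..<length \<beta>s. sym_mat n gen_a (\<beta>s ! i) (ks ! i) * mon_eval gen_y (ks ! i)) * minor (sym_mat K gen_b) ks \<alpha>s)"
      by (rule has_weights_mult[OF _ weight_free_sym_mat(2)[OF has_weights_gen_b]]) auto
    moreover have "(\<Sum>i = 0..<length \<beta>s. ks ! i) = \<Sum>(set ks)"
      using ks by (simp add: distinct_sum_list_conv_Sum[symmetric] sum_list_sum_nth)
    ultimately show "has_weights ?E
       ((\<Prod>i = 0..<length \<beta>s. sym_mat n gen_a (\<beta>s ! i) (ks ! i) * mon_eval gen_y (ks ! i)) * minor (sym_mat K gen_b) ks \<alpha>s)"
      by (elim has_weights_mono) (use ks in \<open>auto intro!: exI[of _ "set ks"] simp: distinct_card\<close>)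
  qed
  finally show ?thesis .
qed

subsection \<open>Minimal shapes\<close>

lemma has_shape_young_diagram:
  assumes "has_shape (\<mu> :: 'v monomial) \<sigma>" shows "young_diagram \<sigma>"
proof -
  obtain fs :: "'v monomial list" where fs: "\<forall>g\<in>set fs. squarefree_mono g \<and> g \<noteq> 0" "sorted_wrt (\<lambda>g h. mono_dvd h g) fs" "\<sigma> = map mdeg fs"
    using assms unfolding has_shape_def by blast
  have pos: "mdeg g > 0" if "g \<noteq> 0" for g :: "'v monomial"
  proof -
    have "keys g \<noteq> {}" using that by simp
    then obtain v where "v \<in> keys g" by blast
    then show ?thesis unfolding mdeg_def by (intro sum_pos2[of _ v]) (auto simp: in_keys_iff)
  qed
  have "sorted_wrt (\<lambda>g h. mdeg g \<ge> mdeg h) fs"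
    by (rule sorted_wrt_mono_rel[OF _ fs(2)]) (auto simp: mono_dvd_def mdeg_add)
  then show ?thesis unfolding young_diagram_def fs(3) sorted_wrt_map using fs(1) pos by auto
qed

text \<open>This is the form of the \<open>Y\<close>-part of a leading monomial: each row longer
  than \<open>p\<close> contributes one factor \<open>y_p\<close>. Its squarefree factors are nested
  because they are initial segments of the variables.\<close>

lemma has_shape_indicators:
  assumes "young_diagram \<sigma>"
  shows "has_shape (\<Sum>s\<leftarrow>\<sigma>. indicator_mon {0..<s}) \<sigma>"
  unfolding has_shape_def
proof (intro exI[of _ "map (\<lambda>s. indicator_mon {0..<s}) \<sigma>"] conjI ballI)
  show "sorted_wrt (\<lambda>g h. mono_dvd h g) (map (\<lambda>s. indicator_mon {0..<s}) \<sigma>)"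
    unfolding sorted_wrt_map
  proof (rule sorted_wrt_mono_rel)
    show "sorted_wrt (\<ge>) \<sigma>" using assms by (simp add: young_diagram_def)
    fix s t :: nat assume "t \<le> s"
    then have "indicator_mon {0..<s} = indicator_mon {0..<t} + indicator_mon {t..<s}"
      by (intro poly_mapping_eqI) (auto simp: lookup_indicator_mon lookup_add)
    then show "mono_dvd (indicator_mon {0..<t}) (indicator_mon {0..<s})" unfolding mono_dvd_def by blast
  qed
  fix g assume "g \<in> set (map (\<lambda>s. indicator_mon {0..<s}) \<sigma>)"
  then obtain s where s: "s \<in> set \<sigma>" "g = indicator_mon {0..<s}" by auto
  then have "s > 0" using assms by (auto simp: young_diagram_def)
  then have "lookup g 0 = 1" by (simp add: s lookup_indicator_mon)
  then show "g \<noteq> 0" by auto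
  show "squarefree_mono g" by (simp add: squarefree_mono_def s lookup_indicator_mon)
qed (simp_all add: comp_def mdeg_indicator_mon)

lemma length_filter_gamma:
  "length (filter (\<lambda>s. Suc q \<le> s) \<sigma>) + gamma (Suc (Suc q)) \<sigma> = gamma (Suc q) \<sigma>"
  unfolding gamma_def by (induction \<sigma>) auto

text \<open>First differences of \<open>gamma\<close> count the rows of length at least
  \<open>Suc q\<close>, second differences those of a given length; rows of length 0 stay
  invisible.\<close>

lemma gamma_eq_mset:
  assumes "\<And>q. gamma (Suc q) \<sigma> = gamma (Suc q) \<tau>"
  shows "filter_mset (\<lambda>s. s > 0) (mset \<sigma>) = filter_mset (\<lambda>s. s > 0) (mset \<tau>)"
proof (rule multiset_eqI)
  fix s
  have *: "length (filter (\<lambda>s. Suc q \<le> s) \<sigma>) = length (filter (\<lambda>s. Suc q \<le> s) \<tau>)" for q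
    using length_filter_gamma[of q \<sigma>] length_filter_gamma[of q \<tau>] assms by simp
  show "count (filter_mset (\<lambda>s. s > 0) (mset \<sigma>)) s = count (filter_mset (\<lambda>s. s > 0) (mset \<tau>)) s"
  proof (cases s)
    case (Suc q)
    have "count (mset \<upsilon>) (Suc q) + length (filter (\<lambda>s. Suc (Suc q) \<le> s) \<upsilon>) = length (filter (\<lambda>s. Suc q \<le> s) \<upsilon>)" for \<upsilon>
      by (induction \<upsilon>) auto
    from this[of \<sigma>] this[of \<tau>] show ?thesis using *[of q] *[of "Suc q"] Suc by simp
  qed simp
qed

lemma young_le_antisym:
  assumes "young_diagram \<sigma>" "young_diagram \<tau>" "young_le \<sigma> \<tau>" "young_le \<tau> \<sigma>"
  shows "\<sigma> = \<tau>"
proof -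
  have "gamma (Suc q) \<sigma> = gamma (Suc q) \<tau>" for q
    using assms(3,4) by (auto simp: young_le_iff intro: le_antisym)
  then have "filter_mset (\<lambda>s. s > 0) (mset \<sigma>) = filter_mset (\<lambda>s. s > 0) (mset \<tau>)" by (rule gamma_eq_mset)
  moreover have "filter_mset (\<lambda>s. s > 0) (mset \<upsilon>) = mset \<upsilon>" if "young_diagram \<upsilon>" for \<upsilon>
    using that by (intro filter_mset_eq_conv[THEN iffD2]) (auto simp: young_diagram_def)
  ultimately have "mset (rev \<sigma>) = mset (rev \<tau>)" using assms by simp
  moreover have "sorted (rev \<sigma>)" "sorted (rev \<tau>)" using assms by (auto simp: young_diagram_def sorted_wrt_rev)
  ultimately show ?thesis by (metis properties_for_sort rev_is_rev_conv)
qed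

definition shapes :: "nat \<Rightarrow> nat \<Rightarrow> nat \<Rightarrow> nat \<Rightarrow> nat list set" where
  "shapes m n d r = {\<sigma>. \<exists>\<mu>\<in>generating_monomials m n d r. has_shape \<mu> \<sigma>}"

lemma minimal_shapes_eq:
  "minimal_shapes m n d r = {\<sigma>\<in>shapes m n d r. \<forall>\<tau>\<in>shapes m n d r. young_le \<tau> \<sigma> \<longrightarrow> \<tau> = \<sigma>}"
  by (simp add: minimal_shapes_def shapes_def Let_def)

text \<open>On shapes below \<sigma> all \<open>gamma\<close> beyond the size of \<sigma> vanish, so
  the finite sum \<open>w\<close> detects every strict decrease, and a shape with least
  \<open>w\<close> is minimal.\<close>

lemma ex_minimal_shape:
  assumes "\<sigma> \<in> shapes m n d r"
  shows "\<exists>\<tau>\<in>minimal_shapes m n d r. young_le \<tau> \<sigma>"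
proof -
  define w where "w \<tau> = (\<Sum>q<Suc (sum_list \<sigma>). gamma (Suc q) \<tau>)" for \<tau>
  have "\<exists>\<tau>. \<tau> \<in> shapes m n d r \<and> young_le \<tau> \<sigma>" using assms by auto
  then obtain \<tau> where \<tau>: "\<tau> \<in> shapes m n d r" "young_le \<tau> \<sigma>"
    and least: "\<And>\<rho>. \<rho> \<in> shapes m n d r \<Longrightarrow> young_le \<rho> \<sigma> \<Longrightarrow> w \<tau> \<le> w \<rho>"
    using ex_has_least_nat[of "\<lambda>\<tau>. \<tau> \<in> shapes m n d r \<and> young_le \<tau> \<sigma>" _ w] by blast
  have "\<rho> = \<tau>" if \<rho>: "\<rho> \<in> shapes m n d r" "young_le \<rho> \<tau>" for \<rho>
  proof -
    have le: "gamma (Suc q) \<rho> \<le> gamma (Suc q) \<tau>" for q using \<rho>(2) by (simp add: young_le_iff)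
    have "w \<tau> \<le> w \<rho>" using least \<rho> \<tau>(2) young_le_trans by blast
    then have eq: "gamma (Suc q) \<rho> = gamma (Suc q) \<tau>" if "q \<le> sum_list \<sigma>" for q
    proof -
      have "w \<rho> \<le> w \<tau>" unfolding w_def by (intro sum_mono le)
      then have "w \<rho> = w \<tau>" using \<open>w \<tau> \<le> w \<rho>\<close> by simp
      then show ?thesis using le that unfolding w_def
        using sum_mono_inv[of "\<lambda>q. gamma (Suc q) \<rho>" "{..<Suc (sum_list \<sigma>)}" "\<lambda>q. gamma (Suc q) \<tau>" q] by auto
    qed
    have "gamma (Suc q) \<sigma> = 0" if "q \<ge> sum_list \<sigma>" for q
      using that by (auto simp: gamma_def dest: member_le_sum_list)
    then have "gamma (Suc q) \<tau> = 0" if "q \<ge> sum_list \<sigma>" for q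
      using that \<tau>(2) by (metis young_le_iff le_zero_eq)
    then have "young_le \<tau> \<rho>" unfolding young_le_iff using eq by (metis le0 linear order_refl)
    then show ?thesis using \<rho> \<tau> has_shape_young_diagram by (auto simp: shapes_def intro!: young_le_antisym)
  qed
  then show ?thesis using \<tau> by (auto simp: minimal_shapes_eq)
qed

section \<open>Minors of symmetric powers in terms of minors\<close>

definition mset_of_mon :: "'v monomial \<Rightarrow> 'v multiset" where
  "mset_of_mon \<alpha> = (\<Sum>v\<in>keys \<alpha>. replicate_mset (lookup \<alpha> v) v)"

lemma count_mset_of_mon: "count (mset_of_mon \<alpha>) v = lookup \<alpha> v"
proof -
  have "count (mset_of_mon \<alpha>) v = (\<Sum>w\<in>keys \<alpha>. if w = v then lookup \<alpha> w else 0)"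
    unfolding mset_of_mon_def by (simp add: count_sum)
  then show ?thesis by (simp add: in_keys_iff)
qed

lemma mset_of_mon_add: "mset_of_mon (\<alpha> + \<beta>) = mset_of_mon \<alpha> + mset_of_mon \<beta>"
  by (rule multiset_eqI) (simp add: count_mset_of_mon lookup_add)

lemma mset_of_mon_single: "mset_of_mon (single v k) = replicate_mset k v"
  by (rule multiset_eqI) (simp add: count_mset_of_mon lookup_single when_def)

lemma mset_of_mon_0 [simp]: "mset_of_mon 0 = {#}"
  by (simp add: mset_of_mon_def)

lemma mset_of_mon_sum_list: "mset_of_mon (sum_list xs) = (\<Sum>x\<leftarrow>xs. mset_of_mon x)"
  by (induction xs) (auto simp: mset_of_mon_add)

text \<open>The image in the ring of the integral polynomials in the entries that are homogeneous of
  row content \<open>R\<close> and column content \<open>C\<close>, described as the least additive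
  subgroup containing the monomials.\<close>

definition entry_span :: "(nat \<Rightarrow> nat \<Rightarrow> 'a::comm_ring_1) \<Rightarrow> nat multiset \<Rightarrow> nat multiset \<Rightarrow> 'a set" where
  "entry_span M R C = \<Inter>{S. add_subgroup S \<and>
     (\<forall>ps. mset (map fst ps) = R \<and> mset (map snd ps) = C \<longrightarrow> (\<Prod>p\<leftarrow>ps. M (fst p) (snd p)) \<in> S)}"

lemma add_subgroup_entry_span: "add_subgroup (entry_span M R C)"
  by (auto simp: entry_span_def add_subgroup_def)

lemma entry_span_base: "(\<Prod>p\<leftarrow>ps. M (fst p) (snd p)) \<in> entry_span M (mset (map fst ps)) (mset (map snd ps))"
  by (auto simp: entry_span_def)

lemma entry_span_least:
  assumes "add_subgroup S" "\<And>ps. mset (map fst ps) = R \<Longrightarrow> mset (map snd ps) = C \<Longrightarrow> (\<Prod>p\<leftarrow>ps. M (fst p) (snd p)) \<in> S"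
  shows "entry_span M R C \<subseteq> S"
  using assms by (auto simp: entry_span_def)

lemma entry_span_mult:
  assumes "x \<in> entry_span M R C" "y \<in> entry_span M R' C'"
  shows "x * y \<in> entry_span M (R + R') (C + C')"
proof -
  let ?E = "entry_span M (R + R') (C + C')"
  note E = add_subgroup_entry_span[of M "R + R'" "C + C'"]
  have *: "add_subgroup {x. x * z \<in> ?E}" "add_subgroup {x. z * x \<in> ?E}" for z
    using E by (auto simp: add_subgroup_def algebra_simps)
  have "entry_span M R' C' \<subseteq> {y. (\<Prod>p\<leftarrow>ps. M (fst p) (snd p)) * y \<in> ?E}"
    if "mset (map fst ps) = R" "mset (map snd ps) = C" for ps
  proof (intro entry_span_least *)
    fix qs assume "mset (map fst qs) = R'" "mset (map snd qs) = C'"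
    then show "(\<Prod>p\<leftarrow>qs. M (fst p) (snd p)) \<in> {y. (\<Prod>p\<leftarrow>ps. M (fst p) (snd p)) * y \<in> ?E}"
      using entry_span_base[of M "ps @ qs"] that by simp
  qed
  then have "entry_span M R C \<subseteq> {x. x * y \<in> ?E}" using assms(2) by (intro entry_span_least *) auto
  then show ?thesis using assms(1) by auto
qed

text \<open>Each variable of the monomial \<alpha> is replaced by a linear form, whose term in the
  variable \<open>i\<close> carries an entry of row \<open>i\<close>; extracting the coefficient of
  \<beta> fixes the row content.\<close>

lemma sym_mat_in_entry_span:
  "sym_mat n M \<beta> \<alpha> \<in> entry_span M (mset_of_mon \<beta>) (mset_of_mon \<alpha>)"
proof -
  define H where "H C = {p. \<forall>\<beta>. lookup p \<beta> \<in> entry_span M (mset_of_mon \<beta>) C}" for C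
  note E = add_subgroup_entry_span[of M]
  have one: "1 \<in> H {#}"
    using entry_span_base[of M "[]"] add_subgroupD(1)[OF E] by (auto simp: H_def lookup_one when_def)
  have mult: "p * q \<in> H (C + C')" if "p \<in> H C" "q \<in> H C'" for p q C C'
  proof -
    have "lookup (p * q) \<gamma> \<in> entry_span M (mset_of_mon \<gamma>) (C + C')" for \<gamma>
      unfolding lookup_mult_superset[OF finite_keys order_refl finite_keys order_refl]
    proof (intro add_subgroup_sum[OF E])
      fix \<alpha> \<beta>
      show "(if \<alpha> + \<beta> = \<gamma> then lookup p \<alpha> * lookup q \<beta> else 0) \<in> entry_span M (mset_of_mon \<gamma>) (C + C')"
        using entry_span_mult[of "lookup p \<alpha>" M "mset_of_mon \<alpha>" C "lookup q \<beta>" "mset_of_mon \<beta>" C'] that add_subgroupD(1)[OF E]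
        by (auto simp: H_def mset_of_mon_add)
    qed
    then show ?thesis by (simp add: H_def)
  qed
  have lin: "lin_form n M v \<in> H {#v#}" for v
  proof -
    have "lookup (Const (M i v) * Var i) \<beta> \<in> entry_span M (mset_of_mon \<beta>) {#v#}" for i \<beta>
      using entry_span_base[of M "[(i, v)]"] add_subgroupD(1)[OF E]
      by (auto simp: lookup_Const_mult Var_def lookup_single when_def mset_of_mon_single)
    then show ?thesis by (auto simp: H_def lin_form_def lookup_sum intro!: add_subgroup_sum[OF E])
  qed
  have pow: "lin_form n M v ^ k \<in> H (replicate_mset k v)" for v k
  proof (induction k)
    case (Suc k)
    then show ?case using mult[OF lin[of v] Suc] by simp
  qed (simp add: one)
  have "(\<Prod>v\<in>F. lin_form n M v ^ lookup \<alpha> v) \<in> H (\<Sum>v\<in>F. replicate_mset (lookup \<alpha> v) v)" if "finite F" for F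
    using that by (induction F) (auto intro: one mult pow)
  from this[of "keys \<alpha>"] show ?thesis by (simp add: sym_mat_def mon_eval_def H_def mset_of_mon_def)
qed

lemma sym_minor_in_entry_span:
  assumes "length \<alpha>s = length \<beta>s"
  shows "minor (sym_mat n M) \<beta>s \<alpha>s \<in> entry_span M (\<Sum>\<beta>\<leftarrow>\<beta>s. mset_of_mon \<beta>) (\<Sum>\<alpha>\<leftarrow>\<alpha>s. mset_of_mon \<alpha>)"
proof -
  let ?E = "entry_span M (\<Sum>\<beta>\<leftarrow>\<beta>s. mset_of_mon \<beta>) (\<Sum>\<alpha>\<leftarrow>\<alpha>s. mset_of_mon \<alpha>)"
  note E = add_subgroup_entry_span[of M]
  have "(\<Prod>i = 0..<length \<beta>s. sym_mat n M (\<beta>s ! i) (\<alpha>s ! p i)) \<in> ?E" if p: "p permutes {0..<length \<beta>s}" for p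
  proof -
    have "(\<Prod>i\<in>F. sym_mat n M (\<beta>s ! i) (\<alpha>s ! p i)) \<in>
        entry_span M (\<Sum>i\<in>F. mset_of_mon (\<beta>s ! i)) (\<Sum>i\<in>F. mset_of_mon (\<alpha>s ! p i))" if "finite F" for F
      using that
    proof (induction F)
      case empty
      show ?case using entry_span_base[of M "[]"] by simp
    qed (auto intro: entry_span_mult sym_mat_in_entry_span)
    from this[of "{0..<length \<beta>s}"]
    have "(\<Prod>i = 0..<length \<beta>s. sym_mat n M (\<beta>s ! i) (\<alpha>s ! p i)) \<in>
        entry_span M (\<Sum>i = 0..<length \<beta>s. mset_of_mon (\<beta>s ! i)) (\<Sum>i = 0..<length \<beta>s. mset_of_mon (\<alpha>s ! p i))" by simp
    also have "(\<Sum>i = 0..<length \<beta>s. mset_of_mon (\<alpha>s ! p i)) = (\<Sum>i = 0..<length \<beta>s. mset_of_mon (\<alpha>s ! i))"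
      using sum.permute[OF p, of "\<lambda>i. mset_of_mon (\<alpha>s ! i)"] by (simp add: comp_def)
    finally show ?thesis using assms by (simp add: sum_list_sum_nth)
  qed
  then show ?thesis unfolding minor_leibniz
    by (intro add_subgroup_sum[OF E]) (auto intro: add_subgroup_sign[OF E signof_cases])
qed

text \<open>Explicit finite sums, in contrast to \<open>entry_span\<close>, since the coefficients
  themselves are examined in the argument on leading monomials.\<close>

definition bitableau_span :: "(nat \<Rightarrow> nat \<Rightarrow> 'a::comm_ring_1) \<Rightarrow> bitableau set \<Rightarrow> 'a set" where
  "bitableau_span M B = {\<Sum>bt\<in>F. of_int (c bt) * bidet M bt | F c. finite F \<and> F \<subseteq> B}"

lemma add_subgroup_bitableau_span: "add_subgroup (bitableau_span M B)"
  unfolding add_subgroup_def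
proof (intro conjI ballI)
  show "0 \<in> bitableau_span M B" unfolding bitableau_span_def by (auto intro!: exI[of _ "{}"])
next
  fix x y assume "x \<in> bitableau_span M B" "y \<in> bitableau_span M B"
  then obtain F c F' c' where F: "x = (\<Sum>bt\<in>F. of_int (c bt) * bidet M bt)" "finite F" "F \<subseteq> B"
    "y = (\<Sum>bt\<in>F'. of_int (c' bt) * bidet M bt)" "finite F'" "F' \<subseteq> B" by (auto simp: bitableau_span_def)
  have ext: "(\<Sum>bt\<in>F. of_int (c bt) * bidet M bt) = (\<Sum>bt\<in>F \<union> F'. of_int (if bt \<in> F then c bt else 0) * bidet M bt)"
    using F by (intro sum.mono_neutral_cong_left) auto
  have ext': "(\<Sum>bt\<in>F'. of_int (c' bt) * bidet M bt) = (\<Sum>bt\<in>F \<union> F'. of_int (if bt \<in> F' then c' bt else 0) * bidet M bt)"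
    using F by (intro sum.mono_neutral_cong_left) auto
  have "x + y = (\<Sum>bt\<in>F \<union> F'. of_int ((if bt \<in> F then c bt else 0) + (if bt \<in> F' then c' bt else 0)) * bidet M bt)"
    unfolding F(1,4) ext ext' of_int_add distrib_right sum.distrib ..
  then show "x + y \<in> bitableau_span M B" using F unfolding bitableau_span_def
    by (intro CollectI exI[of _ "F \<union> F'"] exI[of _ "\<lambda>bt. (if bt \<in> F then c bt else 0) + (if bt \<in> F' then c' bt else 0)"]) auto
next
  fix x assume "x \<in> bitableau_span M B"
  then obtain F c where F: "x = (\<Sum>bt\<in>F. of_int (c bt) * bidet M bt)" "finite F" "F \<subseteq> B" by (auto simp: bitableau_span_def)
  then have "- x = (\<Sum>bt\<in>F. of_int (- c bt) * bidet M bt)" by (simp add: sum_negf)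
  then show "- x \<in> bitableau_span M B" using F unfolding bitableau_span_def
    by (intro CollectI exI[of _ F] exI[of _ "\<lambda>bt. - c bt"]) auto
qed

lemma bitableau_span_base: "bt \<in> B \<Longrightarrow> bidet M bt \<in> bitableau_span M B"
  unfolding bitableau_span_def by (auto intro!: exI[of _ "{bt}"] exI[of _ "\<lambda>_. 1"])

section \<open>Expansion of a minor of a symmetric power into standard bitableaux\<close>

definition generic_entry :: "nat \<Rightarrow> nat \<Rightarrow> (nat \<times> nat, int) polynomial" where
  "generic_entry i j = Var (i, j)"

lemma bidet_hom: "comm_ring_hom h \<Longrightarrow> h (bidet M bt) = bidet (\<lambda>i j. h (M i j)) bt"
proof -
  assume h: "comm_ring_hom h"
  then interpret comm_ring_hom h .
  show ?thesis by (induction bt) (auto simp: hom_distribs minor_hom[OF h])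
qed

lemma entries_bounded:
  assumes "set xs \<subseteq> monomials l d" "entries T = (\<Sum>\<beta>\<leftarrow>xs. mset_of_mon \<beta>)" "r \<in> set T"
  shows "set r \<subseteq> {..<l}"
proof -
  have "set r \<subseteq> set_mset (entries T)" using assms(3) by (auto simp: entries_def)
  moreover have "set_mset (\<Sum>\<beta>\<leftarrow>xs. mset_of_mon \<beta>) \<subseteq> {..<l}" using assms(1)
  proof (induction xs)
    case (Cons \<beta> xs)
    have "set_mset (mset_of_mon \<beta>) = keys \<beta>"
      by (auto simp: in_keys_iff simp flip: count_greater_zero_iff count_mset_of_mon)
    then show ?case using Cons by (auto simp: monomials_def)
  qed simp
  ultimately show ?thesis using assms(2) by simp
qed

text \<open>The shapes are read off the leading monomials after the substitution \<open>X = A Y B\<close>.\<close>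

theorem sym_minor_expansion:
  assumes \<beta>s: "set \<beta>s \<subseteq> monomials n d" "length \<beta>s = r" and \<alpha>s: "set \<alpha>s \<subseteq> monomials m d" "length \<alpha>s = r"
  shows "minor (sym_mat n generic_entry) \<beta>s \<alpha>s \<in> bitableau_span generic_entry
    {bt. standard bt \<and> entries (map fst bt) = (\<Sum>\<beta>\<leftarrow>\<beta>s. mset_of_mon \<beta>) \<and>
       entries (map snd bt) = (\<Sum>\<alpha>\<leftarrow>\<alpha>s. mset_of_mon \<alpha>) \<and> (\<exists>\<sigma>\<in>minimal_shapes m n d r. young_le \<sigma> (shape bt))}"
proof -
  let ?R = "\<Sum>\<beta>\<leftarrow>\<beta>s. mset_of_mon \<beta>" and ?C = "\<Sum>\<alpha>\<leftarrow>\<alpha>s. mset_of_mon \<alpha>"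
  define B where "B = {bt. standard bt \<and> entries (map fst bt) = ?R \<and> entries (map snd bt) = ?C}"
  define f where "f = minor (sym_mat n generic_entry) \<beta>s \<alpha>s"
  define K where "K = min m n"
  define Up where "Up bt \<longleftrightarrow> (\<exists>\<sigma>\<in>minimal_shapes m n d r. young_le \<sigma> (shape bt))" for bt
  have "f \<in> bitableau_span generic_entry B"
  proof -
    have "entry_span generic_entry ?R ?C \<subseteq> bitableau_span generic_entry B"
    proof (rule entry_span_least[OF add_subgroup_bitableau_span])
      fix ps :: "(nat \<times> nat) list" assume ps: "mset (map fst ps) = ?R" "mset (map snd ps) = ?C"
      define bt where "bt = map (\<lambda>p. ([fst p], [snd p])) ps"
      have ent: "entries (map fst bt) = ?R" "entries (map snd bt) = ?C"
        unfolding ps[symmetric] bt_def by (induction ps) auto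
      have "bidet generic_entry bt \<in> bitableau_span generic_entry B"
      proof (rule straightening[OF add_subgroup_bitableau_span])
        show "eqlen bt" by (simp add: bt_def eqlen_def)
        fix bt' assume "standard bt'" "entries (map fst bt') = entries (map fst bt)"
          "entries (map snd bt') = entries (map snd bt)"
        then show "bidet generic_entry bt' \<in> bitableau_span generic_entry B"
          by (intro bitableau_span_base) (simp add: B_def ent)
      qed
      moreover have "bidet generic_entry bt = (\<Prod>p\<leftarrow>ps. generic_entry (fst p) (snd p))"
        unfolding bt_def by (induction ps) (auto simp: minor_def det_single)
      ultimately show "(\<Prod>p\<leftarrow>ps. generic_entry (fst p) (snd p)) \<in> bitableau_span generic_entry B" by simp
    qed
    then show ?thesis using sym_minor_in_entry_span[of \<alpha>s \<beta>s n generic_entry] \<alpha>s \<beta>s by (auto simp: f_def)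
  qed
  then obtain F c where F: "f = (\<Sum>bt\<in>F. of_int (c bt) * bidet generic_entry bt)" "finite F" "F \<subseteq> B"
    by (auto simp: bitableau_span_def)
  have in_entries: "set (fst x) \<subseteq> {..<n}" "set (snd x) \<subseteq> {..<m}" if "bt \<in> B" "x \<in> set bt" for bt x
    using that entries_bounded[OF \<beta>s(1), of "map fst bt" "fst x"] entries_bounded[OF \<alpha>s(1), of "map snd bt" "snd x"]
    by (auto simp: B_def)
  \<comment> \<open>The indices in a row are distinct and below \<open>n\<close> or
    \<open>m\<close>, so rows have length at most \<open>K\<close> and the leading monomials are
    available.\<close>
  have rows: "row_ok x" "length (fst x) \<le> K" if "bt \<in> B" "x \<in> set bt" for bt x
  proof -
    show ok: "row_ok x" using that by (auto simp: B_def standard_def good_def)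
    have d: "distinct (fst x)" "distinct (snd x)" "length (snd x) = length (fst x)"
      using ok by (auto simp: row_ok_def strict_sorted_iff)
    have "card (set (fst x)) \<le> card {..<n}" "card (set (snd x)) \<le> card {..<m}"
      by (intro card_mono finite_lessThan in_entries[OF that])+
    then show "length (fst x) \<le> K" using d by (simp add: K_def distinct_card)
  qed
  define h :: "(nat \<times> nat, int) polynomial \<Rightarrow> (gvar, int) polynomial" where "h = poly_eval of_int (\<lambda>(i, j). gen_prod K i j)"
  have hom: "comm_ring_hom h" unfolding h_def by (rule comm_ring_hom_poly_eval[OF comm_ring_hom_of_int])
  interpret h: comm_ring_hom h by (rule hom)
  have hX: "h (generic_entry i j) = gen_prod K i j" for i j
    unfolding h_def generic_entry_def by (simp add: poly_eval_Var[OF comm_ring_hom_of_int])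
  have hb: "h (bidet generic_entry bt) = bidet (gen_prod K) bt" for bt
    unfolding bidet_hom[OF hom] hX ..
  have hf: "h f = minor (sym_mat n (gen_prod K)) \<beta>s \<alpha>s"
    unfolding f_def minor_hom[OF hom] sym_mat_hom[OF hom] hX ..
  have hf_sum: "h f = (\<Sum>bt\<in>F. of_int (c bt) * bidet (gen_prod K) bt)"
    unfolding F(1) by (simp add: h.hom_sum h.hom_mult hb h.hom_of_int)
  have look: "lookup (of_int k * p) \<mu> = k * lookup p \<mu>" for k :: int and p :: "(gvar, int) polynomial" and \<mu>
  proof -
    have "of_int k = (Const k :: (gvar, int) polynomial)"
      unfolding Const_def using single_of_int[where 'b = int and 'a = "gvar monomial"] by simp
    then show ?thesis by (simp add: lookup_Const_mult)
  qed
  have lead: "lead (bidet (gen_prod K) bt) (bitableau_lead bt)" if "bt \<in> B" for bt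
    using rows[OF that] by (intro lead_bidet) auto
  have "\<forall>bt\<in>F. \<not> Up bt \<longrightarrow> c bt = 0"
  proof (rule ccontr)
    assume "\<not> ?thesis"
    \<comment> \<open>Among the offending bitableaux the one with the largest leading monomial is
      compared with \<open>h f\<close> and with the admissible bitableaux; none of them contains
      that monomial, so its coefficient would have to be 0.\<close>
    define G where "G = {bt\<in>F. \<not> Up bt \<and> c bt \<noteq> 0}"
    have G: "G \<noteq> {}" "finite G" "G \<subseteq> B" using \<open>\<not> _\<close> F by (auto simp: G_def)
    define \<mu> where "\<mu> = Max (bitableau_lead ` G)"
    have "\<mu> \<in> bitableau_lead ` G" unfolding \<mu>_def using G by (intro Max_in) auto
    then obtain bt0 where bt0: "bt0 \<in> G" "\<mu> = bitableau_lead bt0" by auto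
    have max: "bitableau_lead bt \<le> \<mu>" if "bt \<in> G" for bt unfolding \<mu>_def using G that by auto
    have look_G: "lookup (bidet (gen_prod K) bt) \<mu> = (if bt = bt0 then 1 else 0)" if "bt \<in> G" for bt
    proof (cases "bt = bt0")
      case True
      then show ?thesis using lead[of bt] G that bt0 by (auto simp: lead_def)
    next
      case False
      have "bitableau_lead bt \<noteq> \<mu>" using False bitableau_lead_inj[of bt bt0] that bt0 G by (auto simp: B_def)
      then have "bitableau_lead bt < \<mu>" using max[OF that] by simp
      moreover have "bt \<in> B" using G(3) that by blast
      ultimately have "\<mu> \<notin> keys (bidet (gen_prod K) bt)" using lead[of bt] by (auto simp: lead_def)
      then show ?thesis using False by (simp add: in_keys_iff)
    qed
    have shape0: "young_diagram (shape bt0)"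
      using bt0 G rows unfolding young_diagram_def shape_def sorted_wrt_map
      by (auto simp: B_def standard_def good_def row_ok_def G_def)
    have yp: "y_part (bitableau_lead bt) = (\<Sum>s\<leftarrow>shape bt. indicator_mon {0..<s})" for bt
    proof (induction bt)
      case (Cons x bt)
      have "y_part (row_lead x) = indicator_mon {0..<length (fst x)}"
        by (rule poly_mapping_eqI) (simp add: lookup_y_part lookup_row_lead lookup_indicator_mon)
      then show ?case using Cons by (simp add: y_part_add)
    qed simp
    \<comment> \<open>Otherwise the \<open>Y\<close>-part of \<mu> would be a product of
      \<open>r\<close> distinct monomials of degree \<open>d\<close>, and its shape, that of
      \<open>bt0\<close>, would lie above a minimal one.\<close>
    have not_f: "lookup (h f) \<mu> = 0"
    proof (rule ccontr)
      assume "lookup (h f) \<mu> \<noteq> 0"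
      then have "\<mu> \<in> keys (h f)" by (simp add: in_keys_iff)
      then have "y_part \<mu> \<in> {\<Sum>S | S. S \<subseteq> monomials K d \<and> finite S \<and> card S = length \<beta>s}"
        using has_weights_sym_minor[OF \<alpha>s(1), of \<beta>s K n] \<alpha>s \<beta>s by (auto simp: hf has_weights_def)
      then have "y_part \<mu> \<in> generating_monomials m n d r"
        unfolding generating_monomials_eq K_def using \<beta>s by simp
      then have "shape bt0 \<in> shapes m n d r"
        using has_shape_indicators[OF shape0] by (auto simp: shapes_def bt0(2) yp)
      then have "Up bt0" using ex_minimal_shape by (auto simp: Up_def)
      then show False using bt0 by (simp add: G_def)
    qed
    \<comment> \<open>A bitableau containing \<mu> has the \<open>Y\<close>-part of \<mu> among its
      weights, which forces its shape to be at most that of \<open>bt0\<close>; an admissible one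
      would make \<open>bt0\<close> admissible.\<close>
    have not_up: "lookup (bidet (gen_prod K) bt) \<mu> = 0" if "bt \<in> F" "Up bt" for bt
    proof (rule ccontr)
      assume "lookup (bidet (gen_prod K) bt) \<mu> \<noteq> 0"
      then have "\<mu> \<in> keys (bidet (gen_prod K) bt)" by (simp add: in_keys_iff)
      moreover have "\<forall>x\<in>set bt. row_ok x" using rows(1) F(3) that(1) by blast
      ultimately have w: "y_part \<mu> \<in> weights (shape bt)"
        using has_weights_bidet[of bt K] by (auto simp: has_weights_def)
      have "young_le (shape bt) (shape bt0)"
      proof (rule young_leI[OF w])
        show "mdeg (y_part \<mu>) = sum_list (shape bt0)"
        proof -
          have "mdeg (\<Sum>s\<leftarrow>\<sigma>. indicator_mon {0..<s}) = sum_list \<sigma>" for \<sigma>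
            by (induction \<sigma>) (auto simp: mdeg_add mdeg_indicator_mon)
          then show ?thesis by (simp add: bt0(2) yp)
        qed
        fix q
        have "(\<Sum>k\<in>{0..<q}. lookup (\<Sum>s\<leftarrow>\<sigma>. indicator_mon {0..<s}) k) = (\<Sum>s\<leftarrow>\<sigma>. min s q)" for \<sigma>
        proof (induction \<sigma>)
          case (Cons s \<sigma>)
          have "(\<Sum>k\<in>{0..<q}. lookup (indicator_mon {0..<s}) k) = min s q"
          proof -
            have "{0..<q} \<inter> {k. k < s} = {0..<min s q}" by auto
            then show ?thesis by (simp add: lookup_indicator_mon sum.If_cases)
          qed
          then show ?case using Cons by (simp add: lookup_add sum.distrib)
        qed simp
        then show "\<exists>F. finite F \<and> card F \<le> q \<and> (\<Sum>s\<leftarrow>shape bt0. min s q) \<le> (\<Sum>k\<in>F. lookup (y_part \<mu>) k)"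
          unfolding bt0(2) yp by (intro exI[of _ "{0..<q}"]) simp
      qed
      then have "Up bt0" using that(2) young_le_trans unfolding Up_def by blast
      then show False using bt0 by (simp add: G_def)
    qed
    have "lookup (h f) \<mu> = (\<Sum>bt\<in>F. c bt * lookup (bidet (gen_prod K) bt) \<mu>)"
      unfolding hf_sum lookup_sum look ..
    also have "\<dots> = (\<Sum>bt\<in>F. if bt = bt0 then c bt0 else 0)"
    proof (rule sum.cong[OF refl])
      fix bt assume bt: "bt \<in> F"
      show "c bt * lookup (bidet (gen_prod K) bt) \<mu> = (if bt = bt0 then c bt0 else 0)"
        using look_G[of bt] not_up[OF bt] bt bt0
        by (cases "Up bt"; cases "c bt = 0") (auto simp: G_def)
    qed
    also have "\<dots> = c bt0" using bt0 F by (simp add: G_def)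
    finally show False using not_f bt0 by (simp add: G_def)
  qed
  then have "f = (\<Sum>bt\<in>{bt\<in>F. Up bt}. of_int (c bt) * bidet generic_entry bt)"
    unfolding F(1) using F(2) by (intro sum.mono_neutral_right) auto
  then show ?thesis unfolding f_def[symmetric] bitableau_span_def using F(2,3)
    by (intro CollectI exI[of _ "{bt\<in>F. Up bt}"] exI[of _ c]) (auto simp: B_def Up_def)
qed

section \<open>The ideals of minors of a symmetric power\<close>

definition minors_ideal :: "nat \<Rightarrow> nat \<Rightarrow> (nat \<Rightarrow> nat \<Rightarrow> 'a::comm_ring_1) \<Rightarrow> nat \<Rightarrow> 'a set" where
  "minors_ideal m n M t = ideal_gen (minors {..<n} {..<m} M t)"

definition sym_minors_ideal :: "nat \<Rightarrow> nat \<Rightarrow> nat \<Rightarrow> (nat \<Rightarrow> nat \<Rightarrow> 'a::comm_ring_1) \<Rightarrow> nat \<Rightarrow> 'a set" where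
  "sym_minors_ideal m n d M r = ideal_gen (minors (monomials n d) (monomials m d) (sym_mat n M) r)"

lemma is_ideal_minors_ideal [simp]: "is_ideal (minors_ideal m n M t)"
  and is_ideal_sym_minors_ideal [simp]: "is_ideal (sym_minors_ideal m n d M r)"
  by (simp_all add: minors_ideal_def sym_minors_ideal_def)

lemma minor_in_minors_ideal:
  assumes "set rs \<subseteq> {..<n}" "set cs \<subseteq> {..<m}" "length rs = t" "length cs = t"
  shows "minor M rs cs \<in> minors_ideal m n M t"
proof (cases "distinct rs \<and> distinct cs")
  case True
  then show ?thesis unfolding minors_ideal_def minors_eq using assms by (intro ideal_gen_base) blast
next
  case False
  then have "minor M rs cs = 0" using minor_rows_repeat minor_cols_repeat assms by metis
  then show ?thesis by (simp add: is_idealD)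
qed

lemma minor_in_sym_minors_ideal:
  assumes "set \<beta>s \<subseteq> monomials n d" "set \<alpha>s \<subseteq> monomials m d" "length \<beta>s = r" "length \<alpha>s = r"
  shows "minor (sym_mat n M) \<beta>s \<alpha>s \<in> sym_minors_ideal m n d M r"
proof (cases "distinct \<beta>s \<and> distinct \<alpha>s")
  case True
  then show ?thesis unfolding sym_minors_ideal_def minors_eq using assms by (intro ideal_gen_base) blast
next
  case False
  then have "minor (sym_mat n M) \<beta>s \<alpha>s = 0" using minor_rows_repeat minor_cols_repeat assms by metis
  then show ?thesis by (simp add: is_idealD)
qed

lemma minors_ideal_least:
  assumes "is_ideal I" "\<And>rs cs. set rs \<subseteq> {..<n} \<Longrightarrow> set cs \<subseteq> {..<m} \<Longrightarrow> length rs = t \<Longrightarrow> length cs = t \<Longrightarrow> minor M rs cs \<in> I"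
  shows "minors_ideal m n M t \<subseteq> I"
  unfolding minors_ideal_def minors_eq using assms by (intro ideal_gen_least) auto

lemma sym_minors_ideal_least:
  assumes "is_ideal I" "\<And>\<beta>s \<alpha>s. set \<beta>s \<subseteq> monomials n d \<Longrightarrow> set \<alpha>s \<subseteq> monomials m d \<Longrightarrow> length \<beta>s = r \<Longrightarrow> length \<alpha>s = r \<Longrightarrow>
     minor (sym_mat n M) \<beta>s \<alpha>s \<in> I"
  shows "sym_minors_ideal m n d M r \<subseteq> I"
  unfolding sym_minors_ideal_def minors_eq using assms by (intro ideal_gen_least) auto

text \<open>Cauchy--Binet: the ideals do not grow under multiplication of the matrix from either side.\<close>

lemma sym_minor_mat_prod:
  assumes \<alpha>s: "set \<alpha>s \<subseteq> monomials m' d" "length \<alpha>s = r" and \<beta>s: "length \<beta>s = r" and I: "is_ideal I"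
    and min: "\<And>\<gamma>s \<delta>s. set \<gamma>s \<subseteq> monomials n d \<Longrightarrow> set \<delta>s \<subseteq> monomials m d \<Longrightarrow> length \<gamma>s = r \<Longrightarrow> length \<delta>s = r \<Longrightarrow>
      minor (sym_mat n M) \<gamma>s \<delta>s \<in> I"
  shows "minor (sym_mat n' (mat_prod n A (mat_prod m M B))) \<beta>s \<alpha>s \<in> I"
proof -
  have "minor (sym_mat n (mat_prod m M B)) \<gamma>s \<alpha>s \<in> I" if "set \<gamma>s \<subseteq> monomials n d" "length \<gamma>s = r" for \<gamma>s
  proof -
    have "minor (sym_mat n (mat_prod m M B)) \<gamma>s \<alpha>s =
      minor (\<lambda>\<gamma> \<alpha>. \<Sum>\<delta>\<in>monomials m d. sym_mat n M \<gamma> \<delta> * sym_mat m B \<delta> \<alpha>) \<gamma>s \<alpha>s"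
      using \<alpha>s that by (intro minor_cong sym_mat_mult[where m = m']) auto
    also have "\<dots> \<in> I" using \<alpha>s that by (intro minor_mult_in_ideal' finite_monomials I min) auto
    finally show ?thesis .
  qed
  then have *: "minor (\<lambda>\<beta> \<alpha>. \<Sum>\<gamma>\<in>monomials n d. sym_mat n' A \<beta> \<gamma> * sym_mat n (mat_prod m M B) \<gamma> \<alpha>) \<beta>s \<alpha>s \<in> I"
    using \<alpha>s \<beta>s by (intro minor_mult_in_ideal finite_monomials I) auto
  have "minor (sym_mat n' (mat_prod n A (mat_prod m M B))) \<beta>s \<alpha>s =
      minor (\<lambda>\<beta> \<alpha>. \<Sum>\<gamma>\<in>monomials n d. sym_mat n' A \<beta> \<gamma> * sym_mat n (mat_prod m M B) \<gamma> \<alpha>) \<beta>s \<alpha>s"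
    using \<alpha>s \<beta>s by (intro minor_cong sym_mat_mult[where m = m']) auto
  with * show ?thesis by simp
qed

lemma minor_mat_prod:
  assumes cs: "length cs = length rs" and I: "is_ideal I"
    and min: "\<And>rs' cs'. set rs' \<subseteq> {..<n} \<Longrightarrow> set cs' \<subseteq> {..<m} \<Longrightarrow> length rs' = length rs \<Longrightarrow> length cs' = length rs \<Longrightarrow>
      minor M rs' cs' \<in> I"
  shows "minor (mat_prod n A (mat_prod m M B)) rs cs \<in> I"
proof -
  have "minor (mat_prod m M B) rs' cs \<in> I" if "set rs' \<subseteq> {..<n}" "length rs' = length rs" for rs'
    unfolding mat_prod_def[abs_def] using that cs by (intro minor_mult_in_ideal' I min) auto
  then show ?thesis unfolding mat_prod_def[of n, abs_def] using cs by (intro minor_mult_in_ideal I) auto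
qed

subsection \<open>The products of nested minors attached to a minimal shape\<close>

lemma squarefree_indicator: "squarefree_mono f \<Longrightarrow> f = indicator_mon (keys f)"
proof (rule poly_mapping_eqI)
  fix v assume "squarefree_mono f"
  then have "lookup f v \<le> 1" by (simp add: squarefree_mono_def)
  then show "lookup f v = lookup (indicator_mon (keys f)) v"
    by (cases "lookup f v = 0") (auto simp: lookup_indicator_mon in_keys_iff)
qed

text \<open>The supports of the factors form a descending chain of sets, so one list
  \<open>ws\<close> that enumerates them from the smallest outwards has all of them as initial
  segments.\<close>

lemma chain_list:
  assumes "\<forall>f\<in>set fs. squarefree_mono f" "sorted_wrt (\<lambda>g h. mono_dvd h g) fs"
  shows "\<exists>ws. distinct ws \<and> set ws = (case fs of [] \<Rightarrow> {} | f # _ \<Rightarrow> keys f) \<and>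
     (\<forall>f\<in>set fs. mdeg f \<le> length ws \<and> f = indicator_mon (set (take (mdeg f) ws)))"
  using assms
proof (induction fs)
  case Nil
  show ?case by (intro exI[of _ "[]"]) simp
next
  case (Cons f fs)
  then obtain ws where ws: "distinct ws" "set ws = (case fs of [] \<Rightarrow> {} | f # _ \<Rightarrow> keys f)"
     "\<forall>f\<in>set fs. mdeg f \<le> length ws \<and> f = indicator_mon (set (take (mdeg f) ws))" by auto
  have sub: "set ws \<subseteq> keys f"
  proof (cases fs)
    case (Cons g gs)
    then obtain h where "f = g + h" using Cons.prems(2) by (auto simp: mono_dvd_def)
    then show ?thesis using ws(2) by (auto simp: Cons in_keys_iff lookup_add)
  qed (use ws(2) in simp)
  obtain us where us: "set us = keys f - set ws" "distinct us"
    using finite_distinct_list[of "keys f - set ws"] by auto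
  have set: "set (ws @ us) = keys f" using us sub by auto
  have d: "distinct (ws @ us)" using us ws by auto
  have f: "f = indicator_mon (keys f)" using Cons.prems(1) by (intro squarefree_indicator) simp
  have "mdeg f = card (keys f)" by (subst f) (simp add: mdeg_indicator_mon)
  also have "\<dots> = length (ws @ us)" using distinct_card[OF d] by (simp only: set)
  finally have len: "mdeg f = length (ws @ us)" .
  show ?case
  proof (intro exI[of _ "ws @ us"] conjI ballI)
    fix g assume g: "g \<in> set (f # fs)"
    show "mdeg g \<le> length (ws @ us)" using g ws(3) len by (auto intro: trans_le_add1)
    show "g = indicator_mon (set (take (mdeg g) (ws @ us)))"
    proof (cases "g = f")
      case True
      then show ?thesis using f len set by simp
    next
      case False
      then show ?thesis using g ws(3) by auto
    qed
  qed (use d set in auto)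
qed

lemma minor_identity:
  assumes "distinct xs" shows "minor (\<lambda>\<beta> \<alpha>. if \<alpha> = \<beta> then 1 else 0) xs xs = 1"
proof -
  have "mat (length xs) (length xs) (\<lambda>(a, b). (if xs ! b = xs ! a then 1 else 0)) = (1\<^sub>m (length xs) :: 'b mat)"
    using assms by (intro eq_matI) (auto simp: nth_eq_iff_index_eq)
  then show ?thesis by (simp add: minor_def)
qed

lemma take_weights_bound:
  assumes "distinct ws" "\<forall>s\<in>set \<sigma>. s \<le> length ws"
  shows "(\<Sum>k\<in>set (take q ws). lookup (\<Sum>s\<leftarrow>\<sigma>. indicator_mon (set (take s ws))) k) = (\<Sum>s\<leftarrow>\<sigma>. min s q)"
  using assms(2)
proof (induction \<sigma>)
  case (Cons s \<sigma>)
  have "(\<Sum>k\<in>set (take q ws). lookup (indicator_mon (set (take s ws))) k) = card (set (take q ws) \<inter> set (take s ws))"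
    by (simp add: lookup_indicator_mon sum.If_cases)
  also have "set (take q ws) \<inter> set (take s ws) = set (take (min s q) ws)"
    by (cases "s \<le> q") (use set_take_subset_set_take[of s q ws] set_take_subset_set_take[of q s ws] in \<open>auto simp: min_def\<close>)
  also have "card \<dots> = min s q" using assms(1) Cons.prems by (auto simp: distinct_card min_def)
  finally show ?case using Cons by (simp add: lookup_add sum.distrib)
qed simp

text \<open>For the initial segment \<open>F\<close> of length \<open>length r0\<close> the total of
  \<open>card (F \<inter> set r)\<close> is the largest that the row lengths allow, because the
  content is that of nested segments. Hence every row attains its bound, and the row
  \<open>r0\<close> fills \<open>F\<close>.\<close>

lemma rows_eq_take:
  assumes ws: "distinct ws" "\<forall>r\<in>set T. length r \<le> length ws" and T: "\<forall>r\<in>set T. distinct r"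
    and wt: "entries T = mset_of_mon (\<Sum>s\<leftarrow>map length T. indicator_mon (set (take s ws)))"
  shows "\<forall>r\<in>set T. set r = set (take (length r) ws)"
proof
  fix r0 assume r0: "r0 \<in> set T"
  define F where "F = set (take (length r0) ws)"
  have cF: "card F = length r0" using ws r0 by (simp add: F_def distinct_card)
  have "(\<Sum>k\<in>F. count (entries T) k) = (\<Sum>r\<leftarrow>T. card (F \<inter> set r))" using T
  proof (induction T)
    case (Cons r T)
    have "(\<Sum>k\<in>F. count (mset r) k) = (\<Sum>k\<in>F. if k \<in> set r then 1 else 0)"
      using Cons.prems by (intro sum.cong) (auto simp: distinct_count_atmost_1 count_mset)
    also have "\<dots> = card (F \<inter> set r)" by (simp add: F_def sum.If_cases)
    finally show ?case using Cons by (simp add: sum.distrib)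
  qed simp
  moreover have "(\<Sum>k\<in>F. count (entries T) k) = (\<Sum>s\<leftarrow>map length T. min s (length r0))"
    unfolding wt count_mset_of_mon F_def using ws by (intro take_weights_bound) auto
  ultimately have eq: "(\<Sum>r\<leftarrow>T. card (F \<inter> set r)) = (\<Sum>r\<leftarrow>T. min (length r) (length r0))" by (simp add: comp_def)
  have le: "card (F \<inter> set r) \<le> min (length r) (length r0)" if "r \<in> set T" for r
  proof -
    have "card (F \<inter> set r) \<le> card (set r)" "card (F \<inter> set r) \<le> card F" by (auto intro!: card_mono simp: F_def)
    then show ?thesis using T that cF by (simp add: distinct_card)
  qed
  have "card (F \<inter> set r) = min (length r) (length r0)" if "r \<in> set T" for r
    using that eq le
  proof (induction T)
    case (Cons r' T)
    have "(\<Sum>r\<leftarrow>T. card (F \<inter> set r)) \<le> (\<Sum>r\<leftarrow>T. min (length r) (length r0))"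
      using Cons.prems(3) by (intro sum_list_mono) auto
    moreover have "card (F \<inter> set r') \<le> min (length r') (length r0)" using Cons.prems(3) by auto
    ultimately have "card (F \<inter> set r') = min (length r') (length r0)"
      "(\<Sum>r\<leftarrow>T. card (F \<inter> set r)) = (\<Sum>r\<leftarrow>T. min (length r) (length r0))" using Cons.prems(2) by auto
    then show ?case using Cons by auto
  qed simp
  from this[OF r0] have c: "card (F \<inter> set r0) = length r0" by simp
  have "card (set r0) = length r0" using T r0 by (simp add: distinct_card)
  then have "F \<inter> set r0 = set r0" using c by (intro card_subset_eq) auto
  moreover have "F \<inter> set r0 = F" using c cF by (intro card_subset_eq) (auto simp: F_def)
  ultimately show "set r0 = set (take (length r0) ws)" by (simp add: F_def)
qed

text \<open>\<open>xs\<close> lists \<open>r\<close> monomials whose product has shape \<sigma>, and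
  \<open>ws\<close> enumerates the nested supports of its squarefree factors. Both sides of a
  bitableau in the expansion have the content of this product, which together with minimality leaves
  \<open>bt0\<close> as the only candidate.\<close>

lemma highest_weight_generic:
  assumes \<sigma>: "\<sigma> \<in> minimal_shapes m n d r"
  shows "\<exists>ws xs. distinct ws \<and> set ws \<subseteq> {..<min m n} \<and> (\<forall>s\<in>set \<sigma>. s \<le> length ws) \<and>
     set xs \<subseteq> monomials (min m n) d \<and> length xs = r \<and>
     (bidet generic_entry (map (\<lambda>s. (take s ws, take s ws)) \<sigma>) = minor (sym_mat n generic_entry) xs xs \<or>
      bidet generic_entry (map (\<lambda>s. (take s ws, take s ws)) \<sigma>) = - minor (sym_mat n generic_entry) xs xs)"
proof -
  obtain \<mu> where \<mu>: "\<mu> \<in> generating_monomials m n d r" "has_shape \<mu> \<sigma>"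
    using \<sigma> by (auto simp: minimal_shapes_eq shapes_def)
  obtain S where S: "\<mu> = \<Sum>S" "S \<subseteq> monomials (min m n) d" "finite S" "card S = r"
    using \<mu>(1) unfolding generating_monomials_eq by auto
  obtain xs where xs: "set xs = S" "distinct xs" using finite_distinct_list[OF S(3)] by auto
  have lxs: "length xs = r" using xs S distinct_card by metis
  have sxs: "sum_list xs = \<mu>" using xs S(1) by (simp add: distinct_sum_list_conv_Sum)
  obtain fs :: "nat monomial list" where fs: "\<forall>g\<in>set fs. squarefree_mono g \<and> g \<noteq> 0"
    "sorted_wrt (\<lambda>g h. mono_dvd h g) fs" "sum_list fs = \<mu>" "\<sigma> = map mdeg fs"
    using \<mu>(2) unfolding has_shape_def by blast
  obtain ws where ws: "distinct ws" "set ws = (case fs of [] \<Rightarrow> {} | f # _ \<Rightarrow> keys f)"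
     "\<forall>f\<in>set fs. mdeg f \<le> length ws \<and> f = indicator_mon (set (take (mdeg f) ws))"
    using chain_list[of fs] fs by blast
  have yd: "young_diagram \<sigma>" using has_shape_young_diagram[OF \<mu>(2)] .
  have lws: "\<forall>s\<in>set \<sigma>. s \<le> length ws" using ws(3) fs(4) by auto
  have wsK: "set ws \<subseteq> {..<min m n}"
  proof (cases fs)
    case (Cons f gs)
    have "keys f \<subseteq> keys \<mu>" unfolding fs(3)[symmetric] Cons by (auto simp: in_keys_iff lookup_add)
    moreover have "keys \<mu> \<subseteq> (\<Union>x\<in>S. keys x)" unfolding S(1) using keys_sum[of "\<lambda>x. x" S] by simp
    moreover have "(\<Union>x\<in>S. keys x) \<subseteq> {..<min m n}" using S(2) by (auto simp: monomials_def)
    ultimately show ?thesis using ws(2) Cons by auto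
  qed (use ws in simp)
  have map_id: "map (\<lambda>s. indicator_mon (set (take s ws))) \<sigma> = fs"
    unfolding fs(4) map_map by (rule map_idI) (use ws(3) in \<open>auto simp: comp_def\<close>)
  have \<mu>_eq: "\<mu> = (\<Sum>s\<leftarrow>\<sigma>. indicator_mon (set (take s ws)))"
    unfolding map_id fs(3) ..
  have md: "mdeg \<mu> = sum_list \<sigma>"
    unfolding fs(3)[symmetric] fs(4) by (induction fs) (auto simp: mdeg_add)
  define bt0 where "bt0 = map (\<lambda>s. (sort (take s ws), sort (take s ws))) \<sigma>"
  define f where "f = minor (sym_mat n generic_entry) xs xs"
  have mons: "set xs \<subseteq> monomials n d" "set xs \<subseteq> monomials m d" using S xs by (auto simp: monomials_min)
  have ent: "(\<Sum>\<beta>\<leftarrow>xs. mset_of_mon \<beta>) = mset_of_mon \<mu>" by (simp add: sxs flip: mset_of_mon_sum_list)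
  obtain F c where F: "f = (\<Sum>bt\<in>F. of_int (c bt) * bidet generic_entry bt)" "finite F"
    "F \<subseteq> {bt. standard bt \<and> entries (map fst bt) = mset_of_mon \<mu> \<and> entries (map snd bt) = mset_of_mon \<mu> \<and>
       (\<exists>\<sigma>'\<in>minimal_shapes m n d r. young_le \<sigma>' (shape bt))}"
    using sym_minor_expansion[OF mons(1) lxs mons(2) lxs] unfolding ent f_def[symmetric] bitableau_span_def by blast
  have "bt = bt0" if btF: "bt \<in> F" for bt
  proof -
    have bt: "standard bt" "entries (map fst bt) = mset_of_mon \<mu>" "entries (map snd bt) = mset_of_mon \<mu>"
      using F(3) that by auto
    obtain \<sigma>' where \<sigma>': "\<sigma>' \<in> minimal_shapes m n d r" "young_le \<sigma>' (shape bt)" using F(3) btF by auto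
    have ok: "\<forall>x\<in>set bt. row_ok x" using bt(1) by (simp add: standard_def good_def)
    have "\<mu> \<in> weights (shape bt)"
    proof -
      have "(\<Sum>x\<leftarrow>bt. indicator_mon (set (fst x))) \<in> weights (shape bt)" using ok
      proof (induction bt)
        case (Cons x bt)
        then have "card (set (fst x)) = length (fst x)" by (auto simp: row_ok_def strict_sorted_iff distinct_card)
        then show ?case using Cons by auto
      qed simp
      moreover have "mset_of_mon (\<Sum>x\<leftarrow>bt. indicator_mon (set (fst x))) = entries (map fst bt)" using ok
      proof (induction bt)
        case (Cons x bt)
        then have "distinct (fst x)" by (auto simp: row_ok_def strict_sorted_iff)
        then have "mset_of_mon (indicator_mon (set (fst x))) = mset (fst x)"
          by (intro multiset_eqI) (auto simp: count_mset_of_mon lookup_indicator_mon distinct_count_atmost_1 count_mset)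
        then show ?case using Cons by (simp add: mset_of_mon_add)
      qed simp
      moreover have "\<nu> = \<mu>" if "mset_of_mon \<nu> = mset_of_mon \<mu>" for \<nu> :: "nat monomial"
        using that by (intro poly_mapping_eqI) (metis count_mset_of_mon)
      ultimately show ?thesis using bt(2) by metis
    qed
    then have le: "young_le (shape bt) \<sigma>"
    proof (rule young_leI[OF _ md])
      fix q
      show "\<exists>F. finite F \<and> card F \<le> q \<and> (\<Sum>s\<leftarrow>\<sigma>. min s q) \<le> (\<Sum>k\<in>F. lookup \<mu> k)"
        using take_weights_bound[OF ws(1) lws, of q] card_length[of "take q ws"]
        by (intro exI[of _ "set (take q ws)"]) (auto simp flip: \<mu>_eq)
    qed
    \<comment> \<open>The shape of \<open>bt\<close> lies between the minimal shapes \<sigma>' and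
      \<sigma>.\<close>
    then have "\<sigma>' = \<sigma>" using \<sigma>' \<sigma> young_le_trans by (auto simp: minimal_shapes_eq)
    moreover have "young_diagram (shape bt)"
      using bt(1) unfolding young_diagram_def shape_def sorted_wrt_map
      by (auto simp: standard_def good_def row_ok_def)
    ultimately have sh: "shape bt = \<sigma>" using \<sigma>'(2) le yd young_le_antisym by blast
    have ml: "map length (map fst bt) = \<sigma>" "map length (map snd bt) = \<sigma>"
      using sh ok by (auto simp: shape_def row_ok_def comp_def)
    have dd: "\<forall>r\<in>set (map fst bt) \<union> set (map snd bt). distinct r \<and> sorted r"
      using ok by (auto simp: row_ok_def strict_sorted_iff)
    have lr: "\<forall>r\<in>set (map fst bt) \<union> set (map snd bt). length r \<le> length ws"
      using lws ml by (metis (no_types, lifting) UnE imageI list.set_map)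
    have "\<forall>r\<in>set (map fst bt). set r = set (take (length r) ws)"
      using ws(1) lr dd bt(2) ml(1) by (intro rows_eq_take) (auto simp only: \<mu>_eq)
    moreover have "\<forall>r\<in>set (map snd bt). set r = set (take (length r) ws)"
      using ws(1) lr dd bt(3) ml(2) by (intro rows_eq_take) (auto simp only: \<mu>_eq)
    moreover have srt: "r = sort (take (length r) ws)" if "set r = set (take (length r) ws)" "distinct r" "sorted r" for r
      using that ws(1) by (intro sorted_distinct_set_unique) auto
    ultimately have r: "\<forall>r\<in>set (map fst bt) \<union> set (map snd bt). r = sort (take (length r) ws)"
      using dd by blast
    have "bt = map (\<lambda>s. (sort (take s ws), sort (take s ws))) (map (\<lambda>x. length (fst x)) bt)"
      unfolding map_map
    proof (rule map_idI[symmetric])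
      fix x assume x: "x \<in> set bt"
      then have "sort (take (length (fst x)) ws) = fst x" "sort (take (length (snd x)) ws) = snd x"
        using r[rule_format, of "fst x", symmetric] r[rule_format, of "snd x", symmetric] by simp_all
      moreover have "length (snd x) = length (fst x)" using ok x by (simp add: row_ok_def)
      ultimately show "((\<lambda>s. (sort (take s ws), sort (take s ws))) \<circ> (\<lambda>x. length (fst x))) x = x"
        by (simp add: prod_eq_iff)
    qed
    then show "bt = bt0" using sh unfolding shape_def bt0_def by simp
  qed
  then have "F \<subseteq> {bt0}" by auto
  then obtain c0 :: int where c0: "f = of_int c0 * bidet generic_entry bt0"
    unfolding F(1) by (cases "F = {}") (auto simp: subset_singleton_iff intro: that[of 0] that[of "c bt0"])
  \<comment> \<open>At the identity matrix this principal minor of the symmetric power is 1, which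
    makes the integer coefficient a unit.\<close>
  define h :: "(nat \<times> nat, int) polynomial \<Rightarrow> int" where "h = poly_eval of_int (\<lambda>(i, j). if i = j then 1 else 0)"
  have hom: "comm_ring_hom h" unfolding h_def by (rule comm_ring_hom_poly_eval[OF comm_ring_hom_of_int])
  interpret h: comm_ring_hom h by (rule hom)
  have hX: "h (generic_entry i j) = (if i = j then 1 else 0)" for i j
    unfolding h_def generic_entry_def poly_eval_Var[OF comm_ring_hom_of_int] by simp
  have "h f = minor (sym_mat n (\<lambda>i j. if i = j then 1 else 0)) xs xs"
    unfolding f_def minor_hom[OF hom] sym_mat_hom[OF hom] hX ..
  also have "\<dots> = minor (\<lambda>\<beta> \<alpha>. if \<alpha> = \<beta> then 1 else 0) xs xs"
  proof (rule minor_cong)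
    fix \<beta> \<alpha> assume "\<beta> \<in> set xs" "\<alpha> \<in> set xs"
    then have "\<alpha> \<in> monomials m d" "\<beta> \<in> monomials n d" using mons by auto
    then show "sym_mat n (\<lambda>i j. if i = j then 1 else 0) \<beta> \<alpha> = (if \<alpha> = \<beta> then 1 else (0::int))"
      using sym_mat_diag[of \<alpha> m d \<beta> n "\<lambda>_. 1 :: int"] by (simp add: mon_eval_def)
  qed simp
  finally have "h f = 1" using minor_identity[OF xs(2)] by simp
  then have "c0 * h (bidet generic_entry bt0) = 1" unfolding c0 by (simp add: h.hom_mult h.hom_of_int)
  then have "c0 = 1 \<or> c0 = -1" using zmult_eq_1_iff by blast
  then have "bidet generic_entry bt0 = f \<or> bidet generic_entry bt0 = - f" using c0 by auto
  moreover have "bidet generic_entry bt0 = bidet generic_entry (map (\<lambda>s. (take s ws, take s ws)) \<sigma>) \<or>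
     bidet generic_entry bt0 = - bidet generic_entry (map (\<lambda>s. (take s ws, take s ws)) \<sigma>)"
    unfolding bt0_def
  proof (induction \<sigma>)
    case (Cons s \<sigma>)
    have "minor generic_entry (sort (take s ws)) (sort (take s ws)) = minor generic_entry (take s ws) (sort (take s ws)) \<or>
      minor generic_entry (sort (take s ws)) (sort (take s ws)) = - minor generic_entry (take s ws) (sort (take s ws))"
      by (rule minor_rows_mset) simp
    moreover have "minor generic_entry (take s ws) (sort (take s ws)) = minor generic_entry (take s ws) (take s ws) \<or>
      minor generic_entry (take s ws) (sort (take s ws)) = - minor generic_entry (take s ws) (take s ws)"
      by (rule minor_cols_mset) simp_all
    ultimately show ?case using Cons by auto
  qed simp
  ultimately have "bidet generic_entry (map (\<lambda>s. (take s ws, take s ws)) \<sigma>) = f \<or>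
    bidet generic_entry (map (\<lambda>s. (take s ws, take s ws)) \<sigma>) = - f" by auto
  then show ?thesis using ws(1) wsK lws S(2) xs(1) lxs unfolding f_def by blast
qed

section \<open>Contents of polynomials\<close>

text \<open>For an ideal \<open>J\<close> this is its extension to the polynomial ring: the
  polynomials whose content lies in \<open>J\<close>.\<close>

definition coeffs_in :: "'a::comm_ring_1 set \<Rightarrow> ('v, 'a) polynomial set" where
  "coeffs_in J = {p. \<forall>\<mu>. lookup p \<mu> \<in> J}"

lemma is_ideal_coeffs_in:
  assumes "is_ideal J" shows "is_ideal (coeffs_in J)"
proof (rule is_idealI)
  show "0 \<in> coeffs_in J" using assms by (simp add: coeffs_in_def is_idealD)
  show "p + q \<in> coeffs_in J" if "p \<in> coeffs_in J" "q \<in> coeffs_in J" for p q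
    using that assms by (simp add: coeffs_in_def is_idealD lookup_add)
  show "q * p \<in> coeffs_in J" if "p \<in> coeffs_in J" for p q
    using that assms
    by (auto simp: coeffs_in_def lookup_mult_superset[OF finite_keys order_refl finite_keys order_refl]
       intro!: is_ideal_sum is_idealD(1) is_idealD(3))
qed

lemma coeffs_in_mult:
  assumes "p \<in> coeffs_in I" "q \<in> coeffs_in J" shows "p * q \<in> coeffs_in (ideal_mult I J)"
  using assms
  by (auto simp: coeffs_in_def lookup_mult_superset[OF finite_keys order_refl finite_keys order_refl]
     intro!: is_ideal_sum ideal_multI is_idealD(1))

lemma Const_coeffs_in: "is_ideal J \<Longrightarrow> c \<in> J \<Longrightarrow> Const c \<in> coeffs_in J"
  by (auto simp: coeffs_in_def Const_def lookup_single when_def is_idealD)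

lemma ideal_pow_Suc: "ideal_pow A (Suc n) = ideal_mult A (ideal_pow A n)"
  by simp

text \<open>The Dedekind--Mertens lemma: with \<open>A\<close> the content of \<open>f\<close> and \<open>J\<close> that of \<open>f g\<close>, one has
  \<open>A\<^sup>n\<^sup>+\<^sup>1 c(g) \<subseteq> J A\<^sup>n\<close>, by induction on the number of terms of \<open>g\<close>.\<close>

lemma dedekind_mertens:
  fixes f g :: "('v::linorder, 'a::comm_ring_1) polynomial"
  assumes "card (keys g) \<le> Suc n" "is_ideal J" "f * g \<in> coeffs_in J"
    and "a \<in> ideal_pow (ideal_gen (range (lookup f))) (Suc n)"
  shows "a * lookup g \<beta> \<in> ideal_mult J (ideal_pow (ideal_gen (range (lookup f))) n)"
  using assms
proof (induction n arbitrary: g J a \<beta>)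
  define A where "A = ideal_gen (range (lookup f))"
  have fA: "lookup f \<alpha> \<in> A" for \<alpha> unfolding A_def by (rule ideal_gen_base) simp
  have look_fg: "lookup (f * g) \<gamma> = (\<Sum>\<alpha>\<in>keys f. \<Sum>\<beta>\<in>keys g. if \<alpha> + \<beta> = \<gamma> then lookup f \<alpha> * lookup g \<beta> else 0)" for g \<gamma>
    by (rule lookup_mult_superset) auto
  {
    case 0
    have J: "ideal_mult J (ideal_pow A 0) = J" using 0(2) by (simp add: ideal_mult_commute[of J] ideal_mult_UNIV)
    have aA: "a \<in> A" using 0(4) by (simp add: A_def ideal_mult_commute[of _ UNIV] ideal_mult_UNIV)
    show ?case
    proof (cases "\<beta> \<in> keys g")
      case True
      then have k: "keys g = {\<beta>}" using 0(1) card_le_Suc0_iff_eq[OF finite_keys, of g] by auto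
      have "lookup f \<alpha> * lookup g \<beta> \<in> J" for \<alpha>
      proof -
        have "lookup (f * g) (\<alpha> + \<beta>) = (\<Sum>\<alpha>'\<in>keys f. if \<alpha>' = \<alpha> then lookup f \<alpha> * lookup g \<beta> else 0)"
          unfolding look_fg k by (intro sum.cong) auto
        also have "\<dots> = lookup f \<alpha> * lookup g \<beta>" by (auto simp: in_keys_iff)
        finally show ?thesis using 0(3) unfolding coeffs_in_def by (metis mem_Collect_eq)
      qed
      then have "A \<subseteq> {x. x * lookup g \<beta> \<in> J}" unfolding A_def
        using 0(2) by (intro ideal_gen_least is_ideal_colon) auto
      then show ?thesis using aA J by (auto simp: A_def)
    qed (simp add: in_keys_iff is_idealD)
  next
    case (Suc n)
    define JA where "JA = ideal_mult J (ideal_pow A (Suc n))"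
    have JA: "is_ideal JA" by (simp add: JA_def)
    have JA_I: "x * y \<in> JA" if "x \<in> J" "y \<in> ideal_pow A (Suc n)" for x y
      unfolding JA_def using that by (rule ideal_multI)
    have JA_up: "lookup f \<alpha> * x \<in> JA" if "x \<in> ideal_mult J (ideal_pow A n)" for \<alpha> x
    proof -
      have "ideal_mult J (ideal_pow A n) \<subseteq> {x. x * lookup f \<alpha> \<in> JA}"
      proof (rule ideal_mult_least)
        fix j y assume "j \<in> J" "y \<in> ideal_pow A n"
        then have "j * (lookup f \<alpha> * y) \<in> JA" using fA by (intro JA_I) (auto intro: ideal_multI)
        then show "j * y \<in> {x. x * lookup f \<alpha> \<in> JA}" by (simp add: algebra_simps)
      qed (rule is_ideal_colon[OF JA])
      then show ?thesis using that by (auto simp: mult.commute)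
    qed
    show ?case
    proof (cases "keys g = {}")
      case True
      then show ?thesis by (simp add: is_idealD)
    next
      case False
      \<comment> \<open>The greatest monomial of \<open>g\<close> is split off, with coefficient
        \<open>b\<close>; any other way of reaching \<open>\<alpha> + \<beta>0\<close> in the
        product then uses a monomial of \<open>f\<close> above \<alpha>.\<close>
      define \<beta>0 where "\<beta>0 = Max (keys g)"
      define b where "b = lookup g \<beta>0"
      have \<beta>0: "\<beta>0 \<in> keys g" unfolding \<beta>0_def using False by (intro Max_in) auto
      have max: "\<beta> \<le> \<beta>0" if "\<beta> \<in> keys g" for \<beta> unfolding \<beta>0_def using that by simp
      define g' where "g' = g - single \<beta>0 b"
      have lg': "lookup g' \<beta> = (if \<beta> = \<beta>0 then 0 else lookup g \<beta>)" for \<beta>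
        by (simp add: g'_def lookup_minus lookup_single b_def when_def)
      have kg': "keys g' = keys g - {\<beta>0}" by (auto simp: in_keys_iff lg' split: if_splits)
      \<comment> \<open>The ideal \<open>J + b A\<close>: removing the term changes the coefficients
        of the product by multiples of \<open>b\<close> with cofactors in \<open>A\<close>.\<close>
      define J' where "J' = {x + b * a | x a. x \<in> J \<and> a \<in> A}"
      have J': "is_ideal J'"
      proof (rule is_idealI)
        show "0 \<in> J'" unfolding J'_def using is_idealD(1)[OF Suc.prems(2)] is_idealD(1)[of A]
          by (auto simp: A_def intro!: exI[of _ 0])
        show "u + v \<in> J'" if uv: "u \<in> J'" "v \<in> J'" for u v
        proof -
          obtain x a y c where "u = x + b * a" "v = y + b * c" "x \<in> J" "y \<in> J" "a \<in> A" "c \<in> A" using uv by (auto simp: J'_def)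
          then have "u + v = (x + y) + b * (a + c)" "x + y \<in> J" "a + c \<in> A"
            using is_idealD(2)[OF Suc.prems(2)] is_idealD(2)[of A] by (auto simp: A_def algebra_simps)
          then show ?thesis unfolding J'_def by blast
        qed
        show "t * u \<in> J'" if u: "u \<in> J'" for t u
        proof -
          obtain x a where u': "u = x + b * a" "x \<in> J" "a \<in> A" using u by (auto simp: J'_def)
          have "t * u = t * x + b * (t * a)" by (simp add: u' algebra_simps)
          moreover have "t * x \<in> J" using is_idealD(3)[OF Suc.prems(2)] u' by blast
          moreover have "t * a \<in> A" using is_idealD(3)[of A] u' by (simp add: A_def)
          ultimately show ?thesis unfolding J'_def by blast
        qed
      qed
      have fg': "f * g' \<in> coeffs_in J'"
        unfolding coeffs_in_def
      proof (intro CollectI allI)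
        fix \<mu>
        have "lookup (f * single \<beta>0 b) \<mu> = (\<Sum>\<alpha>\<in>keys f. \<Sum>\<beta>\<in>{\<beta>0}. if \<alpha> + \<beta> = \<mu> then lookup f \<alpha> * lookup (single \<beta>0 b) \<beta> else 0)"
          by (rule lookup_mult_superset) auto
        also have "\<dots> = b * (\<Sum>\<alpha>\<in>keys f. if \<alpha> + \<beta>0 = \<mu> then lookup f \<alpha> else 0)"
          by (auto simp: sum_distrib_left intro!: sum.cong)
        finally have "lookup (f * g') \<mu> = lookup (f * g) \<mu> + b * - (\<Sum>\<alpha>\<in>keys f. if \<alpha> + \<beta>0 = \<mu> then lookup f \<alpha> else 0)"
          by (simp add: g'_def right_diff_distrib lookup_minus)
        moreover have "lookup (f * g) \<mu> \<in> J" using Suc.prems(3) by (simp add: coeffs_in_def)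
        moreover have "- (\<Sum>\<alpha>\<in>keys f. if \<alpha> + \<beta>0 = \<mu> then lookup f \<alpha> else 0) \<in> A"
          using fA by (intro is_ideal_uminus is_ideal_sum) (auto simp: A_def is_idealD)
        ultimately show "lookup (f * g') \<mu> \<in> J'" unfolding J'_def by blast
      qed
      \<comment> \<open>The induction hypothesis for \<open>g'\<close> and \<open>J'\<close>, with
        the part from \<open>J\<close> and the multiple of \<open>b\<close> kept apart.\<close>
      have split: "\<exists>x y. a * lookup g' \<beta> = x + b * y \<and> x \<in> ideal_mult J (ideal_pow A n) \<and> y \<in> ideal_pow A (Suc n)"
        if "a \<in> ideal_pow A (Suc n)" for a \<beta>
      proof -
        have "card (keys g') \<le> Suc n" using Suc.prems(1) \<beta>0 by (simp add: kg')
        then have "a * lookup g' \<beta> \<in> ideal_mult J' (ideal_pow A n)"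
          using Suc.IH[OF _ J' fg', of a \<beta>] that by (simp add: A_def)
        moreover have "ideal_mult J' (ideal_pow A n) \<subseteq> {x + b * y | x y. x \<in> ideal_mult J (ideal_pow A n) \<and> y \<in> ideal_pow A (Suc n)}"
          (is "_ \<subseteq> ?W")
        proof (rule ideal_mult_least)
          fix u v assume uv: "u \<in> J'" "v \<in> ideal_pow A n"
          then obtain x a where x: "u = x + b * a" "x \<in> J" "a \<in> A" by (auto simp: J'_def)
          have "u * v = x * v + b * (a * v)" by (simp add: x algebra_simps)
          moreover have "x * v \<in> ideal_mult J (ideal_pow A n)" "a * v \<in> ideal_pow A (Suc n)"
            using x uv by (auto intro: ideal_multI)
          ultimately show "u * v \<in> ?W" by blast
        next
          let ?P = "ideal_mult J (ideal_pow A n)" and ?Q = "ideal_pow A (Suc n)"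
          have P: "is_ideal ?P" "is_ideal ?Q" by (auto simp del: replicate_Suc)
          show "is_ideal ?W"
          proof (rule is_idealI)
            show "0 \<in> ?W" using is_idealD(1)[OF P(1)] is_idealD(1)[OF P(2)]
              by (intro CollectI exI[of _ 0]) (simp del: replicate_Suc)
            show "u + v \<in> ?W" if uv: "u \<in> ?W" "v \<in> ?W" for u v
            proof -
              obtain x a y c where *: "u = x + b * a" "v = y + b * c" "x \<in> ?P" "y \<in> ?P" "a \<in> ?Q" "c \<in> ?Q" using uv by blast
              then have "u + v = (x + y) + b * (a + c)" by (simp add: algebra_simps)
              then show ?thesis using is_idealD(2)[OF P(1) *(3,4)] is_idealD(2)[OF P(2) *(5,6)] by blast
            qed
            show "t * u \<in> ?W" if u: "u \<in> ?W" for t u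
            proof -
              obtain x a where *: "u = x + b * a" "x \<in> ?P" "a \<in> ?Q" using u by blast
              then have "t * u = t * x + b * (t * a)" by (simp add: algebra_simps)
              then show ?thesis using is_idealD(3)[OF P(1) *(2)] is_idealD(3)[OF P(2) *(3)] by blast
            qed
          qed
        qed
        ultimately show ?thesis by blast
      qed
      \<comment> \<open>Downward induction along the monomials of \<open>f\<close>: the coefficient
        of \<open>\<alpha> + \<beta>0\<close> in \<open>f * g\<close> is
        \<open>lookup f \<alpha> * b\<close> plus terms with a monomial of \<open>f\<close> above
        \<alpha>. Up to \<open>JA\<close>, \<open>split\<close> makes each of these a multiple of
        \<open>b\<close> to which the induction applies.\<close>
      have claim: "lookup f \<alpha> * b * a \<in> JA" if "a \<in> ideal_pow A (Suc n)" for \<alpha> a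
        using that
      proof (induction "card {\<alpha>'\<in>keys f. \<alpha> < \<alpha>'}" arbitrary: \<alpha> a rule: less_induct)
        case less
        let ?T = "\<lambda>\<alpha>' \<beta>'. if \<alpha>' + \<beta>' = \<alpha> + \<beta>0 \<and> \<beta>' \<noteq> \<beta>0 then lookup f \<alpha>' * lookup g \<beta>' else 0"
        have "lookup (f * g) (\<alpha> + \<beta>0) =
           (\<Sum>\<alpha>'\<in>insert \<alpha> (keys f). \<Sum>\<beta>'\<in>keys g. if \<alpha>' + \<beta>' = \<alpha> + \<beta>0 then lookup f \<alpha>' * lookup g \<beta>' else 0)"
          by (rule lookup_mult_superset) auto
        also have "\<dots> = (\<Sum>\<alpha>'\<in>insert \<alpha> (keys f). \<Sum>\<beta>'\<in>keys g.
             (if \<alpha>' = \<alpha> then if \<beta>' = \<beta>0 then lookup f \<alpha> * b else 0 else 0) + ?T \<alpha>' \<beta>')"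
          by (intro sum.cong refl) (auto simp: b_def)
        also have "\<dots> = (\<Sum>\<alpha>'\<in>insert \<alpha> (keys f). if \<alpha>' = \<alpha> then \<Sum>\<beta>'\<in>keys g. if \<beta>' = \<beta>0 then lookup f \<alpha> * b else 0 else 0) +
            (\<Sum>\<alpha>'\<in>insert \<alpha> (keys f). \<Sum>\<beta>'\<in>keys g. ?T \<alpha>' \<beta>')"
          unfolding sum.distrib by (intro arg_cong2[of _ _ _ _ "(+)"] sum.cong refl) auto
        also have "(\<Sum>\<alpha>'\<in>insert \<alpha> (keys f). if \<alpha>' = \<alpha> then \<Sum>\<beta>'\<in>keys g. if \<beta>' = \<beta>0 then lookup f \<alpha> * b else 0 else 0) = lookup f \<alpha> * b"
          using \<beta>0 by simp
        finally have "lookup f \<alpha> * b * a = lookup (f * g) (\<alpha> + \<beta>0) * a -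
            (\<Sum>\<alpha>'\<in>insert \<alpha> (keys f). \<Sum>\<beta>'\<in>keys g. ?T \<alpha>' \<beta>') * a"
          by (simp add: algebra_simps)
        also have "\<dots> \<in> JA"
        proof (rule is_ideal_diff[OF JA])
          show "lookup (f * g) (\<alpha> + \<beta>0) * a \<in> JA"
            using Suc.prems(3) less.prems by (intro JA_I) (auto simp: coeffs_in_def)
          have "?T \<alpha>' \<beta>' * a \<in> JA" if ab: "\<alpha>' \<in> insert \<alpha> (keys f)" "\<beta>' \<in> keys g" for \<alpha>' \<beta>'
          proof (cases "\<alpha>' + \<beta>' = \<alpha> + \<beta>0 \<and> \<beta>' \<noteq> \<beta>0")
            case True
            then have "\<beta>' < \<beta>0" using max[OF ab(2)] by (simp only: less_le simp_thms)
            have "\<alpha> < \<alpha>'"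
            proof (rule ccontr)
              assume "\<not> \<alpha> < \<alpha>'"
              then have "\<alpha>' + \<beta>' < \<alpha> + \<beta>0" using \<open>\<beta>' < \<beta>0\<close> by (intro add_le_less_mono) auto
              then show False using True by simp
            qed
            then have "\<alpha>' \<in> keys f" using ab(1) by auto
            have lt: "card {\<alpha>''\<in>keys f. \<alpha>' < \<alpha>''} < card {\<alpha>''\<in>keys f. \<alpha> < \<alpha>''}"
              using \<open>\<alpha> < \<alpha>'\<close> \<open>\<alpha>' \<in> keys f\<close> by (intro psubset_card_mono) (auto intro: less_trans)
            obtain x y where xy: "a * lookup g' \<beta>' = x + b * y" "x \<in> ideal_mult J (ideal_pow A n)" "y \<in> ideal_pow A (Suc n)"
              using split[OF less.prems, of \<beta>'] by blast
            have "?T \<alpha>' \<beta>' * a = lookup f \<alpha>' * (a * lookup g' \<beta>')" using True by (simp add: lg' algebra_simps)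
            also have "\<dots> = lookup f \<alpha>' * x + lookup f \<alpha>' * b * y" by (simp add: xy(1) algebra_simps)
            also have "\<dots> \<in> JA" using JA_up[OF xy(2)] less.hyps[OF lt xy(3)] by (intro is_idealD(2)[OF JA])
            finally show ?thesis .
          next
            case False
            have "?T \<alpha>' \<beta>' * a = 0" using False by (simp only: if_False mult_zero_left)
            then show ?thesis using is_idealD(1)[OF JA] by simp
          qed
          then show "(\<Sum>\<alpha>'\<in>insert \<alpha> (keys f). \<Sum>\<beta>'\<in>keys g. ?T \<alpha>' \<beta>') * a \<in> JA"
            unfolding sum_distrib_right by (intro is_ideal_sum[OF JA])
        qed
        finally show ?case .
      qed
      have gen: "lookup f \<alpha> * a1 * lookup g \<beta> \<in> JA" if a1: "a1 \<in> ideal_pow A (Suc n)" for \<alpha> a1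
      proof (cases "\<beta> = \<beta>0")
        case True
        then show ?thesis using claim[OF a1, of \<alpha>] by (simp add: b_def algebra_simps)
      next
        case False
        obtain x y where xy: "a1 * lookup g' \<beta> = x + b * y" "x \<in> ideal_mult J (ideal_pow A n)" "y \<in> ideal_pow A (Suc n)"
          using split[OF a1, of \<beta>] by blast
        have "lookup f \<alpha> * a1 * lookup g \<beta> = lookup f \<alpha> * (a1 * lookup g' \<beta>)" using False by (simp add: lg' algebra_simps)
        also have "\<dots> = lookup f \<alpha> * x + lookup f \<alpha> * b * y" by (simp add: xy(1) algebra_simps)
        also have "\<dots> \<in> JA" using JA_up[OF xy(2)] claim[OF xy(3)] by (intro is_idealD(2)[OF JA])
        finally show ?thesis .
      qed
      have "A \<subseteq> {x. x * (a1 * lookup g \<beta>) \<in> JA}" if "a1 \<in> ideal_pow A (Suc n)" for a1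
        unfolding A_def using gen[OF that] by (intro ideal_gen_least is_ideal_colon JA) (auto simp: mult.assoc)
      then have "ideal_mult A (ideal_pow A (Suc n)) \<subseteq> {x. x * lookup g \<beta> \<in> JA}"
        by (intro ideal_mult_least is_ideal_colon JA) (auto simp: mult.assoc)
      then have "a * lookup g \<beta> \<in> JA" using Suc.prems(4) unfolding A_def[symmetric] ideal_pow_Suc[of "Suc n" A] by auto
      then show ?thesis unfolding JA_def A_def .
    qed
  }
qed

text \<open>The reduction criterion is applied to the module \<open>A^n\<close>, with
  \<open>A\<close> the content of \<open>f\<close> and \<open>n\<close> the number of terms of
  \<open>g\<close>: by Dedekind--Mertens, multiplication by
  \<open>lookup f \<alpha> * lookup g \<beta>\<close> sends it into \<open>J A^n\<close>. Its
  generators are the products of \<open>n\<close> coefficients of \<open>f\<close>.\<close>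

theorem content_mult_integral:
  fixes f g :: "('v::linorder, 'a::comm_ring_1) polynomial"
  assumes J: "is_ideal J" and fg: "f * g \<in> coeffs_in J"
  shows "lookup f \<alpha> * lookup g \<beta> \<in> integral_closure J"
proof (cases "lookup f \<alpha> = 0")
  case True
  then show ?thesis by (simp add: is_idealD)
next
  case False
  define A where "A = ideal_gen (range (lookup f))"
  define n where "n = card (keys g)"
  define L where "L = {as. set as \<subseteq> keys f \<and> length as = n}"
  define V where "V = (\<lambda>as. prod_list (map (lookup f) as)) ` L"
  have "finite L" unfolding L_def by (rule finite_lists_length_eq) simp
  then have "finite V" by (simp add: V_def)
  then obtain v N where v: "V = v ` {..<N::nat}"
    by (metis atLeast0LessThan card_Collect_less_nat ex_bij_betw_nat_finite bij_betw_imp_surj_on)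
  have pow: "ideal_pow A k \<subseteq> ideal_gen ((\<lambda>as. prod_list (map (lookup f) as)) ` {as. set as \<subseteq> keys f \<and> length as = k})" (is "_ \<subseteq> ?G k") for k
  proof (induction k)
    case 0
    have one: "1 \<in> ?G 0" by (rule ideal_gen_base) (auto intro!: image_eqI[of _ _ "[]"])
    show ?case
    proof
      fix x
      show "x \<in> ?G 0" using is_idealD(3)[OF is_ideal_gen one, of x] by simp
    qed
  next
    case (Suc k)
    have "lookup f \<alpha> * y \<in> ?G (Suc k)" if "y \<in> ?G k" for \<alpha> y
    proof (cases "\<alpha> \<in> keys f")
      case True
      have "?G k \<subseteq> {y. y * lookup f \<alpha> \<in> ?G (Suc k)}"
      proof (rule ideal_gen_least[OF _ is_ideal_colon[OF is_ideal_gen]])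
        show "(\<lambda>as. prod_list (map (lookup f) as)) ` {as. set as \<subseteq> keys f \<and> length as = k} \<subseteq> {y. y * lookup f \<alpha> \<in> ?G (Suc k)}"
        proof (intro image_subsetI CollectI)
          fix as assume as: "as \<in> {as. set as \<subseteq> keys f \<and> length as = k}"
          have "prod_list (map (lookup f) as) * lookup f \<alpha> = prod_list (map (lookup f) (\<alpha> # as))" by (simp add: mult.commute)
          also have "\<dots> \<in> ?G (Suc k)" using as True by (intro ideal_gen_base imageI) auto
          finally show "prod_list (map (lookup f) as) * lookup f \<alpha> \<in> ?G (Suc k)" .
        qed
      qed
      then show ?thesis using that by (auto simp: mult.commute)
    qed (simp add: in_keys_iff is_idealD)
    then have "A \<subseteq> {x. x * y \<in> ?G (Suc k)}" if "y \<in> ?G k" for y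
      unfolding A_def using that by (intro ideal_gen_least is_ideal_colon is_ideal_gen) auto
    then show ?case unfolding ideal_pow_Suc using Suc by (intro ideal_mult_least is_ideal_gen) blast
  qed
  define W where "W = {\<Sum>i<N. c i * v i | c. \<forall>i. c i \<in> J}"
  have W: "is_ideal W"
  proof (rule is_idealI)
    show "0 \<in> W" using is_idealD(1)[OF J] unfolding W_def by (intro CollectI exI[of _ "\<lambda>_. 0"]) auto
    show "x + y \<in> W" if xy: "x \<in> W" "y \<in> W" for x y
    proof -
      obtain c c' where c: "x = (\<Sum>i<N. c i * v i)" "y = (\<Sum>i<N. c' i * v i)" "\<forall>i. c i \<in> J" "\<forall>i. c' i \<in> J" using xy by (auto simp: W_def)
      then have "x + y = (\<Sum>i<N. (c i + c' i) * v i)" by (simp add: distrib_right sum.distrib)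
      then show ?thesis using is_idealD(2)[OF J] c unfolding W_def by (intro CollectI exI[of _ "\<lambda>i. c i + c' i"]) auto
    qed
    show "r * x \<in> W" if x: "x \<in> W" for r x
    proof -
      obtain c where c: "x = (\<Sum>i<N. c i * v i)" "\<forall>i. c i \<in> J" using x by (auto simp: W_def)
      then have "r * x = (\<Sum>i<N. (r * c i) * v i)" by (simp add: sum_distrib_left mult.assoc)
      then show ?thesis using is_idealD(3)[OF J] c unfolding W_def by (intro CollectI exI[of _ "\<lambda>i. r * c i"]) auto
    qed
  qed
  have JW: "ideal_mult J (ideal_pow A n) \<subseteq> W"
  proof (rule ideal_mult_least[OF _ W])
    fix j y assume jy: "j \<in> J" "y \<in> ideal_pow A n"
    have "ideal_gen V \<subseteq> {y. y * j \<in> W}"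
    proof (rule ideal_gen_least[OF _ is_ideal_colon[OF W]])
      show "V \<subseteq> {y. y * j \<in> W}"
      proof
        fix y assume "y \<in> V"
        then obtain i where i: "i < N" "y = v i" by (auto simp: v)
        have "(\<Sum>k<N. (if k = i then j else 0) * v k) = (\<Sum>k<N. if k = i then j * v i else 0)"
          by (intro sum.cong) auto
        then have "y * j = (\<Sum>k<N. (if k = i then j else 0) * v k)"
          using i by (simp add: mult.commute)
        then show "y \<in> {y. y * j \<in> W}" using jy is_idealD(1)[OF J] unfolding W_def
          by (intro CollectI exI[of _ "\<lambda>k. if k = i then j else 0"]) auto
      qed
    qed
    then show "j * y \<in> W" using pow[of n] jy(2) unfolding V_def L_def by (auto simp: mult.commute)
  qed
  let ?x = "lookup f \<alpha> * lookup g \<beta>"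
  have "?x * v i \<in> W" if "i < N" for i
  proof -
    have "v i \<in> V" using that by (auto simp: v)
    then obtain as where as: "as \<in> L" "v i = prod_list (map (lookup f) as)" by (auto simp: V_def)
    have "prod_list (map (lookup f) as) \<in> ideal_pow A (length as)"
      by (rule ideal_prod_list_mem) (auto simp: list_all2_conv_all_nth A_def intro!: ideal_gen_base)
    then have "v i \<in> ideal_pow A n" using as by (simp add: L_def)
    then have "lookup f \<alpha> * v i \<in> ideal_pow A (Suc n)"
      unfolding ideal_pow_Suc by (intro ideal_multI) (auto simp: A_def intro!: ideal_gen_base)
    then have "(lookup f \<alpha> * v i) * lookup g \<beta> \<in> ideal_mult J (ideal_pow A n)"
      using dedekind_mertens[of g n J f "lookup f \<alpha> * v i" \<beta>] J fg by (simp add: n_def A_def)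
    then show ?thesis using JW by (auto simp: algebra_simps)
  qed
  then have "\<forall>i. \<exists>c. i < N \<longrightarrow> (\<forall>j. c j \<in> J) \<and> ?x * v i = (\<Sum>j<N. c j * v j)" unfolding W_def by blast
  then obtain c where c: "\<And>i j. i < N \<Longrightarrow> c i j \<in> J" "\<And>i. i < N \<Longrightarrow> ?x * v i = (\<Sum>j<N. c i j * v j)" by metis
  show ?thesis
  proof (rule integral_closure_reduction[of N ?x v c J n])
    fix q assume q: "\<And>i. i < N \<Longrightarrow> q * v i = 0"
    \<comment> \<open>The power \<open>lookup f \<alpha> ^ n\<close> is itself one of the
      generators, so whatever annihilates the module annihilates \<open>?x ^ n\<close>.\<close>
    have "lookup f \<alpha> ^ n \<in> V"
      using False unfolding V_def L_def by (intro image_eqI[of _ _ "replicate n \<alpha>"]) (auto simp: in_keys_iff prod_list_replicate)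
    then obtain i where "i < N" "v i = lookup f \<alpha> ^ n" by (auto simp: v)
    then have "q * lookup f \<alpha> ^ n = 0" using q by metis
    then show "q * ?x ^ n = 0" by (simp add: power_mult_distrib flip: mult.assoc)
  qed (use c in auto)
qed

text \<open>Induction on the number of factors: the content \<open>J2\<close> of the remaining
  product, times a coefficient of the first factor, is integral over \<open>J\<close>, and
  integrality over \<open>J2\<close> survives multiplication by that coefficient.\<close>

corollary content_prod_integral:
  fixes ps :: "('v::linorder, 'a::comm_ring_1) polynomial list"
  assumes "is_ideal J" "prod_list ps \<in> coeffs_in J" "list_all2 (\<lambda>x p. \<exists>\<mu>. x = lookup p \<mu>) xs ps"
  shows "prod_list xs \<in> integral_closure J"
  using assms(3,1,2)
proof (induction xs ps arbitrary: J rule: list_all2_induct)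
  case Nil
  then have "lookup 1 (0 :: 'v monomial) \<in> J" by (simp add: coeffs_in_def del: lookup_one_zero)
  then show ?case using integral_closure_superset by auto
next
  case (Cons x xs p ps)
  define J2 where "J2 = ideal_gen (range (lookup (prod_list ps)))"
  have "prod_list ps \<in> coeffs_in J2" by (auto simp: coeffs_in_def J2_def intro!: ideal_gen_base)
  then have IH: "prod_list xs \<in> integral_closure J2" using Cons.IH[of J2] by (simp add: J2_def)
  obtain \<mu> where \<mu>: "x = lookup p \<mu>" using Cons.hyps by auto
  have "J2 \<subseteq> {y. y * x \<in> integral_closure J}" unfolding J2_def \<mu>
    using Cons.prems by (intro ideal_gen_least is_ideal_colon is_ideal_integral_closure)
      (auto intro: content_mult_integral simp: mult.commute[of "lookup (prod_list ps) _"])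
  then have "ideal_mult J2 {x} \<subseteq> integral_closure J" by (intro ideal_mult_least) auto
  then have "integral_closure (ideal_mult J2 {x}) \<subseteq> integral_closure J" by (rule integral_closure_trans)
  moreover have "prod_list xs * x \<in> integral_closure (ideal_mult J2 {x})"
    using IH integral_closure_mult[of J2 "{x}"] ideal_multI[of "prod_list xs" "integral_closure J2" x "{x}"] by auto
  ultimately show ?case by (auto simp: mult.commute)
qed

section \<open>Minors ideals and the generic extension\<close>

abbreviation shape_ideal :: "nat \<Rightarrow> nat \<Rightarrow> (nat \<Rightarrow> nat \<Rightarrow> 'a::comm_ring_1) \<Rightarrow> nat list \<Rightarrow> 'a set" where
  "shape_ideal m n M \<sigma> \<equiv> ideal_prod_list (map (minors_ideal m n M) \<sigma>)"

lemma ideal_prod_list_gen_least: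
  assumes "is_ideal I" "\<And>xs. list_all2 (\<in>) xs Ss \<Longrightarrow> prod_list xs \<in> I"
  shows "ideal_prod_list (map ideal_gen Ss) \<subseteq> I"
  using assms
proof (induction Ss arbitrary: I)
  case Nil
  then have "1 \<in> I" by fastforce
  then show ?case using is_idealD(3)[OF Nil(1), of 1] by auto
next
  case (Cons S Ss)
  have *: "ideal_prod_list (map ideal_gen Ss) \<subseteq> {y. y * a \<in> I}" if "a \<in> S" for a
  proof (rule Cons.IH[OF is_ideal_colon[OF Cons.prems(1)]])
    fix xs assume "list_all2 (\<in>) xs Ss"
    then have "prod_list (a # xs) \<in> I" using that by (intro Cons.prems(2)) simp
    then show "prod_list xs \<in> {y. y * a \<in> I}" by (simp add: mult.commute)
  qed
  have "ideal_gen S \<subseteq> {a. a * y \<in> I}" if "y \<in> ideal_prod_list (map ideal_gen Ss)" for y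
    using * that by (intro ideal_gen_least is_ideal_colon[OF Cons.prems(1)]) (auto simp: mult.commute)
  then show ?case by (auto dest!: ideal_mult_least[OF _ Cons.prems(1), THEN subsetD, rotated])
qed

lemma minor_mult_right:
  assumes "finite K" "length cs = length rs"
  shows "minor (\<lambda>i j. \<Sum>k\<in>K. A i k * B k j) rs cs =
    (\<Sum>ks | set ks \<subseteq> K \<and> length ks = length rs \<and> distinct ks.
       minor A rs ks * (\<Prod>i = 0..<length rs. B (ks ! i) (cs ! i)))"
proof -
  have "minor (\<lambda>i j. \<Sum>k\<in>K. A i k * B k j) rs cs = minor (\<lambda>j i. \<Sum>k\<in>K. B k j * A i k) cs rs"
    using minor_transpose[OF assms(2), of "\<lambda>i j. \<Sum>k\<in>K. A i k * B k j"] by (simp add: mult.commute)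
  also have "\<dots> = (\<Sum>ks | set ks \<subseteq> K \<and> length ks = length cs \<and> distinct ks.
       (\<Prod>i = 0..<length cs. B (ks ! i) (cs ! i)) * minor (\<lambda>k i. A i k) ks rs)"
    using assms by (intro minor_mult) auto
  also have "\<dots> = (\<Sum>ks | set ks \<subseteq> K \<and> length ks = length rs \<and> distinct ks.
       minor A rs ks * (\<Prod>i = 0..<length rs. B (ks ! i) (cs ! i)))"
    using assms by (intro sum.cong) (auto simp: minor_transpose[of _ rs A] mult.commute)
  finally show ?thesis .
qed

section \<open>The generic extension \<open>G M H\<close> of a matrix\<close>

definition gen_left :: "nat \<Rightarrow> nat \<Rightarrow> (gvar, 'a::comm_ring_1) polynomial" where "gen_left i k = Var (1, i, k)"
definition gen_right :: "nat \<Rightarrow> nat \<Rightarrow> (gvar, 'a::comm_ring_1) polynomial" where "gen_right k j = Var (2, k, j)"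

definition gen_ext :: "nat \<Rightarrow> nat \<Rightarrow> (nat \<Rightarrow> nat \<Rightarrow> 'a::comm_ring_1) \<Rightarrow> nat \<Rightarrow> nat \<Rightarrow> (gvar, 'a) polynomial" where
  "gen_ext m n M = mat_prod n gen_left (mat_prod m (\<lambda>i j. Const (M i j)) gen_right)"

lemma minor_Const: "minor (\<lambda>i j. Const (M i j)) rs cs = Const (minor M rs cs)"
  by (rule minor_hom[OF comm_ring_hom_Const, symmetric])

text \<open>Cauchy--Binet on both sides: \<open>minor M ks ls\<close> appears with the product of
  the variables \<open>g_{ws_p, ks_p}\<close> and \<open>h_{ls_p, ws_p}\<close>, and since
  \<open>ws\<close> is distinct this monomial determines \<open>ks\<close> and \<open>ls\<close>. So
  one fixed minor of the extension contains all minors of \<open>M\<close> of its size among its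
  coefficients.\<close>

lemma gen_ext_coeff:
  assumes ws: "distinct ws" and rs: "distinct rs" "set rs \<subseteq> {..<n}" "length rs = length ws"
    and cs: "distinct cs" "set cs \<subseteq> {..<m}" "length cs = length ws"
  shows "\<exists>\<mu>. minor M rs cs = lookup (minor (gen_ext m n M) ws ws) \<mu>"
proof -
  define s where "s = length ws"
  define mon :: "nat list \<Rightarrow> nat list \<Rightarrow> gvar monomial" where
    "mon ks ls = (\<Sum>p<s. single (1, ws ! p, ks ! p) 1 + single (2, ls ! p, ws ! p) 1)" for ks ls
  define L where "L l = {ks. set ks \<subseteq> {..<l::nat} \<and> length ks = s \<and> distinct ks}" for l
  have L: "finite (L l)" for l unfolding L_def
    by (rule finite_subset[OF _ finite_lists_length_eq[of "{..<l}" s]]) auto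
  have "minor (gen_ext m n M) ws ws =
      (\<Sum>ks\<in>L n. (\<Prod>i = 0..<s. gen_left (ws ! i) (ks ! i)) * minor (mat_prod m (\<lambda>i j. Const (M i j)) gen_right) ks ws)"
    unfolding gen_ext_def mat_prod_def[of n, abs_def] L_def s_def by (rule minor_mult) auto
  also have "\<dots> = (\<Sum>ks\<in>L n. \<Sum>ls\<in>L m. single (mon ks ls) (minor M ks ls))"
  proof (rule sum.cong[OF refl])
    fix ks assume ks: "ks \<in> L n"
    have "minor (mat_prod m (\<lambda>i j. Const (M i j)) gen_right) ks ws =
        (\<Sum>ls\<in>L m. minor (\<lambda>i j. Const (M i j)) ks ls * (\<Prod>i = 0..<s. gen_right (ls ! i) (ws ! i)))"
      using ks minor_mult_right[of "{..<m}" ws ks "\<lambda>i j. Const (M i j)" gen_right]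
      unfolding mat_prod_def[abs_def] L_def s_def by simp
    moreover have "(\<Prod>i = 0..<s. gen_left (ws ! i) (ks ! i)) * (minor (\<lambda>i j. Const (M i j)) ks ls * (\<Prod>i = 0..<s. gen_right (ls ! i) (ws ! i))) =
       single (mon ks ls) (minor M ks ls)" for ls
      unfolding minor_Const gen_left_def gen_right_def Var_def mon_def
      by (simp add: Const_def prod_single mult_single sum.distrib lessThan_atLeast0)
    ultimately show "(\<Prod>i = 0..<s. gen_left (ws ! i) (ks ! i)) * minor (mat_prod m (\<lambda>i j. Const (M i j)) gen_right) ks ws =
      (\<Sum>ls\<in>L m. single (mon ks ls) (minor M ks ls))" by (simp add: sum_distrib_left)
  qed
  finally have ex: "minor (gen_ext m n M) ws ws = (\<Sum>ks\<in>L n. \<Sum>ls\<in>L m. single (mon ks ls) (minor M ks ls))" .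
  have inj: "ks = rs \<and> ls = cs" if "mon ks ls = mon rs cs" "ks \<in> L n" "ls \<in> L m" for ks ls
  proof -
    have l: "length ks = s" "length ls = s" "length rs = s" "length cs = s" using that rs cs by (auto simp: L_def s_def)
    have S: "(\<Sum>p<s. if ws ! p = ws ! q \<and> P p then 1 else (0::nat)) = (if P q then 1 else 0)" if "q < s" for q P
      using sum_nth_distinct[OF ws(1), of q P] that by (simp add: s_def)
    have k1: "lookup (mon ks ls) (1, ws ! q, k) = (if ks ! q = k then 1 else 0)" if "q < s" for ks ls q k
    proof -
      have "lookup (mon ks ls) (1, ws ! q, k) = (\<Sum>p<s. if ws ! p = ws ! q \<and> ks ! p = k then 1 else 0)"
        by (auto simp: mon_def lookup_sum lookup_add lookup_single when_def intro!: sum.cong)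
      then show ?thesis unfolding S[OF that] .
    qed
    have k2: "lookup (mon ks ls) (2, k, ws ! q) = (if ls ! q = k then 1 else 0)" if "q < s" for ks ls q k
    proof -
      have "lookup (mon ks ls) (2, k, ws ! q) = (\<Sum>p<s. if ws ! p = ws ! q \<and> ls ! p = k then 1 else 0)"
        by (auto simp: mon_def lookup_sum lookup_add lookup_single when_def intro!: sum.cong)
      then show ?thesis unfolding S[OF that] .
    qed
    have "ks ! q = rs ! q" if "q < s" for q
    proof -
      have "(if ks ! q = rs ! q then 1 else 0) = (if rs ! q = rs ! q then 1 else (0::nat))"
        unfolding k1[OF that, of ks ls, symmetric] k1[OF that, of rs cs, symmetric] \<open>mon ks ls = mon rs cs\<close> ..
      then show ?thesis by (simp split: if_splits)
    qed
    moreover have "ls ! q = cs ! q" if "q < s" for q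
    proof -
      have "(if ls ! q = cs ! q then 1 else 0) = (if cs ! q = cs ! q then 1 else (0::nat))"
        unfolding k2[OF that, of ks ls, symmetric] k2[OF that, of rs cs, symmetric] \<open>mon ks ls = mon rs cs\<close> ..
      then show ?thesis by (simp split: if_splits)
    qed
    ultimately show ?thesis using l by (auto intro!: nth_equalityI)
  qed
  have "lookup (minor (gen_ext m n M) ws ws) (mon rs cs) =
     (\<Sum>ks\<in>L n. if ks = rs then \<Sum>ls\<in>L m. if ls = cs then minor M rs cs else 0 else 0)"
    unfolding ex lookup_sum
  proof (rule sum.cong[OF refl])
    fix ks assume ks: "ks \<in> L n"
    have "lookup (single (mon ks ls) (minor M ks ls)) (mon rs cs) = (if ks = rs then if ls = cs then minor M rs cs else 0 else 0)"
      if "ls \<in> L m" for ls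
      using inj[OF _ ks that] by (auto simp: lookup_single when_def)
    then show "(\<Sum>ls\<in>L m. lookup (single (mon ks ls) (minor M ks ls)) (mon rs cs)) =
       (if ks = rs then \<Sum>ls\<in>L m. if ls = cs then minor M rs cs else 0 else 0)" by simp
  qed
  also have "\<dots> = minor M rs cs" using L rs cs by (simp add: L_def s_def)
  finally show ?thesis by metis
qed

lemma minor_gen_ext_in:
  assumes "length cs = length rs" "length rs = t"
  shows "minor (gen_ext m n M) rs cs \<in> coeffs_in (minors_ideal m n M t)"
  unfolding gen_ext_def
  by (rule minor_mat_prod[OF assms(1)])
     (auto simp: minor_Const assms intro!: is_ideal_coeffs_in Const_coeffs_in minor_in_minors_ideal)

text \<open>One product of nested minors of \<open>G M H\<close> stands for all generators of the
  shape ideal: these are products of coefficients of its factors.\<close>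

lemma shape_ideal_integral:
  assumes I: "is_ideal I" and ws: "distinct ws" "\<forall>s\<in>set \<sigma>. s \<le> length ws"
    and prod: "bidet (gen_ext m n M) (map (\<lambda>s. (take s ws, take s ws)) \<sigma>) \<in> coeffs_in I"
  shows "shape_ideal m n M \<sigma> \<subseteq> integral_closure I"
proof -
  have "ideal_prod_list (map ideal_gen (map (minors {..<n} {..<m} M) \<sigma>)) \<subseteq> integral_closure I"
  proof (rule ideal_prod_list_gen_least)
    fix xs assume xs: "list_all2 (\<in>) xs (map (minors {..<n} {..<m} M) \<sigma>)"
    let ?ps = "map (\<lambda>s. minor (gen_ext m n M) (take s ws) (take s ws)) \<sigma>"
    have "list_all2 (\<lambda>x p. \<exists>\<mu>. x = lookup p \<mu>) xs ?ps"
      unfolding list_all2_conv_all_nth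
    proof (intro conjI allI impI)
      show "length xs = length ?ps" using list_all2_lengthD[OF xs] by simp
      fix i assume "i < length xs"
      then have i: "i < length \<sigma>" "xs ! i \<in> minors {..<n} {..<m} M (\<sigma> ! i)"
        using xs by (auto simp: list_all2_conv_all_nth)
      then obtain rs cs where *: "xs ! i = minor M rs cs" "distinct rs" "set rs \<subseteq> {..<n}" "length rs = \<sigma> ! i"
        "distinct cs" "set cs \<subseteq> {..<m}" "length cs = \<sigma> ! i" by (auto simp: minors_eq)
      have "length (take (\<sigma> ! i) ws) = \<sigma> ! i" using ws(2) i(1) by auto
      then show "\<exists>\<mu>. xs ! i = lookup (?ps ! i) \<mu>"
        using gen_ext_coeff[of "take (\<sigma> ! i) ws" rs n cs m M] * ws(1) i(1) by simp
    qed
    moreover have "prod_list ?ps \<in> coeffs_in I" using prod by (simp add: bidet_def comp_def)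
    ultimately show "prod_list xs \<in> integral_closure I" using content_prod_integral[OF I] by blast
  qed simp
  then show ?thesis by (simp add: minors_ideal_def[abs_def] comp_def)
qed

text \<open>The generic identity specialized to an arbitrary commutative ring; it is used over the
  polynomial ring of the extension \<open>G M H\<close> and over the ground ring.\<close>

lemma highest_weight:
  assumes "\<sigma> \<in> minimal_shapes m n d r"
  obtains ws xs where "distinct ws" "set ws \<subseteq> {..<min m n}" "\<forall>s\<in>set \<sigma>. s \<le> length ws"
    "set xs \<subseteq> monomials (min m n) d" "length xs = r"
    "\<And>M :: nat \<Rightarrow> nat \<Rightarrow> 'a::comm_ring_1. bidet M (map (\<lambda>s. (take s ws, take s ws)) \<sigma>) = minor (sym_mat n M) xs xs \<or>
      bidet M (map (\<lambda>s. (take s ws, take s ws)) \<sigma>) = - minor (sym_mat n M) xs xs"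
proof -
  obtain ws xs where *: "distinct ws" "set ws \<subseteq> {..<min m n}" "\<forall>s\<in>set \<sigma>. s \<le> length ws"
    "set xs \<subseteq> monomials (min m n) d" "length xs = r"
    and pm: "bidet generic_entry (map (\<lambda>s. (take s ws, take s ws)) \<sigma>) = minor (sym_mat n generic_entry) xs xs \<or>
      bidet generic_entry (map (\<lambda>s. (take s ws, take s ws)) \<sigma>) = - minor (sym_mat n generic_entry) xs xs"
    using highest_weight_generic[OF assms] by blast
  have "bidet M (map (\<lambda>s. (take s ws, take s ws)) \<sigma>) = minor (sym_mat n M) xs xs \<or>
      bidet M (map (\<lambda>s. (take s ws, take s ws)) \<sigma>) = - minor (sym_mat n M) xs xs" for M :: "nat \<Rightarrow> nat \<Rightarrow> 'a"
  proof -
    define h :: "(nat \<times> nat, int) polynomial \<Rightarrow> 'a" where "h = poly_eval of_int (\<lambda>(i, j). M i j)"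
    have hom: "comm_ring_hom h" unfolding h_def by (rule comm_ring_hom_poly_eval[OF comm_ring_hom_of_int])
    interpret h: comm_ring_hom h by (rule hom)
    have hX: "h (generic_entry i j) = M i j" for i j
      unfolding h_def generic_entry_def by (simp add: poly_eval_Var[OF comm_ring_hom_of_int])
    have 1: "h (bidet generic_entry (map (\<lambda>s. (take s ws, take s ws)) \<sigma>)) = bidet M (map (\<lambda>s. (take s ws, take s ws)) \<sigma>)"
      unfolding bidet_hom[OF hom] hX ..
    have 2: "h (minor (sym_mat n generic_entry) xs xs) = minor (sym_mat n M) xs xs"
      unfolding minor_hom[OF hom] sym_mat_hom[OF hom] hX ..
    from pm show ?thesis
    proof
      assume "bidet generic_entry (map (\<lambda>s. (take s ws, take s ws)) \<sigma>) = minor (sym_mat n generic_entry) xs xs"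
      from arg_cong[OF this, of h] show ?thesis by (simp add: 1 2)
    next
      assume "bidet generic_entry (map (\<lambda>s. (take s ws, take s ws)) \<sigma>) = - minor (sym_mat n generic_entry) xs xs"
      from arg_cong[OF this, of h] show ?thesis by (simp add: 1 2 h.hom_uminus)
    qed
  qed
  with * show ?thesis by (rule that)
qed

text \<open>By Cauchy--Binet the coefficients of the minor of the symmetric power of
  \<open>G M H\<close> lie in the ideal for \<open>M\<close>; up to sign that minor is the product
  of nested minors whose contents are wanted.\<close>

theorem minimal_shape_integral:
  fixes M :: "nat \<Rightarrow> nat \<Rightarrow> 'a::comm_ring_1"
  assumes "\<sigma> \<in> minimal_shapes m n d r"
  shows "shape_ideal m n M \<sigma> \<subseteq> integral_closure (sym_minors_ideal m n d M r)"
proof -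
  let ?I = "sym_minors_ideal m n d M r"
  obtain ws xs where ws: "distinct ws" "set ws \<subseteq> {..<min m n}" "\<forall>s\<in>set \<sigma>. s \<le> length ws"
      "set xs \<subseteq> monomials (min m n) d" "length xs = r"
    and pm: "\<And>N :: nat \<Rightarrow> nat \<Rightarrow> (gvar, 'a) polynomial.
      bidet N (map (\<lambda>s. (take s ws, take s ws)) \<sigma>) = minor (sym_mat n N) xs xs \<or>
      bidet N (map (\<lambda>s. (take s ws, take s ws)) \<sigma>) = - minor (sym_mat n N) xs xs"
    by (rule highest_weight[OF assms, where 'a = "(gvar, 'a) polynomial"]) (rule that; assumption)
  have "minor (sym_mat n (gen_ext m n M)) xs xs \<in> coeffs_in ?I"
    unfolding gen_ext_def
  proof (rule sym_minor_mat_prod[where m' = m and d = d and r = r])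
    fix \<gamma>s \<delta>s assume gd: "set \<gamma>s \<subseteq> monomials n d" "set \<delta>s \<subseteq> monomials m d" "length \<gamma>s = r" "length \<delta>s = r"
    have eq: "minor (sym_mat n (\<lambda>i j. Const (M i j))) \<gamma>s \<delta>s =
        (Const (minor (sym_mat n M) \<gamma>s \<delta>s) :: (gvar, 'a) polynomial)"
      unfolding minor_hom[OF comm_ring_hom_Const] sym_mat_hom[OF comm_ring_hom_Const] ..
    show "minor (sym_mat n (\<lambda>i j. Const (M i j))) \<gamma>s \<delta>s \<in> (coeffs_in ?I :: (gvar, 'a) polynomial set)"
      unfolding eq by (rule Const_coeffs_in[OF is_ideal_sym_minors_ideal minor_in_sym_minors_ideal[OF gd]])
  qed (use ws in \<open>auto simp: monomials_min intro!: is_ideal_coeffs_in\<close>)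
  then have "bidet (gen_ext m n M) (map (\<lambda>s. (take s ws, take s ws)) \<sigma>) \<in> coeffs_in ?I"
    using pm[of "gen_ext m n M"] is_ideal_uminus[OF is_ideal_coeffs_in[of ?I]] by auto
  then show ?thesis using ws by (intro shape_ideal_integral) auto
qed

section \<open>Exchange relations\<close>

definition del :: "nat \<Rightarrow> 'b list \<Rightarrow> 'b list" where
  "del i xs = take i xs @ drop (Suc i) xs"

lemma length_del [simp]: "i < length xs \<Longrightarrow> length (del i xs) = length xs - 1"
  by (simp add: del_def)

lemma del_0 [simp]: "del 0 (x # xs) = xs"
  by (simp add: del_def)

lemma nth_del: "i < length xs \<Longrightarrow> k < length xs - 1 \<Longrightarrow> del i xs ! k = xs ! (if k < i then k else Suc k)"
  by (simp add: del_def nth_append)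

lemma set_del: "set (del i xs) \<subseteq> set xs"
  by (auto simp: del_def dest: in_set_takeD in_set_dropD)

lemma mat_delete_minor:
  assumes "length cs = length rs" "i < length rs" "j < length cs"
  shows "det (mat_delete (mat (length rs) (length rs) (\<lambda>(a, b). M (rs ! a) (cs ! b))) i j) = minor M (del i rs) (del j cs)"
  unfolding minor_def mat_delete_def using assms
  by (intro arg_cong[of _ _ det] eq_matI) (auto simp: nth_del)

lemma minor_expand_column:
  assumes "length cs = length rs" "j < length cs"
  shows "minor M rs cs = (\<Sum>i<length rs. M (rs ! i) (cs ! j) * ((-1) ^ (i + j) * minor M (del i rs) (del j cs)))"
proof -
  have "minor M rs cs = (\<Sum>i<length rs. mat (length rs) (length rs) (\<lambda>(a, b). M (rs ! a) (cs ! b)) $$ (i, j) *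
      cofactor (mat (length rs) (length rs) (\<lambda>(a, b). M (rs ! a) (cs ! b))) i j)"
    unfolding minor_def using assms by (intro laplace_expansion_column) auto
  then show ?thesis using assms by (simp add: cofactor_def mat_delete_minor)
qed

lemma minor_expand_row:
  assumes "length cs = length rs" "i < length rs"
  shows "minor M rs cs = (\<Sum>j<length rs. M (rs ! i) (cs ! j) * ((-1) ^ (i + j) * minor M (del i rs) (del j cs)))"
proof -
  have "minor M rs cs = (\<Sum>j<length rs. mat (length rs) (length rs) (\<lambda>(a, b). M (rs ! a) (cs ! b)) $$ (i, j) *
      cofactor (mat (length rs) (length rs) (\<lambda>(a, b). M (rs ! a) (cs ! b))) i j)"
    unfolding minor_def using assms by (intro laplace_expansion_row) auto
  then show ?thesis using assms by (simp add: cofactor_def mat_delete_minor)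
qed

lemma minor_swap_rows: "minor M (P @ x # R @ y # Q) cs = - minor M (P @ y # R @ x # Q) cs"
proof -
  define rs where "rs = P @ y # R @ x # Q"
  define i where "i = length P"
  define j where "j = length P + Suc (length R)"
  have ij: "i < length rs" "j < length rs" "i \<noteq> j" by (auto simp: rs_def i_def j_def)
  have p: "transpose i j permutes {0..<length rs}" using ij by (intro permutes_swap_id) auto
  have nth: "rs ! i = y" "rs ! j = x" by (simp_all add: rs_def i_def j_def nth_append)
  have rest: "rs ! k = (P @ x # R @ y # Q) ! k" if "k \<noteq> i" "k \<noteq> j" for k
    using that by (auto simp: rs_def i_def j_def nth_append nth_Cons split: nat.split)
  have nth': "(P @ x # R @ y # Q) ! i = x" "(P @ x # R @ y # Q) ! j = y" by (simp_all add: i_def j_def nth_append)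
  have "rs ! transpose i j k = (P @ x # R @ y # Q) ! k" for k
    using nth nth' rest[of k] by (cases "k = i"; cases "k = j") (simp_all add: transpose_def)
  then have "map (\<lambda>k. rs ! transpose i j k) [0..<length rs] = map ((!) (P @ x # R @ y # Q)) [0..<length (P @ x # R @ y # Q)]"
    by (simp add: rs_def)
  then have "map (\<lambda>k. rs ! transpose i j k) [0..<length rs] = P @ x # R @ y # Q"
    unfolding map_nth .
  then have "minor M (P @ x # R @ y # Q) cs = signof (transpose i j) * minor M rs cs"
    using minor_permute_rows[OF p, of M cs] by simp
  then show ?thesis using ij by (simp add: sign_swap_id rs_def)
qed

lemma minor_swap_cols:
  assumes "length (P @ x # R @ y # Q) = length rs"
  shows "minor M rs (P @ x # R @ y # Q) = - minor M rs (P @ y # R @ x # Q)"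
  using assms minor_swap_rows[of "\<lambda>j i. M i j" P x R y Q rs]
    minor_transpose[of "P @ x # R @ y # Q" rs M] minor_transpose[of "P @ y # R @ x # Q" rs M] by simp

lemma minor_move_col:
  assumes "length (xs @ c # ys) = length rs"
  shows "minor M rs (c # xs @ ys) = (-1) ^ length xs * minor M rs (xs @ c # ys)"
  using assms
proof (induction xs arbitrary: ys rule: rev_induct)
  case (snoc x xs)
  have "minor M rs (c # (xs @ [x]) @ ys) = (-1) ^ length xs * minor M rs (xs @ c # x # ys)"
    using snoc.IH[of "x # ys"] snoc.prems by simp
  also have "minor M rs (xs @ c # x # ys) = - minor M rs (xs @ x # c # ys)"
    using minor_swap_cols[of xs c "[]" x ys rs M] snoc.prems by simp
  finally show ?case by simp
qed simp

text \<open>Expansion along the row \<open>x\<close>. Moving \<open>c\<close> to the place of the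
  deleted column \<open>J' ! l\<close> costs a sign that combines with the cofactor sign to -1,
  uniformly in \<open>l\<close>.\<close>

lemma minor_border:
  assumes "length J' = length b"
  shows "minor M (x # b) (c # J') = M x c * minor M b J' - (\<Sum>l<length b. M x (J' ! l) * minor M b (J'[l := c]))"
proof -
  have "minor M b (del (Suc l) (c # J')) = (-1) ^ l * minor M b (J'[l := c])" if "l < length b" for l
  proof -
    have "J'[l := c] = take l J' @ c # drop (Suc l) J'" using that assms by (simp add: upd_conv_take_nth_drop)
    moreover have "del (Suc l) (c # J') = c # take l J' @ drop (Suc l) J'" by (simp add: del_def)
    ultimately show ?thesis using minor_move_col[of "take l J'" c "drop (Suc l) J'" b M] that assms by simp
  qed
  then have "M x (J' ! l) * ((-1) ^ Suc l * minor M b (del (Suc l) (c # J'))) = - (M x (J' ! l) * minor M b (J'[l := c]))"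
    if "l < length b" for l
    using that by (simp flip: power_add mult.assoc)
  moreover have "minor M (x # b) (c # J') =
     M x c * minor M b J' + (\<Sum>l<length b. M x (J' ! l) * ((-1) ^ Suc l * minor M b (del (Suc l) (c # J'))))"
  proof -
    have "minor M (x # b) (c # J') = (\<Sum>j<Suc (length b). M x ((c # J') ! j) * ((-1) ^ j * minor M b (del j (c # J'))))"
      using minor_expand_row[of "c # J'" "x # b" 0 M] assms by simp
    then show ?thesis unfolding sum.lessThan_Suc_shift by simp
  qed
  ultimately show ?thesis by (simp add: sum_negf)
qed

text \<open>The products in \<open>low\<close> are summed over \<open>i\<close> with the cofactor
  signs, each bordered minor being expanded along its added row. By expansion along column
  \<open>j0\<close> the sums over \<open>i\<close> then reassemble into minors on \<open>a\<close>
  with that column replaced.\<close>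

lemma exchange_relation:
  assumes len: "length J = length a" "length J' = length b" and j0: "j0 < length J" and N: "is_ideal N"
    and low: "\<And>i. i < length a \<Longrightarrow> minor M (del i a) (del j0 J) * minor M (a ! i # b) (J ! j0 # J') \<in> N"
  shows "minor M a J * minor M b J' - (\<Sum>l<length b. minor M a (J[j0 := J' ! l]) * minor M b (J'[l := J ! j0])) \<in> N"
proof -
  have col: "minor M a (J[j0 := y]) = (\<Sum>i<length a. M (a ! i) y * ((-1) ^ (i + j0) * minor M (del i a) (del j0 J)))" for y
    using minor_expand_column[of "J[j0 := y]" a j0 M] len j0 by (simp add: del_def)
  have colJ: "minor M a J = (\<Sum>i<length a. M (a ! i) (J ! j0) * ((-1) ^ (i + j0) * minor M (del i a) (del j0 J)))"
    using col[of "J ! j0"] by simp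
  have "(\<Sum>i<length a. (-1) ^ (i + j0) * (minor M (del i a) (del j0 J) * minor M (a ! i # b) (J ! j0 # J'))) =
     (\<Sum>i<length a. M (a ! i) (J ! j0) * ((-1) ^ (i + j0) * minor M (del i a) (del j0 J)) * minor M b J' -
       (\<Sum>l<length b. M (a ! i) (J' ! l) * ((-1) ^ (i + j0) * minor M (del i a) (del j0 J)) * minor M b (J'[l := J ! j0])))"
    unfolding minor_border[OF len(2)] by (intro sum.cong refl) (simp add: right_diff_distrib sum_distrib_left mult_ac)
  also have "\<dots> = minor M a J * minor M b J' - (\<Sum>l<length b. minor M a (J[j0 := J' ! l]) * minor M b (J'[l := J ! j0]))"
    unfolding sum_subtractf colJ col sum_distrib_right by (subst sum.swap) simp
  finally have eq: "(\<Sum>i<length a. (-1) ^ (i + j0) * (minor M (del i a) (del j0 J) * minor M (a ! i # b) (J ! j0 # J'))) =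
    minor M a J * minor M b J' - (\<Sum>l<length b. minor M a (J[j0 := J' ! l]) * minor M b (J'[l := J ! j0]))" .
  have "(\<Sum>i<length a. (-1) ^ (i + j0) * (minor M (del i a) (del j0 J) * minor M (a ! i # b) (J ! j0 # J'))) \<in> N"
    by (rule is_ideal_sum[OF N], rule is_idealD(3)[OF N], rule low) simp
  then show ?thesis unfolding eq .
qed

text \<open>The last column of the larger minor is exchanged. Every column that could come in from
  the smaller minor is already present, so all exchange terms have a repeated column and
  vanish.\<close>

lemma nested_minors:
  assumes "v < u" and N: "is_ideal N"
    and low: "\<And>rs cs rs' cs'. length rs = u - 1 \<Longrightarrow> length cs = u - 1 \<Longrightarrow> length rs' = Suc v \<Longrightarrow> length cs' = Suc v \<Longrightarrow>
      minor M rs cs * minor M rs' cs' \<in> N"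
  shows "minor M [0..<u] [0..<u] * minor M [0..<v] [0..<v] \<in> N"
proof -
  have "minor M [0..<u] ([0..<u][u - 1 := [0..<v] ! l]) = 0" if "l < v" for l
  proof (rule minor_cols_repeat)
    have "([0..<u][u - 1 := l]) ! (u - 1) = ([0..<u][u - 1 := l]) ! l" "l \<noteq> u - 1" "l < u" "u - 1 < u" using that assms(1) by auto
    then have "\<not> distinct ([0..<u][u - 1 := l])" by (metis diff_zero length_list_update length_upt nth_eq_iff_index_eq)
    then show "\<not> distinct ([0..<u][u - 1 := [0..<v] ! l])" using that by simp
  qed simp
  then show ?thesis
    using exchange_relation[of "[0..<u]" "[0..<u]" "[0..<v]" "[0..<v]" "u - 1" N M] assms by simp
qed

text \<open>The nested product for the generic extension lies in the extended ideal, and the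
  contents of its two factors yield all products of minors of \<open>M\<close>, up to integral
  closure.\<close>

lemma minors_ideal_exchange_integral:
  assumes "v < u"
  shows "shape_ideal m n M [u, v] \<subseteq> integral_closure (shape_ideal m n M [u - 1, Suc v])"
proof (rule shape_ideal_integral[where ws = "[0..<u]"])
  have "minor (gen_ext m n M) rs cs * minor (gen_ext m n M) rs' cs' \<in> coeffs_in (shape_ideal m n M [u - 1, Suc v])"
    if "length rs = u - 1" "length cs = u - 1" "length rs' = Suc v" "length cs' = Suc v" for rs cs rs' cs'
  proof -
    have "minor (gen_ext m n M) rs cs * minor (gen_ext m n M) rs' cs' \<in>
        coeffs_in (ideal_mult (minors_ideal m n M (u - 1)) (minors_ideal m n M (Suc v)))"
      using that by (intro coeffs_in_mult minor_gen_ext_in) auto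
    then show ?thesis by (simp add: ideal_mult_commute[of _ UNIV] ideal_mult_UNIV)
  qed
  then have "minor (gen_ext m n M) [0..<u] [0..<u] * minor (gen_ext m n M) [0..<v] [0..<v] \<in> coeffs_in (shape_ideal m n M [u - 1, Suc v])"
    using assms by (intro nested_minors is_ideal_coeffs_in) auto
  then show "bidet (gen_ext m n M) (map (\<lambda>s. (take s [0..<u], take s [0..<u])) [u, v]) \<in> coeffs_in (shape_ideal m n M [u - 1, Suc v])"
    using assms by simp
qed (use assms in auto)

lemma minors_ideal_Suc: "minors_ideal m n M (Suc t) \<subseteq> minors_ideal m n M t"
proof (rule minors_ideal_least)
  fix rs cs assume a: "set rs \<subseteq> {..<n}" "set cs \<subseteq> {..<m}" "length rs = Suc t" "length cs = Suc t"
  have *: "minor M (del i rs) (del 0 cs) \<in> minors_ideal m n M t" if "i < Suc t" for i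
    using a that set_del[of i rs] set_del[of 0 cs] by (intro minor_in_minors_ideal) auto
  have "minor M rs cs = (\<Sum>i<Suc t. M (rs ! i) (cs ! 0) * ((-1) ^ (i + 0) * minor M (del i rs) (del 0 cs)))"
    using minor_expand_column[of cs rs 0 M] a(3,4) by (simp del: sum.lessThan_Suc)
  also have "\<dots> \<in> minors_ideal m n M t"
    by (rule is_ideal_sum, simp, rule is_idealD(3), simp, rule is_idealD(3), simp, rule *) simp
  finally show "minor M rs cs \<in> minors_ideal m n M t" .
qed simp

lemma minors_ideal_0: "minors_ideal m n M 0 = UNIV"
proof -
  have "1 \<in> minors_ideal m n M 0" using minor_in_minors_ideal[of "[]" n "[]" m 0 M] by simp
  then show ?thesis using is_idealD(3)[of "minors_ideal m n M 0" 1] by auto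
qed

section \<open>Chains of Young diagrams\<close>

lemma gamma_Nil [simp]: "gamma j [] = 0"
  and gamma_Cons [simp]: "gamma j (s # \<sigma>) = (s + 1 - j) + gamma j \<sigma>"
  by (simp_all add: gamma_def)

lemma gamma_mset: "mset \<sigma> = mset \<tau> \<Longrightarrow> gamma j \<sigma> = gamma j \<tau>"
proof -
  have "gamma j \<upsilon> = (\<Sum>s\<in>#mset \<upsilon>. s + 1 - j)" for \<upsilon> by (induction \<upsilon>) auto
  then show "mset \<sigma> = mset \<tau> \<Longrightarrow> gamma j \<sigma> = gamma j \<tau>" by simp
qed

lemma gamma_second_difference:
  "gamma (Suc k) \<sigma> + gamma (Suc (Suc (Suc k))) \<sigma> = 2 * gamma (Suc (Suc k)) \<sigma> + count (mset \<sigma>) (Suc k)"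
proof (induction \<sigma>)
  case (Cons s \<sigma>)
  have "(s + 1 - Suc k) + (s + 1 - Suc (Suc (Suc k))) = 2 * (s + 1 - Suc (Suc k)) + (if s = Suc k then 1 else 0)" by auto
  then show ?case using Cons by (cases "s = Suc k") auto
qed simp

lemma gamma_eventually_zero: "k \<ge> sum_list \<sigma> \<Longrightarrow> gamma (Suc k) \<sigma> = 0"
  by (induction \<sigma>) auto

text \<open>Any diagram above \<open>\<sigma>\<close> is obtained from \<open>\<sigma>\<close> by adding boxes and by moving boxes from a row to one
  that is not shorter; the converse moves are used here, on diagrams with rows of length \<open>0\<close> admitted.\<close>

lemma young_le_induct:
  fixes Q :: "nat list \<Rightarrow> bool"
  assumes le: "young_le \<sigma> \<tau>"
    and perm: "\<And>\<tau> \<tau>'. mset \<tau> = mset \<tau>' \<Longrightarrow> Q \<tau> \<Longrightarrow> Q \<tau>'"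
    and zero: "\<And>\<tau>. Q (0 # \<tau>) \<longleftrightarrow> Q \<tau>"
    and base: "Q \<sigma>"
    and move: "\<And>u v \<rho>. Suc v < u \<Longrightarrow> Q ((u - 1) # Suc v # \<rho>) \<Longrightarrow> Q (u # v # \<rho>)"
    and drop: "\<And>u \<rho>. Q (u # \<rho>) \<Longrightarrow> Q (Suc u # \<rho>)"
  shows "Q \<tau>"
  using le
\<comment> \<open>The sum of squares drops when a box is removed, and when a box moves from a row of
  length \<open>Suc q\<close> to one of length \<open>i0 < q\<close>.\<close>
proof (induction "\<Sum>s\<leftarrow>\<tau>. s * s" arbitrary: \<tau> rule: less_induct)
  case less
  have le: "gamma (Suc k) \<sigma> \<le> gamma (Suc k) \<tau>" for k using less.prems by (simp add: young_le_iff)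
  define pos where "pos k \<longleftrightarrow> gamma (Suc k) \<sigma> < gamma (Suc k) \<tau>" for k
  have eq: "gamma (Suc k) \<sigma> = gamma (Suc k) \<tau>" if "\<not> pos k" for k using that le[of k] by (simp add: pos_def)
  have squares: "(\<Sum>s\<leftarrow>\<upsilon>. s * s) = (\<Sum>s\<in>#mset \<upsilon>. s * s)" for \<upsilon> :: "nat list" by (induction \<upsilon>) auto
  show ?case
  proof (cases "\<exists>k. pos k")
    case False
    have zeros: "Q \<upsilon> \<longleftrightarrow> Q (filter (\<lambda>s. s > 0) \<upsilon>)" for \<upsilon>
    proof -
      define z where "z = length (filter (\<lambda>s. s = 0) \<upsilon>)"
      have "filter (\<lambda>s. s = 0) \<upsilon> = replicate z 0" unfolding z_def by (rule replicate_eqI[symmetric, THEN sym]) auto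
      moreover have "mset \<upsilon> = mset (filter (\<lambda>s. s = 0) \<upsilon>) + mset (filter (\<lambda>s. s > 0) \<upsilon>)" by (induction \<upsilon>) auto
      ultimately have "mset \<upsilon> = mset (replicate z 0 @ filter (\<lambda>s. s > 0) \<upsilon>)" by simp
      then have "Q \<upsilon> \<longleftrightarrow> Q (replicate z 0 @ filter (\<lambda>s. s > 0) \<upsilon>)" using perm by metis
      moreover have "Q (replicate z 0 @ \<rho>) \<longleftrightarrow> Q \<rho>" for z \<rho> by (induction z) (auto simp: zero)
      ultimately show ?thesis by simp
    qed
    have "filter_mset (\<lambda>s. s > 0) (mset \<sigma>) = filter_mset (\<lambda>s. s > 0) (mset \<tau>)"
      using False eq by (intro gamma_eq_mset) auto
    then have "mset (filter (\<lambda>s. s > 0) \<sigma>) = mset (filter (\<lambda>s. s > 0) \<tau>)" by simp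
    then show ?thesis using base zeros perm by metis
  next
    case True
    then obtain k0 where k0: "pos k0" by auto
    have ex: "\<exists>l. l \<ge> k0 \<and> \<not> pos (Suc l)"
      using gamma_eventually_zero[of \<tau> "Suc (k0 + sum_list \<tau>)"] by (intro exI[of _ "k0 + sum_list \<tau>"]) (simp add: pos_def)
    \<comment> \<open>The last index of the run of strict inequalities that starts at
      \<open>k0\<close>.\<close>
    define q where "q = (LEAST l. l \<ge> k0 \<and> \<not> pos (Suc l))"
    have q: "q \<ge> k0" "\<not> pos (Suc q)" using LeastI_ex[OF ex] by (auto simp: q_def)
    have posq: "pos l" if "k0 \<le> l" "l \<le> q" for l
    proof (cases "l = k0")
      case False
      then have "l - 1 < q" "l - 1 \<ge> k0" "Suc (l - 1) = l" using that by auto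
      then show ?thesis using not_less_Least[of "l - 1" "\<lambda>l. l \<ge> k0 \<and> \<not> pos (Suc l)"] unfolding q_def by auto
    qed (use k0 in simp)
    \<comment> \<open>At the end of the run the second difference of \<open>gamma\<close> for \<tau>
      exceeds that for \<sigma>, so \<tau> has a row of length \<open>Suc q\<close>.\<close>
    have "count (mset \<tau>) (Suc q) \<ge> 1"
      using gamma_second_difference[of q \<tau>] gamma_second_difference[of q \<sigma>] eq[OF q(2)] le[of "Suc (Suc q)"]
        posq[OF q(1) order.refl, unfolded pos_def] by linarith
    then have uin: "Suc q \<in># mset \<tau>" by (metis count_greater_eq_one_iff)
    show ?thesis
    proof (cases "\<forall>k\<le>q. pos k")
      \<comment> \<open>Dropping a box of that row lowers \<open>gamma (Suc k)\<close> by one for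
        \<open>k \<le> q\<close>, where all inequalities are strict.\<close>
      case True
      obtain \<rho> where \<rho>: "mset \<tau> = mset (Suc q # \<rho>)" using uin by (metis ex_mset mset.simps(2) multi_member_split)
      have g: "gamma j \<tau> = gamma j (Suc q # \<rho>)" for j using gamma_mset[OF \<rho>] .
      have "young_le \<sigma> (q # \<rho>)" unfolding young_le_iff
      proof
        fix k
        show "gamma (Suc k) \<sigma> \<le> gamma (Suc k) (q # \<rho>)"
        proof (cases "k \<le> q")
          case True
          then show ?thesis using \<open>\<forall>k\<le>q. pos k\<close> g[of "Suc k"] by (auto simp: pos_def)
        next
          case False
          then show ?thesis using le[of k] g[of "Suc k"] by auto
        qed
      qed
      moreover have "(\<Sum>s\<leftarrow>q # \<rho>. s * s) < (\<Sum>s\<leftarrow>\<tau>. s * s)" unfolding squares \<rho> by simp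
      ultimately have "Q (q # \<rho>)" using less.hyps by blast
      then have "Q (Suc q # \<rho>)" by (rule drop)
      then show ?thesis using perm \<rho> by metis
    next
      case False
      \<comment> \<open>The last equality before the run determines the target row: the inequalities
        are strict for all \<open>k\<close> with \<open>i0 < k \<le> q\<close>, and these are the
        indices at which moving a box from a row of length \<open>Suc q\<close> to one of length
        \<open>i0\<close> lowers \<open>gamma (Suc k)\<close>.\<close>
      define Z where "Z = {k. k < k0 \<and> \<not> pos k}"
      obtain k where "k \<le> q" "\<not> pos k" using False by auto
      then have "k \<in> Z" using posq[of k] by (auto simp: Z_def not_le[symmetric])
      then have "Z \<noteq> {}" by auto
      moreover have "finite Z" by (simp add: Z_def)
      ultimately have i: "Max Z \<in> Z" "\<And>k. k \<in> Z \<Longrightarrow> k \<le> Max Z" by auto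
      define i0 where "i0 = Max Z"
      have i0: "i0 < k0" "\<not> pos i0" using i(1) by (auto simp: i0_def Z_def)
      have posi: "pos l" if "i0 < l" "l \<le> q" for l
      proof (rule ccontr)
        assume "\<not> pos l"
        then have "l \<in> Z" using posq[of l] that by (auto simp: Z_def not_le[symmetric])
        then show False using i(2)[of l] that by (simp add: i0_def)
      qed
      \<comment> \<open>For \<open>i0 = 0\<close> the box starts a new row, represented by an added
        row of length 0; otherwise the second difference at \<open>i0\<close> again provides a
        row.\<close>
      obtain \<rho> where \<rho>: "mset (if i0 = 0 then 0 # \<tau> else \<tau>) = mset (Suc q # i0 # \<rho>)"
      proof (cases "i0 = 0")
        case True
        obtain \<rho> where "mset \<tau> = mset (Suc q # \<rho>)" using uin by (metis ex_mset mset.simps(2) multi_member_split)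
        then show thesis using True by (intro that[of \<rho>]) (simp add: add_mset_commute)
      next
        case False
        then obtain i1 where i1: "i0 = Suc i1" by (cases i0) auto
        have "pos (Suc i0)" using posi[of "Suc i0"] i0(1) q(1) by simp
        then have "gamma (Suc (Suc (Suc i1))) \<sigma> < gamma (Suc (Suc (Suc i1))) \<tau>" by (simp add: pos_def i1)
        then have "count (mset \<tau>) i0 \<ge> 1"
          using gamma_second_difference[of i1 \<tau>] gamma_second_difference[of i1 \<sigma>] eq[OF i0(2), unfolded i1] le[of i1]
          unfolding i1 by linarith
        then have "i0 \<in># mset \<tau>" by (metis count_greater_eq_one_iff)
        moreover have "i0 \<noteq> Suc q" using i0 q by simp
        ultimately have "i0 \<in># mset \<tau> - {#Suc q#}" by (simp add: in_diff_count)
        then obtain B where "mset \<tau> - {#Suc q#} = add_mset i0 B" by (metis multi_member_split)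
        moreover obtain \<rho> where "mset \<rho> = B" using ex_mset by blast
        ultimately have "mset \<tau> = mset (Suc q # i0 # \<rho>)" using uin by (metis insert_DiffM mset.simps(2))
        then show thesis using False by (intro that[of \<rho>]) simp
      qed
      have g0: "gamma (Suc k) (if i0 = 0 then 0 # \<tau> else \<tau>) = gamma (Suc k) \<tau>" for k by simp
      have g: "gamma (Suc k) \<tau> = gamma (Suc k) (Suc q # i0 # \<rho>)" for k
        using gamma_mset[OF \<rho>, of "Suc k"] unfolding g0 .
      have "young_le \<sigma> (q # Suc i0 # \<rho>)" unfolding young_le_iff
      proof
        fix k
        show "gamma (Suc k) \<sigma> \<le> gamma (Suc k) (q # Suc i0 # \<rho>)"
        proof (cases "i0 < k \<and> k \<le> q")
          case True
          then show ?thesis using posi[of k] g[of k] by (auto simp: pos_def)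
        next
          case False
          then show ?thesis using le[of k] g[of k] i0(1) q(1) by auto
        qed
      qed
      moreover have "(\<Sum>s\<leftarrow>q # Suc i0 # \<rho>. s * s) < (\<Sum>s\<leftarrow>\<tau>. s * s)"
      proof -
        have "(\<Sum>s\<leftarrow>\<tau>. s * s) = (\<Sum>s\<in>#mset (if i0 = 0 then 0 # \<tau> else \<tau>). s * s)" unfolding squares by simp
        then show ?thesis unfolding \<rho> squares using i0(1) q(1) by simp
      qed
      ultimately have "Q (q # Suc i0 # \<rho>)" using less.hyps by blast
      then have "Q (Suc q # i0 # \<rho>)" using move[of i0 "Suc q" \<rho>] i0(1) q(1) by simp
      then have "Q (if i0 = 0 then 0 # \<tau> else \<tau>)" using perm \<rho> by metis
      then show ?thesis by (auto simp: zero split: if_splits)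
    qed
  qed
qed

section \<open>Products of determinantal ideals over the rationals\<close>

lemma sum_Pow_alternating:
  "finite X \<Longrightarrow> (\<Sum>A\<in>Pow X. (-1) ^ card A) = (if X = {} then 1 else (0 :: 'a::comm_ring_1))"
proof (induction X rule: finite_induct)
  case (insert x F)
  have "(\<Sum>A\<in>Pow (insert x F). (-1) ^ card A) = (\<Sum>A\<in>Pow F. (-1) ^ card A) + (\<Sum>A\<in>insert x ` Pow F. (-1) ^ card A :: 'a)"
    unfolding Pow_insert using insert.hyps by (intro sum.union_disjoint) auto
  also have "(\<Sum>A\<in>insert x ` Pow F. (-1) ^ card A) = (\<Sum>A\<in>Pow F. (-1) ^ card (insert x A) :: 'a)"
    using insert.hyps by (intro sum.reindex_cong[of "insert x"]) (auto simp: inj_on_def insert_eq_iff subset_iff)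
  also have "\<dots> = (\<Sum>A\<in>Pow F. - ((-1) ^ card A))"
  proof (rule sum.cong[OF refl])
    fix A assume "A \<in> Pow F"
    then have "x \<notin> A" "finite A" using insert.hyps finite_subset[of A F] by auto
    then show "(-1) ^ card (insert x A) = - ((-1) ^ card A :: 'a)" by simp
  qed
  finally show ?case by (simp add: sum_negf)
qed simp

lemma swap_invariant_mset:
  assumes "\<And>P x y Q. f (P @ x # y # Q) = f (P @ y # x # Q)" "mset xs = mset ys"
  shows "f xs = f ys"
  using assms
proof (induction xs arbitrary: ys f)
  case (Cons x xs)
  have "x \<in> set ys" using Cons.prems(2) by (metis list.set_intros(1) set_mset_mset)
  then obtain P Q where ys: "ys = P @ x # Q" by (meson split_list)
  have "f (P @ x # Q) = f (x # P @ Q)"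
  proof (induction P arbitrary: Q rule: rev_induct)
    case (snoc y P)
    have "f ((P @ [y]) @ x # Q) = f (P @ x # y # Q)" using Cons.prems(1)[of P y x Q] by simp
    also have "\<dots> = f (x # P @ y # Q)" by (rule snoc.IH)
    finally show ?case by simp
  qed simp
  moreover have "f (x # xs) = f (x # (P @ Q))"
  proof (rule Cons.IH[of "\<lambda>zs. f (x # zs)"])
    show "f (x # P @ y # z # Q) = f (x # P @ z # y # Q)" for P y z Q
      using Cons.prems(1)[of "x # P" y z Q] by simp
    show "mset xs = mset (P @ Q)" using Cons.prems(2) ys by simp
  qed
  ultimately show ?case by (simp add: ys)
qed simp

text \<open>Modulo \<open>N\<close>, the signed products \<open>G P\<close>, for \<open>P\<close> ranging over the subsets of cardinality \<open>p\<close> of the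
  symmetric difference \<open>D\<close> of the two column sets, sum up to \<open>0\<close> over the supersets of any set with \<open>p - 1\<close>
  elements. As \<open>card D < 2 p\<close>, inclusion-exclusion then gives \<open>G P = 0\<close>.\<close>

lemma minors_ideal_exchange_rational:
  fixes M :: "nat \<Rightarrow> nat \<Rightarrow> 'a::comm_ring_1"
  assumes uv: "v < u" and div: "\<And>k. k > 0 \<Longrightarrow> \<exists>y::'a. y * of_nat k = 1"
  shows "shape_ideal m n M [u, v] \<subseteq> shape_ideal m n M [u - 1, Suc v]"
proof -
  define N where "N = shape_ideal m n M [u - 1, Suc v]"
  have N: "is_ideal N" by (simp add: N_def)
  have N_I: "minor M rs cs * minor M rs' cs' \<in> N"
    if "set rs \<subseteq> {..<n}" "set cs \<subseteq> {..<m}" "length rs = u - 1" "length cs = u - 1"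
      "set rs' \<subseteq> {..<n}" "set cs' \<subseteq> {..<m}" "length rs' = Suc v" "length cs' = Suc v" for rs cs rs' cs'
    using that by (auto simp: N_def ideal_mult_commute[of _ UNIV] ideal_mult_UNIV intro!: ideal_multI minor_in_minors_ideal)
  have main: "minor M a J * minor M b J' \<in> N"
    if a: "set a \<subseteq> {..<n}" "length a = u" and b: "set b \<subseteq> {..<n}" "length b = v"
      and J: "distinct J" "set J \<subseteq> {..<m}" "length J = u" and J': "distinct J'" "set J' \<subseteq> {..<m}" "length J' = v" for a b J J'
  proof -
    define C where "C = filter (\<lambda>j. j \<in> set J') J"
    define P0 where "P0 = filter (\<lambda>j. j \<notin> set J') J"
    define Q0 where "Q0 = filter (\<lambda>j. j \<notin> set J) J'"
    define p where "p = length P0"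
    define q where "q = length Q0"
    define D where "D = set P0 \<union> set Q0"
    define E where "E = P0 @ Q0"
    have mJ: "mset J = mset (P0 @ C)" using multiset_partition[of "mset J" "\<lambda>j. j \<notin> set J'"] by (simp add: P0_def C_def)
    have dist: "distinct C" "distinct P0" "distinct Q0" "distinct E"
      using J J' by (auto simp: C_def P0_def Q0_def E_def)
    have mJ': "mset J' = mset (Q0 @ C)"
    proof -
      have "set J' = set (Q0 @ C)" "distinct (Q0 @ C)" using dist by (auto simp: C_def Q0_def)
      then show ?thesis using J'(1) set_eq_iff_mset_eq_distinct by blast
    qed
    have len: "p + length C = u" "q + length C = v"
      using J(3) J'(3) mset_eq_length[OF mJ] mset_eq_length[OF mJ'] by (simp_all add: p_def q_def)
    then have qp: "q < p" using uv by simp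
    have setE: "set E = D" "length E = p + q" by (simp_all add: E_def D_def p_def q_def)
    have finD: "finite D" by (simp add: D_def)
    have cardD: "card D = p + q" using distinct_card[OF dist(4)] setE by simp
    have DC: "D \<inter> set C = {}" by (auto simp: D_def C_def P0_def Q0_def)
    have Dm: "D \<subseteq> {..<m}" "set C \<subseteq> {..<m}" using J J' by (auto simp: D_def C_def P0_def Q0_def)
    \<comment> \<open>\<open>\<delta> xs\<close> is the sign of \<open>xs\<close> as a rearrangement
      of \<open>E\<close>, written as a determinant; it compensates the signs of the two minors
      under reordering, so that \<open>\<Psi>\<close> depends on the two column sets only.\<close>
    define \<delta> :: "nat list \<Rightarrow> 'a" where "\<delta> xs = minor (\<lambda>i j. if j = i then 1 else 0) E xs" for xs
    define \<Psi> where "\<Psi> ps qs = \<delta> (ps @ qs) * (minor M a (ps @ C) * minor M b (qs @ C))" for ps qs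
    have \<delta>_swap: "\<delta> (P @ x # R @ y # Q) = - \<delta> (P @ y # R @ x # Q)" if "length (P @ x # R @ y # Q) = p + q" for P x R y Q
      unfolding \<delta>_def using that setE by (intro minor_swap_cols) simp
    have inv: "\<Psi> ps qs = \<Psi> ps' qs'" if "mset ps = mset ps'" "mset qs = mset qs'" "length ps = p" "length qs = q" for ps qs ps' qs'
    proof -
      define f where "f qs ps = (if length ps = p then \<Psi> ps qs else 0)" for qs ps
      have "f qs ps = f qs ps'" if "length qs = q" "mset ps = mset ps'" for qs ps ps'
      proof (rule swap_invariant_mset[OF _ that(2)])
        fix P x y Q
        show "f qs (P @ x # y # Q) = f qs (P @ y # x # Q)"
        proof (cases "length (P @ x # y # Q) = p")
          case True
          have "\<delta> (P @ x # [] @ y # Q @ qs) = - \<delta> (P @ y # [] @ x # Q @ qs)" using True that(1) by (intro \<delta>_swap) simp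
          moreover have "minor M a (P @ x # [] @ y # Q @ C) = - minor M a (P @ y # [] @ x # Q @ C)"
            using True len a by (intro minor_swap_cols) simp
          ultimately show ?thesis by (simp add: f_def \<Psi>_def)
        qed (simp add: f_def)
      qed
      from this[of qs ps ps'] have 1: "\<Psi> ps qs = \<Psi> ps' qs"
        using that mset_eq_length[OF that(1)] by (simp add: f_def)
      define g where "g qs = (if length qs = q then \<Psi> ps' qs else 0)" for qs
      have lp: "length ps' = p" using that mset_eq_length[OF that(1)] by simp
      have "g qs = g qs'"
      proof (rule swap_invariant_mset[OF _ that(2)])
        fix P x y Q
        show "g (P @ x # y # Q) = g (P @ y # x # Q)"
        proof (cases "length (P @ x # y # Q) = q")
          case True
          have "\<delta> ((ps' @ P) @ x # [] @ y # Q) = - \<delta> ((ps' @ P) @ y # [] @ x # Q)" using True lp by (intro \<delta>_swap) simp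
          moreover have "minor M b (P @ x # [] @ y # Q @ C) = - minor M b (P @ y # [] @ x # Q @ C)"
            using True len b by (intro minor_swap_cols) simp
          ultimately show ?thesis by (simp add: g_def \<Psi>_def)
        qed (simp add: g_def)
      qed
      then have "\<Psi> ps' qs = \<Psi> ps' qs'" using that mset_eq_length[OF that(2)] by (simp add: g_def)
      with 1 show ?thesis by simp
    qed
    define G where "G P = \<Psi> (sorted_list_of_set P) (sorted_list_of_set (D - P))" for P
    have G: "\<Psi> ps qs = G P" if "distinct ps" "set ps = P" "distinct qs" "set qs = D - P" "P \<subseteq> D" "card P = p" for ps qs P
      unfolding G_def
    proof (rule inv)
      have fin: "finite P" using that finD finite_subset by blast
      show "mset ps = mset (sorted_list_of_set P)"
        using that fin set_eq_iff_mset_eq_distinct[of ps "sorted_list_of_set P"] by simp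
      show "mset qs = mset (sorted_list_of_set (D - P))"
        using that finD set_eq_iff_mset_eq_distinct[of qs "sorted_list_of_set (D - P)"] by simp
      show "length ps = p" using that distinct_card by metis
      have "card (D - P) = q" using card_Diff_subset[OF fin that(5)] cardD that(6) by simp
      then show "length qs = q" using that distinct_card by metis
    qed
    \<comment> \<open>The exchange relation for a column \<open>j\<close> outside \<open>P'\<close>:
      columns of \<open>C\<close> coming in give a repetition, and every other term is
      \<open>G\<close> of \<open>P'\<close> with a different element added, up to the sign that
      \<delta> absorbs.\<close>
    have exch: "(\<Sum>x\<in>D - P'. G (insert x P')) \<in> N" if P': "P' \<subseteq> D" "card P' = p - 1" for P'
    proof -
      have fin: "finite P'" using P' finD finite_subset by blast
      have cDP: "card (D - P') = Suc q" using card_Diff_subset[OF fin P'(1)] cardD P'(2) qp by simp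
      then obtain j where j: "j \<in> D - P'" by (metis card.empty ex_in_conv nat.distinct(1))
      define ps where "ps = sorted_list_of_set P'"
      define qs where "qs = sorted_list_of_set (D - P' - {j})"
      have ps: "distinct ps" "set ps = P'" "length ps = p - 1"
        using fin P' by (auto simp: ps_def)
      have qs: "distinct qs" "set qs = D - P' - {j}" "length qs = q"
        using finD j cDP by (auto simp: qs_def)
      have rel: "minor M a (j # ps @ C) * minor M b (qs @ C) -
          (\<Sum>l<length b. minor M a ((j # ps @ C)[0 := (qs @ C) ! l]) * minor M b ((qs @ C)[l := (j # ps @ C) ! 0])) \<in> N"
      proof (rule exchange_relation[OF _ _ _ N])
        fix i assume i: "i < length a"
        show "minor M (del i a) (del 0 (j # ps @ C)) * minor M (a ! i # b) ((j # ps @ C) ! 0 # qs @ C) \<in> N"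
          using i a b ps qs len qp j P'(1) Dm set_del[of i a] by (intro N_I) (auto simp: nth_mem subset_iff)
      qed (use a b len ps qs qp in auto)
      have "(\<Sum>l<length b. minor M a ((j # ps @ C)[0 := (qs @ C) ! l]) * minor M b ((qs @ C)[l := (j # ps @ C) ! 0])) =
         (\<Sum>l<q. minor M a (qs ! l # ps @ C) * minor M b (qs[l := j] @ C))"
      proof (rule sum.mono_neutral_cong_right)
        show "\<forall>l\<in>{..<length b} - {..<q}. minor M a ((j # ps @ C)[0 := (qs @ C) ! l]) * minor M b ((qs @ C)[l := (j # ps @ C) ! 0]) = 0"
        proof
          fix l assume l: "l \<in> {..<length b} - {..<q}"
          then have "(qs @ C) ! l \<in> set C" using qs len b by (auto simp: nth_append intro!: nth_mem)
          then have "\<not> distinct ((j # ps @ C)[0 := (qs @ C) ! l])" by simp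
          then have "minor M a ((j # ps @ C)[0 := (qs @ C) ! l]) = 0" using ps len qp a by (intro minor_cols_repeat) auto
          then show "minor M a ((j # ps @ C)[0 := (qs @ C) ! l]) * minor M b ((qs @ C)[l := (j # ps @ C) ! 0]) = 0" by simp
        qed
      qed (use qs len b in \<open>auto simp: nth_append list_update_append\<close>)
      then have "\<delta> (j # ps @ qs) * (minor M a (j # ps @ C) * minor M b (qs @ C) -
          (\<Sum>l<q. minor M a (qs ! l # ps @ C) * minor M b (qs[l := j] @ C))) \<in> N"
        using rel by (auto intro: is_idealD(3)[OF N])
      moreover have "\<delta> (j # ps @ qs) * (minor M a (j # ps @ C) * minor M b (qs @ C) -
          (\<Sum>l<q. minor M a (qs ! l # ps @ C) * minor M b (qs[l := j] @ C))) = (\<Sum>x\<in>D - P'. G (insert x P'))"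
      proof -
        have cins: "card (insert x P') = p" if "x \<in> D - P'" for x using that fin P'(2) qp by simp
        have t0: "\<delta> (j # ps @ qs) * (minor M a (j # ps @ C) * minor M b (qs @ C)) = G (insert j P')"
          using G[of "j # ps" "insert j P'" qs] ps qs j P' cins[OF j] by (auto simp: \<Psi>_def)
        have tl: "\<delta> (j # ps @ qs) * (minor M a (qs ! l # ps @ C) * minor M b (qs[l := j] @ C)) = - G (insert (qs ! l) P')"
          if l: "l < q" for l
        proof -
          have xin: "qs ! l \<in> D - P'" "qs ! l \<noteq> j" using qs l nth_mem[of l qs] by auto
          have qse: "qs = take l qs @ qs ! l # drop (Suc l) qs" using qs l by (simp add: id_take_nth_drop)
          have qsu: "qs[l := j] = take l qs @ j # drop (Suc l) qs" using qs l by (simp add: upd_conv_take_nth_drop)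
          have "\<delta> ([] @ j # (ps @ take l qs) @ qs ! l # drop (Suc l) qs) = - \<delta> ([] @ qs ! l # (ps @ take l qs) @ j # drop (Suc l) qs)"
            using ps qs l qp by (intro \<delta>_swap) simp
          then have "\<delta> (j # ps @ qs) = - \<delta> (qs ! l # ps @ qs[l := j])" using qse qsu by (metis append.assoc append_Nil)
          moreover have "\<Psi> (qs ! l # ps) (qs[l := j]) = G (insert (qs ! l) P')"
          proof (rule G)
            have d: "distinct (take l qs @ qs ! l # drop (Suc l) qs)" using qs(1) qse by simp
            have jn: "j \<notin> set qs" using qs by auto
            have sub: "set (take l qs) \<subseteq> set qs" "set (drop (Suc l) qs) \<subseteq> set qs" by (auto dest: in_set_takeD in_set_dropD)
            show "distinct (qs[l := j])" unfolding qsu using d jn sub by auto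
            have "set qs = insert (qs ! l) (set (take l qs) \<union> set (drop (Suc l) qs))" by (subst qse) auto
            then have "set (take l qs) \<union> set (drop (Suc l) qs) = set qs - {qs ! l}" using d by auto
            then have "set (qs[l := j]) = insert j (set qs - {qs ! l})" unfolding qsu by auto
            then show "set (qs[l := j]) = D - insert (qs ! l) P'" using qs j xin by auto
          qed (use ps xin P' cins[OF xin(1)] in auto)
          ultimately show ?thesis by (simp add: \<Psi>_def)
        qed
        have "(\<Sum>x\<in>D - P'. G (insert x P')) = G (insert j P') + (\<Sum>x\<in>set qs. G (insert x P'))"
          using finD j qs(2) by (subst sum.remove[of _ j]) auto
        also have "(\<Sum>x\<in>set qs. G (insert x P')) = (\<Sum>l<q. G (insert (qs ! l) P'))"
          using sum_list_distinct_conv_sum_set[OF qs(1), of "\<lambda>x. G (insert x P')"] qs(3)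
          by (simp add: sum_list_sum_nth lessThan_atLeast0)
        finally show ?thesis by (simp add: right_diff_distrib sum_distrib_left t0 tl sum_negf)
      qed
      ultimately show ?thesis by simp
    qed
    define PP where "PP = {P. P \<subseteq> D \<and> card P = p}"
    have PPfin: "finite PP" using finD by (simp add: PP_def)
    \<comment> \<open>Summing the relations over all \<open>P'\<close> that contain \<open>A\<close>
      produces every \<open>P\<close> once for each of its \<open>p - card A\<close> elements
      outside \<open>A\<close>; this integer is then divided out.\<close>
    have super: "(\<Sum>P\<in>{P\<in>PP. A \<subseteq> P}. G P) \<in> N" if A: "A \<subseteq> D" "card A < p" for A
    proof -
      have finA: "finite A" using A finD finite_subset by blast
      have "(\<Sum>P'\<in>{P'. P' \<subseteq> D \<and> card P' = p - 1 \<and> A \<subseteq> P'}. \<Sum>x\<in>D - P'. G (insert x P')) =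
         (\<Sum>(P', x)\<in>Sigma {P'. P' \<subseteq> D \<and> card P' = p - 1 \<and> A \<subseteq> P'} (\<lambda>P'. D - P'). G (insert x P'))"
        using finD by (intro sum.Sigma) auto
      also have "\<dots> = (\<Sum>(P, x)\<in>Sigma {P\<in>PP. A \<subseteq> P} (\<lambda>P. P - A). G P)"
      proof (rule sum.reindex_bij_witness[of _ "\<lambda>(P, x). (P - {x}, x)" "\<lambda>(P', x). (insert x P', x)"])
        fix y assume "y \<in> Sigma {P'. P' \<subseteq> D \<and> card P' = p - 1 \<and> A \<subseteq> P'} (\<lambda>P'. D - P')"
        then obtain P' x where y: "y = (P', x)" "P' \<subseteq> D" "card P' = p - 1" "A \<subseteq> P'" "x \<in> D" "x \<notin> P'" by auto
        have "finite P'" using y finD finite_subset by blast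
        then have "card (insert x P') = p" using y qp by simp
        then show "(case y of (P', x) \<Rightarrow> (insert x P', x)) \<in> Sigma {P\<in>PP. A \<subseteq> P} (\<lambda>P. P - A)"
          using y by (auto simp: PP_def)
        show "(case (case y of (P', x) \<Rightarrow> (insert x P', x)) of (P, x) \<Rightarrow> (P - {x}, x)) = y" using y by auto
        show "(case (case y of (P', x) \<Rightarrow> (insert x P', x)) of (P, x) \<Rightarrow> G P) = (case y of (P', x) \<Rightarrow> G (insert x P'))" by (simp add: y)
      next
        fix y assume "y \<in> Sigma {P\<in>PP. A \<subseteq> P} (\<lambda>P. P - A)"
        then obtain P x where y: "y = (P, x)" "P \<subseteq> D" "card P = p" "A \<subseteq> P" "x \<in> P" "x \<notin> A" by (auto simp: PP_def)
        have "finite P" using y finD finite_subset by blast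
        then have "card (P - {x}) = p - 1" using y by simp
        then show "(case y of (P, x) \<Rightarrow> (P - {x}, x)) \<in> Sigma {P'. P' \<subseteq> D \<and> card P' = p - 1 \<and> A \<subseteq> P'} (\<lambda>P'. D - P')"
          using y by auto
        show "(case (case y of (P, x) \<Rightarrow> (P - {x}, x)) of (P', x) \<Rightarrow> (insert x P', x)) = y" using y by auto
      qed
      also have "\<dots> = (\<Sum>P\<in>{P\<in>PP. A \<subseteq> P}. \<Sum>x\<in>P - A. G P)"
        using PPfin finD by (intro sum.Sigma[symmetric]) (auto simp: PP_def intro: finite_subset)
      also have "\<dots> = (\<Sum>P\<in>{P\<in>PP. A \<subseteq> P}. of_nat (p - card A) * G P)"
      proof (rule sum.cong[OF refl])
        fix P assume P: "P \<in> {P\<in>PP. A \<subseteq> P}"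
        then have "card (P - A) = p - card A" using card_Diff_subset[OF finA, of P] by (auto simp: PP_def)
        then show "(\<Sum>x\<in>P - A. G P) = of_nat (p - card A) * G P" by simp
      qed
      finally have "of_nat (p - card A) * (\<Sum>P\<in>{P\<in>PP. A \<subseteq> P}. G P) =
          (\<Sum>P'\<in>{P'. P' \<subseteq> D \<and> card P' = p - 1 \<and> A \<subseteq> P'}. \<Sum>x\<in>D - P'. G (insert x P'))" by (simp add: sum_distrib_left)
      also have "\<dots> \<in> N" by (rule is_ideal_sum[OF N]) (use exch in auto)
      finally have mem: "of_nat (p - card A) * (\<Sum>P\<in>{P\<in>PP. A \<subseteq> P}. G P) \<in> N" .
      obtain y :: 'a where y: "y * of_nat (p - card A) = 1" using div[of "p - card A"] A(2) by auto
      have "y * (of_nat (p - card A) * (\<Sum>P\<in>{P\<in>PP. A \<subseteq> P}. G P)) \<in> N" using mem by (rule is_idealD(3)[OF N])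
      then show ?thesis unfolding mult.assoc[symmetric] y by simp
    qed
    let ?B = "set Q0"
    \<comment> \<open>Inclusion-exclusion over the subsets of \<open>set Q0\<close> keeps only the
      \<open>P\<close> disjoint from it, that is \<open>P = set P0\<close>; each subset has at most
      \<open>q < p\<close> elements, as \<open>super\<close> requires.\<close>
    have "(\<Sum>A\<in>Pow ?B. (-1) ^ card A * (\<Sum>P\<in>{P\<in>PP. A \<subseteq> P}. G P)) \<in> N"
    proof (rule is_ideal_sum[OF N])
      fix A assume A: "A \<in> Pow ?B"
      have "A \<subseteq> D" using A by (auto simp: D_def)
      moreover have "card A < p" using A card_mono[of ?B A] qp distinct_card[OF dist(3)] by (simp add: q_def)
      ultimately show "(-1) ^ card A * (\<Sum>P\<in>{P\<in>PP. A \<subseteq> P}. G P) \<in> N" by (intro is_idealD(3)[OF N] super)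
    qed
    also have "(\<Sum>A\<in>Pow ?B. (-1) ^ card A * (\<Sum>P\<in>{P\<in>PP. A \<subseteq> P}. G P)) = (\<Sum>A\<in>Pow ?B. \<Sum>P\<in>PP. if A \<subseteq> P then (-1) ^ card A * G P else 0)"
      by (simp add: sum_distrib_left sum.inter_filter[OF PPfin, symmetric])
    also have "\<dots> = (\<Sum>P\<in>PP. \<Sum>A\<in>Pow ?B. if A \<subseteq> P then (-1) ^ card A * G P else 0)" by (rule sum.swap)
    also have "\<dots> = (\<Sum>P\<in>PP. if P = set P0 then G P else 0)"
    proof (rule sum.cong[OF refl])
      fix P assume P: "P \<in> PP"
      have "(\<Sum>A\<in>Pow ?B. if A \<subseteq> P then (-1) ^ card A * G P else 0) = (\<Sum>A\<in>Pow (?B \<inter> P). (-1) ^ card A * G P)"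
        by (rule sum.mono_neutral_cong_right) auto
      also have "\<dots> = (if ?B \<inter> P = {} then 1 else 0) * G P"
        unfolding sum_distrib_right[symmetric] by (subst sum_Pow_alternating) auto
      also have "?B \<inter> P = {} \<longleftrightarrow> P = set P0"
      proof
        assume "?B \<inter> P = {}"
        then have "P \<subseteq> set P0" using P by (auto simp: PP_def D_def)
        moreover have "card P = card (set P0)" using P distinct_card[OF dist(2)] by (simp add: PP_def p_def)
        ultimately show "P = set P0" by (intro card_subset_eq) auto
      qed (auto simp: P0_def Q0_def)
      finally show "(\<Sum>A\<in>Pow ?B. if A \<subseteq> P then (-1) ^ card A * G P else 0) = (if P = set P0 then G P else 0)" by simp
    qed
    also have "\<dots> = G (set P0)"
    proof -
      have "set P0 \<in> PP" using distinct_card[OF dist(2)] by (auto simp: PP_def D_def p_def)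
      then show ?thesis using PPfin by simp
    qed
    also have "\<dots> = \<Psi> P0 Q0"
      using distinct_card[OF dist(2)] dist by (intro G[symmetric]) (auto simp: D_def p_def P0_def Q0_def)
    also have "\<dots> = minor M a (P0 @ C) * minor M b (Q0 @ C)"
      unfolding \<Psi>_def \<delta>_def by (subst E_def[symmetric], subst minor_identity[OF dist(4)]) simp
    finally have "minor M a (P0 @ C) * minor M b (Q0 @ C) \<in> N" .
    moreover have "minor M a J = minor M a (P0 @ C) \<or> minor M a J = - minor M a (P0 @ C)"
      using minor_cols_mset[OF mJ, of a M] len a p_def by simp
    moreover have "minor M b J' = minor M b (Q0 @ C) \<or> minor M b J' = - minor M b (Q0 @ C)"
      using minor_cols_mset[OF mJ', of b M] len b q_def by simp
    ultimately show ?thesis using is_ideal_uminus[OF N] by auto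
  qed
  have "ideal_prod_list (map ideal_gen (map (minors {..<n} {..<m} M) [u, v])) \<subseteq> N"
  proof (rule ideal_prod_list_gen_least[OF N])
    fix xs assume "list_all2 (\<in>) xs (map (minors {..<n} {..<m} M) [u, v])"
    then obtain x y where "xs = [x, y]" "x \<in> minors {..<n} {..<m} M u" "y \<in> minors {..<n} {..<m} M v"
      by (auto simp: list_all2_Cons2)
    then show "prod_list xs \<in> N" using main by (auto simp: minors_eq)
  qed
  then show ?thesis by (simp add: N_def minors_ideal_def)
qed

section \<open>Comparison of the ideals\<close>

lemma shape_ideal_Cons_Cons:
  "shape_ideal m n M (u # v # \<rho>) = ideal_mult (shape_ideal m n M [u, v]) (shape_ideal m n M \<rho>)"
  using ideal_prod_list_append[of "map (minors_ideal m n M) [u, v]" "map (minors_ideal m n M) \<rho>"]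
  by (simp only: list.map append.simps)

text \<open>The exchange step is left as a hypothesis, because it holds up to integral closure in
  one application and exactly in the other.\<close>

lemma shape_ideal_young_le:
  assumes le: "young_le \<sigma> \<tau>" and base: "shape_ideal m n M \<sigma> \<subseteq> C"
    and exch: "\<And>u v \<rho>. Suc v < u \<Longrightarrow> shape_ideal m n M ((u - 1) # Suc v # \<rho>) \<subseteq> C \<Longrightarrow> shape_ideal m n M (u # v # \<rho>) \<subseteq> C"
  shows "shape_ideal m n M \<tau> \<subseteq> C"
proof (rule young_le_induct[OF le, where Q = "\<lambda>\<tau>. shape_ideal m n M \<tau> \<subseteq> C"])
  fix \<tau> \<tau>' assume m: "mset \<tau> = mset \<tau>'" and C: "shape_ideal m n M \<tau> \<subseteq> C"
  have "mset (map (minors_ideal m n M) \<tau>) = mset (map (minors_ideal m n M) \<tau>')" using m by simp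
  then show "shape_ideal m n M \<tau>' \<subseteq> C" using C ideal_prod_list_mset by metis
next
  fix \<tau>
  show "shape_ideal m n M (0 # \<tau>) \<subseteq> C \<longleftrightarrow> shape_ideal m n M \<tau> \<subseteq> C"
    by (simp add: minors_ideal_0 ideal_mult_UNIV)
next
  fix u \<rho> assume "shape_ideal m n M (u # \<rho>) \<subseteq> C"
  moreover have "shape_ideal m n M (Suc u # \<rho>) \<subseteq> shape_ideal m n M (u # \<rho>)"
    using ideal_mult_mono[OF minors_ideal_Suc order.refl] by simp
  ultimately show "shape_ideal m n M (Suc u # \<rho>) \<subseteq> C" by blast
qed (use base exch in auto)

lemma shape_ideal_le_integral:
  assumes \<sigma>: "\<sigma> \<in> minimal_shapes m n d r" and le: "young_le \<sigma> \<tau>"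
  shows "shape_ideal m n M \<tau> \<subseteq> integral_closure (sym_minors_ideal m n d M r)"
proof (rule shape_ideal_young_le[OF le minimal_shape_integral[OF \<sigma>]])
  fix u v \<rho> assume uv: "Suc v < u"
    and le: "shape_ideal m n M ((u - 1) # Suc v # \<rho>) \<subseteq> integral_closure (sym_minors_ideal m n d M r)"
  have "shape_ideal m n M (u # v # \<rho>) \<subseteq>
      ideal_mult (integral_closure (shape_ideal m n M [u - 1, Suc v])) (shape_ideal m n M \<rho>)"
    unfolding shape_ideal_Cons_Cons[of m n M u v \<rho>]
    using uv by (intro ideal_mult_mono minors_ideal_exchange_integral order.refl) simp
  also have "\<dots> \<subseteq> integral_closure (shape_ideal m n M ((u - 1) # Suc v # \<rho>))"
    unfolding shape_ideal_Cons_Cons[of m n M "u - 1" "Suc v" \<rho>] by (rule integral_closure_mult)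
  also have "\<dots> \<subseteq> integral_closure (sym_minors_ideal m n d M r)" using le by (rule integral_closure_trans)
  finally show "shape_ideal m n M (u # v # \<rho>) \<subseteq> integral_closure (sym_minors_ideal m n d M r)" .
qed

lemma shape_ideal_le_rational:
  fixes M :: "nat \<Rightarrow> nat \<Rightarrow> 'a::comm_ring_1"
  assumes le: "young_le \<sigma> \<tau>" and div: "\<And>k. k > 0 \<Longrightarrow> \<exists>y::'a. y * of_nat k = 1"
  shows "shape_ideal m n M \<tau> \<subseteq> shape_ideal m n M \<sigma>"
proof (rule shape_ideal_young_le[OF le order.refl])
  fix u v \<rho> assume uv: "Suc v < u" and le: "shape_ideal m n M ((u - 1) # Suc v # \<rho>) \<subseteq> shape_ideal m n M \<sigma>"
  have "shape_ideal m n M (u # v # \<rho>) \<subseteq> shape_ideal m n M ((u - 1) # Suc v # \<rho>)"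
    unfolding shape_ideal_Cons_Cons[of m n M u v \<rho>] shape_ideal_Cons_Cons[of m n M "u - 1" "Suc v" \<rho>] using uv
    by (intro ideal_mult_mono minors_ideal_exchange_rational[OF _ div] order.refl) simp_all
  then show "shape_ideal m n M (u # v # \<rho>) \<subseteq> shape_ideal m n M \<sigma>" using le by blast
qed

text \<open>The integral expansion specialized to \<open>M\<close>. The ideal \<open>I\<close> is
  left open to serve for the sum of the \<open>ideal_up_shape\<close> and, over the rationals, for
  that of the \<open>ideal_pow_shape\<close>.\<close>

lemma sym_minors_ideal_le_shape_ideals:
  fixes M :: "nat \<Rightarrow> nat \<Rightarrow> 'a::comm_ring_1"
  assumes I: "is_ideal I"
    and shp: "\<And>\<sigma> \<tau>. \<sigma> \<in> minimal_shapes m n d r \<Longrightarrow> young_diagram \<tau> \<Longrightarrow> young_le \<sigma> \<tau> \<Longrightarrow> shape_ideal m n M \<tau> \<subseteq> I"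
  shows "sym_minors_ideal m n d M r \<subseteq> I"
proof (rule sym_minors_ideal_least[OF I])
  fix \<beta>s \<alpha>s assume \<beta>s: "set \<beta>s \<subseteq> monomials n d" and \<alpha>s: "set \<alpha>s \<subseteq> monomials m d" and len: "length \<beta>s = r" "length \<alpha>s = r"
  define h :: "(nat \<times> nat, int) polynomial \<Rightarrow> 'a" where "h = poly_eval of_int (\<lambda>(i, j). M i j)"
  have h: "comm_ring_hom h" unfolding h_def by (intro comm_ring_hom_poly_eval comm_ring_hom_of_int)
  then interpret comm_ring_hom h .
  have gen: "(\<lambda>i j. h (generic_entry i j)) = M"
    unfolding h_def generic_entry_def by (simp add: poly_eval_Var[OF comm_ring_hom_of_int])
  obtain F c where eq: "minor (sym_mat n generic_entry) \<beta>s \<alpha>s = (\<Sum>bt\<in>F. of_int (c bt) * bidet generic_entry bt)"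
    and F: "finite F" "F \<subseteq> {bt. standard bt \<and> entries (map fst bt) = (\<Sum>\<beta>\<leftarrow>\<beta>s. mset_of_mon \<beta>) \<and>
      entries (map snd bt) = (\<Sum>\<alpha>\<leftarrow>\<alpha>s. mset_of_mon \<alpha>) \<and> (\<exists>\<sigma>\<in>minimal_shapes m n d r. young_le \<sigma> (shape bt))}"
    using sym_minor_expansion[OF \<beta>s len(1) \<alpha>s len(2)] unfolding bitableau_span_def by blast
  have mem: "bidet M bt \<in> I" if "bt \<in> F" for bt
  proof -
    have good: "good bt" and ent: "entries (map fst bt) = (\<Sum>\<beta>\<leftarrow>\<beta>s. mset_of_mon \<beta>)" "entries (map snd bt) = (\<Sum>\<alpha>\<leftarrow>\<alpha>s. mset_of_mon \<alpha>)"
      using F(2) that by (auto simp: standard_def)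
    have "\<exists>\<sigma>\<in>minimal_shapes m n d r. young_le \<sigma> (shape bt)" using subsetD[OF F(2) that] by simp
    then obtain \<sigma> where \<sigma>: "\<sigma> \<in> minimal_shapes m n d r" "young_le \<sigma> (shape bt)" by blast
    have "young_diagram (shape bt)"
      using good unfolding young_diagram_def shape_def good_def by (auto simp: sorted_wrt_map row_ok_def)
    then have sub: "shape_ideal m n M (shape bt) \<subseteq> I" by (intro shp[OF \<sigma>(1) _ \<sigma>(2)])
    have mi: "minor M (fst x) (snd x) \<in> minors_ideal m n M (length (fst x))" if "x \<in> set bt" for x
    proof (rule minor_in_minors_ideal)
      show "set (fst x) \<subseteq> {..<n}" using entries_bounded[OF \<beta>s ent(1), of "fst x"] that by simp
      show "set (snd x) \<subseteq> {..<m}" using entries_bounded[OF \<alpha>s ent(2), of "snd x"] that by simp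
      show "length (snd x) = length (fst x)" using good that by (auto simp: good_def row_ok_def)
    qed simp
    have "list_all2 (\<in>) (map (\<lambda>x. minor M (fst x) (snd x)) bt) (map (minors_ideal m n M) (shape bt))"
      using mi by (auto simp: shape_def list_all2_conv_all_nth)
    then show ?thesis using sub ideal_prod_list_mem unfolding bidet_def by blast
  qed
  have "minor (sym_mat n M) \<beta>s \<alpha>s = h (minor (sym_mat n generic_entry) \<beta>s \<alpha>s)"
    unfolding minor_hom[OF h] sym_mat_hom[OF h] gen ..
  also have "\<dots> = (\<Sum>bt\<in>F. h (of_int (c bt)) * bidet M bt)"
    unfolding eq hom_sum hom_mult bidet_hom[OF h] gen ..
  also have "\<dots> \<in> I" by (intro is_ideal_sum[OF I] is_idealD(3)[OF I] mem)
  finally show "minor (sym_mat n M) \<beta>s \<alpha>s \<in> I" .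
qed

section \<open>The ideals generated by orbits of the general linear groups\<close>

lemma generic_ideal_least:
  fixes \<iota> :: "rat \<Rightarrow> 'a::comm_ring_1"
  assumes h: "comm_ring_hom \<iota>" and J: "is_ideal J"
    and orbit: "\<And>A B'. A \<in> carrier_mat n n \<Longrightarrow> B' \<in> carrier_mat m m \<Longrightarrow>
      poly_eval \<iota> f (gl_act m n A B' (prod_list (map (corner_minor m n) \<sigma>))) \<in> J"
  shows "poly_eval \<iota> f ` generic_ideal m n \<sigma> \<subseteq> J"
proof -
  define ev where "ev = poly_eval \<iota> f"
  have ev: "comm_ring_hom ev" unfolding ev_def by (rule comm_ring_hom_poly_eval[OF h])
  then interpret ev: comm_ring_hom ev .
  interpret c: comm_ring_hom "Const :: rat \<Rightarrow> generic_poly" by (rule comm_ring_hom_Const)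
  interpret mo: Modules.module "\<lambda>c (p::generic_poly). Const c * p"
    by (rule Modules.module.intro) (simp_all add: c.hom_add c.hom_mult algebra_simps)
  have "gl_submodule m n \<sigma> \<subseteq> {p. ev p \<in> J}" unfolding gl_submodule_def
  proof (rule mo.span_minimal)
    show "gl_orbit m n (prod_list (map (corner_minor m n) \<sigma>)) \<subseteq> {p. ev p \<in> J}"
      using orbit by (auto simp: gl_orbit_def GL_def ev_def)
    show "mo.subspace {p. ev p \<in> J}"
      by (rule mo.subspaceI) (auto simp: ev.hom_add ev.hom_mult is_idealD[OF J])
  qed
  then have sub: "ev p \<in> J" if "p \<in> gl_submodule m n \<sigma>" for p using that by auto
  show ?thesis unfolding ev_def[symmetric]
  proof (rule image_subsetI)
    fix x assume "x \<in> generic_ideal m n \<sigma>"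
    then obtain F q where x: "x = (\<Sum>p\<in>F. q p * p)" and F: "F \<subseteq> gl_submodule m n \<sigma>"
      unfolding generic_ideal_def by blast
    have "ev x = (\<Sum>p\<in>F. ev (q p) * ev p)" unfolding x by (simp add: ev.hom_sum ev.hom_mult)
    also have "\<dots> \<in> J" using F by (intro is_ideal_sum[OF J] is_idealD(3)[OF J] sub) auto
    finally show "ev x \<in> J" .
  qed
qed

text \<open>Acting on the generic matrix and then substituting \<open>M\<close> amounts to
  substituting the product of \<open>A\<close>, \<open>M\<close> and \<open>B\<close>; corner minors
  become those of this product.\<close>

lemma poly_eval_gl_act:
  fixes \<iota> :: "rat \<Rightarrow> 'a::comm_ring_1" and M :: "nat \<Rightarrow> nat \<Rightarrow> 'a"
  assumes h: "comm_ring_hom \<iota>" and A: "A \<in> carrier_mat n n" and B: "B \<in> carrier_mat m m" and \<sigma>: "\<forall>s\<in>set \<sigma>. s \<le> min m n"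
  defines "N \<equiv> mat_prod n (\<lambda>i k. \<iota> (A $$ (i, k))) (mat_prod m M (\<lambda>l j. \<iota> (B $$ (l, j))))"
  shows "poly_eval \<iota> (\<lambda>(i, j). M i j) (gl_act m n A B (prod_list (map (corner_minor m n) \<sigma>))) = (\<Prod>s\<leftarrow>\<sigma>. minor N [0..<s] [0..<s])"
proof -
  define ev where "ev = poly_eval \<iota> (\<lambda>(i, j). M i j)"
  have ev: "comm_ring_hom ev" unfolding ev_def by (rule comm_ring_hom_poly_eval[OF h])
  then interpret ev: comm_ring_hom ev .
  interpret i: comm_ring_hom \<iota> by (rule h)
  have evC: "ev (Const c) = \<iota> c" for c unfolding ev_def by (rule poly_eval_Const) simp
  have evV: "ev (Var (i, j)) = M i j" for i j unfolding ev_def by (simp add: poly_eval_Var[OF h])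
  define E where "E p = ev (gl_act m n A B p)" for p
  have g: "comm_ring_hom (gl_act m n A B)" unfolding gl_act_def by (intro comm_ring_hom_poly_eval comm_ring_hom_Const)
  then interpret g: comm_ring_hom "gl_act m n A B" .
  have E: "comm_ring_hom E" unfolding E_def by unfold_locales (simp_all add: g.hom_add g.hom_mult ev.hom_add ev.hom_mult)
  then interpret E: comm_ring_hom E .
  have EV: "E (Var (i, j)) = N i j" if ij: "i < n" "j < m" for i j
  proof -
    have "E (Var (i, j)) = ev ((map_mat Const A * generic_mat m n * map_mat Const B) $$ (i, j))"
      unfolding E_def gl_act_def by (simp add: poly_eval_Var[OF comm_ring_hom_Const])
    also have "\<dots> = ev (\<Sum>l<m. (\<Sum>k<n. Const (A $$ (i, k)) * Var (k, l)) * Const (B $$ (l, j)))"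
      using A B ij by (simp add: generic_mat_def scalar_prod_def lessThan_atLeast0)
    also have "\<dots> = (\<Sum>l<m. \<Sum>k<n. \<iota> (A $$ (i, k)) * (M k l * \<iota> (B $$ (l, j))))"
      by (simp add: ev.hom_sum ev.hom_mult evC evV sum_distrib_right mult.assoc)
    also have "\<dots> = N i j" unfolding N_def mat_prod_def sum_distrib_left by (rule sum.swap)
    finally show ?thesis .
  qed
  have "E (corner_minor m n s) = minor N [0..<s] [0..<s]" if "s \<in> set \<sigma>" for s
  proof -
    have s: "s \<le> m" "s \<le> n" using \<sigma> that by auto
    have "corner_minor m n s = minor (\<lambda>i j. Var (i, j)) [0..<s] [0..<s]"
      unfolding corner_minor_def minor_def
      by (rule arg_cong[of _ _ det], rule eq_matI) (use s in \<open>auto simp: generic_mat_def\<close>)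
    then have "E (corner_minor m n s) = minor (\<lambda>i j. E (Var (i, j))) [0..<s] [0..<s]" by (simp add: minor_hom[OF E])
    also have "\<dots> = minor N [0..<s] [0..<s]" using s by (intro minor_cong) (auto simp: EV)
    finally show ?thesis .
  qed
  then have "map E (map (corner_minor m n) \<sigma>) = map (\<lambda>s. minor N [0..<s] [0..<s]) \<sigma>" by simp
  moreover have "E (prod_list ps) = prod_list (map E ps)" for ps by (induction ps) (simp_all add: E.hom_mult)
  ultimately have "E (prod_list (map (corner_minor m n) \<sigma>)) = (\<Prod>s\<leftarrow>\<sigma>. minor N [0..<s] [0..<s])" by metis
  then show ?thesis by (simp add: E_def ev_def)
qed

text \<open>The corner minors of \<open>A M B\<close> are relabelled as nested minors on
  \<open>ws\<close> by rearranging the rows of \<open>A\<close> and the columns of \<open>B\<close>;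
  the matrix obtained is still a two-sided multiple of \<open>M\<close>, so its minor of the
  symmetric power lies in the ideal by Cauchy--Binet.\<close>

lemma poly_eval_generic_ideal:
  fixes \<iota> :: "rat \<Rightarrow> 'a::comm_ring_1" and M :: "nat \<Rightarrow> nat \<Rightarrow> 'a"
  assumes h: "comm_ring_hom \<iota>" and mini: "\<sigma> \<in> minimal_shapes m n d r"
  shows "poly_eval \<iota> (\<lambda>(i, j). M i j) ` generic_ideal m n \<sigma> \<subseteq> sym_minors_ideal m n d M r"
proof (rule generic_ideal_least[OF h is_ideal_sym_minors_ideal])
  fix A B :: "rat mat" assume A: "A \<in> carrier_mat n n" and B: "B \<in> carrier_mat m m"
  let ?J = "sym_minors_ideal m n d M r"
  obtain ws xs where ws: "distinct ws" "set ws \<subseteq> {..<min m n}" "\<forall>s\<in>set \<sigma>. s \<le> length ws"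
    and xs: "set xs \<subseteq> monomials (min m n) d" "length xs = r"
    and hw: "\<And>M :: nat \<Rightarrow> nat \<Rightarrow> 'a. bidet M (map (\<lambda>s. (take s ws, take s ws)) \<sigma>) = minor (sym_mat n M) xs xs \<or>
      bidet M (map (\<lambda>s. (take s ws, take s ws)) \<sigma>) = - minor (sym_mat n M) xs xs"
    by (rule highest_weight[OF mini, where 'a='a]) (rule that; assumption)
  have "length ws = card (set ws)" using distinct_card[OF ws(1)] by simp
  also have "\<dots> \<le> min m n" using card_mono[OF _ ws(2)] by simp
  finally have bound: "\<forall>s\<in>set \<sigma>. s \<le> min m n" using ws(3) by auto
  define P where "P = (\<lambda>i k. \<iota> (A $$ (i, k)))"
  define S where "S = (\<lambda>l j. \<iota> (B $$ (l, j)))"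
  define N where "N = mat_prod n P (mat_prod m M S)"
  \<comment> \<open>The position of an index in \<open>ws\<close>. Outside \<open>ws\<close> the
    value is arbitrary, but whatever row and column it selects, \<open>N'\<close> stays a two-sided
    multiple of \<open>M\<close>.\<close>
  define p where "p v = (SOME a. a < length ws \<and> ws ! a = v)" for v
  have p: "p (ws ! a) = a" if "a < length ws" for a
  proof -
    have "p (ws ! a) < length ws \<and> ws ! p (ws ! a) = ws ! a" unfolding p_def by (rule someI) (use that in simp)
    then show ?thesis using ws(1) that nth_eq_iff_index_eq by blast
  qed
  define N' where "N' i j = N (p i) (p j)" for i j
  have N': "N' = mat_prod n (\<lambda>i. P (p i)) (mat_prod m M (\<lambda>l j. S l (p j)))"
    by (intro ext) (simp add: N'_def N_def mat_prod_def)
  have "minor N' (take s ws) (take s ws) = minor N [0..<s] [0..<s]" if "s \<in> set \<sigma>" for s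
  proof -
    have "s \<le> length ws" using that ws(3) by auto
    then have "map p (take s ws) = [0..<s]" by (intro nth_equalityI) (auto simp: p)
    then show ?thesis using minor_map[of "take s ws" "take s ws" N p p] by (simp add: N'_def[abs_def])
  qed
  then have eq: "map (\<lambda>s. minor N' (take s ws) (take s ws)) \<sigma> = map (\<lambda>s. minor N [0..<s] [0..<s]) \<sigma>" by simp
  have "bidet N' (map (\<lambda>s. (take s ws, take s ws)) \<sigma>) = (\<Prod>s\<leftarrow>\<sigma>. minor N [0..<s] [0..<s])"
    unfolding bidet_def map_map comp_def fst_conv snd_conv eq ..
  also have "\<dots> = poly_eval \<iota> (\<lambda>(i, j). M i j) (gl_act m n A B (prod_list (map (corner_minor m n) \<sigma>)))"
    unfolding N_def P_def S_def by (rule poly_eval_gl_act[OF h A B bound, symmetric])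
  finally have eq: "poly_eval \<iota> (\<lambda>(i, j). M i j) (gl_act m n A B (prod_list (map (corner_minor m n) \<sigma>))) =
    bidet N' (map (\<lambda>s. (take s ws, take s ws)) \<sigma>)" ..
  have mem: "minor (sym_mat n N') xs xs \<in> ?J" unfolding N'
    by (rule sym_minor_mat_prod[where m'=m, OF _ xs(2) xs(2) is_ideal_sym_minors_ideal minor_in_sym_minors_ideal])
      (use xs(1) in \<open>auto simp: monomials_min\<close>)
  then show "poly_eval \<iota> (\<lambda>(i, j). M i j) (gl_act m n A B (prod_list (map (corner_minor m n) \<sigma>))) \<in> ?J"
    unfolding eq using hw[of N'] is_ideal_uminus[OF is_ideal_sym_minors_ideal mem] by (elim disjE) (simp_all only:)
qed

lemma rational_inverse:
  fixes \<iota> :: "rat \<Rightarrow> 'a::comm_ring_1"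
  assumes "comm_ring_hom \<iota>" "k > 0" shows "\<exists>y::'a. y * of_nat k = 1"
proof -
  interpret comm_ring_hom \<iota> by fact
  have "\<iota> (of_nat k) = of_nat k" for k by (induction k) (auto simp: hom_add)
  then have "\<iota> (1 / of_nat k) * of_nat k = \<iota> (1 / of_nat k * of_nat k)" by (simp only: hom_mult)
  also have "\<dots> = 1" using assms(2) by simp
  finally show ?thesis by blast
qed

theorem theorem3:
  fixes \<phi> :: "'a::comm_ring_1 vec \<Rightarrow> 'a vec" and m n r d :: nat
  assumes "\<phi> \<in> LinearCombinations.module_hom class_ring (module_vec TYPE('a) m) (module_vec TYPE('a) n)"
    and "r \<ge> 1" and "d \<ge> 1"
  shows
    "sym_det_ideal m n d \<phi> r \<subseteq>
       ideal_sum (ideal_up_shape m n \<phi> ` minimal_shapes m n d r) \<and>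
     integral_closure (sym_det_ideal m n d \<phi> r) =
       integral_closure (ideal_sum (ideal_up_shape m n \<phi> ` minimal_shapes m n d r)) \<and>
     (\<forall>\<iota> :: rat \<Rightarrow> 'a. comm_ring_hom \<iota> \<and> inj \<iota> \<longrightarrow>
       ideal_sum (ideal_gl_shape \<iota> m n \<phi> ` minimal_shapes m n d r) \<subseteq> sym_det_ideal m n d \<phi> r \<and>
       sym_det_ideal m n d \<phi> r \<subseteq> ideal_sum (ideal_pow_shape m n \<phi> ` minimal_shapes m n d r))"
proof -
  define M where "M = map_entry m \<phi>"
  let ?\<Sigma> = "minimal_shapes m n d r" and ?J = "sym_minors_ideal m n d M r"
  have dim: "dim_vec (\<phi> (unit_vec m j)) = n" if "j < m" for j
  proof -
    have "\<phi> \<in> carrier_vec m \<rightarrow> carrier_vec n"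
      using assms(1) by (simp add: LinearCombinations.module_hom_def module_vec_def)
    then have "\<phi> (unit_vec m j) \<in> carrier_vec n" by (rule funcset_mem) simp
    then show ?thesis by simp
  qed
  have sym: "sym_det_ideal m n d \<phi> r = ?J"
  proof -
    have "minor (sym_entry m \<phi>) rs cs = minor (sym_mat n M) rs cs" if "set cs \<subseteq> monomials m d" "length cs = length rs" for rs cs
      using that unfolding M_def by (intro minor_cong sym_entry_eq dim) (auto simp: monomials_def)
    then have "sym_minors m n d \<phi> r = minors (monomials n d) (monomials m d) (sym_mat n M) r"
      unfolding sym_minors_def minors_eq by (intro Collect_cong ex_cong1) auto
    then show ?thesis by (simp add: sym_det_ideal_def sym_minors_ideal_def)
  qed
  have pow: "ideal_pow_shape m n \<phi> \<sigma> = shape_ideal m n M \<sigma>" for \<sigma>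
    unfolding ideal_pow_shape_def det_ideal_def[abs_def] minors_ideal_def[abs_def] M_def ..
  have up: "shape_ideal m n M \<tau> \<subseteq> ideal_up_shape m n \<phi> \<sigma>" if "young_diagram \<tau>" "young_le \<sigma> \<tau>" for \<sigma> \<tau>
    unfolding ideal_up_shape_def pow using that by (intro ideal_sum_superset) auto
  have subset: "?J \<subseteq> ideal_sum (ideal_up_shape m n \<phi> ` ?\<Sigma>)"
  proof (rule sym_minors_ideal_le_shape_ideals)
    fix \<sigma> \<tau> assume "\<sigma> \<in> ?\<Sigma>" "young_diagram \<tau>" "young_le \<sigma> \<tau>"
    then show "shape_ideal m n M \<tau> \<subseteq> ideal_sum (ideal_up_shape m n \<phi> ` ?\<Sigma>)"
      using up ideal_sum_superset[of "ideal_up_shape m n \<phi> \<sigma>" "ideal_up_shape m n \<phi> ` ?\<Sigma>"] by blast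
  qed simp
  have "ideal_sum (ideal_up_shape m n \<phi> ` ?\<Sigma>) \<subseteq> integral_closure ?J"
  proof (rule ideal_sum_least)
    fix I assume "I \<in> ideal_up_shape m n \<phi> ` ?\<Sigma>"
    then obtain \<sigma> where \<sigma>: "\<sigma> \<in> ?\<Sigma>" "I = ideal_up_shape m n \<phi> \<sigma>" by auto
    show "I \<subseteq> integral_closure ?J" unfolding \<sigma>(2) ideal_up_shape_def pow
      by (rule ideal_sum_least) (auto simp: is_ideal_integral_closure dest!: shape_ideal_le_integral[OF \<sigma>(1)])
  qed (simp add: is_ideal_integral_closure)
  then have closure: "integral_closure ?J = integral_closure (ideal_sum (ideal_up_shape m n \<phi> ` ?\<Sigma>))"
    using integral_closure_mono[OF subset] integral_closure_trans by blast
  have gl: "ideal_sum (ideal_gl_shape \<iota> m n \<phi> ` ?\<Sigma>) \<subseteq> ?J" if \<iota>: "comm_ring_hom \<iota>" for \<iota> :: "rat \<Rightarrow> 'a"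
  proof (rule ideal_sum_least)
    fix I assume "I \<in> ideal_gl_shape \<iota> m n \<phi> ` ?\<Sigma>"
    then obtain \<sigma> where \<sigma>: "\<sigma> \<in> ?\<Sigma>" "I = ideal_gl_shape \<iota> m n \<phi> \<sigma>" by auto
    show "I \<subseteq> ?J" unfolding \<sigma>(2) ideal_gl_shape_def M_def[symmetric]
      by (intro ideal_gen_least poly_eval_generic_ideal[OF \<iota> \<sigma>(1)] is_ideal_sym_minors_ideal)
  qed simp
  have rational: "?J \<subseteq> ideal_sum (ideal_pow_shape m n \<phi> ` ?\<Sigma>)" if \<iota>: "comm_ring_hom \<iota>" for \<iota> :: "rat \<Rightarrow> 'a"
  proof (rule sym_minors_ideal_le_shape_ideals)
    fix \<sigma> \<tau> assume \<sigma>: "\<sigma> \<in> ?\<Sigma>" and le: "young_le \<sigma> \<tau>"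
    have "shape_ideal m n M \<tau> \<subseteq> shape_ideal m n M \<sigma>"
      by (rule shape_ideal_le_rational[OF le rational_inverse[OF \<iota>]])
    also have "\<dots> \<subseteq> ideal_sum (ideal_pow_shape m n \<phi> ` ?\<Sigma>)"
      using \<sigma> by (intro ideal_sum_superset) (auto simp: pow)
    finally show "shape_ideal m n M \<tau> \<subseteq> ideal_sum (ideal_pow_shape m n \<phi> ` ?\<Sigma>)" .
  qed simp
  show ?thesis unfolding sym using subset closure gl rational by blast
qed

end
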